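(* Let $f$ be a simple parabolic germ at $\infty$, $\omega\in2\pi\mathrm{i}\mathbb{Z}\setminus\{0\}$, $\Gamma$ a path in $\mathbb{C}\setminus2\pi\mathrm{i}\mathbb{Z}$ from $1$ to $\omega+1$, and let $\alpha$, $N$, $\beta$, $b_\alpha$, $c_\alpha$ and $S^\Gamma_{\omega,k}$ be as defined in the context. Let $\hat b:=\mathcal{B}b$, $\hat b_\alpha:=\mathcal{B}b_\alpha$, and $\hat c_*:=\mathcal{B}(c_\alpha-1)$, which is an entire function, and let $$K_\alpha(\xi,\zeta)=\hat c_*(\zeta-\xi)+\sum_{k\ge1}\frac{(-\xi)^k}{k!}\hat b^{*k}(\zeta-\xi)+\sum_{k\ge1}\frac{(-\xi)^k}{k!}(\hat c_**\hat b^{*k})(\zeta-\xi),$$ which is holomorphic in $\mathbb{C}\times\mathbb{C}$. Let $\tilde\Gamma$ denote a parametrization of the path obtained by concatenating the line segment $(0,1]$, the path $\Gamma$ and the line segment $[\omega+1,\omega]$. Then $$S^\Gamma_{\omega,0}=2\pi\mathrm{i}\,\operatorname{cont}_{\tilde\Gamma}\hat b_\alpha(\omega),$$ and for every $k\ge1$ $$S^\Gamma_{\omega,k}=2\pi\mathrm{i}\int_{\Delta_{\tilde\Gamma,k}}\operatorname{cont}_{\tilde\Gamma}\hat b_\alpha(\xi_1)\,\frac{K_\alpha(\xi_1,\xi_2)\cdots K_\alpha(\xi_{k-1},\xi_k)K_\alpha(\xi_k,\omega)}{(e^{\xi_1}-1)\cdots(e^{\xi_{k-1}}-1)(e^{\xi_k}-1)}\,d\xi_1\wedge\cdots\wedge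 d\xi_k,$$ with the notation $\Delta_{\tilde\Gamma,k}:=\{(\tilde\Gamma(s_1),\dots,\tilde\Gamma(s_k))\mid s_1\le\cdots\le s_k\}$ for each positive integer $k$.
   Context: **Resurgence.** $\mathbb{C}_{\log}$ is the Riemann surface of the logarithm (universal cover of $\mathbb{C}^*$ with base-point at $1$). For $\beta\in\mathbb{C}$ with $\operatorname{Re}\beta>-1$, the formal Borel transform is $$\mathcal{B}:\ \sum_{n\ge0}c_n z^{-n-\beta-1}\in z^{-\beta-1}\mathbb{C}[[z^{-1}]]\ \mapsto\ \sum_{n\ge0}c_n\frac{\zeta^{n+\beta}}{\Gamma(n+\beta+1)}\in\zeta^\beta\mathbb{C}[[\zeta]]$$ (in this formula $\Gamma(\cdot)$ is Euler's Gamma function). The convolution is $\hat\phi_1*\hat\phi_2(\zeta)=\int_0^1\hat\phi_1((1-t)\zeta)\hat\phi_2(t\zeta)\zeta\,dt$, and $\hat b^{*k}$ is the $k$-fold convolution power. If $\hat\phi\in\zeta^\beta\mathbb{C}\{\zeta\}$ converges for all $\zeta\in\mathbb{C}_{\log}$ with $|\zeta|<2\pi$ and extends analytically along any path of $\mathbb{C}\setminus2\pi\mathrm{i}\mathbb{Z}$ issuing from $1$, then $\hat\phi$ and $\tilde\phi=\mathcal{B}^{-1}\hat\phi$ are called $2\pi\mathrm{i}\mathbb{Z}$-resurgent; $\operatorname{cont}_\gamma\hat\phi$ denotes the analytic continuation along $\gamma$. In the integrals, $\operatorname{cont}_{\tilde\Gamma}\hat b_\alpha(\xi_1)$ with $\xi_1=\tilde\Gamma(s_1)$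 means the value at $\tilde\Gamma(s_1)$ of the continuation of $\hat b_\alpha$ along $\tilde\Gamma$ up to parameter $s_1$; the function $\hat b_\alpha$ extends to the whole of $\mathbb{C}_{\log}$ and is equal to $\zeta^{\beta+1}$ times an entire function. Paths are piecewise $C^1$. Given $\omega\in2\pi\mathrm{i}\mathbb{Z}$ and a path $\Gamma$ in $\mathbb{C}\setminus2\pi\mathrm{i}\mathbb{Z}$ from $1$ to $\omega+1$, a $2\pi\mathrm{i}\mathbb{Z}$-resurgent $\hat\phi$ (and $\tilde\phi=\mathcal{B}^{-1}\hat\phi$) is $(\omega,\Gamma)$-simple if $$\operatorname{cont}_\Gamma\hat\phi(\omega+\zeta)=\frac{c}{2\pi\mathrm{i}\zeta}+\hat\chi(\zeta)\frac{\log\zeta}{2\pi\mathrm{i}}+\hat R(\zeta)\quad\text{for }\zeta>0\text{ (small)},$$ with $c\in\mathbb{C}$, $\hat\chi,\hat R\in\mathbb{C}\{\zeta\}$ (the germ at $\omega+1$ being continued along the segment towards $\omega$). The alien operator is then $\mathcal{A}^\Gamma_\omega\tilde\phi:=c+\mathcal{B}^{-1}\hat\chi\in\mathbb{C}[[z^{-1}]]$. **The germ.** $C_g$ denotes the composition operator $C_g\psi=\psi\circ g$. $f=(\mathrm{id}+b)\circ(\mathrm{id}+1)$ is a simple parabolic germ at $\infty$, i.e. holomorphic near $\infty$ with $f(z)=z+1-\rho z^{-1}+O(z^{-2})$, $\rho\in\mathbb{C}$, $b\in z^{-1}\mathbb{C}\{z^{-1}\}$. Put $b_*(z):=b(z)+\rho\log\frac{1+z^{-1}b(z)}{1-z^{-1}}\in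 z^{-2}\mathbb{C}\{z^{-1}\}$. The equation $C_{\mathrm{id}-1}\varphi=C_{\mathrm{id}+b}\varphi+b_*$ has a unique solution $\tilde\varphi\in z^{-1}\mathbb{C}[[z^{-1}]]$. **Definition of $S^\Gamma_{\omega,k}$.** Let $\alpha:=-\rho\omega$, $N\ge\max\{0,-2\operatorname{Re}\alpha\}$ an integer, $\beta:=\alpha+N$ (so $\operatorname{Re}\beta\ge0$). Let $[\tilde\varphi]_N\in\operatorname{Span}(z^{-1},\dots,z^{-N})$ be the truncation of $\tilde\varphi$ with $\tilde\varphi-[\tilde\varphi]_N\in z^{-N-1}\mathbb{C}[[z^{-1}]]$. Let $E_\beta:z^{-\beta-2}\mathbb{C}[[z^{-1}]]\to z^{-\beta-1}\mathbb{C}[[z^{-1}]]$ be the inverse of $C_{\mathrm{id}-1}-\mathrm{Id}$; let $B_\alpha\tilde\phi:=c_\alpha C_{\mathrm{id}+b}\tilde\phi-\tilde\phi$ with $c_\alpha:=\big(\frac{1+z^{-1}b}{1-z^{-1}}\big)^\alpha\in1+z^{-1}\mathbb{C}\{z^{-1}\}$, mapping $z^{-\beta-1}\mathbb{C}[[z^{-1}]]$ to $z^{-\beta-2}\mathbb{C}[[z^{-1}]]$; let $b_\alpha:=z^{-\alpha}(1-z^{-1})^{-\alpha}b_N\in z^{-\beta-2}\mathbb{C}\{z^{-1}\}$ with $b_N:=b_*-C_{\mathrm{id}-1}[\tilde\varphi]_N+C_{\mathrm{id}+b}[\tilde\varphi]_N$. The formal series $\tilde\Phi_k:=(E_\beta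 B_\alpha)^kE_\beta b_\alpha$, $k\ge0$, are $(\omega,\Gamma)$-simple, and $S^\Gamma_{\omega,k}\in\mathbb{C}$ is the constant term of $\mathcal{A}^\Gamma_\omega\tilde\Phi_k$; equivalently these are the numbers such that $\mathcal{A}^\Gamma_\omega\tilde\Phi_k=\sum_{k_1+k_2=k}S^\Gamma_{\omega,k_1}\tilde\Psi_{k_2}$ for all $k\ge 0$, where $\tilde\Psi_k=(EB^\omega)^k1\in z^{-k}\mathbb{C}[[z^{-1}]]$, $E:z^{-2}\mathbb{C}[[z^{-1}]]\to z^{-1}\mathbb{C}[[z^{-1}]]$ is the inverse of $C_{\mathrm{id}-1}-\mathrm{Id}$, and $B^\omega\tilde\psi=e^{-\omega b_*}C_{\mathrm{id}+b}\tilde\psi-\tilde\psi$. *)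

theory Defs
  imports "HOL-Complex_Analysis.Complex_Analysis" "HOL-Library.Landau_Symbols"
begin

text \<open>
  Conventions. A formal series in \<open>z\<^sup>-\<^sup>1\<close> is a \<open>complex fps\<close> whose indeterminate \<open>fps_X\<close>
  stands for \<open>z\<^sup>-\<^sup>1\<close>. An element \<open>z\<^sup>-\<^sup>\<mu> F\<close> of \<open>z\<^sup>-\<^sup>\<mu> \<complex>[[z\<^sup>-\<^sup>1]]\<close>, with \<open>\<mu>\<close> complex, is given
  by its coefficient series \<open>F\<close>, and \<open>\<mu>\<close> (or \<open>\<beta>\<close> with \<open>\<mu> = \<beta> + 1\<close>) is passed separately.
  Germs are convergent series: \<open>fps_conv_radius F > 0\<close>.
\<close>

definition two_pi_i_Z :: "complex set" where
  "two_pi_i_Z = {2 * of_real pi * \<i> * of_int m | m. True}"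


subsection \<open>Paths\<close>

text \<open>
  Piecewise \<open>C\<^sup>1\<close> in the usual sense: \<open>C\<^sup>1\<close> on each closed interval of a partition. The
  library's \<open>valid_path\<close> puts no condition on the derivative near the break points, so that
  it admits paths of infinite length, over which multiple integrals need not converge.
\<close>

definition piecewise_C1 :: "(real \<Rightarrow> 'a::real_normed_vector) \<Rightarrow> bool" where
  "piecewise_C1 \<gamma> \<longleftrightarrow> (\<exists>(n::nat) (t::nat \<Rightarrow> real). t 0 = 0 \<and> t n = 1 \<and>
     (\<forall>i<n. t i < t (Suc i) \<and>
        (\<exists>D. continuous_on {t i..t (Suc i)} D \<and>
             (\<forall>s\<in>{t i..t (Suc i)}.
                (\<gamma> has_vector_derivative D s) (at s within {t i..t (Suc i)})))))"

definition parametrization_of :: "(real \<Rightarrow> complex) \<Rightarrow> (real \<Rightarrow> complex) \<Rightarrow> bool" where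
  "parametrization_of \<gamma> p \<longleftrightarrow> (\<exists>h::real \<Rightarrow> real. piecewise_C1 h \<and> strict_mono_on {0..1} h \<and>
     h 0 = 0 \<and> h 1 = 1 \<and> (\<forall>s\<in>{0..1}. \<gamma> s = p (h s)))"


subsection \<open>Analytic continuation\<close>

text \<open>
  \<open>F t\<close> represents the germ at \<open>\<gamma> t\<close> of the continuation of \<open>\<phi>\<close> along \<open>\<gamma>\<close>. The parameter
  \<open>t = 0\<close> is left out and the initial condition is imposed for all small \<open>t > 0\<close>; this
  covers both paths starting at a point where \<open>\<phi>\<close> is holomorphic and paths which
  leave the branch point \<open>0\<close> along the positive real axis.
\<close>

definition continuation_along ::
    "(real \<Rightarrow> complex) \<Rightarrow> (complex \<Rightarrow> complex) \<Rightarrow> (real \<Rightarrow> complex \<Rightarrow> complex) \<Rightarrow> bool" where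
  "continuation_along \<gamma> \<phi> F \<longleftrightarrow>
     (\<forall>t\<in>{0<..1}. F t analytic_on {\<gamma> t} \<and>
        (\<forall>\<^sub>F s in at t within {0<..1}. \<forall>\<^sub>F z in nhds (\<gamma> s). F s z = F t z)) \<and>
     (\<forall>\<^sub>F t in at_right 0. \<forall>\<^sub>F z in nhds (\<gamma> t). F t z = \<phi> z)"

definition cont_val :: "(real \<Rightarrow> complex) \<Rightarrow> (complex \<Rightarrow> complex) \<Rightarrow> real \<Rightarrow> complex" where
  "cont_val \<gamma> \<phi> t = (THE v. \<exists>F. continuation_along \<gamma> \<phi> F \<and> v = F t (\<gamma> t))"


subsection \<open>Borel transform and convolution\<close>

text \<open>
  \<open>borel_coeffs \<beta> F\<close> is the series \<open>G\<close> such that the Borel transform of \<open>z\<^sup>-\<^sup>\<beta>\<^sup>-\<^sup>1 F\<close> is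
  \<open>\<zeta>\<^sup>\<beta> G(\<zeta>)\<close>. \<open>borel_sum \<beta> F\<close> is its sum on the principal sheet of the Riemann surface of
  the logarithm, which contains the base point \<open>1\<close> and the ray \<open>\<zeta> > 0\<close>. For \<open>\<beta> = 0\<close> use
  \<open>eval_fps (borel_coeffs 0 F)\<close> instead, since \<open>0 powr 0 = 0\<close>.
\<close>

definition borel_coeffs :: "complex \<Rightarrow> complex fps \<Rightarrow> complex fps" where
  "borel_coeffs \<beta> F = Abs_fps (\<lambda>n. fps_nth F n / Gamma (of_nat n + \<beta> + 1))"

definition borel_sum :: "complex \<Rightarrow> complex fps \<Rightarrow> complex \<Rightarrow> complex" where
  "borel_sum \<beta> F \<zeta> = \<zeta> powr \<beta> * eval_fps (borel_coeffs \<beta> F) \<zeta>"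

definition convolution ::
    "(complex \<Rightarrow> complex) \<Rightarrow> (complex \<Rightarrow> complex) \<Rightarrow> complex \<Rightarrow> complex" where
  "convolution f g \<zeta> =
     integral {0..1} (\<lambda>t::real. f ((1 - of_real t) * \<zeta>) * g (of_real t * \<zeta>) * \<zeta>)"

text \<open>The convolution power, only meaningful for exponents \<open>k \<ge> 1\<close>.\<close>

definition conv_pow :: "(complex \<Rightarrow> complex) \<Rightarrow> nat \<Rightarrow> complex \<Rightarrow> complex" where
  "conv_pow f k = (convolution f ^^ (k - 1)) f"


subsection \<open>Resurgent and simple series, alien operators\<close>

definition resurgent :: "complex \<Rightarrow> complex fps \<Rightarrow> bool" where
  "resurgent \<beta> F \<longleftrightarrow>
     fps_conv_radius (borel_coeffs \<beta> F) \<ge> ereal (2 * pi) \<and>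
     (\<forall>\<gamma>. piecewise_C1 \<gamma> \<and> pathstart \<gamma> = 1 \<and> path_image \<gamma> \<inter> two_pi_i_Z = {} \<longrightarrow>
        (\<exists>G. continuation_along \<gamma> (borel_sum \<beta> F) G))"

definition simple_singularity ::
    "complex \<Rightarrow> (real \<Rightarrow> complex) \<Rightarrow> complex \<Rightarrow> complex fps \<Rightarrow>
     complex \<Rightarrow> complex fps \<Rightarrow> complex fps \<Rightarrow> bool" where
  "simple_singularity \<omega> \<Gamma> \<beta> F c \<psi> R \<longleftrightarrow>
     fps_conv_radius \<psi> > 0 \<and> fps_conv_radius R > 0 \<and>
     (\<forall>\<^sub>F \<zeta> in at_right (0::real).
        cont_val (\<Gamma> +++ linepath (\<omega> + 1) (\<omega> + of_real \<zeta>)) (borel_sum \<beta> F) 1 =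
          c / (2 * of_real pi * \<i> * of_real \<zeta>)
          + eval_fps \<psi> (of_real \<zeta>) * of_real (ln \<zeta>) / (2 * of_real pi * \<i>)
          + eval_fps R (of_real \<zeta>))"

definition simple_resurgent ::
    "complex \<Rightarrow> (real \<Rightarrow> complex) \<Rightarrow> complex \<Rightarrow> complex fps \<Rightarrow> bool" where
  "simple_resurgent \<omega> \<Gamma> \<beta> F \<longleftrightarrow>
     resurgent \<beta> F \<and> (\<exists>c \<psi> R. simple_singularity \<omega> \<Gamma> \<beta> F c \<psi> R)"

text \<open>The series \<open>c + \<B>\<^sup>-\<^sup>1 \<psi>\<close>.\<close>

definition alien ::
    "complex \<Rightarrow> (real \<Rightarrow> complex) \<Rightarrow> complex \<Rightarrow> complex fps \<Rightarrow> complex fps" where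
  "alien \<omega> \<Gamma> \<beta> F =
     (THE A. \<exists>R. simple_singularity \<omega> \<Gamma> \<beta> F (fps_nth A 0) (borel_coeffs 0 (fps_shift 1 A)) R)"


subsection \<open>Formal series\<close>

text \<open>Power and logarithm of a series with constant term 1.\<close>

definition fps_cpow :: "complex fps \<Rightarrow> complex \<Rightarrow> complex fps" where
  "fps_cpow u a = fps_binomial a oo (u - 1)"

definition fps_log :: "complex fps \<Rightarrow> complex fps" where
  "fps_log u = fps_ln 1 oo (u - 1)"

text \<open>
  The coefficient series, in \<open>z\<^sup>-\<^sup>\<mu> \<complex>[[z\<^sup>-\<^sup>1]]\<close>, of \<open>z\<^sup>-\<^sup>\<mu> F\<close> composed with \<open>id + g\<close>:
  substitute \<open>(z + g)\<^sup>-\<^sup>\<mu> = z\<^sup>-\<^sup>\<mu> (1 + z\<^sup>-\<^sup>1 g)\<^sup>-\<^sup>\<mu>\<close> and \<open>(z + g)\<^sup>-\<^sup>1 = z\<^sup>-\<^sup>1 / (1 + z\<^sup>-\<^sup>1 g)\<close>.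
\<close>

definition comp_op :: "complex \<Rightarrow> complex fps \<Rightarrow> complex fps \<Rightarrow> complex fps" where
  "comp_op \<mu> g F =
     fps_cpow (1 + fps_X * g) (- \<mu>) * (F oo (fps_X * inverse (1 + fps_X * g)))"


subsection \<open>The germ\<close>

definition simple_parabolic_germ :: "(complex \<Rightarrow> complex) \<Rightarrow> complex \<Rightarrow> bool" where
  "simple_parabolic_germ f \<rho> \<longleftrightarrow>
     (\<exists>r. f holomorphic_on {z. norm z > r}) \<and>
     (\<lambda>z. f z - (z + 1 - \<rho> / z)) \<in> O[at_infinity](\<lambda>z. 1 / z ^ 2)"

text \<open>\<open>f = (id + b) \<circ> (id + 1)\<close> means \<open>b(w) = f(w - 1) - w\<close>, expanded here in \<open>x = w\<^sup>-\<^sup>1\<close>.\<close>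

definition germ_b :: "(complex \<Rightarrow> complex) \<Rightarrow> complex fps" where
  "germ_b f = fps_expansion (\<lambda>x. if x = 0 then 0 else f (1 / x - 1) - 1 / x) 0"

definition b_star :: "complex \<Rightarrow> complex fps \<Rightarrow> complex fps" where
  "b_star \<rho> b = b + fps_const \<rho> * fps_log ((1 + fps_X * b) * inverse (1 - fps_X))"

definition phi_sol :: "complex \<Rightarrow> complex fps \<Rightarrow> complex fps" where
  "phi_sol \<rho> b = (THE \<phi>. fps_nth \<phi> 0 = 0 \<and>
     comp_op 0 (-1) \<phi> = comp_op 0 b \<phi> + b_star \<rho> b)"

definition b_N :: "complex \<Rightarrow> complex fps \<Rightarrow> nat \<Rightarrow> complex fps" where
  "b_N \<rho> b N = (let \<phi>N = fps_cutoff (N + 1) (phi_sol \<rho> b)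
     in b_star \<rho> b - comp_op 0 (-1) \<phi>N + comp_op 0 b \<phi>N)"

definition c_alpha :: "complex fps \<Rightarrow> complex \<Rightarrow> complex fps" where
  "c_alpha b \<alpha> = fps_cpow ((1 + fps_X * b) * inverse (1 - fps_X)) \<alpha>"

text \<open>
  Coefficient series of \<open>z\<^sup>-\<^sup>\<alpha> (1 - z\<^sup>-\<^sup>1)\<^sup>-\<^sup>\<alpha> b\<^sub>N\<close> in \<open>z\<^sup>-\<^sup>\<beta>\<^sup>-\<^sup>2 \<complex>[[z\<^sup>-\<^sup>1]]\<close> where \<open>\<beta> = \<alpha> + N\<close>;
  \<open>b\<^sub>N\<close> is divisible by \<open>z\<^sup>-\<^sup>N\<^sup>-\<^sup>2\<close>.
\<close>

definition b_alpha :: "complex \<Rightarrow> complex fps \<Rightarrow> complex \<Rightarrow> nat \<Rightarrow> complex fps" where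
  "b_alpha \<rho> b \<alpha> N = fps_shift (N + 2) (fps_cpow (1 - fps_X) (- \<alpha>) * b_N \<rho> b N)"

text \<open>
  \<open>E_op \<beta>\<close> maps coefficient series in \<open>z\<^sup>-\<^sup>\<beta>\<^sup>-\<^sup>2 \<complex>[[z\<^sup>-\<^sup>1]]\<close> to coefficient series in
  \<open>z\<^sup>-\<^sup>\<beta>\<^sup>-\<^sup>1 \<complex>[[z\<^sup>-\<^sup>1]]\<close>, and \<open>B_op\<close> the other way; hence the factor \<open>fps_X\<close> and the shift.
\<close>

definition E_op :: "complex \<Rightarrow> complex fps \<Rightarrow> complex fps" where
  "E_op \<beta> F = (THE G. comp_op (\<beta> + 1) (-1) G - G = fps_X * F)"

definition B_op :: "complex fps \<Rightarrow> complex \<Rightarrow> complex \<Rightarrow> complex fps \<Rightarrow> complex fps" where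
  "B_op b \<alpha> \<beta> G = fps_shift 1 (c_alpha b \<alpha> * comp_op (\<beta> + 1) b G - G)"

definition Phi :: "complex \<Rightarrow> complex fps \<Rightarrow> complex \<Rightarrow> nat \<Rightarrow> nat \<Rightarrow> complex fps" where
  "Phi \<rho> b \<omega> N k = (let \<alpha> = - \<rho> * \<omega>; \<beta> = \<alpha> + of_nat N
     in ((E_op \<beta> \<circ> B_op b \<alpha> \<beta>) ^^ k) (E_op \<beta> (b_alpha \<rho> b \<alpha> N)))"

definition S_coeff ::
    "complex \<Rightarrow> complex fps \<Rightarrow> complex \<Rightarrow> nat \<Rightarrow> (real \<Rightarrow> complex) \<Rightarrow> nat \<Rightarrow> complex" where
  "S_coeff \<rho> b \<omega> N \<Gamma> k = fps_nth (alien \<omega> \<Gamma> (- \<rho> * \<omega> + of_nat N) (Phi \<rho> b \<omega> N k)) 0"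


subsection \<open>The kernel\<close>

definition b_hat :: "complex fps \<Rightarrow> complex \<Rightarrow> complex" where
  "b_hat b = eval_fps (borel_coeffs 0 (fps_shift 1 b))"

definition c_star_hat :: "complex fps \<Rightarrow> complex \<Rightarrow> complex \<Rightarrow> complex" where
  "c_star_hat b \<alpha> = eval_fps (borel_coeffs 0 (fps_shift 1 (c_alpha b \<alpha> - 1)))"

definition b_alpha_hat :: "complex \<Rightarrow> complex fps \<Rightarrow> complex \<Rightarrow> nat \<Rightarrow> complex \<Rightarrow> complex" where
  "b_alpha_hat \<rho> b \<alpha> N = borel_sum (\<alpha> + of_nat N + 1) (b_alpha \<rho> b \<alpha> N)"

text \<open>The terms of the two series in the kernel, for \<open>k \<ge> 1\<close>.\<close>

definition K_term1 :: "complex fps \<Rightarrow> complex \<Rightarrow> complex \<Rightarrow> nat \<Rightarrow> complex" where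
  "K_term1 b \<xi> \<zeta> k = (- \<xi>) ^ k / fact k * conv_pow (b_hat b) k (\<zeta> - \<xi>)"

definition K_term2 :: "complex fps \<Rightarrow> complex \<Rightarrow> complex \<Rightarrow> complex \<Rightarrow> nat \<Rightarrow> complex" where
  "K_term2 b \<alpha> \<xi> \<zeta> k =
     (- \<xi>) ^ k / fact k * convolution (c_star_hat b \<alpha>) (conv_pow (b_hat b) k) (\<zeta> - \<xi>)"

definition K_alpha :: "complex fps \<Rightarrow> complex \<Rightarrow> complex \<Rightarrow> complex \<Rightarrow> complex" where
  "K_alpha b \<alpha> \<xi> \<zeta> = c_star_hat b \<alpha> (\<zeta> - \<xi>)
     + (\<Sum>k. K_term1 b \<xi> \<zeta> (Suc k)) + (\<Sum>k. K_term2 b \<alpha> \<xi> \<zeta> (Suc k))"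

definition holomorphic_C2 :: "(complex \<Rightarrow> complex \<Rightarrow> complex) \<Rightarrow> bool" where
  "holomorphic_C2 K \<longleftrightarrow>
     (\<forall>p. \<exists>a b. ((\<lambda>(\<xi>, \<zeta>). K \<xi> \<zeta>) has_derivative (\<lambda>(u, v). a * u + b * v)) (at p))"


subsection \<open>Integration over the simplices\<close>

text \<open>
  The parameter \<open>0\<close> is excluded, as the path starts with the half-open segment \<open>(0,1]\<close>.
\<close>

definition param_simplex :: "nat \<Rightarrow> (nat \<Rightarrow> real) set" where
  "param_simplex k = {s \<in> {1..k} \<rightarrow>\<^sub>E {0<..1}. \<forall>i\<in>{1..<k}. s i \<le> s (Suc i)}"

text \<open>
  The integral of the form \<open>G d\<xi>\<^sub>1 \<and> \<dots> \<and> d\<xi>\<^sub>k\<close> over the image of the simplex under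
  \<open>s \<mapsto> (\<gamma>(s\<^sub>1), \<dots>, \<gamma>(s\<^sub>k))\<close>, i.e. of its pull-back. \<open>G\<close> is a function of the parameters
  because the continuation of a function along \<open>\<gamma>\<close> is not a function of the point \<open>\<gamma>(s)\<close>.
\<close>

definition pullback_form ::
    "(real \<Rightarrow> complex) \<Rightarrow> nat \<Rightarrow> ((nat \<Rightarrow> real) \<Rightarrow> complex) \<Rightarrow> (nat \<Rightarrow> real) \<Rightarrow> complex" where
  "pullback_form \<gamma> k G s = G s * (\<Prod>i\<in>{1..k}. vector_derivative \<gamma> (at (s i)))"

definition simplex_form_integrable ::
    "(real \<Rightarrow> complex) \<Rightarrow> nat \<Rightarrow> ((nat \<Rightarrow> real) \<Rightarrow> complex) \<Rightarrow> bool" where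
  "simplex_form_integrable \<gamma> k G \<longleftrightarrow>
     set_integrable (\<Pi>\<^sub>M i\<in>{1..k}. lborel) (param_simplex k) (pullback_form \<gamma> k G)"

definition simplex_form_integral ::
    "(real \<Rightarrow> complex) \<Rightarrow> nat \<Rightarrow> ((nat \<Rightarrow> real) \<Rightarrow> complex) \<Rightarrow> complex" where
  "simplex_form_integral \<gamma> k G =
     set_lebesgue_integral (\<Pi>\<^sub>M i\<in>{1..k}. lborel) (param_simplex k) (pullback_form \<gamma> k G)"

text \<open>For \<open>k \<ge> 1\<close>.\<close>

definition S_integrand ::
    "complex \<Rightarrow> complex fps \<Rightarrow> complex \<Rightarrow> nat \<Rightarrow> (real \<Rightarrow> complex) \<Rightarrow> nat \<Rightarrow> (nat \<Rightarrow> real) \<Rightarrow> complex"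
where
  "S_integrand \<rho> b \<omega> N \<gamma> k s = (let \<alpha> = - \<rho> * \<omega> in
     cont_val \<gamma> (b_alpha_hat \<rho> b \<alpha> N) (s 1) *
     ((\<Prod>i\<in>{1..<k}. K_alpha b \<alpha> (\<gamma> (s i)) (\<gamma> (s (Suc i)))) * K_alpha b \<alpha> (\<gamma> (s k)) \<omega>) /
     (\<Prod>i\<in>{1..k}. (exp (\<gamma> (s i)) - 1)))"

end

theory Submission
  imports Defs "HOL-Real_Asymp.Real_Asymp"
begin

text \<open>The continuation is carried as a family of germs indexed by the path parameter, because
  a path that crosses itself may meet the same point on different sheets. One step of the recursion
  integrates along the path up to parameter \<open>t\<close> and then along a short segment to
  \<open>z\<close>; each new germ is thus a parameter integral in one variable, and no multiple
  integral is ever deformed. Two obstacles shape the rest. First, 1 / (e^\<xi> - 1) has a pole at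
  both ends of the path, while Fubini needs absolute convergence over the whole simplex; the
  vanishing of K at (\<omega>, \<omega>) is needed for this as well as for the form of the
  singularity. Second, logarithm and residue must be separated with holomorphic dependence on
  \<open>z\<close> near \<omega>, which needs a primitive that is explicit in both variables. The
  condition on N enters only through Re \<beta> \<ge> 0: it keeps \<zeta>^\<beta> bounded near 0, so
  that all series can be integrated term by term under a constant majorant. On the formal side
  everything reduces to Beta integrals: the Gamma quotients produced by differentiating powers of z
  are exactly those of the moments of t^(\<beta>+j) (1-t)^m.\<close>

text \<open>
  The Borel transform turns \<open>E\<^bsub>\<beta>\<^esub>\<close> into division by \<open>e\<^sup>\<zeta> - 1\<close> and \<open>B\<^bsub>\<alpha>\<^esub>\<close> into the Volterra operator
  with kernel \<open>K = K\<^bsub>\<alpha>\<^esub>\<close>, so the transforms \<open>\<phi>\<^sub>k\<close> of the iterates satisfy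
  \<open>(e\<^sup>\<zeta> - 1) \<phi>\<^sub>0 = b\<^bsub>\<alpha>\<^esub>\<close> (hatted) and
  \<open>(e\<^sup>\<zeta> - 1) \<phi>\<^sub>k\<^sub>+\<^sub>1(\<zeta>) = \<integral>\<^sub>0\<^sup>\<zeta> K(\<xi>, \<zeta>) \<phi>\<^sub>k(\<xi>) d\<xi>\<close>. Integrating along a path
  propagates this recursion to the continuations of the \<open>\<phi>\<^sub>k\<close>.
  Since \<open>e\<^sup>\<zeta> - 1\<close> has a simple zero at \<open>\<omega>\<close> and \<open>K(\<omega>, \<omega>) = \<alpha> + \<rho> \<omega> = 0\<close>, the form
  \<open>A(x) log x + R(x) / x\<close> with \<open>x = \<zeta> - \<omega>\<close> and \<open>A\<close>, \<open>R\<close> holomorphic at 0 is preserved by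
  the recursion, and the residue \<open>R(0)\<close> of \<open>\<phi>\<^sub>k\<^sub>+\<^sub>1\<close> is the integral of \<open>K(\<cdot>, \<omega>) \<phi>\<^sub>k\<close>
  along the whole path. Unrolling the recursion by Fubini gives the integral over the simplex.
\<close>

section \<open>Beta moments\<close>

lemma norm_powr_le_one:
  assumes "0 \<le> t" "t \<le> 1" "Re \<beta> \<ge> 0"
  shows "norm (complex_of_real t powr \<beta>) \<le> 1"
proof (cases "t = 0")
  case False
  then show ?thesis using assms
    by (simp add: norm_powr_real_powr powr_le1)
qed simp

lemma has_integral_powr_01:
  assumes "Re \<beta> \<ge> 0"
  shows "((\<lambda>t. complex_of_real t powr \<beta>) has_integral 1 / (\<beta> + 1)) {0..1}"
proof -
  have nz: "\<beta> + 1 \<noteq> 0" using assms by (auto simp: complex_eq_iff)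
  have "((\<lambda>t. complex_of_real t powr \<beta>) has_integral
      (complex_of_real 1 powr (\<beta>+1) / (\<beta> + 1) - complex_of_real 0 powr (\<beta>+1) / (\<beta> + 1))) {0..1}"
  \<comment> \<open>The primitive is differentiable only for positive argument. At 0 its continuity
    suffices, and that follows from the comparison of t^(Re \<beta> + 1) with t.\<close>
  proof (rule fundamental_theorem_of_calculus_interior)
    have der: "((\<lambda>t. complex_of_real t powr (\<beta>+1) / (\<beta>+1)) has_vector_derivative complex_of_real x powr \<beta>) (at x)"
      if x: "x > 0" for x
    proof -
      have "((\<lambda>z. z powr (\<beta>+1) / (\<beta>+1)) has_field_derivative (complex_of_real x powr \<beta>)) (at (complex_of_real x))"
        using x nz by (auto intro!: derivative_eq_intros simp: complex_nonpos_Reals_iff powr_diff)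
      then show ?thesis by (rule has_vector_derivative_real_field)
    qed
    show "continuous_on {0..1} (\<lambda>t. complex_of_real t powr (\<beta>+1) / (\<beta>+1))"
      unfolding continuous_on_eq_continuous_within
    proof
      fix x :: real assume x: "x \<in> {0..1}"
      show "continuous (at x within {0..1}) (\<lambda>t. complex_of_real t powr (\<beta>+1) / (\<beta>+1))"
      proof (cases "x = 0")
        case True
        have "((\<lambda>t. complex_of_real t powr (\<beta>+1)) \<longlongrightarrow> 0) (at 0 within {0..1})"
        proof (rule Lim_null_comparison)
          show "\<forall>\<^sub>F t in at 0 within {0..1}. norm (complex_of_real t powr (\<beta>+1)) \<le> t"
            using assms powr_mono'[of 1 "Re \<beta> + 1"]
            by (auto simp: eventually_at norm_powr_real_powr intro!: exI[of _ 1])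
        qed (auto intro!: tendsto_eq_intros)
        from tendsto_divide[OF this tendsto_const nz]
        show ?thesis using True by (simp add: continuous_within)
      next
        case False
        then have "x > 0" using x by simp
        from has_vector_derivative_continuous[OF der[OF this]]
        show ?thesis by (rule continuous_at_imp_continuous_at_within)
      qed
    qed
    show "((\<lambda>t. complex_of_real t powr (\<beta>+1) / (\<beta>+1)) has_vector_derivative complex_of_real x powr \<beta>) (at x)"
      if "x \<in> {0<..<1}" for x using der that by simp
  qed simp
  then show ?thesis using nz by simp
qed

text \<open>Euler's Beta function at \<open>j + \<beta> + 1\<close> and \<open>m + 1\<close>, with
  Gamma(m + 1) written as a factorial.\<close>

definition beta_moment :: "complex \<Rightarrow> nat \<Rightarrow> nat \<Rightarrow> complex" where
  "beta_moment \<beta> j m = fact m * Gamma (of_nat j + \<beta> + 1) / Gamma (of_nat (j + m) + \<beta> + 2)"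

lemma not_nonpos_Int_Re: "Re s > 0 \<Longrightarrow> s \<notin> \<int>\<^sub>\<le>\<^sub>0"
  by (auto elim!: nonpos_Ints_cases)

lemma Gamma_nz_Re: "Re s > 0 \<Longrightarrow> Gamma s \<noteq> (0::complex)"
  by (simp add: Gamma_eq_zero_iff not_nonpos_Int_Re)

lemma Gamma_plus1_Re: "Re s > 0 \<Longrightarrow> Gamma (s + 1) = s * Gamma (s::complex)"
  by (rule Gamma_plus1) (simp add: not_nonpos_Int_Re)

text \<open>Induction on \<open>m\<close> by writing one factor 1 - t as a difference. This raises
  \<open>j\<close>, hence \<open>j\<close> is arbitrary in the induction, and only pure powers of t
  are ever integrated.\<close>

lemma has_integral_beta_moment:
  assumes "Re \<beta> \<ge> 0"
  shows "((\<lambda>t. complex_of_real t powr \<beta> * (of_real t ^ j * of_real (1 - t) ^ m)) has_integral beta_moment \<beta> j m) {0..1}"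
proof (induction m arbitrary: j)
  case 0
  have "((\<lambda>t. complex_of_real t powr (\<beta> + of_nat j)) has_integral 1 / (\<beta> + of_nat j + 1)) {0..1}"
    by (rule has_integral_powr_01) (use assms in simp)
  moreover have "beta_moment \<beta> j 0 = 1 / (\<beta> + of_nat j + 1)"
  proof -
    define s where "s = of_nat j + \<beta> + 1"
    have s: "Re s > 0" using assms by (simp add: s_def)
    have e: "of_nat (j + 0) + \<beta> + 2 = s + 1" "\<beta> + of_nat j + 1 = s" "of_nat j + \<beta> + 1 = s" by (auto simp: s_def)
    show ?thesis unfolding beta_moment_def e using s Gamma_nz_Re[OF s] by (simp add: Gamma_plus1_Re)
  qed
  ultimately show ?case
    by (auto elim!: has_integral_spike_finite[rotated 2, where S="{0}"] simp: powr_add powr_nat)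
next
  case (Suc m)
  have *: "beta_moment \<beta> j m - beta_moment \<beta> (Suc j) m = beta_moment \<beta> j (Suc m)"
  proof -
    define s where "s = of_nat j + \<beta> + 1"
    define u where "u = s + of_nat m + 1"
    have s: "Re s > 0" "Re u > 0" using assms by (auto simp: s_def u_def)
    have e: "of_nat (j + m) + \<beta> + 2 = u" "of_nat (Suc j) + \<beta> + 1 = s + 1"
      "of_nat (Suc j + m) + \<beta> + 2 = u + 1" "of_nat (j + Suc m) + \<beta> + 2 = u + 1" "of_nat j + \<beta> + 1 = s"
      by (auto simp: s_def u_def)
    have u0: "u \<noteq> 0" using s by auto
    have "fact m * Gamma s / Gamma u - fact m * (s * Gamma s) / (u * Gamma u)
       = fact (Suc m) * Gamma s / (u * Gamma u)"
      using Gamma_nz_Re[OF s(2)] u0 by (simp add: field_simps) (simp add: u_def algebra_simps)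
    then show ?thesis unfolding beta_moment_def e by (simp add: Gamma_plus1_Re s)
  qed
  have "((\<lambda>t. complex_of_real t powr \<beta> * (of_real t ^ j * of_real (1 - t) ^ m) -
           complex_of_real t powr \<beta> * (of_real t ^ Suc j * of_real (1 - t) ^ m)) has_integral beta_moment \<beta> j (Suc m)) {0..1}"
    unfolding *[symmetric] by (intro has_integral_diff Suc.IH)
  then show ?case
    by (rule has_integral_eq[rotated]) (simp add: algebra_simps)
qed

text \<open>Dominated convergence with the constant majorant \<open>suminf M\<close>. The weight has
  absolute value at most 1 because Re \<beta> \<ge> 0, so a bound for the terms alone is
  enough.\<close>

lemma has_integral_weighted_suminf:
  fixes c :: "nat \<Rightarrow> real \<Rightarrow> complex"
  assumes \<beta>: "Re \<beta> \<ge> 0"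
    and int: "\<And>n. ((\<lambda>t. complex_of_real t powr \<beta> * c n t) has_integral I n) {0..1}"
    and bd: "\<And>n t. t \<in> {0..1} \<Longrightarrow> norm (c n t) \<le> M n"
    and M: "summable M"
  shows "I sums integral {0..1} (\<lambda>t. complex_of_real t powr \<beta> * (\<Sum>n. c n t))"
    and "(\<lambda>t. complex_of_real t powr \<beta> * (\<Sum>n. c n t)) integrable_on {0..1}"
proof -
  let ?S = "\<lambda>n t. complex_of_real t powr \<beta> * (\<Sum>i<n. c i t)"
  let ?g = "\<lambda>t. complex_of_real t powr \<beta> * (\<Sum>i. c i t)"
  have part: "(?S n has_integral (\<Sum>i<n. I i)) {0..1}" for n
    unfolding sum_distrib_left by (intro has_integral_sum int) auto
  have sm: "summable (\<lambda>n. norm (c n t))" if "t \<in> {0..1}" for t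
    by (rule summable_comparison_test'[OF M]) (use bd that in auto)
  have bound: "norm (?S n t) \<le> suminf M" if "t \<in> {0..1}" for n t
  proof -
    have "norm (?S n t) \<le> 1 * (\<Sum>i<n. norm (c i t))"
      unfolding norm_mult
      by (intro mult_mono norm_powr_le_one \<beta> norm_sum sum_nonneg) (use that in auto)
    also have "\<dots> \<le> (\<Sum>i<n. M i)" using bd[OF that] by (auto intro!: sum_mono)
    also have "\<dots> \<le> suminf M"
      using bd[OF that] by (intro sum_le_suminf M) (auto intro: order_trans[OF norm_ge_zero])
    finally show ?thesis .
  qed
  have conv: "(\<lambda>n. ?S n t) \<longlonglongrightarrow> ?g t" if "t \<in> {0..1}" for t
    using summable_LIMSEQ[OF summable_norm_cancel[OF sm[OF that]]] by (intro tendsto_mult tendsto_const)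
  have ii: "?S n integrable_on {0..1}" for n using part by blast
  have ih: "(\<lambda>t. suminf M) integrable_on {0..1::real}"
    by (rule integrable_const_ivl)
  note dc = dominated_convergence[OF ii ih bound conv]
  show "?g integrable_on {0..1}" by (rule dc(1))
  have "(\<lambda>n. integral {0..1} (?S n)) = (\<lambda>n. \<Sum>i<n. I i)"
    using part by (auto simp: integral_unique)
  then show "I sums integral {0..1} ?g" using dc(2) by (simp add: sums_def)
qed

section \<open>The Borel transform of the operators on formal series\<close>

text \<open>The exponent law comes from the addition theorem of the binomial series. It merges the
  two factors of \<open>comp_op\<close> into one power, which can then be expanded
  binomially.\<close>

lemma fps_cpow_mult_inverse_power:
  assumes "fps_nth Y 0 = (0::complex)"
  shows "fps_cpow (1 + Y) a * inverse (1 + Y) ^ i = fps_cpow (1 + Y) (a - of_nat i)"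
proof (induction i)
  case (Suc i)
  let ?a = "a - of_nat i"
  have nz: "fps_nth (1 + Y) 0 \<noteq> 0" using assms by simp
  have "fps_binomial ?a = fps_binomial (?a - 1) * (1 + fps_X)"
    using fps_binomial_add_mult[of "?a - 1" 1] by (simp add: fps_binomial_1)
  then have eq: "fps_cpow (1 + Y) ?a = fps_cpow (1 + Y) (?a - 1) * (1 + Y)"
    unfolding fps_cpow_def using assms
    by (simp add: fps_compose_mult_distrib fps_compose_add_distrib)
  have "fps_cpow (1 + Y) a * inverse (1 + Y) ^ Suc i = fps_cpow (1 + Y) ?a * inverse (1 + Y)"
    unfolding Suc.IH[symmetric] by (simp only: power_Suc2 mult.assoc)
  also have "\<dots> = fps_cpow (1 + Y) (?a - 1)"
    unfolding eq mult.assoc by (simp add: inverse_mult_eq_1'[OF nz])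
  also have "?a - 1 = a - of_nat (Suc i)" by simp
  finally show ?case .
qed simp

text \<open>The coefficient of z^(-\<mu>-i-k) in 1/k! times the k-th derivative of the term of index
  \<open>i\<close> of z^(-\<mu>) F.\<close>

definition comp_coeff :: "complex \<Rightarrow> complex fps \<Rightarrow> nat \<Rightarrow> nat \<Rightarrow> complex" where
  "comp_coeff \<mu> F k i = (-1) ^ k / fact k * pochhammer (\<mu> + of_nat i) k * fps_nth F i"

text \<open>Taylor's formula: composition with id + g is the sum over k of g^k times the k-th
  derivative over k!. The truncation \<open>N\<close> may exceed \<open>M\<close>, since the
  additional terms are divisible by a power of \<open>fps_X\<close> above \<open>M\<close>; one
  truncation then serves for all coefficients that enter a product.\<close>

lemma comp_op_nth_eq:
  assumes "M \<le> N"
  shows "fps_nth (comp_op \<mu> g F) M =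
    fps_nth (\<Sum>i\<le>N. \<Sum>k\<le>N. fps_const (comp_coeff \<mu> F k i) * fps_X ^ (k + i) * g ^ k) M"
proof -
  define U where "U = fps_cpow (1 + fps_X * g) (- \<mu>)"
  define V where "V = inverse (1 + fps_X * g)"
  define W where "W = fps_X * V"
  have Wn: "fps_nth (W ^ i) m = 0" if "m < i" for m i
    unfolding W_def power_mult_distrib using that by (simp add: fps_X_power_mult_nth)
  have UW: "U * W ^ i = fps_X ^ i * fps_cpow (1 + fps_X * g) (- \<mu> - of_nat i)" for i
    unfolding W_def V_def U_def power_mult_distrib
    by (subst fps_cpow_mult_inverse_power[symmetric]) (simp_all add: algebra_simps)
  have cp: "fps_nth (fps_cpow (1 + fps_X * g) (- \<mu> - of_nat i)) m =
     (\<Sum>k\<le>m. (-1) ^ k / fact k * pochhammer (\<mu> + of_nat i) k * fps_nth (fps_X ^ k * g ^ k) m)" for i m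
    unfolding fps_cpow_def fps_compose_nth
    by (simp add: gbinomial_pochhammer power_mult_distrib add.commute atLeast0AtMost)
  have "fps_nth (comp_op \<mu> g F) M = (\<Sum>p\<le>M. fps_nth U p * (\<Sum>i\<le>M. fps_nth F i * fps_nth (W ^ i) (M - p)))"
    unfolding comp_op_def U_def[symmetric] V_def[symmetric] W_def[symmetric] fps_mult_nth fps_compose_nth atLeast0AtMost
    by (intro sum.cong refl arg_cong2[where f="(*)"] sum.mono_neutral_left) (auto simp: Wn)
  also have "\<dots> = (\<Sum>i\<le>M. fps_nth F i * fps_nth (U * W ^ i) M)"
    unfolding fps_mult_nth sum_distrib_left atLeast0AtMost
    by (subst sum.swap) (simp add: algebra_simps)
  also have "\<dots> = (\<Sum>i\<le>M. \<Sum>k\<le>M - i. fps_nth F i * ((-1) ^ k / fact k * pochhammer (\<mu> + of_nat i) k * fps_nth (fps_X ^ k * g ^ k) (M - i)))"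
    unfolding UW by (intro sum.cong refl) (simp add: fps_X_power_mult_nth cp sum_distrib_left)
  also have "\<dots> = (\<Sum>i\<le>M. \<Sum>k\<le>M - i. fps_nth (fps_const (comp_coeff \<mu> F k i) * fps_X ^ (k + i) * g ^ k) M)"
    by (intro sum.cong refl) (auto simp: comp_coeff_def fps_X_power_mult_nth mult.assoc add.commute)
  also have "\<dots> = (\<Sum>i\<le>M. \<Sum>k\<le>N. fps_nth (fps_const (comp_coeff \<mu> F k i) * fps_X ^ (k + i) * g ^ k) M)"
    using assms by (intro sum.cong sum.mono_neutral_left) (auto simp: fps_X_power_mult_nth mult.assoc)
  also have "\<dots> = (\<Sum>i\<le>N. \<Sum>k\<le>N. fps_nth (fps_const (comp_coeff \<mu> F k i) * fps_X ^ (k + i) * g ^ k) M)"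
    using assms by (intro sum.mono_neutral_left) (auto simp: fps_X_power_mult_nth mult.assoc intro!: sum.neutral)
  finally show ?thesis by (simp add: fps_sum_nth)
qed

text \<open>By Taylor expansion of the composition operator, \<open>B_op\<close> is the sum over \<open>k\<close> of multiplication by \<open>D_k\<close>
  after \<open>(d/dz)\<^sup>k / k!\<close>. Under the Borel transform the derivative becomes multiplication by \<open>-\<xi>\<close>
  and the product with \<open>D_k\<close> a convolution, which produces the coefficients of \<open>K_coeff\<close> below.\<close>

definition D_series :: "complex fps \<Rightarrow> complex fps \<Rightarrow> nat \<Rightarrow> complex fps" where
  "D_series c b k = c * b ^ k - (if k = 0 then 1 else 0)"

lemma D_series_0_nth: "fps_nth c 0 = 1 \<Longrightarrow> fps_nth b 0 = 0 \<Longrightarrow> fps_nth (D_series c b k) 0 = 0"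
  by (simp add: D_series_def fps_power_zeroth)

lemma B_op_nth:
  assumes "fps_nth (c_alpha b \<alpha>) 0 = 1" "fps_nth b 0 = 0"
  shows "fps_nth (B_op b \<alpha> \<beta> F) N =
    (\<Sum>i\<le>N. \<Sum>k\<le>N - i. comp_coeff (\<beta> + 1) F k i * fps_nth (D_series (c_alpha b \<alpha>) b k) (Suc (N - i - k)))"
proof -
  define c where "c = c_alpha b \<alpha>"
  let ?a = "comp_coeff (\<beta> + 1) F"
  let ?n = "Suc N"
  define S where "S = (\<Sum>i\<le>?n. \<Sum>k\<le>?n. fps_const (?a k i) * fps_X ^ (k + i) * b ^ k)"
  have D0: "fps_nth (D_series c b k) 0 = 0" for k
    using assms by (simp add: D_series_0_nth c_def)
  have "fps_nth (c * comp_op (\<beta> + 1) b F) ?n = fps_nth (c * S) ?n"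
    unfolding fps_mult_nth S_def using comp_op_nth_eq[of _ ?n "\<beta> + 1" b F]
    by (intro sum.cong refl) simp
  also have "c * S = (\<Sum>i\<le>?n. \<Sum>k\<le>?n. fps_const (?a k i) * fps_X ^ (k + i) * (c * b ^ k))"
    unfolding S_def sum_distrib_left by (simp add: algebra_simps)
  \<comment> \<open>For k = 0 the constant 1 is split off from \<open>c\<close>. These pieces add up
    to \<open>F\<close> in the degrees considered and cancel the \<open>F\<close> subtracted in
    \<open>B_op\<close>.\<close>
  also have "\<dots> = (\<Sum>i\<le>?n. \<Sum>k\<le>?n. fps_const (?a k i) * fps_X ^ (k + i) * D_series c b k)
      + (\<Sum>i\<le>?n. fps_const (fps_nth F i) * fps_X ^ i)"
  proof -
    have "fps_const (?a k i) * fps_X ^ (k + i) * (c * b ^ k) =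
       fps_const (?a k i) * fps_X ^ (k + i) * D_series c b k + (if k = 0 then fps_const (fps_nth F i) * fps_X ^ i else 0)" for i k
      by (simp add: D_series_def comp_coeff_def algebra_simps)
    then show ?thesis by (simp add: sum.distrib sum.delta)
  qed
  finally have 1: "fps_nth (c * comp_op (\<beta> + 1) b F - F) ?n =
     (\<Sum>i\<le>?n. \<Sum>k\<le>?n. fps_nth (fps_const (?a k i) * fps_X ^ (k + i) * D_series c b k) ?n)"
  proof -
    have "(\<Sum>i\<le>?n. fps_nth (fps_const (fps_nth F i) * fps_X ^ i) ?n) = (\<Sum>i\<le>?n. if i = ?n then fps_nth F i else 0)"
      by (intro sum.cong refl) (auto simp: fps_X_power_nth)
    then show "fps_nth (c * comp_op (\<beta> + 1) b F) ?n = fps_nth ((\<Sum>i\<le>?n. \<Sum>k\<le>?n. fps_const (?a k i) * fps_X ^ (k + i) * D_series c b k)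
      + (\<Sum>i\<le>?n. fps_const (fps_nth F i) * fps_X ^ i)) ?n \<Longrightarrow> ?thesis"
      by (simp only: fps_sub_nth fps_add_nth fps_sum_nth sum.delta finite_atMost atMost_iff le_refl if_True) simp
  qed
  \<comment> \<open>Since \<open>D_series\<close> has no constant term, the terms with
    \<open>k + i = Suc N\<close> vanish too. This pays for the shift by one in
    \<open>B_op\<close>.\<close>
  have trm: "fps_nth (fps_const (?a k i) * fps_X ^ (k + i) * D_series c b k) ?n =
      (if k + i \<le> N then ?a k i * fps_nth (D_series c b k) (Suc (N - i - k)) else 0)" for k i
  proof -
    have "Suc N - (k + i) = Suc (N - i - k)" if "k + i \<le> N" using that by simp
    moreover have "fps_nth (D_series c b k) (Suc N - (k + i)) = 0" if "\<not> k + i \<le> N"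
      using that D0 by (simp add: not_le Suc_le_eq)
    ultimately show ?thesis by (auto simp: mult.assoc fps_X_power_mult_nth)
  qed
  have "fps_nth (B_op b \<alpha> \<beta> F) N = (\<Sum>i\<le>?n. \<Sum>k\<le>?n. (if k + i \<le> N then ?a k i * fps_nth (D_series c b k) (Suc (N - i - k)) else 0))"
    unfolding B_op_def c_def[symmetric] fps_shift_nth by (simp only: Suc_eq_plus1[symmetric] 1 trm)
  also have "\<dots> = (\<Sum>i\<le>N. \<Sum>k\<le>?n. (if k + i \<le> N then ?a k i * fps_nth (D_series c b k) (Suc (N - i - k)) else 0))"
    by (intro sum.mono_neutral_right) (auto intro!: sum.neutral)
  also have "\<dots> = (\<Sum>i\<le>N. \<Sum>k\<le>N - i. (if k + i \<le> N then ?a k i * fps_nth (D_series c b k) (Suc (N - i - k)) else 0))"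
    by (intro sum.cong sum.mono_neutral_right) auto
  also have "\<dots> = (\<Sum>i\<le>N. \<Sum>k\<le>N - i. ?a k i * fps_nth (D_series c b k) (Suc (N - i - k)))"
    by (intro sum.cong) auto
  finally show ?thesis by (simp add: c_def)
qed

definition K_coeff :: "complex fps \<Rightarrow> complex fps \<Rightarrow> nat \<Rightarrow> nat \<Rightarrow> complex" where
  "K_coeff c b k m = (-1) ^ k / fact k * fps_nth (D_series c b k) (Suc m) / fact m"

text \<open>The Pochhammer symbol from differentiation is a quotient of two Gamma values. One of
  them is absorbed by the transform of \<open>F\<close>, the other one together with the Gamma of
  the transformed result forms a Beta moment.\<close>

lemma borel_B_op_nth:
  assumes "fps_nth (c_alpha b \<alpha>) 0 = 1" "fps_nth b 0 = 0" and \<beta>: "Re \<beta> \<ge> 0"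
  shows "fps_nth (borel_coeffs (\<beta> + 1) (B_op b \<alpha> \<beta> F)) N =
    (\<Sum>i\<le>N. \<Sum>k\<le>N - i. fps_nth (borel_coeffs \<beta> F) i * K_coeff (c_alpha b \<alpha>) b k (N - i - k) * beta_moment \<beta> (k + i) (N - i - k))"
proof -
  have "comp_coeff (\<beta> + 1) F k i * d / Gamma (of_nat N + (\<beta> + 1) + 1) =
     fps_nth F i / Gamma (of_nat i + \<beta> + 1) * ((-1) ^ k / fact k * d / fact m) * beta_moment \<beta> (k + i) m"
     if "i + k + m = N" for i k m d
  proof -
    have s: "Re (of_nat i + \<beta> + 1) > 0" using \<beta> by simp
    have p: "pochhammer (\<beta> + 1 + of_nat i) k = Gamma (of_nat (k + i) + \<beta> + 1) / Gamma (of_nat i + \<beta> + 1)"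
      using pochhammer_Gamma[OF not_nonpos_Int_Re[OF s], of k] by (simp add: algebra_simps)
    have "of_nat N + (\<beta> + 1) + 1 = of_nat (k + i + m) + \<beta> + 2" using that by auto
    then show ?thesis unfolding comp_coeff_def p beta_moment_def by (simp add: mult_ac add_ac)
  qed
  then show ?thesis
    unfolding borel_coeffs_def B_op_nth[OF assms(1,2)] fps_nth_Abs_fps sum_divide_distrib K_coeff_def
    by (intro sum.cong refl) auto
qed

text \<open>In the Taylor formula with the constant increment -1 only \<open>k = N - i\<close>
  contributes to coefficient \<open>N\<close>. The Gamma quotients cancel against those of the
  transform, and 1 / (N - i)! remains, the coefficient of the exponential.\<close>

lemma borel_comp_op_shift:
  assumes \<beta>: "Re \<beta> \<ge> 0"
  shows "borel_coeffs \<beta> (comp_op (\<beta> + 1) (-1) F) = fps_exp 1 * borel_coeffs \<beta> F"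
proof (rule fps_ext)
  fix N
  have X1: "fps_nth (fps_const a * fps_X ^ j * (-1) ^ k) N = (if j = N then (-1) ^ k * a else 0)" for a :: complex and j k N :: nat
  proof -
    have e: "(-1::complex fps) ^ k = fps_const ((-1) ^ k)"
      by (metis fps_const_1_eq_1 fps_const_neg fps_const_power)
    show ?thesis unfolding e fps_mult_right_const_nth fps_mult_left_const_nth by (simp add: fps_X_power_nth)
  qed
  have s: "Re (of_nat i + \<beta> + 1) > 0" for i :: nat using \<beta> by simp
  have "fps_nth (comp_op (\<beta> + 1) (-1) F) N = (\<Sum>i\<le>N. \<Sum>k\<le>N. if k = N - i then (-1) ^ k * comp_coeff (\<beta> + 1) F k i else 0)"
    unfolding comp_op_nth_eq[OF le_refl] fps_sum_nth X1
    by (intro sum.cong refl) auto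
  also have "\<dots> = (\<Sum>i\<le>N. (-1) ^ (N - i) * comp_coeff (\<beta> + 1) F (N - i) i)"
    by (intro sum.cong refl) (simp add: sum.delta)
  also have "\<dots> = (\<Sum>i\<le>N. Gamma (of_nat N + \<beta> + 1) / Gamma (of_nat i + \<beta> + 1) / fact (N - i) * fps_nth F i)"
  proof (intro sum.cong refl)
    fix i assume i: "i \<in> {..N}"
    have "pochhammer (\<beta> + 1 + of_nat i) (N - i) = Gamma (of_nat N + \<beta> + 1) / Gamma (of_nat i + \<beta> + 1)"
      using pochhammer_Gamma[OF not_nonpos_Int_Re[OF s], of i "N - i"] i by (simp add: algebra_simps of_nat_diff)
    moreover have sq: "(-1) ^ m * ((-1) ^ m * x) = x" for m and x :: complex
      by (simp add: mult.assoc[symmetric] flip: power_add)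
    ultimately show "(-1) ^ (N - i) * comp_coeff (\<beta> + 1) F (N - i) i = Gamma (of_nat N + \<beta> + 1) / Gamma (of_nat i + \<beta> + 1) / fact (N - i) * fps_nth F i"
      unfolding comp_coeff_def by (simp add: sq mult.assoc mult.commute)
  qed
  finally show "fps_nth (borel_coeffs \<beta> (comp_op (\<beta> + 1) (-1) F)) N = fps_nth (fps_exp 1 * borel_coeffs \<beta> F) N"
    unfolding mult.commute[of "fps_exp 1"]
    using Gamma_nz_Re[OF s, of N]
    by (simp add: borel_coeffs_def fps_mult_nth atLeast0AtMost sum_divide_distrib)
qed

lemma borel_coeffs_inject:
  assumes "Re \<beta> \<ge> 0" "borel_coeffs \<beta> F = borel_coeffs \<beta> G"
  shows "F = G"
proof (rule fps_ext)
  fix n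
  have "Gamma (of_nat n + \<beta> + 1) \<noteq> 0" using assms(1) by (intro Gamma_nz_Re) simp
  then show "fps_nth F n = fps_nth G n"
    using arg_cong[OF assms(2), of "\<lambda>F. fps_nth F n"] by (simp add: borel_coeffs_def)
qed

lemma borel_coeffs_surj:
  assumes "Re \<beta> \<ge> 0"
  obtains F where "borel_coeffs \<beta> F = G"
proof
  have "Gamma (of_nat n + \<beta> + 1) \<noteq> 0" for n using assms(1) by (intro Gamma_nz_Re) simp
  then show "borel_coeffs \<beta> (Abs_fps (\<lambda>n. fps_nth G n * Gamma (of_nat n + \<beta> + 1))) = G"
    by (intro fps_ext) (simp add: borel_coeffs_def)
qed

lemma borel_coeffs_diff: "borel_coeffs \<beta> (F - G) = borel_coeffs \<beta> F - borel_coeffs \<beta> G"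
  by (rule fps_ext) (simp add: borel_coeffs_def diff_divide_distrib)

lemma borel_coeffs_X_mult: "borel_coeffs \<beta> (fps_X * F) = fps_X * borel_coeffs (\<beta> + 1) F"
  by (rule fps_ext) (auto simp: borel_coeffs_def of_nat_diff algebra_simps split: nat.splits)

text \<open>\<open>E_op\<close> is a definite description, so existence and uniqueness are due
  first. After the transform its equation is multiplication by \<open>fps_exp 1 - 1\<close>, which
  is \<open>fps_X\<close> times a unit; both follow by division.\<close>

lemma borel_E_op:
  assumes \<beta>: "Re \<beta> \<ge> 0"
  shows "(fps_exp 1 - 1) * borel_coeffs \<beta> (E_op \<beta> F) = fps_X * borel_coeffs (\<beta> + 1) F"
proof -
  have iff: "comp_op (\<beta> + 1) (-1) G - G = fps_X * F \<longleftrightarrow>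
      (fps_exp 1 - 1) * borel_coeffs \<beta> G = fps_X * borel_coeffs (\<beta> + 1) F" for G
  proof -
    have "borel_coeffs \<beta> (comp_op (\<beta> + 1) (-1) G - G) = (fps_exp 1 - 1) * borel_coeffs \<beta> G"
      using \<beta> by (simp add: borel_coeffs_diff borel_comp_op_shift left_diff_distrib)
    then show ?thesis using borel_coeffs_inject[OF \<beta>] borel_coeffs_X_mult by metis
  qed
  have e0: "fps_exp 1 - 1 = fps_X * fps_shift 1 (fps_exp 1 - 1 :: complex fps)"
    by (rule fps_ext) (auto split: nat.splits)
  have e1: "fps_nth (fps_shift 1 (fps_exp 1 - 1 :: complex fps)) 0 \<noteq> 0" by simp
  obtain G where G: "borel_coeffs \<beta> G = inverse (fps_shift 1 (fps_exp 1 - 1)) * borel_coeffs (\<beta> + 1) F"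
    by (rule borel_coeffs_surj[OF \<beta>])
  have "(fps_exp 1 - 1) * borel_coeffs \<beta> G = fps_X * borel_coeffs (\<beta> + 1) F"
  proof -
    have "(fps_X * s) * (inverse s * H) = fps_X * ((s * inverse s) * H)" for s H :: "complex fps"
      by (simp only: mult.assoc)
    then show ?thesis unfolding G by (subst e0) (simp only: inverse_mult_eq_1'[OF e1] mult_1_left)
  qed
  moreover have "G' = G" if "(fps_exp 1 - 1) * borel_coeffs \<beta> G' = fps_X * borel_coeffs (\<beta> + 1) F" for G'
  proof -
    have "(fps_exp 1 - 1 :: complex fps) \<noteq> 0" using e1 by auto
    then show ?thesis using that calculation borel_coeffs_inject[OF \<beta>] by (metis mult_left_cancel)
  qed
  ultimately show ?thesis unfolding E_op_def iff by (rule theI2)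
qed

section \<open>Convergence of the series built from the germ\<close>

lemma fps_conv_pos_iff: "fps_conv_radius F > 0 \<longleftrightarrow> (\<exists>f. f has_fps_expansion F)" for F :: "complex fps"
  using eval_fps_has_fps_expansion[of F] by (auto simp: has_fps_expansion_def[abs_def] intro!: exI[of _ "eval_fps F"])

lemma fps_conv_pos_mult: "fps_conv_radius F > 0 \<Longrightarrow> fps_conv_radius G > 0 \<Longrightarrow> fps_conv_radius (F * G) > 0" for F :: "complex fps"
  using fps_conv_radius_mult[of F G] by (auto simp: min_def split: if_splits)
lemma fps_conv_pos_add: "fps_conv_radius F > 0 \<Longrightarrow> fps_conv_radius G > 0 \<Longrightarrow> fps_conv_radius (F + G) > 0" for F :: "complex fps"
  using fps_conv_radius_add[of F G] by (auto simp: min_def split: if_splits)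
lemma fps_conv_pos_diff: "fps_conv_radius F > 0 \<Longrightarrow> fps_conv_radius G > 0 \<Longrightarrow> fps_conv_radius (F - G) > 0" for F :: "complex fps"
  using fps_conv_radius_diff[of F G] by (auto simp: min_def split: if_splits)
lemma fps_conv_pos_compose:
  "fps_conv_radius F > 0 \<Longrightarrow> fps_conv_radius G > 0 \<Longrightarrow> fps_nth G 0 = 0 \<Longrightarrow> fps_conv_radius (F oo G) > 0" for F :: "complex fps"
  unfolding fps_conv_pos_iff by (blast intro: has_fps_expansion_compose)
lemma fps_conv_pos_inverse:
  "fps_conv_radius F > 0 \<Longrightarrow> fps_nth F 0 \<noteq> 0 \<Longrightarrow> fps_conv_radius (inverse F) > 0" for F :: "complex fps"
  unfolding fps_conv_pos_iff by (blast intro: has_fps_expansion_inverse)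
lemma fps_conv_pos_binomial: "fps_conv_radius (fps_binomial a :: complex fps) > 0"
  unfolding fps_conv_pos_iff by (blast intro: has_fps_expansion_binomial_complex)
lemma fps_conv_pos_cpow:
  "fps_conv_radius u > 0 \<Longrightarrow> fps_nth u 0 = 1 \<Longrightarrow> fps_conv_radius (fps_cpow u a) > 0"
  unfolding fps_cpow_def by (intro fps_conv_pos_compose fps_conv_pos_binomial fps_conv_pos_diff) auto
lemma fps_conv_pos_cutoff: "fps_conv_radius (fps_cutoff n F :: complex fps) > 0"
proof -
  have e: "fps_cutoff n F = fps_of_poly (poly_cutoff n (Poly (map (fps_nth F) [0..<n])))"
    by (rule fps_ext) (auto simp: fps_cutoff_def coeff_poly_cutoff nth_default_def)
  show ?thesis unfolding e fps_conv_radius_fps_of_poly by simp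
qed
lemma fps_conv_pos_comp_op:
  "fps_conv_radius g > 0 \<Longrightarrow> fps_conv_radius F > 0 \<Longrightarrow> fps_conv_radius (comp_op \<mu> g F) > 0"
  unfolding comp_op_def
  by (intro fps_conv_pos_compose fps_conv_pos_mult fps_conv_pos_add fps_conv_pos_inverse fps_conv_pos_cpow) auto

lemma fps_conv_pos_ratio:
  "fps_conv_radius b > 0 \<Longrightarrow> fps_conv_radius ((1 + fps_X * b) * inverse (1 - fps_X) :: complex fps) > 0"
  by (intro fps_conv_pos_mult fps_conv_pos_add fps_conv_pos_inverse fps_conv_pos_diff) auto

lemma fps_conv_pos_c_alpha: "fps_conv_radius b > 0 \<Longrightarrow> fps_conv_radius (c_alpha b \<alpha>) > 0"
  unfolding c_alpha_def by (intro fps_conv_pos_cpow fps_conv_pos_ratio) (auto)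

lemma fps_conv_pos_b_alpha:
  assumes "fps_conv_radius b > 0"
  shows "fps_conv_radius (b_alpha \<rho> b \<alpha> N) > 0"
proof -
  have bs: "fps_conv_radius (b_star \<rho> b) > 0"
    unfolding b_star_def fps_log_def
    by (intro fps_conv_pos_mult fps_conv_pos_add fps_conv_pos_compose fps_conv_pos_diff fps_conv_pos_ratio assms) auto
  have "fps_conv_radius (b_N \<rho> b N) > 0"
    unfolding b_N_def Let_def
    by (intro fps_conv_pos_add fps_conv_pos_diff bs fps_conv_pos_comp_op fps_conv_pos_cutoff assms) 
       (metis fps_conv_radius_1 fps_conv_radius_uminus ereal_less(5))
  then show ?thesis
    unfolding b_alpha_def fps_conv_radius_shift by (intro fps_conv_pos_mult fps_conv_pos_cpow fps_conv_pos_diff) auto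
qed

text \<open>As \<open>b\<close> has no constant term, the ratio is 1 + X up to second order. The
  coefficient \<alpha> is the value at 0 of the transform of \<open>c_alpha b \<alpha> - 1\<close>,
  one of the two contributions to the kernel on the diagonal.\<close>

lemma c_alpha_nth:
  assumes "fps_nth b 0 = 0"
  shows "fps_nth (c_alpha b \<alpha>) 0 = 1" "fps_nth (c_alpha b \<alpha>) (Suc 0) = \<alpha>"
proof -
  let ?u = "(1 + fps_X * b) * inverse (1 - fps_X) :: complex fps"
  have "inverse (1 - fps_X :: complex fps) = Abs_fps (\<lambda>n. 1)"
    using fps_inverse_gp' by (metis fps_inverse_idempotent fps_nth_Abs_fps one_neq_zero)
  then have "fps_nth ?u (Suc 0) = 1" "fps_nth ?u 0 = 1"
    using assms by (simp_all add: fps_mult_nth)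
  then show "fps_nth (c_alpha b \<alpha>) 0 = 1" "fps_nth (c_alpha b \<alpha>) (Suc 0) = \<alpha>"
    unfolding c_alpha_def fps_cpow_def fps_compose_nth by (simp_all)
qed

section \<open>Analytic continuation along paths\<close>

text \<open>The analytic germ \<open>F t\<close> sits at \<open>\<gamma> t\<close>; only its values near \<open>\<gamma> t\<close> are meaningful.\<close>

definition germ_family :: "(real \<Rightarrow> complex) \<Rightarrow> real set \<Rightarrow> (real \<Rightarrow> complex \<Rightarrow> complex) \<Rightarrow> bool" where
  "germ_family \<gamma> J F \<longleftrightarrow> (\<forall>t\<in>J. F t analytic_on {\<gamma> t} \<and>
     (\<forall>\<^sub>F s in at t within J. \<forall>\<^sub>F z in nhds (\<gamma> s). F s z = F t z))"

lemma germ_familyD: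
  assumes "germ_family \<gamma> J F" "t \<in> J"
  obtains d where "d > 0" "\<And>s. s \<in> J \<Longrightarrow> dist s t < d \<Longrightarrow> \<forall>\<^sub>F z in nhds (\<gamma> s). F s z = F t z"
proof -
  from assms obtain d where d: "d > 0" "\<And>s. s \<in> J \<Longrightarrow> s \<noteq> t \<Longrightarrow> dist s t < d \<Longrightarrow> \<forall>\<^sub>F z in nhds (\<gamma> s). F s z = F t z"
    unfolding germ_family_def eventually_at by blast
  show ?thesis
  proof (rule that[OF d(1)])
    show "\<forall>\<^sub>F z in nhds (\<gamma> s). F s z = F t z" if "s \<in> J" "dist s t < d" for s
      using d(2)[of s] that by (cases "s = t") auto
  qed
qed

text \<open>The identity theorem along a connected parameter set. In a ball around
  \<open>\<gamma> a\<close> on which both germs are holomorphic, agreement at any nearby parameter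
  is equivalent to agreement on the whole ball, so agreement is locally constant in the
  parameter.\<close>

lemma germ_family_unique:
  assumes \<gamma>: "continuous_on J \<gamma>" and J: "connected J"
    and F: "germ_family \<gamma> J F" and G: "germ_family \<gamma> J G"
    and t0: "t0 \<in> J" "\<forall>\<^sub>F z in nhds (\<gamma> t0). F t0 z = G t0 z" and t: "t \<in> J"
  shows "\<forall>\<^sub>F z in nhds (\<gamma> t). F t z = G t z"
proof (rule connected_induction_simple[where P="\<lambda>t. \<forall>\<^sub>F z in nhds (\<gamma> t). F t z = G t z", OF J t0(1) t])
  show "\<forall>\<^sub>F z in nhds (\<gamma> t0). F t0 z = G t0 z" by (rule t0(2))
next
  fix a assume a: "a \<in> J"
  obtain d1 where d1: "d1 > 0" "\<And>s. s \<in> J \<Longrightarrow> dist s a < d1 \<Longrightarrow> \<forall>\<^sub>F z in nhds (\<gamma> s). F s z = F a z"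
    by (rule germ_familyD[OF F a]) blast
  obtain d2 where d2: "d2 > 0" "\<And>s. s \<in> J \<Longrightarrow> dist s a < d2 \<Longrightarrow> \<forall>\<^sub>F z in nhds (\<gamma> s). G s z = G a z"
    by (rule germ_familyD[OF G a]) blast
  obtain r1 where r1: "r1 > 0" "F a holomorphic_on ball (\<gamma> a) r1"
    using F a unfolding germ_family_def analytic_on_def by blast
  obtain r2 where r2: "r2 > 0" "G a holomorphic_on ball (\<gamma> a) r2"
    using G a unfolding germ_family_def analytic_on_def by blast
  define r where "r = min r1 r2"
  have r: "r > 0" "F a holomorphic_on ball (\<gamma> a) r" "G a holomorphic_on ball (\<gamma> a) r"
    using r1 r2 by (auto simp: r_def intro: holomorphic_on_subset)
  obtain d3 where d3: "d3 > 0" "\<And>s. s \<in> J \<Longrightarrow> dist s a < d3 \<Longrightarrow> dist (\<gamma> s) (\<gamma> a) < r"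
    using \<gamma> a r(1) unfolding continuous_on_iff by blast
  define d where "d = min d1 (min d2 d3)"
  define T where "T = J \<inter> ball a d"
  have T: "s \<in> J" "dist s a < d1" "dist s a < d2" "\<gamma> s \<in> ball (\<gamma> a) r" if "s \<in> T" for s
    using that d3(2)[of s] by (auto simp: T_def d_def dist_commute)
  have iff: "(\<forall>\<^sub>F z in nhds (\<gamma> s). F s z = G s z) \<longleftrightarrow> (\<forall>z\<in>ball (\<gamma> a) r. F a z = G a z)" if s: "s \<in> T" for s
  proof
    assume *: "\<forall>\<^sub>F z in nhds (\<gamma> s). F s z = G s z"
    have "\<forall>\<^sub>F z in nhds (\<gamma> s). F a z = G a z"
      using d1(2)[OF T(1,2)[OF s]] d2(2)[OF T(1,3)[OF s]] * by eventually_elim auto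
    then obtain V where V: "open V" "\<gamma> s \<in> V" "\<And>z. z \<in> V \<Longrightarrow> F a z = G a z"
      unfolding eventually_nhds by blast
    show "\<forall>z\<in>ball (\<gamma> a) r. F a z = G a z"
    proof
      fix z assume z: "z \<in> ball (\<gamma> a) r"
      show "F a z = G a z"
        by (rule analytic_continuation_open[of "V \<inter> ball (\<gamma> a) r" "ball (\<gamma> a) r"])
           (use V T(4)[OF s] r z in auto)
    qed
  next
    assume *: "\<forall>z\<in>ball (\<gamma> a) r. F a z = G a z"
    have "\<forall>\<^sub>F z in nhds (\<gamma> s). z \<in> ball (\<gamma> a) r"
      using T(4)[OF s] by (intro eventually_nhds_in_open) auto
    then show "\<forall>\<^sub>F z in nhds (\<gamma> s). F s z = G s z"
      using d1(2)[OF T(1,2)[OF s]] d2(2)[OF T(1,3)[OF s]] by eventually_elim (use * in auto)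
  qed
  have "openin (top_of_set J) T" unfolding T_def by (intro openin_open_Int) auto
  moreover have "a \<in> T" using a d1(1) d2(1) d3(1) by (simp add: T_def d_def)
  ultimately show "\<exists>T. openin (top_of_set J) T \<and> a \<in> T \<and>
       (\<forall>x\<in>T. \<forall>y\<in>T. (\<forall>\<^sub>F z in nhds (\<gamma> x). F x z = G x z) \<longrightarrow> (\<forall>\<^sub>F z in nhds (\<gamma> y). F y z = G y z))"
    using iff by blast
qed

lemma continuation_along_unique:
  assumes \<gamma>: "continuous_on {0..1} \<gamma>" and F: "continuation_along \<gamma> \<phi> F" and G: "continuation_along \<gamma> \<phi> G"
    and t: "t \<in> {0<..1}"
  shows "\<forall>\<^sub>F z in nhds (\<gamma> t). F t z = G t z"
proof -
  have "\<forall>\<^sub>F t in at_right 0. t \<in> {0<..1} \<and> (\<forall>\<^sub>F z in nhds (\<gamma> t). F t z = G t z)"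
  proof -
    have "\<forall>\<^sub>F t in at_right 0. t \<in> {0<..<1::real}" by (rule eventually_at_right_real) simp
    moreover have "\<forall>\<^sub>F t in at_right 0. \<forall>\<^sub>F z in nhds (\<gamma> t). F t z = \<phi> z"
      "\<forall>\<^sub>F t in at_right 0. \<forall>\<^sub>F z in nhds (\<gamma> t). G t z = \<phi> z"
      using F G unfolding continuation_along_def by auto
    ultimately show ?thesis
      by eventually_elim (auto elim: eventually_elim2)
  qed
  then obtain t0 where t0: "t0 \<in> {0<..1}" "\<forall>\<^sub>F z in nhds (\<gamma> t0). F t0 z = G t0 z"
    using eventually_happens'[of "at_right (0::real)"] by force
  show ?thesis
  proof (rule germ_family_unique[where F=F and G=G and \<gamma>=\<gamma>, OF _ _ _ _ t0(1) _ t])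
    show "\<forall>\<^sub>F z in nhds (\<gamma> t0). F t0 z = G t0 z" by (rule t0(2))
    show "continuous_on {0<..1} \<gamma>" by (rule continuous_on_subset[OF \<gamma>]) auto
    show "germ_family \<gamma> {0<..1} F" "germ_family \<gamma> {0<..1} G"
      using F G unfolding continuation_along_def germ_family_def by auto
  qed simp
qed

text \<open>Uniqueness of the continuation makes the definite description meaningful; from here on
  values are computed from any explicit family.\<close>

lemma cont_val_eq:
  assumes "continuous_on {0..1} \<gamma>" "continuation_along \<gamma> \<phi> F" "t \<in> {0<..1}"
  shows "cont_val \<gamma> \<phi> t = F t (\<gamma> t)"
  unfolding cont_val_def
proof (rule the_equality)
  show "v = F t (\<gamma> t)" if "\<exists>F. continuation_along \<gamma> \<phi> F \<and> v = F t (\<gamma> t)" for v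
    using that continuation_along_unique[OF assms(1) _ assms(2,3)] eventually_nhds_x_imp_x by blast
qed (use assms in blast)

text \<open>Serves both for restriction to smaller parameter sets, with \<tau> the identity, and for
  reading a subpath of \<delta> as a path of its own.\<close>

lemma germ_family_compose:
  assumes F: "germ_family \<delta> J F" and \<tau>: "continuous_on I \<tau>" "\<tau> ` I \<subseteq> J"
    and \<gamma>: "\<And>t. t \<in> I \<Longrightarrow> \<gamma> t = \<delta> (\<tau> t)"
  shows "germ_family \<gamma> I (\<lambda>t. F (\<tau> t))"
  unfolding germ_family_def
proof (intro ballI conjI)
  fix t assume t: "t \<in> I"
  then have tJ: "\<tau> t \<in> J" using \<tau> by auto
  show "F (\<tau> t) analytic_on {\<gamma> t}" using F tJ unfolding germ_family_def \<gamma>[OF t] by auto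
  obtain d where d: "d > 0" "\<And>s. s \<in> J \<Longrightarrow> dist s (\<tau> t) < d \<Longrightarrow> \<forall>\<^sub>F z in nhds (\<delta> s). F s z = F (\<tau> t) z"
    by (rule germ_familyD[OF F tJ]) blast
  obtain e where e: "e > 0" "\<And>s. s \<in> I \<Longrightarrow> dist s t < e \<Longrightarrow> dist (\<tau> s) (\<tau> t) < d"
    using \<tau>(1) t d(1) unfolding continuous_on_iff by blast
  show "\<forall>\<^sub>F s in at t within I. \<forall>\<^sub>F z in nhds (\<gamma> s). F (\<tau> s) z = F (\<tau> t) z"
    unfolding eventually_at
    by (rule exI[of _ e]) (use e d \<tau>(2) \<gamma> in auto)
qed

text \<open>For paths that start at a regular point: agreement of germs at parameter 0 spreads to
  all small parameters, because the path stays for a while in the neighbourhood where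
  \<open>F 0\<close> and \<phi> coincide.\<close>

lemma continuation_alongI:
  assumes F: "germ_family \<gamma> {0..1} F" and \<gamma>: "continuous_on {0..1} \<gamma>"
    and init: "\<forall>\<^sub>F z in nhds (\<gamma> 0). F 0 z = \<phi> z"
  shows "continuation_along \<gamma> \<phi> F"
  unfolding continuation_along_def
proof (intro conjI ballI)
  fix t :: real assume t: "t \<in> {0<..1}"
  then show "F t analytic_on {\<gamma> t}" using F unfolding germ_family_def by auto
  obtain d where d: "d > 0" "\<And>s. s \<in> {0..1} \<Longrightarrow> dist s t < d \<Longrightarrow> \<forall>\<^sub>F z in nhds (\<gamma> s). F s z = F t z"
    by (rule germ_familyD[OF F, of t]) (use t in auto)
  then show "\<forall>\<^sub>F s in at t within {0<..1}. \<forall>\<^sub>F z in nhds (\<gamma> s). F s z = F t z"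
    unfolding eventually_at by (intro exI[of _ d]) auto
next
  obtain d where d: "d > 0" "\<And>s. s \<in> {0..1} \<Longrightarrow> dist s 0 < d \<Longrightarrow> \<forall>\<^sub>F z in nhds (\<gamma> s). F s z = F 0 z"
    by (rule germ_familyD[OF F, of 0]) auto
  obtain V where V: "open V" "\<gamma> 0 \<in> V" "\<And>z. z \<in> V \<Longrightarrow> F 0 z = \<phi> z"
    using init unfolding eventually_nhds by blast
  obtain r where r: "r > 0" "ball (\<gamma> 0) r \<subseteq> V" using V open_contains_ball by blast
  obtain e where e: "e > 0" "\<And>s. s \<in> {0..1} \<Longrightarrow> dist s 0 < e \<Longrightarrow> dist (\<gamma> s) (\<gamma> 0) < r"
    using \<gamma> r(1) unfolding continuous_on_iff by (metis atLeastAtMost_iff order_refl zero_le_one)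
  have "\<forall>\<^sub>F z in nhds (\<gamma> s). F s z = \<phi> z" if s: "s > 0" "s < min 1 (min d e)" for s
  proof -
    have "\<gamma> s \<in> V" using e(2)[of s] r s by (auto simp: dist_commute)
    then have "\<forall>\<^sub>F z in nhds (\<gamma> s). z \<in> V" using V by (intro eventually_nhds_in_open) auto
    moreover have "\<forall>\<^sub>F z in nhds (\<gamma> s). F s z = F 0 z" using d(2)[of s] s by auto
    ultimately show ?thesis by eventually_elim (use V in auto)
  qed
  then show "\<forall>\<^sub>F t in at_right 0. \<forall>\<^sub>F z in nhds (\<gamma> t). F t z = \<phi> z"
    unfolding eventually_at_right_field using d(1) e(1)
    by (intro exI[of _ "min 1 (min d e)"]) auto
qed

section \<open>Holomorphic parameter integrals\<close>

text \<open>The weight \<open>g\<close> is kept apart because it will contain the derivative of the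
  path and a germ along it, which are merely integrable. A local bound on \<open>f\<close> suffices:
  Cauchy's estimate turns it into a uniform Lipschitz constant, so the difference quotients are
  dominated by a multiple of the weight.\<close>

lemma holomorphic_on_set_lebesgue_integral:
  fixes f :: "complex \<Rightarrow> real \<Rightarrow> complex" and g :: "real \<Rightarrow> complex"
  assumes g: "set_integrable lborel S g" and U: "open U"
    and hol: "\<And>u. u \<in> S \<Longrightarrow> (\<lambda>z. f z u) holomorphic_on U"
    and meas: "\<And>z. z \<in> U \<Longrightarrow> set_borel_measurable lborel S (f z)"
    and bd: "\<And>z. z \<in> U \<Longrightarrow> \<exists>r>0. \<exists>B. cball z r \<subseteq> U \<and> (\<forall>w\<in>cball z r. \<forall>u\<in>S. norm (f w u) \<le> B)"
  shows "(\<lambda>z. set_lebesgue_integral lborel S (\<lambda>u. f z u * g u)) holomorphic_on U"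
proof -
  define G where "G = (\<lambda>u. indicator S u *\<^sub>R g u)"
  define H where "H = (\<lambda>z u. indicator S u *\<^sub>R f z u)"
  have G: "integrable lborel G" using g by (simp add: set_integrable_def G_def)
  have Gm: "G \<in> borel_measurable lborel" using G by auto
  have Hm: "H z \<in> borel_measurable lborel" if "z \<in> U" for z
    using meas[OF that] by (simp add: set_borel_measurable_def H_def)
  have eq: "set_lebesgue_integral lborel S (\<lambda>u. f z u * g u) = (LINT u|lborel. H z u * G u)" for z
    unfolding set_lebesgue_integral_def H_def G_def
    by (intro Bochner_Integration.integral_cong) (auto simp: indicator_def)
  have "\<exists>D. ((\<lambda>z. LINT u|lborel. H z u * G u) has_field_derivative D) (at z0)" if z0: "z0 \<in> U" for z0
  proof -
    obtain r B where r: "r > 0" "cball z0 r \<subseteq> U" and B: "\<And>w u. w \<in> cball z0 r \<Longrightarrow> u \<in> S \<Longrightarrow> norm (f w u) \<le> B"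
      using bd[OF z0] by blast
    \<comment> \<open>Cauchy's bound for the derivative: a disc of radius r/2 around any point of
      the half disc lies in the disc where \<open>B\<close> is a bound.\<close>
    define L where "L = \<bar>B\<bar> / (r/2)"
    have L0: "L \<ge> 0" using r by (simp add: L_def)
    have lip: "norm (f w u - f z0 u) \<le> L * norm (w - z0)" if u: "u \<in> S" and w: "w \<in> cball z0 (r/2)" for w u
    proof (rule field_differentiable_bound[where S="cball z0 (r/2)" and f'="deriv (\<lambda>z. f z u)"])
      fix z assume z: "z \<in> cball z0 (r/2)"
      have sub: "cball z (r/2) \<subseteq> cball z0 r" proof
        fix w assume "w \<in> cball z (r/2)"
        then show "w \<in> cball z0 r" using z dist_triangle[of z0 w z] by simp
      qed
      have hU: "(\<lambda>z. f z u) holomorphic_on cball z (r/2)"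
        by (rule holomorphic_on_subset[OF hol[OF u]]) (use sub r in auto)
      have "norm ((deriv ^^ 1) (\<lambda>z. f z u) z) \<le> fact 1 * \<bar>B\<bar> / (r/2) ^ 1"
      proof (rule Cauchy_inequality)
        show "(\<lambda>z. f z u) holomorphic_on ball z (r/2)" using hU ball_subset_cball by (rule holomorphic_on_subset)
        show "continuous_on (cball z (r/2)) (\<lambda>z. f z u)" using hU by (rule holomorphic_on_imp_continuous_on)
        show "norm (f x u) \<le> \<bar>B\<bar>" if "norm (z - x) = r/2" for x
          using B[of x u] u sub that by (force simp: dist_norm)
      qed (use r in simp)
      then show "norm (deriv (\<lambda>z. f z u) z) \<le> L" by (simp add: L_def)
      show "((\<lambda>z. f z u) has_field_derivative deriv (\<lambda>z. f z u) z) (at z within cball z0 (r/2))"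
        by (rule has_field_derivative_at_within, rule holomorphic_derivI[OF hol[OF u] U]) (use z r in auto)
    qed (use w r in auto)
    have bH: "norm (H w u) \<le> \<bar>B\<bar>" if "w \<in> cball z0 r" for w u
      using B[OF that, of u] by (auto simp: H_def indicator_def)
    have HG: "integrable lborel (\<lambda>u. H w u * G u)" if "w \<in> cball z0 r" for w
    proof (rule Bochner_Integration.integrable_bound[of _ "\<lambda>u. \<bar>B\<bar> * norm (G u)"])
      show "integrable lborel (\<lambda>u. \<bar>B\<bar> * norm (G u))" using G by simp
      show "(\<lambda>u. H w u * G u) \<in> borel_measurable lborel" using Hm[of w] Gm that r by (intro borel_measurable_times) auto
    qed (use bH[OF that] in \<open>auto simp: norm_mult intro!: mult_right_mono\<close>)
    define D where "D = (\<lambda>u. indicator S u *\<^sub>R deriv (\<lambda>z. f z u) z0)"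
    have "((\<lambda>w. ((LINT u|lborel. H w u * G u) - (LINT u|lborel. H z0 u * G u)) / (w - z0)) \<longlongrightarrow> (LINT u|lborel. D u * G u)) (at z0)"
      unfolding tendsto_at_iff_sequentially
    proof (intro allI impI)
      fix X :: "nat \<Rightarrow> complex" assume X: "\<forall>i. X i \<in> UNIV - {z0}" "X \<longlonglongrightarrow> z0"
      obtain N where N: "\<And>n. n \<ge> N \<Longrightarrow> X n \<in> cball z0 (r/2)"
        using X(2) r unfolding lim_sequentially by (metis half_gt_zero mem_cball dist_commute less_imp_le)
      \<comment> \<open>Dropping the first \<open>N\<close> terms puts the whole sequence into the
        half disc, where the Lipschitz bound holds.\<close>
      define Y where "Y = (\<lambda>i. X (i + N))"
      have Y: "Y i \<noteq> z0" "Y i \<in> cball z0 (r/2)" "Y i \<in> cball z0 r" for i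
        using X(1) N[of "i+N"] r by (auto simp: Y_def)
      have Yl: "Y \<longlonglongrightarrow> z0" unfolding Y_def by (rule LIMSEQ_ignore_initial_segment[OF X(2)])
      have YU: "Y i \<in> U" for i using Y r by auto
      have conv: "(\<lambda>i. (H (Y i) u - H z0 u) / (Y i - z0) * G u) \<longlonglongrightarrow> D u * G u" for u
      proof (cases "u \<in> S")
        case True
        have "((\<lambda>w. (f w u - f z0 u) / (w - z0)) \<longlongrightarrow> deriv (\<lambda>z. f z u) z0) (at z0)"
          using holomorphic_derivI[OF hol[OF True] U z0] by (simp add: has_field_derivative_iff)
        then have "(\<lambda>i. (f (Y i) u - f z0 u) / (Y i - z0)) \<longlonglongrightarrow> deriv (\<lambda>z. f z u) z0"
          using Yl Y(1) unfolding tendsto_at_iff_sequentially comp_def by simp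
        then have "(\<lambda>i. (f (Y i) u - f z0 u) / (Y i - z0) * G u) \<longlonglongrightarrow> deriv (\<lambda>z. f z u) z0 * G u"
          by (rule tendsto_mult[OF _ tendsto_const])
        then show ?thesis using True by (simp add: H_def D_def)
      qed (simp add: H_def D_def)
      have qm: "(\<lambda>u. (H (Y i) u - H z0 u) / (Y i - z0) * G u) \<in> borel_measurable lborel" for i
        using Hm[OF YU[of i]] Hm[OF z0] Gm by (intro borel_measurable_times borel_measurable_divide borel_measurable_diff) auto
      have "(\<lambda>i. LINT u|lborel. (H (Y i) u - H z0 u) / (Y i - z0) * G u) \<longlonglongrightarrow> (LINT u|lborel. D u * G u)"
      proof (rule integral_dominated_convergence[where w="\<lambda>u. L * norm (G u)"])
        show "(\<lambda>u. D u * G u) \<in> borel_measurable lborel"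
          by (rule borel_measurable_LIMSEQ_metric[OF qm conv])
        show "AE u in lborel. norm ((H (Y i) u - H z0 u) / (Y i - z0) * G u) \<le> L * norm (G u)" for i
        proof (rule AE_I2)
          fix u
          have "norm (H (Y i) u - H z0 u) \<le> L * norm (Y i - z0)"
            using lip[of u "Y i"] Y L0 by (auto simp: H_def indicator_def)
          then show "norm ((H (Y i) u - H z0 u) / (Y i - z0) * G u) \<le> L * norm (G u)"
            unfolding norm_mult norm_divide using Y(1)[of i] by (intro mult_right_mono) (auto simp: field_simps)
        qed
      qed (use qm conv G in auto)
      moreover have "(LINT u|lborel. (H (Y i) u - H z0 u) / (Y i - z0) * G u) =
          ((LINT u|lborel. H (Y i) u * G u) - (LINT u|lborel. H z0 u * G u)) / (Y i - z0)" for i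
      proof -
        have "(LINT u|lborel. (H (Y i) u - H z0 u) / (Y i - z0) * G u) = (LINT u|lborel. (H (Y i) u * G u - H z0 u * G u) / (Y i - z0))"
          by (intro Bochner_Integration.integral_cong) (auto simp: left_diff_distrib)
        also have "\<dots> = (LINT u|lborel. (H (Y i) u * G u - H z0 u * G u)) / (Y i - z0)" by simp
        also have "(LINT u|lborel. (H (Y i) u * G u - H z0 u * G u)) = (LINT u|lborel. H (Y i) u * G u) - (LINT u|lborel. H z0 u * G u)"
          using HG Y r by (intro Bochner_Integration.integral_diff) auto
        finally show ?thesis .
      qed
      ultimately have "(\<lambda>i. ((LINT u|lborel. H (X (i+N)) u * G u) - (LINT u|lborel. H z0 u * G u)) / (X (i+N) - z0)) \<longlonglongrightarrow> (LINT u|lborel. D u * G u)"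
        by (simp only: Y_def)
      then show "((\<lambda>w. ((LINT u|lborel. H w u * G u) - (LINT u|lborel. H z0 u * G u)) / (w - z0)) \<circ> X) \<longlonglongrightarrow> (LINT u|lborel. D u * G u)"
        unfolding comp_def by (rule LIMSEQ_offset)
    qed
    then show ?thesis unfolding has_field_derivative_iff by blast
  qed
  then show ?thesis unfolding eq holomorphic_on_def
    by (meson U field_differentiable_def field_differentiable_at_within)
qed

section \<open>Entire functions of two variables\<close>

text \<open>Double power series with coefficients \<open>a k m\<close> of \<open>x\<^sup>k y\<^sup>m\<close>, summed by total degree. The kernel is of this
  form in the variables \<open>x = \<xi>\<close> and \<open>y = \<zeta> - \<xi>\<close>.\<close>

definition dbl_term :: "(nat \<Rightarrow> nat \<Rightarrow> complex) \<Rightarrow> nat \<Rightarrow> complex \<Rightarrow> complex \<Rightarrow> complex" where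
  "dbl_term a n x y = (\<Sum>k\<le>n. a k (n - k) * x ^ k * y ^ (n - k))"

definition dbl :: "(nat \<Rightarrow> nat \<Rightarrow> complex) \<Rightarrow> complex \<Rightarrow> complex \<Rightarrow> complex" where
  "dbl a x y = (\<Sum>n. dbl_term a n x y)"

text \<open>Factorial decay in both indices, i.e. exponential type; it makes the sum entire in both
  variables and is stable under differentiation.\<close>

definition dbl_bdd :: "(nat \<Rightarrow> nat \<Rightarrow> complex) \<Rightarrow> real \<Rightarrow> real \<Rightarrow> bool" where
  "dbl_bdd a C A \<longleftrightarrow> C \<ge> 0 \<and> A \<ge> 0 \<and> (\<forall>k m. norm (a k m) \<le> C * (A ^ k / fact k) * (A ^ m / fact m))"

lemma summable_exp_scaled: "summable (\<lambda>n. C * (z ^ n / fact n) :: real)"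
  using summable_exp[of z] by (intro summable_mult) (simp add: divide_inverse mult.commute)

lemma has_sum_exp_scaled: "((\<lambda>n. c * (z ^ n / fact n)) has_sum c * exp z) UNIV" for c z :: real
proof (rule norm_summable_imp_has_sum)
  show "summable (\<lambda>n. norm (c * (z ^ n / fact n)))"
    using summable_exp_scaled[of "\<bar>c\<bar>" "\<bar>z\<bar>"] by (simp add: abs_mult power_abs)
  have "(\<lambda>n. z ^ n / fact n) sums exp z" using exp_converges[of z] by (simp add: divide_inverse mult.commute)
  then show "(\<lambda>n. c * (z ^ n / fact n)) sums (c * exp z)" by (rule sums_mult)
qed

text \<open>By the binomial theorem the factorials of \<open>k\<close> and \<open>n - k\<close>
  combine to one of \<open>n\<close>, so the homogeneous parts are dominated by an exponential
  series.\<close>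

lemma norm_dbl_term_le:
  assumes "dbl_bdd a C A"
  shows "norm (dbl_term a n x y) \<le> C * ((A * (norm x + norm y)) ^ n / fact n)"
proof -
  have C: "C \<ge> 0" "A \<ge> 0" "\<And>k m. norm (a k m) \<le> C * (A ^ k / fact k) * (A ^ m / fact m)"
    using assms by (auto simp: dbl_bdd_def)
  have "norm (dbl_term a n x y) \<le> (\<Sum>k\<le>n. C * (A ^ k / fact k) * (A ^ (n - k) / fact (n - k)) * norm x ^ k * norm y ^ (n - k))"
    unfolding dbl_term_def
    by (intro sum_norm_le, unfold norm_mult norm_power, intro mult_right_mono C) auto
  also have "\<dots> = (\<Sum>k\<le>n. C / fact n * (of_nat (n choose k) * (A * norm x) ^ k * (A * norm y) ^ (n - k)))"
    by (intro sum.cong refl) (simp add: binomial_fact power_mult_distrib)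
  also have "\<dots> = C / fact n * (A * norm x + A * norm y) ^ n"
    by (simp add: binomial_ring sum_distrib_left)
  finally show ?thesis by (simp add: distrib_left)
qed

lemma norm_dbl_term_le':
  assumes "dbl_bdd a C A" "norm x \<le> R" "norm y \<le> R"
  shows "norm (dbl_term a n x y) \<le> C * ((A * (2 * R)) ^ n / fact n)"
proof -
  have "C \<ge> 0" "A \<ge> 0" using assms by (auto simp: dbl_bdd_def)
  then have "C * ((A * (norm x + norm y)) ^ n / fact n) \<le> C * ((A * (2 * R)) ^ n / fact n)"
    using assms by (intro mult_left_mono divide_right_mono power_mono) auto
  then show ?thesis using norm_dbl_term_le[OF assms(1), of n x y] by linarith
qed

lemma summable_norm_dbl_term:
  assumes "dbl_bdd a C A"
  shows "summable (\<lambda>n. norm (dbl_term a n x y))"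
  by (rule summable_comparison_test'[OF summable_exp_scaled]) (use norm_dbl_term_le[OF assms] in auto)

lemma continuous_on_dbl:
  assumes "dbl_bdd a C A"
  shows "continuous_on UNIV (\<lambda>(x, y). dbl a x y)"
proof -
  have "continuous_on (ball 0 R \<times> ball 0 R) (\<lambda>(x, y). dbl a x y)" for R
  proof (rule uniform_limit_theorem)
    show "uniform_limit (ball 0 R \<times> ball 0 R) (\<lambda>N p. \<Sum>n<N. dbl_term a n (fst p) (snd p)) (\<lambda>(x, y). dbl a x y) sequentially"
      unfolding dbl_def case_prod_unfold
      by (rule Weierstrass_m_test[OF _ summable_exp_scaled[of C "A * (2 * R)"]])
         (use norm_dbl_term_le'[OF assms, of _ R] in \<open>auto simp: less_imp_le\<close>)
    show "\<forall>\<^sub>F N in sequentially. continuous_on (ball 0 R \<times> ball 0 R) (\<lambda>p. \<Sum>n<N. dbl_term a n (fst p) (snd p))"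
      unfolding dbl_term_def by (intro always_eventually allI continuous_intros)
  qed simp
  then have "isCont (\<lambda>(x, y). dbl a x y) p" for p
    by (rule continuous_on_interior[of "ball 0 (norm (fst p) + norm (snd p) + 1) \<times> ball 0 (norm (fst p) + norm (snd p) + 1)"])
       (auto simp: interior_open open_Times mem_Times_iff add_nonneg_pos add_pos_nonneg add.commute
         intro: le_less_trans[OF _ less_add_one])
  then show ?thesis by (simp add: continuous_at_imp_continuous_on)
qed

text \<open>These are the coefficients of the partial derivative in the second variable; only the
  first constant changes.\<close>

lemma dbl_bdd_shift:
  assumes "dbl_bdd a C A"
  shows "dbl_bdd (\<lambda>k m. of_nat (Suc m) * a k (Suc m)) (C * A) A"
proof -
  have C: "C \<ge> 0" "A \<ge> 0" "\<And>k m. norm (a k m) \<le> C * (A ^ k / fact k) * (A ^ m / fact m)"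
    using assms by (auto simp: dbl_bdd_def)
  have "norm (of_nat (Suc m) * a k (Suc m)) \<le> C * A * (A ^ k / fact k) * (A ^ m / fact m)" for k m
  proof -
    have "norm (of_nat (Suc m) * a k (Suc m)) \<le> real (Suc m) * (C * (A ^ k / fact k) * (A ^ Suc m / fact (Suc m)))"
      unfolding norm_mult norm_of_nat by (intro mult_left_mono C) simp
    also have "\<dots> = C * A * (A ^ k / fact k) * (A ^ m / fact m)"
      by (simp add: field_simps del: of_nat_Suc)
    finally show ?thesis .
  qed
  then show ?thesis using C by (simp add: dbl_bdd_def)
qed

lemma dbl_has_field_derivative2:
  assumes "dbl_bdd a C A"
  shows "((\<lambda>y. dbl a x y) has_field_derivative dbl (\<lambda>k m. of_nat (Suc m) * a k (Suc m)) x y) (at y)"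
proof -
  let ?a = "\<lambda>k m. of_nat (Suc m) * a k (Suc m)"
  define R where "R = norm x + norm y + 1"
  define f' where "f' = (\<lambda>n y. if n = 0 then 0 else dbl_term ?a (n - 1) x y)"
  have der: "((\<lambda>y. dbl_term a n x y) has_field_derivative f' n y) (at y within S)" for n y S
  proof (cases n)
    case 0
    then show ?thesis by (simp add: dbl_term_def f'_def)
  next
    case (Suc m)
    have "((\<lambda>y. dbl_term a n x y) has_field_derivative (\<Sum>k\<le>n. a k (n - k) * x ^ k * (of_nat (n - k) * y ^ (n - k - 1)))) (at y within S)"
      unfolding dbl_term_def by (auto intro!: derivative_eq_intros sum.cong)
    also have "(\<Sum>k\<le>n. a k (n - k) * x ^ k * (of_nat (n - k) * y ^ (n - k - 1))) = f' n y"
      unfolding Suc f'_def dbl_term_def sum.atMost_Suc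
      by (simp add: Suc_diff_le mult_ac del: of_nat_Suc of_nat_diff)
    finally show ?thesis .
  qed
  have uc: "uniformly_convergent_on (ball 0 R) (\<lambda>n y. \<Sum>i<n. f' i y)"
  proof (rule Weierstrass_m_test'_ev)
    show "\<forall>\<^sub>F n in sequentially. \<forall>y\<in>ball 0 R. norm (f' n y) \<le> C * A * ((A * (2 * R)) ^ (n - 1) / fact (n - 1))"
      using eventually_gt_at_top[of 0]
    proof eventually_elim
      case (elim n)
      then show ?case using norm_dbl_term_le'[OF dbl_bdd_shift[OF assms], of x R _ "n - 1"] by (auto simp: f'_def R_def)
    qed
    show "summable (\<lambda>n. C * A * ((A * (2 * R)) ^ (n - 1) / fact (n - 1)))"
      using summable_exp_scaled[of "C * A" "A * (2 * R)"] by (subst summable_Suc_iff[symmetric]) simp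
  qed
  have yR: "y \<in> interior (ball 0 R)" by (simp add: R_def add_nonneg_pos)
  have "((\<lambda>y. \<Sum>n. dbl_term a n x y) has_field_derivative (\<Sum>n. f' n y)) (at y)"
    by (rule has_field_derivative_series'(2)[OF _ der uc _ _ yR, of y])
       (use summable_norm_cancel[OF summable_norm_dbl_term[OF assms]] in \<open>auto simp: R_def add_nonneg_pos\<close>)
  also have "(\<Sum>n. f' n y) = dbl ?a x y"
  proof -
    have s: "summable (\<lambda>n. f' (Suc n) y)"
      using summable_norm_cancel[OF summable_norm_dbl_term[OF dbl_bdd_shift[OF assms]], of x y] by (simp add: f'_def)
    then have "summable (\<lambda>n. f' n y)" by (subst summable_Suc_iff[symmetric])
    from suminf_split_head[OF this] show ?thesis by (simp add: f'_def dbl_def)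
  qed
  finally show ?thesis by (simp add: dbl_def)
qed

lemma dbl_bdd_swap: "dbl_bdd a C A \<Longrightarrow> dbl_bdd (\<lambda>k m. a m k) C A"
proof -
  assume *: "dbl_bdd a C A"
  have "norm (a m k) \<le> C * (A ^ k / fact k) * (A ^ m / fact m)" for k m
  proof -
    have "norm (a m k) \<le> C * (A ^ m / fact m) * (A ^ k / fact k)" using * unfolding dbl_bdd_def by blast
    then show ?thesis by (simp only: mult.assoc mult.commute[of "A ^ m / fact m"])
  qed
  then show ?thesis using * by (simp add: dbl_bdd_def)
qed

lemma dbl_swap: "dbl (\<lambda>k m. a m k) x y = dbl a y x"
proof -
  have "dbl_term (\<lambda>k m. a m k) n x y = dbl_term a n y x" for n
    unfolding dbl_term_def
    by (rule sum.reindex_bij_witness[of _ "\<lambda>k. n - k" "\<lambda>k. n - k"]) (auto simp: mult_ac)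
  then show ?thesis by (simp add: dbl_def)
qed

text \<open>Total differentiability from two partial derivatives, of which the second is jointly
  continuous, being a double series of the same kind. The first is obtained by exchanging the
  variables.\<close>

lemma dbl_has_derivative:
  assumes "dbl_bdd a C A"
  shows "\<exists>p q. ((\<lambda>(x, y). dbl a x y) has_derivative (\<lambda>(u, v). p * u + q * v)) (at (x, y))"
proof -
  let ?q = "\<lambda>x y. dbl (\<lambda>k m. of_nat (Suc m) * a k (Suc m)) x y"
  let ?p = "dbl (\<lambda>k m. of_nat (Suc m) * a (Suc m) k) y x"
  have 1: "((\<lambda>x. dbl a x y) has_derivative (*) ?p) (at x within UNIV)"
  proof -
    have "(\<lambda>x. dbl (\<lambda>k m. a m k) y x) = (\<lambda>x. dbl a x y)" by (rule ext) (rule dbl_swap)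
    then show ?thesis
      using dbl_has_field_derivative2[OF dbl_bdd_swap[OF assms], of y x]
      unfolding has_field_derivative_def by simp
  qed
  have 2: "((\<lambda>y. dbl a x y) has_derivative blinfun_apply (blinfun_mult_right (?q x y))) (at y within UNIV)" for x y
    using dbl_has_field_derivative2[OF assms, of x y]
    unfolding has_field_derivative_def by simp
  have 3: "((\<lambda>(x, y). blinfun_mult_right (?q x y)) \<longlongrightarrow> blinfun_mult_right (?q x y)) (at (x, y) within UNIV \<times> UNIV)"
  proof -
    have "((\<lambda>(x, y). ?q x y) \<longlongrightarrow> ?q x y) (at (x, y) within UNIV \<times> UNIV)"
      using continuous_on_dbl[OF dbl_bdd_shift[OF assms]] by (force simp: continuous_on_def)
    then show ?thesis unfolding case_prod_unfold
      by (intro bounded_linear.tendsto[OF bounded_linear_blinfun_mult_right])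
  qed
  have "((\<lambda>(x, y). dbl a x y) has_derivative (\<lambda>(tx, ty). ?p * tx + blinfun_apply (blinfun_mult_right (?q x y)) ty)) (at (x, y) within UNIV \<times> UNIV)"
    by (rule has_derivative_partialsI[OF 1 2]) (use 3 in \<open>auto simp: continuous_within\<close>)
  then show ?thesis by auto
qed

text \<open>Absolute summability over all pairs allows passing from summation by total degree to
  summation row by row. The first order is suited to Cauchy products, the second is the one in which
  the kernel is defined.\<close>

lemma dbl_iterated:
  assumes "dbl_bdd a C A"
  shows "(\<lambda>k. x ^ k * (\<Sum>m. a k m * y ^ m)) sums dbl a x y"
    and "summable (\<lambda>m. a k m * y ^ m)"
proof -
  have C: "C \<ge> 0" "A \<ge> 0" "\<And>k m. norm (a k m) \<le> C * (A ^ k / fact k) * (A ^ m / fact m)"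
    using assms by (auto simp: dbl_bdd_def)
  define e where "e = (\<lambda>(k, m). a k m * x ^ k * y ^ m)"
  define eC where "eC = (\<lambda>k. C * (A * norm x) ^ k / fact k)"
  have s1: "summable (\<lambda>m. norm (a k m * y ^ m))" for k
  proof (rule summable_comparison_test'[OF summable_exp_scaled[of "C * (A ^ k / fact k)" "A * norm y"]])
    fix m
    have "norm (a k m) * norm y ^ m \<le> C * (A ^ k / fact k) * (A ^ m / fact m) * norm y ^ m"
      by (intro mult_right_mono C) simp
    then show "norm (norm (a k m * y ^ m)) \<le> C * (A ^ k / fact k) * ((A * norm y) ^ m / fact m)"
      by (simp add: norm_mult norm_power power_mult_distrib)
  qed
  show "summable (\<lambda>m. a k m * y ^ m)" by (rule summable_norm_cancel[OF s1])
  have bound: "norm (e (k, m)) \<le> eC k * ((A * norm y) ^ m / fact m)" for k m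
  proof -
    have "norm (e (k, m)) = norm (a k m) * (norm x ^ k * norm y ^ m)" by (simp add: e_def norm_mult norm_power)
    also have "\<dots> \<le> C * (A ^ k / fact k) * (A ^ m / fact m) * (norm x ^ k * norm y ^ m)" by (intro mult_right_mono C) auto
    finally show ?thesis by (simp add: eC_def power_mult_distrib mult_ac)
  qed
  have abs: "(\<lambda>p. norm (e p)) summable_on (UNIV \<times> UNIV)"
  proof (rule Infinite_Sum.abs_summable_on_comparison_test')
    have "(\<lambda>(k, m). eC k * ((A * norm y) ^ m / fact m)) summable_on UNIV \<times> UNIV"
    proof (rule summable_on_SigmaI)
      show "((\<lambda>m. case (k, m) of (k, m) \<Rightarrow> eC k * ((A * norm y) ^ m / fact m)) has_sum eC k * exp (A * norm y)) UNIV" for k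
        using has_sum_exp_scaled by simp
      have "(\<lambda>k. (C * exp (A * norm y)) * ((A * norm x) ^ k / fact k)) summable_on UNIV"
        using has_sum_exp_scaled by (rule has_sum_imp_summable)
      then show "(\<lambda>k. eC k * exp (A * norm y)) summable_on UNIV"
        by (simp add: eC_def mult_ac)
    qed (use C in \<open>auto simp: eC_def\<close>)
    then show "(\<lambda>p. eC (fst p) * ((A * norm y) ^ snd p / fact (snd p))) summable_on UNIV \<times> UNIV"
      by (simp add: case_prod_unfold)
  qed (use bound in auto)
  have hs: "(e has_sum infsum e (UNIV \<times> UNIV)) (UNIV \<times> UNIV)"
    by (rule has_sum_infsum[OF abs_summable_summable[OF abs]])
  have 1: "(\<lambda>k. x ^ k * (\<Sum>m. a k m * y ^ m)) sums infsum e (UNIV \<times> UNIV)"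
  proof (rule has_sum_imp_sums, rule has_sum_SigmaD[OF hs])
    fix k
    show "((\<lambda>m. e (k, m)) has_sum x ^ k * (\<Sum>m. a k m * y ^ m)) UNIV"
    proof (rule norm_summable_imp_has_sum)
      show "summable (\<lambda>m. norm (e (k, m)))"
        using summable_mult[OF s1[of k], of "norm (x ^ k)"] by (simp add: e_def norm_mult mult_ac)
      show "(\<lambda>m. e (k, m)) sums (x ^ k * (\<Sum>m. a k m * y ^ m))"
        using sums_mult[OF summable_sums[OF summable_norm_cancel[OF s1[of k]]], of "x ^ k"] by (simp add: e_def mult_ac)
    qed
  qed
  have "((\<lambda>(n, k). e (k, n - k)) has_sum infsum e (UNIV \<times> UNIV)) (Sigma UNIV (\<lambda>n. {..n}))"
    by (rule iffD1[OF has_sum_reindex_bij_witness[where i="\<lambda>(n,k). (k, n - k)" and j="\<lambda>(k,m). (k + m, k)"] hs]) auto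
  then have "(\<lambda>n. dbl_term a n x y) sums infsum e (UNIV \<times> UNIV)"
    by (intro has_sum_imp_sums has_sum_SigmaD[where A=UNIV and B="\<lambda>n. {..n}"])
       (auto simp: e_def dbl_term_def intro!: has_sum_finiteI)
  then have "dbl a x y = infsum e (UNIV \<times> UNIV)" by (simp add: dbl_def sums_iff)
  with 1 show "(\<lambda>k. x ^ k * (\<Sum>m. a k m * y ^ m)) sums dbl a x y" by simp
qed

section \<open>The kernel\<close>

text \<open>Cauchy's estimate for c b^k on one circle inside both discs of convergence. The supremum
  of b enters with power k, so the bound is geometric in k and n simultaneously; dividing by k! and
  m! then gives an entire double series.\<close>

lemma fps_power_coeff_bound:
  fixes c b :: "complex fps"
  assumes c: "fps_conv_radius c > 0" and b: "fps_conv_radius b > 0"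
  obtains M A where "M \<ge> 0" "A \<ge> 1" "\<And>k n. norm (fps_nth (c * b ^ k) n) \<le> M * A ^ k * A ^ n"
proof -
  have "min (fps_conv_radius c) (fps_conv_radius b) > 0" using c b by simp
  then obtain r where r: "0 < ereal r" "ereal r < min (fps_conv_radius c) (fps_conv_radius b)"
    using ereal_dense2 by blast
  have r0: "r > 0" using r by simp
  have sub: "cball (0::complex) r \<subseteq> eball 0 (fps_conv_radius F)" if "min (fps_conv_radius c) (fps_conv_radius b) \<le> fps_conv_radius F" for F :: "complex fps"
  proof
    fix z :: complex assume "z \<in> cball 0 r"
    then have "ereal (norm z) \<le> ereal r" by simp
    also have "\<dots> < fps_conv_radius F" using r(2) that by (rule less_le_trans)
    finally show "z \<in> eball 0 (fps_conv_radius F)" by (simp add: eball_def)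
  qed
  have "compact (eval_fps F ` cball 0 r)" if "min (fps_conv_radius c) (fps_conv_radius b) \<le> fps_conv_radius F" for F :: "complex fps"
    by (intro compact_continuous_image continuous_on_eval_fps sub that continuous_on_subset[OF continuous_on_eval_fps]) auto
  then have "\<exists>B. \<forall>z\<in>cball 0 r. norm (eval_fps F z) \<le> B" if "min (fps_conv_radius c) (fps_conv_radius b) \<le> fps_conv_radius F" for F :: "complex fps"
    using that by (metis bounded_iff compact_imp_bounded imageI)
  then obtain M A0 where M: "\<And>z. z \<in> cball 0 r \<Longrightarrow> norm (eval_fps c z) \<le> M" and A0: "\<And>z. z \<in> cball 0 r \<Longrightarrow> norm (eval_fps b z) \<le> A0"
    by (metis min.cobounded1 min.cobounded2)
  have M0: "M \<ge> 0" "A0 \<ge> 0" using M[of 0] A0[of 0] r0 by (auto intro: order_trans[OF norm_ge_zero])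
  define A where "A = max 1 (max A0 (1 / r))"
  have bound: "norm (fps_nth (c * b ^ k) n) \<le> M * A ^ k * A ^ n" for k n
  proof -
    have rad: "min (fps_conv_radius c) (fps_conv_radius b) \<le> fps_conv_radius (c * b ^ k)"
      using fps_conv_radius_mult[of c "b ^ k"] fps_conv_radius_power[of b k]
      by (meson min.mono order_refl order_trans)
    have pos: "fps_conv_radius (c * b ^ k) > 0"
      using less_le_trans[OF r(1) less_imp_le[OF less_le_trans[OF r(2) rad]]] .
    have ev: "eval_fps (c * b ^ k) z = eval_fps c z * eval_fps b z ^ k" if "z \<in> cball 0 r" for z
    proof -
      have "ereal (norm z) < fps_conv_radius c" "ereal (norm z) < fps_conv_radius b"
        using that sub[of c] sub[of b] by (auto simp: eball_def subset_iff)
      then show ?thesis using fps_conv_radius_power[of b k]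
        by (simp add: eval_fps_mult eval_fps_power less_le_trans)
    qed
    have hol: "eval_fps (c * b ^ k) holomorphic_on cball 0 r"
      by (intro holomorphic_on_eval_fps sub rad)
    have "norm ((deriv ^^ n) (eval_fps (c * b ^ k)) 0) \<le> fact n * (M * A0 ^ k) / r ^ n"
    proof (rule Cauchy_inequality)
      show "eval_fps (c * b ^ k) holomorphic_on ball 0 r" using hol by (rule holomorphic_on_subset) auto
      show "continuous_on (cball 0 r) (eval_fps (c * b ^ k))" using hol by (rule holomorphic_on_imp_continuous_on)
      show "norm (eval_fps (c * b ^ k) x) \<le> M * A0 ^ k" if "norm (0 - x) = r" for x
        using that M[of x] A0[of x] M0 by (simp add: ev norm_mult norm_power mult_mono power_mono)
    qed (rule r0)
    then have "norm (fps_nth (c * b ^ k) n) \<le> M * A0 ^ k * (1 / r) ^ n"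
      unfolding fps_nth_conv_deriv[OF pos] by (simp add: norm_divide field_simps power_divide)
    also have "\<dots> \<le> M * A ^ k * A ^ n"
      using M0 r0 by (intro mult_mono power_mono mult_left_mono) (auto simp: A_def le_max_iff_disj)
    finally show ?thesis .
  qed
  show ?thesis by (rule that[OF M0(1) _ bound]) (simp add: A_def)
qed

text \<open>\<open>K_coeff\<close> with an arbitrary sequence of series in place of
  \<open>D_series\<close>, so that both sums in the kernel are instances.\<close>

definition E_coeff :: "(nat \<Rightarrow> complex fps) \<Rightarrow> nat \<Rightarrow> nat \<Rightarrow> complex" where
  "E_coeff E k m = (-1) ^ k / fact k * fps_nth (E k) (Suc m) / fact m"

lemma dbl_bdd_E_coeff:
  assumes "M \<ge> 0" "A \<ge> 0" "\<And>k n. norm (fps_nth (E k) n) \<le> M * A ^ k * A ^ n"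
  shows "dbl_bdd (E_coeff E) (M * A) A"
proof -
  have "norm (E_coeff E k m) \<le> M * A * (A ^ k / fact k) * (A ^ m / fact m)" for k m
  proof -
    have "norm (E_coeff E k m) = norm (fps_nth (E k) (Suc m)) * (1 / fact k / fact m)"
      by (simp add: E_coeff_def norm_mult norm_divide norm_power)
    also have "\<dots> \<le> M * A ^ k * A ^ Suc m * (1 / fact k / fact m)"
      by (intro mult_right_mono assms) simp
    finally show ?thesis by (simp add: mult_ac)
  qed
  then show ?thesis using assms by (simp add: dbl_bdd_def)
qed

text \<open>Each application of the functional equation contributes a factor whose real part is at
  least n + 1. The growth like n! is why the transform of a convergent series is entire.\<close>

lemma norm_Gamma_shift_ge:
  assumes "Re s \<ge> 1"
  shows "norm (Gamma (of_nat n + s)) \<ge> norm (Gamma s) * fact n"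
proof (induction n)
  case (Suc n)
  have "Gamma (of_nat (Suc n) + s) = (of_nat n + s) * Gamma (of_nat n + s)"
    using Gamma_plus1_Re[of "of_nat n + s"] assms by (simp add: add_ac)
  moreover have "norm (of_nat n + s) \<ge> real (Suc n)"
    using complex_Re_le_cmod[of "of_nat n + s"] assms by simp
  ultimately show ?case using Suc mult_mono[of "real (Suc n)" "norm (of_nat n + s)" "norm (Gamma s) * fact n" "norm (Gamma (of_nat n + s))"]
    by (simp add: norm_mult mult_ac)
qed simp

lemma fps_conv_radius_borel_coeffs:
  assumes F: "fps_conv_radius F > 0" and \<beta>: "Re \<beta> \<ge> 0"
  shows "fps_conv_radius (borel_coeffs \<beta> F) = \<infinity>"
proof -
  obtain M A where M: "M \<ge> 0" "A \<ge> 1" "\<And>k n. norm (fps_nth (F * 0 ^ k) n) \<le> M * A ^ k * A ^ n"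
    by (rule fps_power_coeff_bound[OF F, of 0]) auto
  define G where "G = norm (Gamma (\<beta> + 1))"
  have G: "G > 0" using Gamma_nz_Re[of "\<beta> + 1"] \<beta> by (simp add: G_def)
  have "summable (\<lambda>n. fps_nth (borel_coeffs \<beta> F) n * z ^ n)" for z
  proof (rule summable_norm_cancel, rule summable_comparison_test'[OF summable_exp_scaled[of "M / G" "A * norm z"]])
    fix n
    have "norm (fps_nth (borel_coeffs \<beta> F) n * z ^ n) = norm (fps_nth F n) / norm (Gamma (of_nat n + (\<beta> + 1))) * norm z ^ n"
      by (simp add: borel_coeffs_def norm_mult norm_divide norm_power add.assoc)
    also have "\<dots> \<le> (M * A ^ n) / (G * fact n) * norm z ^ n"
      using M(3)[of 0 n] norm_Gamma_shift_ge[of "\<beta> + 1" n] \<beta> G M(1,2)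
      by (intro mult_right_mono frac_le) (auto simp: G_def)
    finally show "norm (norm (fps_nth (borel_coeffs \<beta> F) n * z ^ n)) \<le> M / G * ((A * norm z) ^ n / fact n)"
      by (simp add: power_mult_distrib mult_ac)
  qed
  then show ?thesis unfolding fps_conv_radius_def by (rule conv_radius_inftyI'')
qed

definition borel_hat :: "complex fps \<Rightarrow> complex \<Rightarrow> complex" where
  "borel_hat F = eval_fps (borel_coeffs 0 (fps_shift 1 F))"

lemma fps_conv_radius_borel_hat:
  "fps_conv_radius F > 0 \<Longrightarrow> fps_conv_radius (borel_coeffs 0 (fps_shift 1 F)) = \<infinity>" for F :: "complex fps"
  by (rule fps_conv_radius_borel_coeffs) auto

lemma borel_hat_coeff: "fps_nth (borel_coeffs 0 (fps_shift 1 F)) n = fps_nth F (Suc n) / fact n"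
  by (simp add: borel_coeffs_def Gamma_fact add.commute)

lemma summable_norm_borel_hat:
  fixes F :: "complex fps"
  assumes "fps_conv_radius F > 0"
  shows "summable (\<lambda>n. norm (fps_nth F (Suc n) / fact n * z ^ n))"
proof -
  have "summable (\<lambda>n. norm (fps_nth (borel_coeffs 0 (fps_shift 1 F)) n * z ^ n))"
    using abs_summable_in_conv_radius[of z "fps_nth (borel_coeffs 0 (fps_shift 1 F))"]
       fps_conv_radius_borel_hat[OF assms] by (simp add: fps_conv_radius_def)
  then show ?thesis by (simp only: borel_hat_coeff)
qed

lemma borel_hat_altdef: "borel_hat F z = (\<Sum>n. fps_nth F (Suc n) / fact n * z ^ n)"
  unfolding borel_hat_def eval_fps_def borel_hat_coeff ..

text \<open>The two expansions at (1-t) \<zeta> and t \<zeta> are multiplied by Cauchy's rule and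
  integrated term by term; the Beta values i! (n-i)! / (n+1)! cancel the factorials of the
  transforms and leave the coefficients of the product series.\<close>

lemma convolution_borel_hat:
  assumes F: "fps_conv_radius F > 0" "fps_nth F 0 = 0" and G: "fps_conv_radius G > 0" "fps_nth G 0 = 0"
  shows "convolution (borel_hat F) (borel_hat G) \<zeta> = borel_hat (F * G) \<zeta>"
proof -
  define f where "f = (\<lambda>n. fps_nth F (Suc n) / fact n)"
  define g where "g = (\<lambda>n. fps_nth G (Suc n) / fact n)"
  define c where "c = (\<lambda>n t. \<Sum>i\<le>n. (f i * ((1 - of_real t) * \<zeta>) ^ i) * (g (n - i) * (of_real t * \<zeta>) ^ (n - i)))"
  define I where "I = (\<lambda>n. fps_nth (F * G) (n + 2) / fact (n + 1) * \<zeta> ^ n)"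
  define M where "M = (\<lambda>n. \<Sum>i\<le>n. norm (f i * \<zeta> ^ i) * norm (g (n - i) * \<zeta> ^ (n - i)))"
  have sf: "summable (\<lambda>n. norm (f n * z ^ n))" and sg: "summable (\<lambda>n. norm (g n * z ^ n))" for z
    unfolding f_def g_def by (intro summable_norm_borel_hat F G)+
  have csum: "(\<Sum>n. c n t) = borel_hat F ((1 - of_real t) * \<zeta>) * borel_hat G (of_real t * \<zeta>)" for t
    using Cauchy_product[OF sf[of "(1 - of_real t) * \<zeta>"] sg[of "of_real t * \<zeta>"]]
    unfolding borel_hat_altdef c_def f_def g_def by simp
  \<comment> \<open>The factor \<open>t powr 0\<close> is 1 except at t = 0, where it is 0. It
    brings the integral into the weighted form with exponent 0 and is removed later as a change on a
    null set.\<close>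
  have int: "((\<lambda>t. complex_of_real t powr 0 * c n t) has_integral I n) {0..1}" for n
  proof -
    have "((\<lambda>t. \<Sum>i\<le>n. f i * g (n - i) * \<zeta> ^ n * (complex_of_real t powr 0 * (of_real t ^ (n - i) * of_real (1 - t) ^ i)))
        has_integral (\<Sum>i\<le>n. f i * g (n - i) * \<zeta> ^ n * beta_moment 0 (n - i) i)) {0..1}"
      by (intro has_integral_sum has_integral_mult_right has_integral_beta_moment) auto
    moreover have "(\<Sum>i\<le>n. f i * g (n - i) * \<zeta> ^ n * beta_moment 0 (n - i) i) = I n"
    proof -
      have "beta_moment 0 (n - i) i = fact i * fact (n - i) / fact (n + 1)" if "i \<le> n" for i
        using that Gamma_fact[of "n - i", where 'a=complex] Gamma_fact[of "n + 1", where 'a=complex]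
        by (simp add: beta_moment_def add_ac)
      then have "(\<Sum>i\<le>n. f i * g (n - i) * \<zeta> ^ n * beta_moment 0 (n - i) i) = 
         (\<Sum>i\<le>n. fps_nth F (Suc i) * fps_nth G (Suc (n - i))) / fact (n + 1) * \<zeta> ^ n"
        by (simp add: f_def g_def sum_divide_distrib sum_distrib_right del: fact_Suc)
      also have "(\<Sum>i\<le>n. fps_nth F (Suc i) * fps_nth G (Suc (n - i))) = fps_nth (F * G) (n + 2)"
      proof -
        have "fps_nth (F * G) (n + 2) = (\<Sum>p\<le>Suc (Suc n). fps_nth F p * fps_nth G (Suc (Suc n) - p))"
          by (simp add: fps_mult_nth atLeast0AtMost)
        also have "\<dots> = (\<Sum>p\<le>Suc n. fps_nth F p * fps_nth G (Suc (Suc n) - p))"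
          using G(2) by (subst sum.atMost_Suc) simp
        also have "\<dots> = (\<Sum>i\<le>n. fps_nth F (Suc i) * fps_nth G (Suc (Suc n) - Suc i))"
          using F(2) by (subst sum.atMost_Suc_shift) simp
        also have "\<dots> = (\<Sum>i\<le>n. fps_nth F (Suc i) * fps_nth G (Suc (n - i)))"
          by (intro sum.cong refl) (simp add: Suc_diff_le)
        finally show ?thesis by simp
      qed
      finally show ?thesis by (simp add: I_def)
    qed
    ultimately have "((\<lambda>t. \<Sum>i\<le>n. f i * g (n - i) * \<zeta> ^ n * (complex_of_real t powr 0 * (of_real t ^ (n - i) * of_real (1 - t) ^ i)))
        has_integral I n) {0..1}" by simp
    then show ?thesis
    proof (rule has_integral_eq[rotated])
      fix t :: real
      have "f i * g (n - i) * \<zeta> ^ n * (w * (of_real t ^ (n - i) * of_real (1 - t) ^ i)) =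
         w * (f i * ((1 - of_real t) * \<zeta>) ^ i * (g (n - i) * (of_real t * \<zeta>) ^ (n - i)))" if "i \<le> n" for i w
      proof -
        have "\<zeta> ^ n = \<zeta> ^ i * \<zeta> ^ (n - i)" using that by (simp flip: power_add)
        then show ?thesis by (simp add: power_mult_distrib mult_ac)
      qed
      then show "(\<Sum>i\<le>n. f i * g (n - i) * \<zeta> ^ n * (complex_of_real t powr 0 * (of_real t ^ (n - i) * of_real (1 - t) ^ i))) = complex_of_real t powr 0 * c n t"
        unfolding c_def sum_distrib_left by (intro sum.cong) auto
    qed
  qed
  have bd: "norm (c n t) \<le> M n" if t: "t \<in> {0..1}" for n t
    unfolding c_def M_def
  proof (intro sum_norm_le)
    fix i assume "i \<in> {..n}"
    define p where "p = (1 - of_real t) * \<zeta>"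
    define q where "q = of_real t * \<zeta>"
    have "norm (1 - complex_of_real t) \<le> 1" using norm_of_real[of "1 - t", where 'a=complex] t by simp
    then have pq: "norm p \<le> norm \<zeta>" "norm q \<le> norm \<zeta>"
      using t by (auto simp: p_def q_def norm_mult mult_left_le_one_le)
    show "norm (f i * ((1 - of_real t) * \<zeta>) ^ i * (g (n - i) * (of_real t * \<zeta>) ^ (n - i))) \<le> norm (f i * \<zeta> ^ i) * norm (g (n - i) * \<zeta> ^ (n - i))"
      unfolding p_def[symmetric] q_def[symmetric] norm_mult norm_power
      by (intro mult_mono power_mono pq) auto
  qed
  have M: "summable M"
    unfolding M_def by (rule summable_Cauchy_product) (use sf[of \<zeta>] sg[of \<zeta>] in auto)
  note res = has_integral_weighted_suminf(1)[of 0, OF _ int bd M]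
  have "convolution (borel_hat F) (borel_hat G) \<zeta> = integral {0..1} (\<lambda>t. complex_of_real t powr 0 * (\<Sum>n. c n t) * \<zeta>)"
    unfolding convolution_def csum
    by (rule integral_spike[where S="{0}"]) auto
  also have "\<dots> = integral {0..1} (\<lambda>t. complex_of_real t powr 0 * (\<Sum>n. c n t)) * \<zeta>"
    by (rule integral_mult_left)
  also have "\<dots> = (\<Sum>n. I n * \<zeta>)"
    using sums_mult2[OF res, of \<zeta>] by (simp add: sums_iff)
  \<comment> \<open>The added term of degree 0 is zero: a product of two series without constant
    term has no linear term.\<close>
  also have "\<dots> = (\<Sum>n. fps_nth (F * G) (Suc n) / fact n * \<zeta> ^ n)"
  proof -
    have "(\<lambda>n. I n * \<zeta>) sums (\<Sum>n. I n * \<zeta>)" using sums_mult2[OF res, of \<zeta>] by (simp add: sums_iff)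
    then have "(\<lambda>n. fps_nth (F * G) (Suc (Suc n)) / fact (Suc n) * \<zeta> ^ Suc n) sums (\<Sum>n. I n * \<zeta>)"
      by (simp add: I_def mult_ac)
    then have "(\<lambda>n. fps_nth (F * G) (Suc n) / fact n * \<zeta> ^ n) sums ((\<Sum>n. I n * \<zeta>) + fps_nth (F * G) (Suc 0) / fact 0 * \<zeta> ^ 0)"
      by (rule sums_Suc)
    then show ?thesis using F(2) G(2) by (simp add: sums_iff fps_mult_nth)
  qed
  finally show ?thesis by (simp add: borel_hat_altdef)
qed

lemma fps_conv_pos_power: "fps_conv_radius b > 0 \<Longrightarrow> fps_conv_radius (b ^ k :: complex fps) > 0"
  using fps_conv_radius_power[of b k] by (rule less_le_trans[rotated])

lemma conv_pow_borel_hat: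
  assumes "fps_conv_radius b > 0" "fps_nth b 0 = 0"
  shows "conv_pow (borel_hat b) (Suc k) = borel_hat (b ^ Suc k)"
proof (induction k)
  case (Suc k)
  have "conv_pow (borel_hat b) (Suc (Suc k)) = convolution (borel_hat b) (conv_pow (borel_hat b) (Suc k))"
    by (simp add: conv_pow_def)
  also have "\<dots> = borel_hat (b * b ^ Suc k)"
    unfolding Suc.IH by (rule ext, rule convolution_borel_hat)
       (use assms in \<open>auto simp: fps_power_zeroth intro!: fps_conv_pos_mult fps_conv_pos_power\<close>)
  finally show ?case by simp
qed (simp add: conv_pow_def)

lemma E_coeff_inner:
  assumes "fps_conv_radius (E k) > 0"
  shows "(\<Sum>m. E_coeff E k m * y ^ m) = (-1) ^ k / fact k * borel_hat (E k) y"
  using suminf_mult[OF summable_norm_cancel[OF summable_norm_borel_hat[OF assms, of y]], of "(-1) ^ k / fact k"]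
  by (simp add: borel_hat_altdef E_coeff_def mult.assoc)

lemma E_coeff_sums:
  assumes "dbl_bdd (E_coeff E) C A" "\<And>k. fps_conv_radius (E k) > 0"
  shows "(\<lambda>k. (- x) ^ k / fact k * borel_hat (E k) y) sums dbl (E_coeff E) x y"
proof -
  have "x ^ k * (\<Sum>m. E_coeff E k m * y ^ m) = (- x) ^ k / fact k * borel_hat (E k) y" for k
    unfolding E_coeff_inner[of E, OF assms(2)] by (simp add: power_minus[of x] mult_ac)
  then show ?thesis
    using dbl_iterated(1)[OF assms(1), of x y] by simp
qed

text \<open>The convolutions in the kernel are transforms of the products b^k and (c - 1) b^k. For
  each k these add up to \<open>D_series\<close>, so the kernel is the double series whose
  coefficients came out of the transform of \<open>B_op\<close>.\<close>

lemma K_alpha_eq_dbl: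
  assumes b: "fps_conv_radius b > 0" "fps_nth b 0 = 0"
  shows "summable (\<lambda>k. K_term1 b \<xi> \<zeta> (Suc k))" "summable (\<lambda>k. K_term2 b \<alpha> \<xi> \<zeta> (Suc k))"
    "K_alpha b \<alpha> \<xi> \<zeta> = dbl (K_coeff (c_alpha b \<alpha>) b) \<xi> (\<zeta> - \<xi>)"
    "\<exists>C A. dbl_bdd (K_coeff (c_alpha b \<alpha>) b) C A"
proof -
  let ?c = "c_alpha b \<alpha>"
  have c: "fps_conv_radius ?c > 0" "fps_nth ?c 0 = 1"
    using b by (auto intro: fps_conv_pos_c_alpha c_alpha_nth)
  have c1: "fps_conv_radius (?c - 1) > 0" "fps_nth (?c - 1) 0 = 0"
    using c by (auto intro!: fps_conv_pos_diff)
  \<comment> \<open>The first sum of the kernel has no term with k = 0. \<open>E2\<close> keeps its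
    term with k = 0, which is the isolated summand \<open>c_star_hat\<close>.\<close>
  define E1 where "E1 = (\<lambda>k. if k = 0 then 0 else b ^ k)"
  define E2 where "E2 = (\<lambda>k. (?c - 1) * b ^ k)"
  have bdd: "\<exists>C A. dbl_bdd (E_coeff E) C A" if E: "\<And>k. E k = 0 \<or> E k = c' * b ^ k" and c': "fps_conv_radius c' > 0" for E c'
  proof -
    obtain M A where M: "M \<ge> 0" "A \<ge> 1" "\<And>k n. norm (fps_nth (c' * b ^ k) n) \<le> M * A ^ k * A ^ n"
      by (rule fps_power_coeff_bound[OF c' b(1)]) auto
    have "norm (fps_nth (E k) n) \<le> M * A ^ k * A ^ n" for k n
      using E[of k] M(3)[of k n] M(1,2) by auto
    then have "dbl_bdd (E_coeff E) (M * A) A" using M by (intro dbl_bdd_E_coeff) auto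
    then show ?thesis by blast
  qed
  have rad: "fps_conv_radius (E1 k) > 0" "fps_conv_radius (E2 k) > 0" for k
    using b c1 by (auto simp: E1_def E2_def intro!: fps_conv_pos_mult fps_conv_pos_power)
  have "\<exists>C A. dbl_bdd (E_coeff E1) C A" by (rule bdd[of E1 1]) (auto simp: E1_def)
  then obtain C1 A1 where 1: "dbl_bdd (E_coeff E1) C1 A1" by blast
  have "\<exists>C A. dbl_bdd (E_coeff E2) C A" by (rule bdd[of E2 "?c - 1"]) (use c1 in \<open>auto simp: E2_def\<close>)
  then obtain C2 A2 where 2: "dbl_bdd (E_coeff E2) C2 A2" by blast
  note s1 = E_coeff_sums[OF 1 rad(1), of \<xi> "\<zeta> - \<xi>"]
  note s2 = E_coeff_sums[OF 2 rad(2), of \<xi> "\<zeta> - \<xi>"]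
  have bh: "b_hat b = borel_hat b" "c_star_hat b \<alpha> = borel_hat (?c - 1)"
    by (simp_all add: b_hat_def c_star_hat_def borel_hat_def)
  have t1: "K_term1 b \<xi> \<zeta> (Suc k) = (- \<xi>) ^ Suc k / fact (Suc k) * borel_hat (E1 (Suc k)) (\<zeta> - \<xi>)" for k
    unfolding K_term1_def bh conv_pow_borel_hat[OF b] by (simp add: E1_def)
  have t2: "K_term2 b \<alpha> \<xi> \<zeta> (Suc k) = (- \<xi>) ^ Suc k / fact (Suc k) * borel_hat (E2 (Suc k)) (\<zeta> - \<xi>)" for k
    unfolding K_term2_def bh conv_pow_borel_hat[OF b]
    by (subst convolution_borel_hat) (use b c1 in \<open>auto simp: E2_def fps_power_zeroth simp del: power_Suc intro!: fps_conv_pos_power\<close>)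
  show "summable (\<lambda>k. K_term1 b \<xi> \<zeta> (Suc k))" unfolding t1 by (rule summable_Suc_iff[THEN iffD2, OF sums_summable[OF s1]])
  show "summable (\<lambda>k. K_term2 b \<alpha> \<xi> \<zeta> (Suc k))" unfolding t2 by (rule summable_Suc_iff[THEN iffD2, OF sums_summable[OF s2]])
  have "E1 k + E2 k = D_series ?c b k" for k
    by (simp add: E1_def E2_def D_series_def algebra_simps)
  then have add: "E_coeff E1 k m + E_coeff E2 k m = K_coeff ?c b k m" for k m
    unfolding E_coeff_def K_coeff_def by (metis (no_types, lifting) add_divide_distrib distrib_left fps_add_nth)
  have "dbl_bdd (K_coeff ?c b) (C1 + C2) (max A1 A2)"
    unfolding dbl_bdd_def
  proof (intro conjI allI)
    fix k m
    have "norm (K_coeff ?c b k m) \<le> norm (E_coeff E1 k m) + norm (E_coeff E2 k m)"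
      unfolding add[symmetric] by (rule norm_triangle_ineq)
    also have "\<dots> \<le> C1 * (A1 ^ k / fact k) * (A1 ^ m / fact m) + C2 * (A2 ^ k / fact k) * (A2 ^ m / fact m)"
      using 1 2 by (intro add_mono) (auto simp: dbl_bdd_def)
    also have "\<dots> \<le> C1 * (max A1 A2 ^ k / fact k) * (max A1 A2 ^ m / fact m) + C2 * (max A1 A2 ^ k / fact k) * (max A1 A2 ^ m / fact m)"
      using 1 2 by (intro add_mono mult_mono divide_right_mono power_mono mult_nonneg_nonneg divide_nonneg_nonneg zero_le_power) (auto simp: dbl_bdd_def)
    finally show "norm (K_coeff ?c b k m) \<le> (C1 + C2) * (max A1 A2 ^ k / fact k) * (max A1 A2 ^ m / fact m)"
      by (simp add: algebra_simps add_divide_distrib)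
  qed (use 1 2 in \<open>auto simp: dbl_bdd_def\<close>)
  then show "\<exists>C A. dbl_bdd (K_coeff ?c b) C A" by blast
  have "dbl (K_coeff ?c b) x y = dbl (E_coeff E1) x y + dbl (E_coeff E2) x y" for x y
  proof -
    have "dbl_term (K_coeff ?c b) n x y = dbl_term (E_coeff E1) n x y + dbl_term (E_coeff E2) n x y" for n
      unfolding dbl_term_def add[symmetric] by (simp add: algebra_simps sum.distrib)
    then show ?thesis unfolding dbl_def
      by (simp add: suminf_add summable_norm_cancel[OF summable_norm_dbl_term[OF 1]] summable_norm_cancel[OF summable_norm_dbl_term[OF 2]])
  qed
  moreover have "dbl (E_coeff E1) \<xi> (\<zeta> - \<xi>) = (\<Sum>k. K_term1 b \<xi> \<zeta> (Suc k))"
    using suminf_split_head[OF sums_summable[OF s1]] sums_unique[OF s1]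
    by (simp add: t1 E1_def borel_hat_altdef)
  moreover have "dbl (E_coeff E2) \<xi> (\<zeta> - \<xi>) = c_star_hat b \<alpha> (\<zeta> - \<xi>) + (\<Sum>k. K_term2 b \<alpha> \<xi> \<zeta> (Suc k))"
    using suminf_split_head[OF sums_summable[OF s2]] sums_unique[OF s2]
    by (simp add: t2 E2_def bh)
  ultimately show "K_alpha b \<alpha> \<xi> \<zeta> = dbl (K_coeff ?c b) \<xi> (\<zeta> - \<xi>)"
    by (simp add: K_alpha_def add_ac)
qed

section \<open>The operators after Borel transform\<close>

text \<open>The Volterra integral over the segment from 0 to z, after the substitution \<xi> = t z
  and with the power z^(\<beta>+1) taken out. It is evaluated by grouping the product of the two
  expansions by total degree and integrating term by term with the Beta moments.\<close>

lemma B_op_borel_integral: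
  assumes b: "fps_conv_radius b > 0" "fps_nth b 0 = 0" and \<beta>: "Re \<beta> \<ge> 0"
    and z: "ereal (norm z) < fps_conv_radius (borel_coeffs \<beta> F)"
  shows "(\<lambda>n. fps_nth (borel_coeffs (\<beta> + 1) (B_op b \<alpha> \<beta> F)) n * z ^ n) sums
    integral {0..1} (\<lambda>t. complex_of_real t powr \<beta> * (eval_fps (borel_coeffs \<beta> F) (of_real t * z) * K_alpha b \<alpha> (of_real t * z) z))"
proof -
  let ?\<kappa> = "K_coeff (c_alpha b \<alpha>) b"
  obtain C A where CA: "dbl_bdd ?\<kappa> C A" using K_alpha_eq_dbl(4)[OF b] by blast
  have C: "C \<ge> 0" "A \<ge> 0" using CA by (auto simp: dbl_bdd_def)
  define g where "g = fps_nth (borel_coeffs \<beta> F)"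
  define c where "c = (\<lambda>n t. \<Sum>i\<le>n. (g i * (of_real t * z) ^ i) * dbl_term ?\<kappa> (n - i) (of_real t * z) ((1 - of_real t) * z))"
  define M where "M = (\<lambda>n. \<Sum>i\<le>n. norm (g i * z ^ i) * (C * ((A * (2 * norm z)) ^ (n - i) / fact (n - i))))"
  define I where "I = (\<lambda>n. fps_nth (borel_coeffs (\<beta> + 1) (B_op b \<alpha> \<beta> F)) n * z ^ n)"
  have norm_t: "norm (complex_of_real t * z) \<le> norm z" "norm ((1 - complex_of_real t) * z) \<le> norm z" if "t \<in> {0..1}" for t
  proof -
    have "norm (1 - complex_of_real t) \<le> 1" using norm_of_real[of "1 - t", where 'a=complex] that by simp
    then show "norm (complex_of_real t * z) \<le> norm z" "norm ((1 - complex_of_real t) * z) \<le> norm z"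
      using that by (auto simp: norm_mult mult_left_le_one_le)
  qed
  have sg: "summable (\<lambda>n. norm (g n * w ^ n))" if "norm w \<le> norm z" for w
    unfolding g_def
  proof (rule abs_summable_in_conv_radius)
    have "ereal (norm w) \<le> ereal (norm z)" using that by simp
    then show "ereal (norm w) < conv_radius (fps_nth (borel_coeffs \<beta> F))"
      using z unfolding fps_conv_radius_def by (rule le_less_trans)
  qed
  have csum: "(\<Sum>n. c n t) = eval_fps (borel_coeffs \<beta> F) (of_real t * z) * K_alpha b \<alpha> (of_real t * z) z" if "t \<in> {0..1}" for t
  proof -
    have "(\<Sum>n. c n t) = (\<Sum>n. g n * (of_real t * z) ^ n) * dbl ?\<kappa> (of_real t * z) ((1 - of_real t) * z)"
      unfolding c_def dbl_def
      by (rule Cauchy_product[OF sg[OF norm_t(1)[OF that]] summable_norm_dbl_term[OF CA], symmetric])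
    then show ?thesis by (simp add: K_alpha_eq_dbl(3)[OF b] eval_fps_def g_def left_diff_distrib)
  qed
  have int: "((\<lambda>t. complex_of_real t powr \<beta> * c n t) has_integral I n) {0..1}" for n
  proof -
    have "((\<lambda>t. \<Sum>i\<le>n. \<Sum>k\<le>n - i. g i * ?\<kappa> k (n - i - k) * z ^ n * (complex_of_real t powr \<beta> * (of_real t ^ (k + i) * of_real (1 - t) ^ (n - i - k))))
        has_integral (\<Sum>i\<le>n. \<Sum>k\<le>n - i. g i * ?\<kappa> k (n - i - k) * z ^ n * beta_moment \<beta> (k + i) (n - i - k))) {0..1}"
      by (intro has_integral_sum has_integral_mult_right has_integral_beta_moment \<beta>) auto
    moreover have "(\<Sum>i\<le>n. \<Sum>k\<le>n - i. g i * ?\<kappa> k (n - i - k) * z ^ n * beta_moment \<beta> (k + i) (n - i - k)) = I n"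
      unfolding I_def borel_B_op_nth[OF c_alpha_nth(1)[OF b(2)] b(2) \<beta>] sum_distrib_right g_def
      by (intro sum.cong refl) (simp add: mult_ac)
    ultimately have "((\<lambda>t. \<Sum>i\<le>n. \<Sum>k\<le>n - i. g i * ?\<kappa> k (n - i - k) * z ^ n * (complex_of_real t powr \<beta> * (of_real t ^ (k + i) * of_real (1 - t) ^ (n - i - k))))
        has_integral I n) {0..1}" by simp
    then show ?thesis
    proof (rule has_integral_eq[rotated])
      fix t :: real
      have "g i * x * z ^ n * (w * (of_real t ^ (k + i) * of_real (1 - t) ^ (n - i - k))) =
         w * (g i * (of_real t * z) ^ i * (x * (of_real t * z) ^ k * ((1 - of_real t) * z) ^ (n - i - k)))" if "i \<le> n" "k \<le> n - i" for i k w x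
      proof -
        have "z ^ n = z ^ i * (z ^ k * z ^ (n - i - k))" using that by (simp flip: power_add)
        then show ?thesis by (simp add: power_mult_distrib power_add mult_ac)
      qed
      then show "(\<Sum>i\<le>n. \<Sum>k\<le>n - i. g i * ?\<kappa> k (n - i - k) * z ^ n * (complex_of_real t powr \<beta> * (of_real t ^ (k + i) * of_real (1 - t) ^ (n - i - k)))) = complex_of_real t powr \<beta> * c n t"
        unfolding c_def dbl_term_def sum_distrib_left by (intro sum.cong) auto
    qed
  qed
  have bd: "norm (c n t) \<le> M n" if t: "t \<in> {0..1}" for n t
    unfolding c_def M_def
  proof (intro sum_norm_le)
    fix i
    have "norm (g i * (of_real t * z) ^ i) \<le> norm (g i * z ^ i)"
      unfolding norm_mult[of "g i"] norm_power by (intro mult_mono power_mono norm_t t) auto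
    then show "norm (g i * (of_real t * z) ^ i * dbl_term ?\<kappa> (n - i) (of_real t * z) ((1 - of_real t) * z))
       \<le> norm (g i * z ^ i) * (C * ((A * (2 * norm z)) ^ (n - i) / fact (n - i)))"
      unfolding norm_mult[of "g i * (of_real t * z) ^ i"]
      by (intro mult_mono norm_dbl_term_le'[OF CA] norm_t t) auto
  qed
  have M: "summable M"
    unfolding M_def
    by (rule summable_Cauchy_product) (use sg[of z] summable_exp_scaled[of C "A * (2 * norm z)"] C in \<open>auto simp: abs_mult\<close>)
  have "integral {0..1} (\<lambda>t. complex_of_real t powr \<beta> * (\<Sum>n. c n t)) =
     integral {0..1} (\<lambda>t. complex_of_real t powr \<beta> * (eval_fps (borel_coeffs \<beta> F) (of_real t * z) * K_alpha b \<alpha> (of_real t * z) z))"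
    by (intro integral_cong) (simp add: csum)
  then show ?thesis using has_integral_weighted_suminf(1)[OF \<beta> int bd M] by (simp add: I_def)
qed

lemma fps_conv_radius_geI_sums:
  assumes "\<And>z. ereal (norm z) < R \<Longrightarrow> summable (\<lambda>n. fps_nth F n * z ^ n)"
  shows "fps_conv_radius (F :: complex fps) \<ge> R"
  unfolding fps_conv_radius_def using assms by (intro conv_radius_geI_ex') simp

text \<open>The integral formula gives a convergent expansion wherever the transform of
  \<open>F\<close> converges, as the kernel is entire; only the division by e^\<zeta> - 1 limits the
  radius.\<close>

lemma fps_conv_radius_B_op:
  assumes "fps_conv_radius b > 0" "fps_nth b 0 = 0" "Re \<beta> \<ge> 0"
  shows "fps_conv_radius (borel_coeffs (\<beta> + 1) (B_op b \<alpha> \<beta> F)) \<ge> fps_conv_radius (borel_coeffs \<beta> F)"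
  by (rule fps_conv_radius_geI_sums) (use B_op_borel_integral[OF assms] in \<open>auto simp: sums_iff\<close>)

lemma exp_eq_1_norm_less:
  assumes "norm z < 2 * pi" "exp z = (1::complex)"
  shows "z = 0"
proof -
  obtain n where n: "Re z = 0" "Im z = of_int (2 * n) * pi" using assms(2) by (auto simp: exp_eq_1)
  then have "\<bar>of_int (2 * n) * pi\<bar> < 2 * pi" using assms(1) abs_Im_le_cmod[of z] by simp
  then have "\<bar>real_of_int n\<bar> < 1" by (simp add: abs_mult)
  then have "n = 0" by linarith
  then show ?thesis using n by (simp add: complex_eq_iff)
qed

text \<open>The quotient (e^\<zeta> - 1) / \<zeta>, here \<open>e1\<close>, has no zero in the disc
  of radius 2 \<pi>, so its reciprocal has at least that radius of convergence.\<close>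

lemma borel_E_op_analytic:
  assumes \<beta>: "Re \<beta> \<ge> 0" and R: "fps_conv_radius (borel_coeffs (\<beta> + 1) F) \<ge> ereal (2 * pi)"
  shows "fps_conv_radius (borel_coeffs \<beta> (E_op \<beta> F)) \<ge> ereal (2 * pi)"
    and "norm z < 2 * pi \<Longrightarrow> (exp z - 1) * eval_fps (borel_coeffs \<beta> (E_op \<beta> F)) z = z * eval_fps (borel_coeffs (\<beta> + 1) F) z"
proof -
  define e1 where "e1 = fps_shift 1 (fps_exp 1 - 1 :: complex fps)"
  have e0: "fps_exp 1 - 1 = fps_X * e1"
    unfolding e1_def by (rule fps_ext) (auto split: nat.splits)
  have rad0: "fps_conv_radius (fps_exp 1 - 1 :: complex fps) = \<infinity>"
    using fps_conv_radius_diff[of "fps_exp 1" "1::complex fps"] by simp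
  have rad: "fps_conv_radius e1 = \<infinity>" unfolding e1_def by (simp add: rad0)
  have ev0: "eval_fps (fps_exp 1 - 1) z = exp z - 1" for z :: complex
    by (subst eval_fps_diff) (auto simp: eval_fps_exp)
  have ev: "z * eval_fps e1 z = exp z - 1" for z
    unfolding ev0[symmetric] e0 by (subst eval_fps_mult) (auto simp: rad)
  have nz: "eval_fps e1 z \<noteq> 0" if "norm z < 2 * pi" for z
  proof (cases "z = 0")
    case True
    then show ?thesis by (simp add: eval_fps_at_0 e1_def)
  next
    case False
    then show ?thesis using ev[of z] exp_eq_1_norm_less[OF that] by auto
  qed
  have "fps_X * (e1 * borel_coeffs \<beta> (E_op \<beta> F)) = fps_X * borel_coeffs (\<beta> + 1) F"
    using borel_E_op[OF \<beta>, of F] unfolding e0 by (simp add: mult.assoc)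
  then have eq: "e1 * borel_coeffs \<beta> (E_op \<beta> F) = borel_coeffs (\<beta> + 1) F" by simp
  have inv: "fps_conv_radius (inverse e1) \<ge> min (ereal (2 * pi)) (fps_conv_radius e1)"
    by (rule fps_conv_radius_inverse) (use nz in \<open>auto simp: eball_def e1_def\<close>)
  have "borel_coeffs \<beta> (E_op \<beta> F) = inverse e1 * borel_coeffs (\<beta> + 1) F"
    unfolding eq[symmetric] mult.assoc[symmetric] by (subst inverse_mult_eq_1) (auto simp: e1_def)
  then show R': "fps_conv_radius (borel_coeffs \<beta> (E_op \<beta> F)) \<ge> ereal (2 * pi)"
    using order_trans[OF _ fps_conv_radius_mult[of "inverse e1" "borel_coeffs (\<beta> + 1) F"]] inv R rad by simp
  assume z: "norm z < 2 * pi"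
  have "eval_fps e1 z * eval_fps (borel_coeffs \<beta> (E_op \<beta> F)) z = eval_fps (borel_coeffs (\<beta> + 1) F) z"
    unfolding eq[symmetric] using z R' less_le_trans[of "ereal (norm z)" "ereal (2 * pi)"]
    by (subst eval_fps_mult) (auto simp: rad)
  then show "(exp z - 1) * eval_fps (borel_coeffs \<beta> (E_op \<beta> F)) z = z * eval_fps (borel_coeffs (\<beta> + 1) F) z"
    unfolding ev[symmetric] by simp
qed

text \<open>The series such that \<open>x\<^sup>\<beta>\<^sup>+\<^sup>1\<close> times it is the primitive of \<open>x\<^sup>\<beta> f(x)\<close> vanishing at 0.\<close>

definition powr_prim :: "complex \<Rightarrow> complex fps \<Rightarrow> complex fps" where
  "powr_prim \<beta> f = Abs_fps (\<lambda>n. fps_nth f n / (of_nat n + \<beta> + 1))"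

lemma norm_powr_prim_le:
  assumes "Re \<beta> \<ge> 0"
  shows "norm (fps_nth (powr_prim \<beta> f) n) \<le> norm (fps_nth f n)"
proof -
  have "1 \<le> norm (of_nat n + \<beta> + 1)" using complex_Re_le_cmod[of "of_nat n + \<beta> + 1"] assms by simp
  then show ?thesis by (simp add: powr_prim_def norm_divide divide_le_eq mult_left_le mult_le_cancel_left1 not_less)
qed

lemma fps_conv_radius_powr_prim:
  assumes \<beta>: "Re \<beta> \<ge> 0"
  shows "fps_conv_radius (powr_prim \<beta> f) \<ge> fps_conv_radius f"
proof (rule fps_conv_radius_geI_sums, rule summable_norm_cancel)
  fix z :: complex assume "ereal (norm z) < fps_conv_radius f"
  then have "summable (\<lambda>n. norm (fps_nth f n * z ^ n))"
    by (intro abs_summable_in_conv_radius) (simp add: fps_conv_radius_def)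
  then show "summable (\<lambda>n. norm (fps_nth (powr_prim \<beta> f) n * z ^ n))"
    by (rule summable_comparison_test') (simp add: norm_mult mult_right_mono norm_powr_prim_le[OF \<beta>])
qed

text \<open>The coefficients are chosen so that (\<beta> + 1) p + x p' = f, and the left side is
  x^(-\<beta>) times the derivative of x^(\<beta>+1) p.\<close>

lemma powr_prim_has_field_derivative:
  assumes \<beta>: "Re \<beta> \<ge> 0" and x: "ereal (norm x) < fps_conv_radius f" "x \<notin> \<real>\<^sub>\<le>\<^sub>0"
  shows "((\<lambda>x. x powr (\<beta> + 1) * eval_fps (powr_prim \<beta> f) x) has_field_derivative x powr \<beta> * eval_fps f x) (at x)"
proof -
  let ?p = "powr_prim \<beta> f"
  have rad: "ereal (norm x) < fps_conv_radius ?p" using x(1) fps_conv_radius_powr_prim[OF \<beta>, of f] by (rule less_le_trans)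
  have nz: "of_nat n + \<beta> + 1 \<noteq> 0" for n using \<beta> by (auto simp: complex_eq_iff)
  have "fps_const (\<beta> + 1) * ?p + fps_X * fps_deriv ?p = f"
  proof (rule fps_ext)
    fix n
    have "(\<beta> + 1) * fps_nth ?p n + of_nat n * fps_nth ?p n = fps_nth f n"
    proof -
      have "(\<beta> + 1) * fps_nth ?p n + of_nat n * fps_nth ?p n = (of_nat n + \<beta> + 1) * fps_nth ?p n"
        by (simp add: algebra_simps)
      also have "\<dots> = fps_nth f n" using nz[of n] by (simp add: powr_prim_def)
      finally show ?thesis .
    qed
    then show "fps_nth (fps_const (\<beta> + 1) * ?p + fps_X * fps_deriv ?p) n = fps_nth f n"
      by (cases n) auto
  qed
  then have "eval_fps f x = eval_fps (fps_const (\<beta> + 1) * ?p + fps_X * fps_deriv ?p) x" by simp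
  also have "\<dots> = (\<beta> + 1) * eval_fps ?p x + x * eval_fps (fps_deriv ?p) x"
  proof -
    have r: "ereal (norm x) < fps_conv_radius (fps_deriv ?p)"
      using rad fps_conv_radius_deriv[of ?p] by (simp add: less_le_trans)
    have "ereal (norm x) < fps_conv_radius (fps_const (\<beta> + 1) * ?p)" "ereal (norm x) < fps_conv_radius (fps_X * fps_deriv ?p)"
      using rad r by (auto intro: less_le_trans[OF _ fps_conv_radius_mult])
    then show ?thesis using rad r by (simp add: eval_fps_add eval_fps_mult)
  qed
  finally have "eval_fps f x = (\<beta> + 1) * eval_fps ?p x + x * eval_fps (fps_deriv ?p) x" .
  moreover have "((\<lambda>x. x powr (\<beta> + 1) * eval_fps ?p x) has_field_derivative
      (\<beta> + 1) * x powr \<beta> * eval_fps ?p x + x powr (\<beta> + 1) * eval_fps (fps_deriv ?p) x) (at x)"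
    using x(2) rad by (auto intro!: derivative_eq_intros simp: powr_diff)
  moreover have "x powr (\<beta> + 1) = x * x powr \<beta>" using x(2) by (auto simp: powr_add)
  ultimately show ?thesis by (simp add: algebra_simps)
qed

text \<open>Brings the primitive into the form of the integral in
  \<open>B_op_borel_integral\<close>, so that its value on the diagonal can be identified with the
  transform of \<open>B_op\<close>.\<close>

lemma eval_powr_prim:
  assumes \<beta>: "Re \<beta> \<ge> 0" and z: "ereal (norm z) < fps_conv_radius f"
  shows "eval_fps (powr_prim \<beta> f) z = integral {0..1} (\<lambda>t. complex_of_real t powr \<beta> * eval_fps f (of_real t * z))"
proof -
  have s: "summable (\<lambda>n. norm (fps_nth f n * z ^ n))"
    using z by (intro abs_summable_in_conv_radius) (simp add: fps_conv_radius_def)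
  have int: "((\<lambda>t. complex_of_real t powr \<beta> * (fps_nth f n * (of_real t * z) ^ n)) has_integral fps_nth (powr_prim \<beta> f) n * z ^ n) {0..1}" for n
  proof -
    define s where "s = of_nat n + \<beta> + 1"
    have sp: "Re s > 0" using \<beta> by (simp add: s_def)
    have e: "of_nat (n + 0) + \<beta> + 2 = s + 1" by (simp add: s_def)
    then have "beta_moment \<beta> n 0 = 1 / s"
      unfolding beta_moment_def e s_def[symmetric] using Gamma_nz_Re[OF sp] by (simp add: Gamma_plus1_Re[OF sp])
    then show ?thesis
      using has_integral_mult_right[OF has_integral_beta_moment[OF \<beta>, of n 0], of "fps_nth f n * z ^ n"]
      by (simp add: powr_prim_def s_def power_mult_distrib mult_ac)
  qed
  have bd: "norm (fps_nth f n * (of_real t * z) ^ n) \<le> norm (fps_nth f n * z ^ n)" if "t \<in> {0..1}" for n t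
    using that unfolding norm_mult norm_power by (intro mult_left_mono power_mono) (auto simp: mult_left_le_one_le)
  show ?thesis
    using has_integral_weighted_suminf(1)[OF \<beta> int bd s] by (simp add: eval_fps_def sums_iff)
qed

section \<open>Integrals along paths\<close>

text \<open>The consequence of \<open>piecewise_C1\<close> that is used: a derivative that is
  continuous and bounded off a finite set. It is stable under joining and under monotone
  reparametrisation without bookkeeping of partitions.\<close>

definition bdd_pc1 :: "(real \<Rightarrow> 'a::real_normed_vector) \<Rightarrow> bool" where
  "bdd_pc1 \<gamma> \<longleftrightarrow> continuous_on {0..1} \<gamma> \<and>
     (\<exists>S D B. finite S \<and> continuous_on ({0<..<1} - S) D \<and>
        (\<forall>t\<in>{0<..<1} - S. (\<gamma> has_vector_derivative D t) (at t) \<and> norm (D t) \<le> B))"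

text \<open>At the exceptional points the vector derivative may be arbitrary; measurability survives
  because they are finitely many.\<close>

lemma bdd_pc1_vector_derivative:
  fixes \<gamma> :: "real \<Rightarrow> complex"
  assumes "bdd_pc1 \<gamma>"
  obtains S B where "finite S" "B \<ge> 0"
    "\<And>t. t \<in> {0<..<1} - S \<Longrightarrow> (\<gamma> has_vector_derivative vector_derivative \<gamma> (at t)) (at t)"
    "\<And>t. t \<in> {0<..<1} - S \<Longrightarrow> norm (vector_derivative \<gamma> (at t)) \<le> B"
    "(\<lambda>t. indicator {0<..<1} t *\<^sub>R vector_derivative \<gamma> (at t)) \<in> borel_measurable borel"
proof -
  obtain S D B where S: "finite S" and D: "continuous_on ({0<..<1} - S) D"
    and der: "\<And>t. t \<in> {0<..<1} - S \<Longrightarrow> (\<gamma> has_vector_derivative D t) (at t) \<and> norm (D t) \<le> B"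
    using assms unfolding bdd_pc1_def by blast
  have vd: "vector_derivative \<gamma> (at t) = D t" if "t \<in> {0<..<1} - S" for t
    using der[OF that] by (intro vector_derivative_at) auto
  have "open ({0<..<1} - S)" using S by (intro open_Diff finite_imp_closed) auto
  then have "(\<lambda>t. indicator ({0<..<1} - S) t *\<^sub>R D t) \<in> borel_measurable borel"
    using D by (intro borel_measurable_continuous_on_indicator) auto
  then have "(\<lambda>t. indicator {0<..<1} t *\<^sub>R vector_derivative \<gamma> (at t)) \<in> borel_measurable borel"
  proof (rule measurable_discrete_difference[where X=S])
    show "indicator ({0<..<1} - S) t *\<^sub>R D t = indicator {0<..<1} t *\<^sub>R vector_derivative \<gamma> (at t)" if "t \<notin> S" for t
      using vd[of t] that by (auto simp: indicator_def)
  qed (use S in \<open>auto intro: countable_finite\<close>)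
  with S der vd show ?thesis by (intro that[of S "\<bar>B\<bar>"]) (auto intro: order_trans[OF _ abs_ge_self])
qed

lemma set_integrable_bdd_pc1:
  fixes \<gamma> :: "real \<Rightarrow> complex" and p :: "real \<Rightarrow> complex"
  assumes \<gamma>: "bdd_pc1 \<gamma>" and st: "0 \<le> s" "t \<le> 1" and p: "continuous_on {s<..<t} p" "\<And>u. u \<in> {s<..<t} \<Longrightarrow> norm (p u) \<le> B"
  shows "set_integrable lborel {s<..<t} (\<lambda>u. p u * vector_derivative \<gamma> (at u))"
proof -
  obtain S B' where S: "finite S" "B' \<ge> 0"
    and bd: "\<And>t. t \<in> {0<..<1} - S \<Longrightarrow> norm (vector_derivative \<gamma> (at t)) \<le> B'"
    and m: "(\<lambda>t. indicator {0<..<1} t *\<^sub>R vector_derivative \<gamma> (at t)) \<in> borel_measurable borel"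
    by (rule bdd_pc1_vector_derivative[OF \<gamma>]) blast
  have sub: "{s<..<t} \<subseteq> {0<..<1}" using st by auto
  have eq: "(\<lambda>u. indicator {s<..<t} u *\<^sub>R (p u * vector_derivative \<gamma> (at u))) =
     (\<lambda>u. (indicator {s<..<t} u *\<^sub>R p u) * (indicator {0<..<1} u *\<^sub>R vector_derivative \<gamma> (at u)))"
    using sub by (auto simp: indicator_def fun_eq_iff)
  have pm: "(\<lambda>u. indicator {s<..<t} u *\<^sub>R p u) \<in> borel_measurable borel"
    by (rule borel_measurable_continuous_on_indicator[OF _ p(1)]) auto
  show ?thesis unfolding set_integrable_def
  proof (rule Bochner_Integration.integrable_bound)
    show "integrable lborel (\<lambda>u. indicator {s<..<t} u *\<^sub>R (\<bar>B\<bar> * B'))"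
      by (cases "s \<le> t") (auto intro!: integrable_real_mult_indicator)
    show "(\<lambda>u. indicator {s<..<t} u *\<^sub>R (p u * vector_derivative \<gamma> (at u))) \<in> borel_measurable lborel"
      unfolding eq measurable_lborel2 by (rule borel_measurable_times[OF pm m])
    have "AE u in lborel. u \<notin> S"
      using S(1) by (intro AE_not_in countable_imp_null_set_lborel countable_finite)
    then show "AE u in lborel. norm (indicator {s<..<t} u *\<^sub>R (p u * vector_derivative \<gamma> (at u))) \<le> norm (indicator {s<..<t} u *\<^sub>R (\<bar>B\<bar> * B'))"
    proof eventually_elim
      case (elim u)
      show ?case
      proof (cases "u \<in> {s<..<t}")
        case True
        then have "norm (p u) * norm (vector_derivative \<gamma> (at u)) \<le> \<bar>B\<bar> * B'"
          using sub elim by (intro mult_mono bd order_trans[OF p(2)]) auto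
        then show ?thesis using True S(2) by (simp add: norm_mult)
      qed simp
    qed
  qed
qed

text \<open>The primitive needs a derivative only at interior parameters and continuity at the ends,
  and integrability is a hypothesis. This allows an integrand that is singular at an end of the
  path.\<close>

lemma bdd_pc1_FTC:
  fixes \<gamma> :: "real \<Rightarrow> complex"
  assumes \<gamma>: "bdd_pc1 \<gamma>" and st: "0 \<le> s" "s \<le> t" "t \<le> 1"
    and cont: "continuous_on {s..t} (\<lambda>u. P (\<gamma> u))"
    and der: "\<And>u. u \<in> {s<..<t} \<Longrightarrow> (P has_field_derivative p u) (at (\<gamma> u))"
    and int: "set_integrable lborel {s<..<t} (\<lambda>u. p u * vector_derivative \<gamma> (at u))"
  shows "set_lebesgue_integral lborel {s<..<t} (\<lambda>u. p u * vector_derivative \<gamma> (at u)) = P (\<gamma> t) - P (\<gamma> s)"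
proof -
  obtain S B' where S: "finite S" 
    and vd: "\<And>t. t \<in> {0<..<1} - S \<Longrightarrow> (\<gamma> has_vector_derivative vector_derivative \<gamma> (at t)) (at t)"
    by (rule bdd_pc1_vector_derivative[OF \<gamma>]) blast
  have "((\<lambda>u. p u * vector_derivative \<gamma> (at u)) has_integral P (\<gamma> t) - P (\<gamma> s)) {s..t}"
  proof (rule fundamental_theorem_of_calculus_interior_strong[OF S st(2) _ cont])
    fix u assume u: "u \<in> {s<..<t} - S"
    then have "(P \<circ> \<gamma> has_vector_derivative vector_derivative \<gamma> (at u) * p u) (at u)"
      using st by (intro field_vector_diff_chain_at vd der) auto
    then show "((\<lambda>u. P (\<gamma> u)) has_vector_derivative p u * vector_derivative \<gamma> (at u)) (at u)"
      by (simp add: o_def mult.commute)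
  qed
  then have "((\<lambda>u. p u * vector_derivative \<gamma> (at u)) has_integral P (\<gamma> t) - P (\<gamma> s)) {s<..<t}"
    by (simp add: has_integral_Icc_iff_Ioo)
  then show ?thesis
    using set_borel_integral_eq_integral(2)[OF int] by (simp add: integral_unique)
qed

text \<open>Integral of \<open>h\<close> over the segment from \<open>a\<close> to \<open>z\<close>, over the open parameter interval, so that
  \<open>h\<close> may be singular at the ends.\<close>

definition seg :: "(complex \<Rightarrow> complex) \<Rightarrow> complex \<Rightarrow> complex \<Rightarrow> complex" where
  "seg h a z = set_lebesgue_integral lborel {0<..<1} (\<lambda>s. h (linepath a z s) * (z - a))"

lemma linepath_in_convex: "convex U \<Longrightarrow> a \<in> U \<Longrightarrow> z \<in> U \<Longrightarrow> s \<in> {0..1} \<Longrightarrow> linepath a z s \<in> U"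
  using closed_segment_subset[of a U z] linepath_in_path[of s a z] by auto

lemma seg_primitive:
  assumes U: "open U" "convex U" and P: "\<And>x. x \<in> U \<Longrightarrow> (P has_field_derivative h x) (at x)"
    and az: "a \<in> U" "z \<in> U"
  shows "seg h a z = P z - P a"
proof -
  have "P holomorphic_on U" using P U(1) by (auto simp: holomorphic_on_open)
  then have "deriv P holomorphic_on U" using U(1) by (rule holomorphic_deriv)
  moreover have "h x = deriv P x" if "x \<in> U" for x using P[OF that] by (simp add: DERIV_imp_deriv)
  ultimately have "h holomorphic_on U" by (metis holomorphic_transform)
  then have "continuous_on U h" by (rule holomorphic_on_imp_continuous_on)
  then have "continuous_on {0..1} (\<lambda>s. h (linepath a z s))"
    by (rule continuous_on_compose2[OF _ continuous_on_linepath]) (use linepath_in_convex[OF U(2) az] in auto)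
  then have ch: "continuous_on {0..1} (\<lambda>s. h (linepath a z s) * (z - a))"
    by (rule continuous_on_mult_right)
  have hc: "(h has_contour_integral (P (pathfinish (linepath a z)) - P (pathstart (linepath a z)))) (linepath a z)"
  proof (rule contour_integral_primitive)
    show "(P has_field_derivative h x) (at x within U)" if "x \<in> U" for x
      using P[OF that] by (rule has_field_derivative_at_within)
    show "path_image (linepath a z) \<subseteq> U" using az U(2) by (simp add: closed_segment_subset)
  qed simp
  have "((\<lambda>s. h (linepath a z s) * (z - a)) has_integral P z - P a) {0..1}"
    using hc by (simp add: has_contour_integral_linepath)
  then have "((\<lambda>s. h (linepath a z s) * (z - a)) has_integral P z - P a) {0<..<1}"
    by (simp add: has_integral_Icc_iff_Ioo)
  moreover have "set_integrable lborel {0<..<1} (\<lambda>s. h (linepath a z s) * (z - a))"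
    by (rule set_integrable_subset[OF borel_integrable_atLeastAtMost'[OF ch]]) auto
  ultimately show ?thesis
    unfolding seg_def using set_borel_integral_eq_integral(2) by (metis integral_unique)
qed

lemma seg_cong:
  assumes "\<And>x. x \<in> closed_segment a z \<Longrightarrow> h x = h' x"
  shows "seg h a z = seg h' a z"
  unfolding seg_def
  by (rule set_lebesgue_integral_cong) (auto intro!: assms linepath_in_path)

lemma seg_same [simp]: "seg h a a = 0"
  by (simp add: seg_def set_lebesgue_integral_def)

text \<open>Continuity up to the closed interval yields the local bound by compactness, with the
  constant weight 1.\<close>

lemma holomorphic_on_integral_Ioo:
  fixes f :: "complex \<Rightarrow> real \<Rightarrow> complex"
  assumes U: "open U" and cont: "continuous_on (U \<times> {0..1}) (\<lambda>(z, s). f z s)"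
    and hol: "\<And>s. s \<in> {0<..<1} \<Longrightarrow> (\<lambda>z. f z s) holomorphic_on U"
  shows "(\<lambda>z. set_lebesgue_integral lborel {0<..<1} (f z)) holomorphic_on U"
proof -
  have "(\<lambda>z. set_lebesgue_integral lborel {0<..<1} (\<lambda>s. f z s * 1)) holomorphic_on U"
  proof (rule holomorphic_on_set_lebesgue_integral[OF _ U hol])
    have "set_integrable lborel {0..1::real} (\<lambda>s. 1::complex)"
      by (rule borel_integrable_atLeastAtMost') (rule continuous_on_const)
    then show "set_integrable lborel {0<..<1::real} (\<lambda>s. 1::complex)"
      by (rule set_integrable_subset) auto
    show "set_borel_measurable lborel {0<..<1} (f z)" if "z \<in> U" for z
    proof -
      have "continuous_on {0<..<1} (\<lambda>s. case (z, s) of (z, s) \<Rightarrow> f z s)"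
        by (rule continuous_on_compose2[OF cont]) (use that in \<open>auto intro!: continuous_intros\<close>)
      then have "continuous_on {0<..<1} (f z)" by simp
      then show ?thesis unfolding set_borel_measurable_def
        by (simp add: borel_measurable_continuous_on_indicator)
    qed
    show "\<exists>r>0. \<exists>B. cball z r \<subseteq> U \<and> (\<forall>w\<in>cball z r. \<forall>s\<in>{0<..<1}. norm (f w s) \<le> B)" if zU: "z \<in> U" for z
    proof -
      obtain r where r: "r > 0" "cball z r \<subseteq> U" using U zU open_contains_cball by blast
      have "compact ((\<lambda>(z, s). f z s) ` (cball z r \<times> {0..1}))"
        by (intro compact_continuous_image compact_Times continuous_on_subset[OF cont]) (use r in auto)
      then obtain B where "\<forall>y\<in>(\<lambda>(z, s). f z s) ` (cball z r \<times> {0..1}). norm y \<le> B"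
        using compact_imp_bounded bounded_iff by blast
      then show ?thesis using r by (intro exI[of _ r] conjI exI[of _ B]) auto
    qed
  qed
  then show ?thesis by simp
qed

lemma germ_family_continuous_on:
  assumes F: "germ_family \<gamma> J F" and \<gamma>: "continuous_on J \<gamma>"
  shows "continuous_on J (\<lambda>t. F t (\<gamma> t))"
  unfolding continuous_on_eq_continuous_within continuous_within
proof
  fix t assume t: "t \<in> J"
  obtain d where d: "d > 0" "\<And>s. s \<in> J \<Longrightarrow> dist s t < d \<Longrightarrow> \<forall>\<^sub>F z in nhds (\<gamma> s). F s z = F t z"
    by (rule germ_familyD[OF F t]) blast
  have "F t analytic_on {\<gamma> t}" using F t unfolding germ_family_def by auto
  then have "isCont (F t) (\<gamma> t)" by (simp add: analytic_at_imp_isCont)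
  moreover have "(\<gamma> \<longlongrightarrow> \<gamma> t) (at t within J)" using \<gamma> t by (auto simp: continuous_on_def)
  ultimately have "((\<lambda>s. F t (\<gamma> s)) \<longlongrightarrow> F t (\<gamma> t)) (at t within J)"
    by (rule isCont_tendsto_compose)
  moreover have "\<forall>\<^sub>F s in at t within J. F t (\<gamma> s) = F s (\<gamma> s)"
    unfolding eventually_at using d eventually_nhds_x_imp_x by (intro exI[of _ d]) fastforce
  ultimately show "((\<lambda>t. F t (\<gamma> t)) \<longlongrightarrow> F t (\<gamma> t)) (at t within J)"
    by (rule Lim_transform_eventually)
qed

lemma germ_family_const:
  assumes "\<And>t. t \<in> J \<Longrightarrow> \<phi> analytic_on {\<gamma> t}"
  shows "germ_family \<gamma> J (\<lambda>t. \<phi>)"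
  using assms by (simp add: germ_family_def)

lemma isCont_imp_tendsto_nhds: "isCont f a \<Longrightarrow> (f \<longlongrightarrow> f a) (nhds a)" for f :: "complex \<Rightarrow> 'b::t2_space"
  by (simp add: isCont_def tendsto_nhds_iff)

text \<open>A branch of the power along the path. The half-open interval is contractible, so
  \<gamma> has a continuous logarithm there; it is normalised by the principal one at a parameter
  \<open>t0\<close> where the path avoids the cut, and uniqueness of continuation extends the
  agreement to all of the initial piece.\<close>

lemma powr_germ_family:
  assumes \<gamma>: "continuous_on {0..1} \<gamma>" and nz: "\<And>t. t \<in> {0<..1} \<Longrightarrow> \<gamma> t \<noteq> 0"
    and \<epsilon>: "0 < \<epsilon>" "\<epsilon> < 1" and pos: "\<And>t. t \<in> {0<..<\<epsilon>} \<Longrightarrow> \<gamma> t \<notin> \<real>\<^sub>\<le>\<^sub>0"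
    and B: "B holomorphic_on UNIV"
  obtains F where "germ_family \<gamma> {0<..1} F"
    "\<And>t. t \<in> {0<..<\<epsilon>} \<Longrightarrow> \<forall>\<^sub>F z in nhds (\<gamma> t). F t z = z powr a * B z"
proof -
  have cont: "continuous_on {0<..1} \<gamma>" by (rule continuous_on_subset[OF \<gamma>]) auto
  have "contractible {0<..1::real}" by (rule convex_imp_contractible) simp
  then obtain g where g: "continuous_on {0<..1} g" "\<And>t. t \<in> {0<..1} \<Longrightarrow> \<gamma> t = exp (g t)"
    using continuous_logarithm_on_contractible[OF cont _ nz] by blast
  define t0 where "t0 = \<epsilon> / 2"
  have t0: "t0 \<in> {0<..<\<epsilon>}" "t0 \<in> {0<..1}" using \<epsilon> by (auto simp: t0_def)
  define L where "L = (\<lambda>t. g t - g t0 + Ln (\<gamma> t0))"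
  have L: "continuous_on {0<..1} L" "\<And>t. t \<in> {0<..1} \<Longrightarrow> exp (L t) = \<gamma> t"
    using g nz[OF t0(2)] t0 by (auto simp: L_def exp_add exp_diff intro!: continuous_intros)
  define F where "F = (\<lambda>t z. exp (a * (L t + Ln (z / \<gamma> t))) * B z)"
  have Fan: "F t analytic_on {\<gamma> t}" if "t \<in> {0<..1}" for t
    unfolding F_def using nz[OF that] B
    by (intro analytic_intros) (auto simp: analytic_on_open intro: analytic_on_subset[of _ UNIV])
  have germ: "germ_family \<gamma> {0<..1} F"
    unfolding germ_family_def
  proof (intro ballI conjI Fan)
    fix t :: real assume t: "t \<in> {0<..1}"
    have "((\<lambda>s. L s - L t) \<longlongrightarrow> L t - L t) (at t within {0<..1})"
      using L(1) t by (intro tendsto_intros) (auto simp: continuous_on_def)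
    then have "\<forall>\<^sub>F s in at t within {0<..1}. dist (L s - L t) 0 < 1"
      by (intro tendstoD) auto
    moreover have "((\<lambda>s. Re (\<gamma> s / \<gamma> t)) \<longlongrightarrow> Re (\<gamma> t / \<gamma> t)) (at t within {0<..1})"
      using cont t nz[OF t] by (intro tendsto_intros) (auto simp: continuous_on_def)
    then have "\<forall>\<^sub>F s in at t within {0<..1}. Re (\<gamma> s / \<gamma> t) > 0"
      using nz[OF t] by (intro order_tendstoD(1)) auto
    moreover have "\<forall>\<^sub>F s in at t within {0<..1}. s \<in> {0<..1}"
      by (simp add: eventually_at_filter)
    ultimately show "\<forall>\<^sub>F s in at t within {0<..1}. \<forall>\<^sub>F z in nhds (\<gamma> s). F s z = F t z"
    proof eventually_elim
      case (elim s)
      have e: "exp (L s - L t) = \<gamma> s / \<gamma> t" using L(2) t elim by (simp add: exp_diff)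
      have "\<bar>Im (L s - L t)\<bar> < 1" using elim abs_Im_le_cmod[of "L s - L t"] by simp
      \<comment> \<open>The imaginary part is less than 1 in absolute value, hence the continuous
        logarithm of the quotient is the principal one.\<close>
      then have "Ln (exp (L s - L t)) = L s - L t" using pi_gt3 by (intro Ln_exp) auto
      then have Ls: "L s = L t + Ln (\<gamma> s / \<gamma> t)" by (simp add: e)
      have nzs: "\<gamma> s \<noteq> 0" "\<gamma> t \<noteq> 0" using nz t elim by auto
      have "((\<lambda>z. Re (z / \<gamma> s)) \<longlongrightarrow> Re (\<gamma> s / \<gamma> s)) (nhds (\<gamma> s))"
        using nzs by (intro isCont_imp_tendsto_nhds continuous_intros) auto
      then have "\<forall>\<^sub>F z in nhds (\<gamma> s). Re (z / \<gamma> s) > 0"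
        using nzs by (intro order_tendstoD(1)) auto
      then show ?case
      proof eventually_elim
        case (elim z)
        have z0: "z \<noteq> 0" using elim by auto
        have "\<bar>Im (Ln (z / \<gamma> s))\<bar> < pi / 2" "\<bar>Im (Ln (\<gamma> s / \<gamma> t))\<bar> < pi / 2"
          using elim \<open>Re (\<gamma> s / \<gamma> t) > 0\<close> z0 nzs by (intro Re_Ln_pos_lt[THEN iffD2]; simp)+
        then have "Ln ((\<gamma> s / \<gamma> t) * (z / \<gamma> s)) = Ln (\<gamma> s / \<gamma> t) + Ln (z / \<gamma> s)"
          using z0 nzs by (intro Ln_times_simple) auto
        then have "L s + Ln (z / \<gamma> s) = L t + Ln (z / \<gamma> t)" using nzs by (simp add: Ls)
        then show ?case by (simp only: F_def)
      qed
    qed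
  qed
  have init0: "\<forall>\<^sub>F z in nhds (\<gamma> t0). F t0 z = z powr a * B z"
  proof -
    have nzs: "\<gamma> t0 \<noteq> 0" using nz t0 by auto
    have "isCont (\<lambda>z. Ln (\<gamma> t0) + Ln (z / \<gamma> t0) - Ln z) (\<gamma> t0)"
      using nzs pos[OF t0(1)] by (intro continuous_intros) auto
    from isCont_imp_tendsto_nhds[OF this]
    have "((\<lambda>z. Ln (\<gamma> t0) + Ln (z / \<gamma> t0) - Ln z) \<longlongrightarrow> 0) (nhds (\<gamma> t0))"
      using nzs by simp
    then have "\<forall>\<^sub>F z in nhds (\<gamma> t0). dist (Ln (\<gamma> t0) + Ln (z / \<gamma> t0) - Ln z) 0 < 1"
      by (rule tendstoD) simp
    moreover have "\<forall>\<^sub>F z in nhds (\<gamma> t0). z \<noteq> 0"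
      using nzs by (intro t1_space_nhds)
    ultimately show ?thesis
    proof eventually_elim
      case (elim z)
      let ?w = "Ln (\<gamma> t0) + Ln (z / \<gamma> t0) - Ln z"
      have e: "exp ?w = 1" using elim nzs by (simp add: exp_add exp_diff)
      \<comment> \<open>A logarithm of 1 is an integer multiple of 2 \<pi> i, and its imaginary part
        is smaller than 1.\<close>
      have "?w = 0" 
      proof -
        have "\<bar>Im ?w\<bar> < 1" using elim abs_Im_le_cmod[of ?w] by simp
        then have "Ln (exp ?w) = ?w" using pi_gt3 by (intro Ln_exp) auto
        then show ?thesis by (simp only: e Ln_1)
      qed
      then have "L t0 + Ln (z / \<gamma> t0) = Ln z" by (simp add: L_def)
      then show ?case using elim by (simp add: F_def powr_def)
    qed
  qed
  show ?thesis
  proof (rule that[OF germ])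
    fix t assume t: "t \<in> {0<..<\<epsilon>}"
    show "\<forall>\<^sub>F z in nhds (\<gamma> t). F t z = z powr a * B z"
    proof (rule germ_family_unique[where F=F and G="\<lambda>t z. z powr a * B z" and \<gamma>=\<gamma>, OF _ _ _ _ t0(1) init0 t])
      show "continuous_on {0<..<\<epsilon>} \<gamma>" by (rule continuous_on_subset[OF cont]) (use \<epsilon> in auto)
      show "germ_family \<gamma> {0<..<\<epsilon>} F"
      proof (rule germ_family_compose[OF germ, where \<tau>="\<lambda>t. t"])
        show "(\<lambda>t. t) ` {0<..<\<epsilon>} \<subseteq> {0<..1}" using \<epsilon> by auto
      qed auto
      show "germ_family \<gamma> {0<..<\<epsilon>} (\<lambda>t z. z powr a * B z)"
        using pos B by (intro germ_family_const analytic_intros) (auto simp: analytic_on_open intro: analytic_on_subset[of _ UNIV])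
    qed simp
  qed
qed

section \<open>Continuation of the iterates\<close>

text \<open>\<open>\<gamma>\<close> leaves 0 along the positive axis. There the \<open>\<phi> k\<close> are explicit,
  defined on \<open>W\<close>, and \<open>P k z\<close> is the primitive of \<open>K(\<cdot>, z) \<phi> k\<close> vanishing at 0; \<open>F0\<close> continues \<open>\<phi> 0\<close>
  along \<open>\<gamma>\<close>.\<close>

locale resurgent_path =
  fixes \<gamma> :: "real \<Rightarrow> complex" and \<epsilon> :: real and K :: "complex \<Rightarrow> complex \<Rightarrow> complex"
    and \<phi> :: "nat \<Rightarrow> complex \<Rightarrow> complex" and P :: "nat \<Rightarrow> complex \<Rightarrow> complex \<Rightarrow> complex"
    and F0 :: "real \<Rightarrow> complex \<Rightarrow> complex" and W :: "complex set"
  assumes pc1: "bdd_pc1 \<gamma>" and eps: "0 < \<epsilon>" "\<epsilon> < 1" and \<gamma>0: "\<gamma> 0 = 0"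
    and pos: "\<And>t. t \<in> {0<..<\<epsilon>} \<Longrightarrow> \<gamma> t = of_real (Re (\<gamma> t)) \<and> 0 < Re (\<gamma> t) \<and> Re (\<gamma> t) < 1"
    and avoid: "\<And>t. t \<in> {0<..<1} \<Longrightarrow> exp (\<gamma> t) \<noteq> 1"
    and Kc: "continuous_on UNIV (\<lambda>(x, z). K x z)"
    and Kh: "\<And>U p q. open U \<Longrightarrow> p holomorphic_on U \<Longrightarrow> q holomorphic_on U \<Longrightarrow> (\<lambda>z. K (p z) (q z)) holomorphic_on U"
    and W: "open W" "convex W" "\<And>x. 0 < x \<Longrightarrow> x < 1 \<Longrightarrow> complex_of_real x \<in> W"
    and Pder: "\<And>k z x. z \<in> W \<Longrightarrow> x \<in> W \<Longrightarrow> (P k z has_field_derivative K x z * \<phi> k x) (at x)"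
    and P0: "\<And>k z. z \<in> W \<Longrightarrow> P k z 0 = 0" "\<And>k z. z \<in> W \<Longrightarrow> ((\<lambda>x. P k z (of_real x)) \<longlongrightarrow> 0) (at_right 0)"
    and Pzz: "\<And>k z. z \<in> W \<Longrightarrow> P k z z = (exp z - 1) * \<phi> (Suc k) z"
    and Wexp: "\<And>z. z \<in> W \<Longrightarrow> exp z \<noteq> 1"
    and \<phi>bd: "\<And>k. \<exists>B. \<forall>x\<in>{0<..<1}. norm (\<phi> k (of_real x)) \<le> B"
    and F0: "germ_family \<gamma> {0<..<1} F0" "\<And>t. t \<in> {0<..<\<epsilon>} \<Longrightarrow> \<forall>\<^sub>F z in nhds (\<gamma> t). F0 t z = \<phi> 0 z"
begin

lemma \<gamma>_cont: "continuous_on {0..1} \<gamma>" using pc1 by (simp add: bdd_pc1_def)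

lemma \<gamma>_cont': "S \<subseteq> {0..1} \<Longrightarrow> continuous_on S \<gamma>" by (rule continuous_on_subset[OF \<gamma>_cont])

lemma K_cont: "continuous_on S p \<Longrightarrow> continuous_on S q \<Longrightarrow> continuous_on S (\<lambda>x. K (p x) (q x))"
  using continuous_on_compose2[OF Kc, of S "\<lambda>x. (p x, q x)"] by (simp add: continuous_on_Pair)

lemma K_bounded:
  assumes "compact A" "compact A'"
  shows "\<exists>B. \<forall>x\<in>A. \<forall>z\<in>A'. norm (K x z) \<le> B"
proof -
  have "compact ((\<lambda>(x, z). K x z) ` (A \<times> A'))"
    by (intro compact_continuous_image compact_Times assms continuous_on_subset[OF Kc]) auto
  then obtain B where "\<forall>y\<in>(\<lambda>(x, z). K x z) ` (A \<times> A'). norm y \<le> B"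
    using compact_imp_bounded bounded_iff by blast
  then show ?thesis by (intro exI[of _ B]) auto
qed

lemma \<gamma>_image_compact: "compact (\<gamma> ` {0..1})"
  by (intro compact_continuous_image \<gamma>_cont) simp

text \<open>The invariant of the recursion. Only parameters below 1 are covered, since the germs are
  singular at the zero of e^\<zeta> - 1 where the path will end.\<close>

definition good :: "nat \<Rightarrow> (real \<Rightarrow> complex \<Rightarrow> complex) \<Rightarrow> bool" where
  "good k F \<longleftrightarrow> germ_family \<gamma> {0<..<1} F \<and> (\<forall>t\<in>{0<..<\<epsilon>}. \<forall>\<^sub>F z in nhds (\<gamma> t). F t z = \<phi> k z)"

lemma good_germ: "good k F \<Longrightarrow> germ_family \<gamma> {0<..<1} F" by (simp add: good_def)

lemma good_near0: "good k F \<Longrightarrow> t \<in> {0<..<\<epsilon>} \<Longrightarrow> \<forall>\<^sub>F z in nhds (\<gamma> t). F t z = \<phi> k z" by (simp add: good_def)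

lemma good_cont:
  assumes "good k F"
  shows "continuous_on {0<..<1} (\<lambda>t. F t (\<gamma> t))"
  by (rule germ_family_continuous_on[OF good_germ[OF assms]], rule \<gamma>_cont') auto

lemma good_init: "good k F \<Longrightarrow> t \<in> {0<..<\<epsilon>} \<Longrightarrow> F t (\<gamma> t) = \<phi> k (\<gamma> t)"
  by (rule eventually_nhds_x_imp_x[OF good_near0])

text \<open>Near 0 the germ is the explicit \<phi> k, bounded on the positive axis; between
  \<epsilon>/2 and \<open>T\<close> compactness applies. \<open>T\<close> must stay below 1 because
  of the singularity at the end.\<close>

lemma good_bounded:
  assumes "good k F" "T < 1"
  shows "\<exists>B. \<forall>u\<in>{0<..T}. norm (F u (\<gamma> u)) \<le> B"
proof -
  obtain B1 where B1: "\<And>x. x \<in> {0<..<1} \<Longrightarrow> norm (\<phi> k (of_real x)) \<le> B1" using \<phi>bd by blast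
  have "compact ((\<lambda>t. F t (\<gamma> t)) ` {\<epsilon>/2..T})"
    using eps assms by (intro compact_continuous_image continuous_on_subset[OF good_cont[OF assms(1)]]) auto
  then obtain B2 where B2: "\<And>t. t \<in> {\<epsilon>/2..T} \<Longrightarrow> norm (F t (\<gamma> t)) \<le> B2"
    by (metis bounded_iff compact_imp_bounded imageI)
  have "norm (F u (\<gamma> u)) \<le> max B1 B2" if u: "u \<in> {0<..T}" for u
  proof (cases "u < \<epsilon>")
    case True
    then have "norm (F u (\<gamma> u)) \<le> B1"
      using good_init[OF assms(1), of u] pos[of u] B1[of "Re (\<gamma> u)"] u by auto
    then show ?thesis by simp
  next
    case False
    then show ?thesis using B2[of u] u eps by auto
  qed
  then show ?thesis by blast
qed

abbreviation "D u \<equiv> vector_derivative \<gamma> (at u)"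

lemma good_integrable:
  assumes "good k F" "0 \<le> s" "t < 1" "continuous_on {s<..<t} p" "\<And>u. u \<in> {s<..<t} \<Longrightarrow> norm (p u) \<le> B"
  shows "set_integrable lborel {s<..<t} (\<lambda>u. p u * (F u (\<gamma> u) * D u))"
proof -
  obtain B' where B': "\<And>u. u \<in> {0<..t} \<Longrightarrow> norm (F u (\<gamma> u)) \<le> B'" using good_bounded[OF assms(1,3)] by blast
  have "set_integrable lborel {s<..<t} (\<lambda>u. (p u * F u (\<gamma> u)) * D u)"
  proof (rule set_integrable_bdd_pc1[OF pc1])
    show "continuous_on {s<..<t} (\<lambda>u. p u * F u (\<gamma> u))"
      by (intro continuous_on_mult assms continuous_on_subset[OF good_cont[OF assms(1)]]) (use assms in auto)
    show "norm (p u * F u (\<gamma> u)) \<le> \<bar>B\<bar> * \<bar>B'\<bar>" if "u \<in> {s<..<t}" for u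
      unfolding norm_mult using assms(2) that
      by (intro mult_mono order_trans[OF assms(5) abs_ge_self] order_trans[OF B' abs_ge_self]) auto
  qed (use assms in auto)
  then show ?thesis by (simp add: mult.assoc)
qed

lemma good_K_integrable:
  assumes "good k F" "0 \<le> s" "t < 1"
  shows "set_integrable lborel {s<..<t} (\<lambda>u. K (\<gamma> u) z * (F u (\<gamma> u) * D u))"
proof -
  obtain B where B: "\<And>x. x \<in> \<gamma> ` {0..1} \<Longrightarrow> norm (K x z) \<le> B"
    using K_bounded[OF \<gamma>_image_compact, of "{z}"] by auto
  show ?thesis
    by (rule good_integrable[OF assms]) (use assms in \<open>auto intro!: K_cont \<gamma>_cont' continuous_intros B\<close>)
qed

definition Cint :: "(real \<Rightarrow> complex \<Rightarrow> complex) \<Rightarrow> real \<Rightarrow> complex \<Rightarrow> complex" where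
  "Cint F t z = set_lebesgue_integral lborel {0<..<t} (\<lambda>u. K (\<gamma> u) z * (F u (\<gamma> u) * D u))"

text \<open>For \<open>z\<close> near \<open>\<gamma> t\<close> the path of integration from 0 to \<open>z\<close> is \<open>\<gamma>\<close> up to \<open>\<gamma> t\<close> followed by the segment to \<open>z\<close>.\<close>

definition nxt :: "(real \<Rightarrow> complex \<Rightarrow> complex) \<Rightarrow> real \<Rightarrow> complex \<Rightarrow> complex" where
  "nxt F t z = (Cint F t z + seg (\<lambda>x. K x z * F t x) (\<gamma> t) z) / (exp z - 1)"

lemma Cint_holomorphic:
  assumes "good k F" "t < 1"
  shows "Cint F t holomorphic_on UNIV"
  unfolding Cint_def[abs_def]
proof (rule holomorphic_on_set_lebesgue_integral)
  show "set_integrable lborel {0<..<t} (\<lambda>u. F u (\<gamma> u) * D u)"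
    using good_integrable[OF assms(1) _ assms(2), of 0 "\<lambda>u. 1" 1] by simp
  show "set_borel_measurable lborel {0<..<t} (\<lambda>u. K (\<gamma> u) z)" for z
    unfolding set_borel_measurable_def measurable_lborel2
    by (rule borel_measurable_continuous_on_indicator) (use assms in \<open>auto intro!: K_cont \<gamma>_cont' continuous_intros\<close>)
  show "\<exists>r>0. \<exists>B. cball z r \<subseteq> UNIV \<and> (\<forall>w\<in>cball z r. \<forall>u\<in>{0<..<t}. norm (K (\<gamma> u) w) \<le> B)" for z
  proof -
    obtain B where "\<And>x w. x \<in> \<gamma> ` {0..1} \<Longrightarrow> w \<in> cball z 1 \<Longrightarrow> norm (K x w) \<le> B"
      using K_bounded[OF \<gamma>_image_compact compact_cball, of z 1] by blast
    then show ?thesis using assms by (intro exI[of _ 1] conjI exI[of _ B]) auto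
  qed
qed (auto intro!: Kh holomorphic_intros)

lemma Cint_split:
  assumes "good k F" "0 < s" "s \<le> t" "t < 1"
  shows "Cint F t z = Cint F s z + set_lebesgue_integral lborel {s<..<t} (\<lambda>u. K (\<gamma> u) z * (F u (\<gamma> u) * D u))"
proof -
  let ?f = "\<lambda>u. K (\<gamma> u) z * (F u (\<gamma> u) * D u)"
  have "Cint F t z = set_lebesgue_integral lborel ({0<..<s} \<union> {s<..<t}) ?f"
    unfolding Cint_def set_lebesgue_integral_def
  proof (rule integral_cong_AE)
    show "(\<lambda>u. indicator {0<..<t} u *\<^sub>R ?f u) \<in> borel_measurable lborel"
      using good_K_integrable[OF assms(1) _ assms(4), of 0 z] unfolding set_integrable_def by auto
    have "set_integrable lborel ({0<..<s} \<union> {s<..<t}) ?f"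
      by (rule set_integrable_Un) (use assms in \<open>auto intro: good_K_integrable\<close>)
    then show "(\<lambda>u. indicator ({0<..<s} \<union> {s<..<t}) u *\<^sub>R ?f u) \<in> borel_measurable lborel"
      unfolding set_integrable_def by auto
    have "AE u in lborel. u \<noteq> s" by (rule AE_lborel_singleton)
    then show "AE u in lborel. indicator {0<..<t} u *\<^sub>R ?f u = indicator ({0<..<s} \<union> {s<..<t}) u *\<^sub>R ?f u"
      by eventually_elim (use assms in \<open>auto simp: indicator_def\<close>)
  qed
  also have "\<dots> = Cint F s z + set_lebesgue_integral lborel {s<..<t} ?f"
    unfolding Cint_def by (rule set_integral_Un) (use assms in \<open>auto intro: good_K_integrable\<close>)
  finally show ?thesis .
qed

lemma int_primitive:
  assumes "good k F" "0 \<le> s" "s \<le> t" "t < 1"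
    and "\<And>u. u \<in> {s<..<t} \<Longrightarrow> (Q has_field_derivative K (\<gamma> u) z * F u (\<gamma> u)) (at (\<gamma> u))"
    and "continuous_on {s..t} (\<lambda>u. Q (\<gamma> u))"
  shows "set_lebesgue_integral lborel {s<..<t} (\<lambda>u. K (\<gamma> u) z * (F u (\<gamma> u) * D u)) = Q (\<gamma> t) - Q (\<gamma> s)"
proof -
  have "set_lebesgue_integral lborel {s<..<t} (\<lambda>u. (K (\<gamma> u) z * F u (\<gamma> u)) * D u) = Q (\<gamma> t) - Q (\<gamma> s)"
    by (rule bdd_pc1_FTC[OF pc1]) (use assms good_K_integrable[OF assms(1,2,4), of z] in \<open>auto simp: mult.assoc\<close>)
  then show ?thesis by (simp add: mult.assoc)
qed

lemma Cint_primitive: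
  assumes F: "good k F" and st: "s \<in> {0<..<1}" "t \<in> {0<..<1}"
    and Q: "\<And>u. u \<in> {min s t..max s t} \<Longrightarrow> (Q has_field_derivative K (\<gamma> u) z * F u (\<gamma> u)) (at (\<gamma> u))"
  shows "Cint F s z - Cint F t z = Q (\<gamma> s) - Q (\<gamma> t)"
proof -
  have cont: "continuous_on {min s t..max s t} (\<lambda>u. Q (\<gamma> u))"
    unfolding continuous_on_eq_continuous_within
  proof
    fix u assume u: "u \<in> {min s t..max s t}"
    have c: "continuous (at u within {min s t..max s t}) \<gamma>"
      using \<gamma>_cont'[of "{min s t..max s t}"] st u by (auto simp: continuous_on_eq_continuous_within)
    show "continuous (at u within {min s t..max s t}) (\<lambda>u. Q (\<gamma> u))"
      by (rule continuous_within_compose3[where f=\<gamma> and g=Q, OF DERIV_isCont[OF Q[OF u]] c])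
  qed
  show ?thesis
  proof (cases "t \<le> s")
    case True
    then show ?thesis using Cint_split[OF F, of t s z] int_primitive[OF F, of t s Q z] st Q cont by (simp add: min_def max_def split: if_splits)
  next
    case False
    then show ?thesis using Cint_split[OF F, of s t z] int_primitive[OF F, of s t Q z] st Q cont by (simp add: min_def max_def split: if_splits)
  qed
qed

lemma K_F_primitive:
  assumes "h holomorphic_on ball a r"
  obtains Q where "\<And>x. x \<in> ball a r \<Longrightarrow> (Q has_field_derivative K x z * h x) (at x)"
proof -
  have "(\<lambda>x. K x z * h x) holomorphic_on ball a r"
    by (intro holomorphic_on_mult Kh assms holomorphic_intros) auto
  then show ?thesis using holomorphic_convex_primitive'[of "ball a r" "\<lambda>x. K x z * h x"] that by (metis at_within_open open_ball convex_ball)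
qed

lemma good_local:
  assumes F: "good k F" and t: "t \<in> {0<..<1}"
  obtains r d where "r > 0" "d > 0" "F t holomorphic_on ball (\<gamma> t) r"
    "\<And>s. dist s t < d \<Longrightarrow> s \<in> {0<..<1} \<and> \<gamma> s \<in> ball (\<gamma> t) r \<and> (\<forall>\<^sub>F z in nhds (\<gamma> s). F s z = F t z)"
proof -
  have gf: "germ_family \<gamma> {0<..<1} F" using F by (simp add: good_def)
  then obtain r where r: "r > 0" "F t holomorphic_on ball (\<gamma> t) r"
    using t unfolding germ_family_def analytic_on_def by blast
  obtain d1 where d1: "d1 > 0" "\<And>s. s \<in> {0<..<1} \<Longrightarrow> dist s t < d1 \<Longrightarrow> \<forall>\<^sub>F z in nhds (\<gamma> s). F s z = F t z"
    by (rule germ_familyD[OF gf t]) blast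
  have "continuous_on {0<..<1} \<gamma>" by (rule \<gamma>_cont') auto
  then obtain d2 where d2: "d2 > 0" "\<And>s. s \<in> {0<..<1} \<Longrightarrow> dist s t < d2 \<Longrightarrow> dist (\<gamma> s) (\<gamma> t) < r"
    using t r(1) unfolding continuous_on_iff by blast
  define d where "d = min (min d1 d2) (min t (1 - t))"
  have dJ: "s \<in> {0<..<1}" if "dist s t < d" for s
    using that by (auto simp: d_def dist_real_def abs_if split: if_splits)
  show ?thesis
  proof (rule that[of r d])
    show "d > 0" using d1(1) d2(1) t by (simp add: d_def)
    fix s assume s: "dist s t < d"
    then show "s \<in> {0<..<1} \<and> \<gamma> s \<in> ball (\<gamma> t) r \<and> (\<forall>\<^sub>F z in nhds (\<gamma> s). F s z = F t z)"
      using d1(2)[OF dJ[OF s]] d2(2)[OF dJ[OF s]] dJ[OF s] by (simp add: d_def dist_commute)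
  qed (use r in auto)
qed

lemma nxt_analytic:
  assumes F: "good k F" and t: "t \<in> {0<..<1}"
  shows "nxt F t analytic_on {\<gamma> t}"
proof -
  obtain r d where r: "r > 0" "F t holomorphic_on ball (\<gamma> t) r"
    by (rule good_local[OF F t])
  let ?a = "\<gamma> t" and ?U = "ball (\<gamma> t) r"
  have lp: "linepath ?a z s \<in> ?U" if "z \<in> ?U" "s \<in> {0..1}" for z s
    using that r(1) by (intro linepath_in_convex) auto
  have "(\<lambda>z. seg (\<lambda>x. K x z * F t x) ?a z) holomorphic_on ?U"
    unfolding seg_def
  proof (rule holomorphic_on_integral_Ioo)
    have c: "continuous_on (?U \<times> {0..1}) (\<lambda>p. linepath ?a (fst p) (snd p))"
      unfolding linepath_def by (intro continuous_intros)
    have "continuous_on (?U \<times> {0..1}) (\<lambda>p. F t (linepath ?a (fst p) (snd p)))"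
      by (rule continuous_on_compose2[OF holomorphic_on_imp_continuous_on[OF r(2)] c]) (use lp in auto)
    then show "continuous_on (?U \<times> {0..1}) (\<lambda>(z, s). K (linepath ?a z s) z * F t (linepath ?a z s) * (z - ?a))"
      unfolding case_prod_unfold by (intro continuous_on_mult K_cont c continuous_intros)
    fix s :: real assume s: "s \<in> {0<..<1}"
    have h: "(\<lambda>z. linepath ?a z s) holomorphic_on ?U"
      unfolding linepath_def scaleR_conv_of_real by (intro holomorphic_intros)
    have "(F t \<circ> (\<lambda>z. linepath ?a z s)) holomorphic_on ?U"
      by (rule holomorphic_on_compose_gen[OF h r(2)]) (use lp s in auto)
    then show "(\<lambda>z. K (linepath ?a z s) z * F t (linepath ?a z s) * (z - ?a)) holomorphic_on ?U"
      unfolding o_def by (intro holomorphic_intros Kh h) auto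
  qed simp
  then have "(\<lambda>z. seg (\<lambda>x. K x z * F t x) ?a z) analytic_on {?a}"
    unfolding analytic_at using r(1) by (intro exI[of _ ?U]) auto
  moreover have "Cint F t analytic_on {?a}"
    using Cint_holomorphic[OF F, of t] t by (auto simp: analytic_at intro!: exI[of _ UNIV])
  ultimately show ?thesis
    unfolding nxt_def[abs_def] using avoid[OF t] by (intro analytic_intros) auto
qed

text \<open>Moving the base point from \<gamma> t to \<gamma> s changes the path integral and the
  segment integral by opposite amounts, as both are increments of one local primitive of K(\<cdot>,
  z) F t.\<close>

lemma nxt_consistent:
  assumes F: "good k F" and t: "t \<in> {0<..<1}"
  shows "\<forall>\<^sub>F s in at t within {0<..<1}. \<forall>\<^sub>F z in nhds (\<gamma> s). nxt F s z = nxt F t z"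
proof -
  obtain r d where r: "r > 0" "d > 0" "F t holomorphic_on ball (\<gamma> t) r"
    and d: "\<And>s. dist s t < d \<Longrightarrow> s \<in> {0<..<1} \<and> \<gamma> s \<in> ball (\<gamma> t) r \<and> (\<forall>\<^sub>F z in nhds (\<gamma> s). F s z = F t z)"
    by (rule good_local[OF F t]) blast
  have Ft: "F u (\<gamma> u) = F t (\<gamma> u)" if "dist u t < d" for u
    using d[OF that] eventually_nhds_x_imp_x by blast
  have "\<forall>\<^sub>F z in nhds (\<gamma> s). nxt F s z = nxt F t z" if s: "dist s t < d" for s
  proof -
    obtain V where V: "open V" "\<gamma> s \<in> V" "\<And>z. z \<in> V \<Longrightarrow> F s z = F t z"
      using d[OF s] unfolding eventually_nhds by blast
    have "open (V \<inter> ball (\<gamma> t) r)" "\<gamma> s \<in> V \<inter> ball (\<gamma> t) r" using V d[OF s] by auto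
    then obtain r' where r': "r' > 0" "ball (\<gamma> s) r' \<subseteq> V \<inter> ball (\<gamma> t) r"
      by (rule openE)
    have "nxt F s z = nxt F t z" if z: "z \<in> ball (\<gamma> s) r'" for z
    proof -
      obtain Q where Q: "\<And>x. x \<in> ball (\<gamma> t) r \<Longrightarrow> (Q has_field_derivative K x z * F t x) (at x)"
        by (rule K_F_primitive[OF r(3), of z]) blast
      have zt: "z \<in> ball (\<gamma> t) r" using z r' by auto
      have "Cint F s z - Cint F t z = Q (\<gamma> s) - Q (\<gamma> t)"
      proof (rule Cint_primitive[OF F])
        fix u assume "u \<in> {min s t..max s t}"
        then have u: "dist u t < d" using s by (auto simp: dist_real_def min_def max_def split: if_splits)
        then show "(Q has_field_derivative K (\<gamma> u) z * F u (\<gamma> u)) (at (\<gamma> u))"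
          using Q[of "\<gamma> u"] d[OF u] Ft[OF u] by auto
      qed (use d[OF s] t in auto)
      moreover have "seg (\<lambda>x. K x z * F t x) (\<gamma> t) z = Q z - Q (\<gamma> t)"
        by (rule seg_primitive[where U="ball (\<gamma> t) r", OF _ _ Q]) (use zt r in auto)
      moreover have "seg (\<lambda>x. K x z * F s x) (\<gamma> s) z = Q z - Q (\<gamma> s)"
      proof -
        have "seg (\<lambda>x. K x z * F s x) (\<gamma> s) z = seg (\<lambda>x. K x z * F t x) (\<gamma> s) z"
        proof (rule seg_cong)
          fix x assume "x \<in> closed_segment (\<gamma> s) z"
          then have "x \<in> ball (\<gamma> s) r'" using closed_segment_subset[of "\<gamma> s" "ball (\<gamma> s) r'" z] z r' by auto
          then show "K x z * F s x = K x z * F t x" using V(3) r' by auto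
        qed
        also have "\<dots> = Q z - Q (\<gamma> s)"
          by (rule seg_primitive[where U="ball (\<gamma> t) r", OF _ _ Q]) (use zt d[OF s] in auto)
        finally show ?thesis .
      qed
      ultimately have "Cint F s z + seg (\<lambda>x. K x z * F s x) (\<gamma> s) z = Cint F t z + seg (\<lambda>x. K x z * F t x) (\<gamma> t) z"
        by algebra
      then show ?thesis by (simp add: nxt_def)
    qed
    moreover have "\<forall>\<^sub>F z in nhds (\<gamma> s). z \<in> ball (\<gamma> s) r'"
      using r' by (intro eventually_nhds_in_open) auto
    ultimately show ?thesis by (auto elim: eventually_mono)
  qed
  then show ?thesis unfolding eventually_at using r(2) by (intro exI[of _ d]) auto
qed

text \<open>On the initial piece the path integral is the value of \<open>P k z\<close> at \<gamma>
  t, since \<open>P k z\<close> vanishes at 0. The segment completes it to the value on the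
  diagonal, which is (e^z - 1) times the next iterate.\<close>

lemma nxt_init:
  assumes F: "good k F" and t: "t \<in> {0<..<\<epsilon>}"
  shows "\<forall>\<^sub>F z in nhds (\<gamma> t). nxt F t z = \<phi> (Suc k) z"
proof -
  have inW: "\<gamma> u \<in> W" if "u \<in> {0<..<\<epsilon>}" for u using pos[OF that] W(3) by metis
  obtain V where V: "open V" "\<gamma> t \<in> V" "\<And>z. z \<in> V \<Longrightarrow> F t z = \<phi> k z"
    using F t unfolding good_def eventually_nhds by blast
  have "open (V \<inter> W)" "\<gamma> t \<in> V \<inter> W" using V inW[OF t] W(1) by auto
  then obtain r where r: "r > 0" "ball (\<gamma> t) r \<subseteq> V \<inter> W" by (rule openE)
  have "nxt F t z = \<phi> (Suc k) z" if z: "z \<in> ball (\<gamma> t) r" for z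
  proof -
    have zW: "z \<in> W" using z r by auto
    have "Cint F t z = P k z (\<gamma> t) - P k z (\<gamma> 0)"
      unfolding Cint_def
    proof (rule int_primitive[OF F])
      show "(P k z has_field_derivative K (\<gamma> u) z * F u (\<gamma> u)) (at (\<gamma> u))" if "u \<in> {0<..<t}" for u
        using that t Pder[OF zW inW, of u k] good_init[OF F, of u] by auto
      show "continuous_on {0..t} (\<lambda>u. P k z (\<gamma> u))"
        unfolding continuous_on_eq_continuous_within
      proof
        fix u assume u: "u \<in> {0..t}"
        have c: "continuous (at u within {0..t}) \<gamma>"
          using \<gamma>_cont'[of "{0..t}"] t eps u by (auto simp: continuous_on_eq_continuous_within)
        show "continuous (at u within {0..t}) (\<lambda>u. P k z (\<gamma> u))"
        proof (cases "u = 0")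
          case False
          then have "isCont (P k z) (\<gamma> u)" using u t inW[of u] Pder[OF zW] DERIV_isCont by (metis atLeastAtMost_iff greaterThanLessThan_iff le_less_trans order_le_less)
          then show ?thesis by (rule continuous_within_compose3[where f=\<gamma> and g="P k z", OF _ c])
        next
          \<comment> \<open>At 0 the primitive is only known to have a limit along the positive
            axis. This suffices because \<gamma> leaves 0 along that axis.\<close>
          case True
          have "((\<lambda>u. Re (\<gamma> u)) \<longlongrightarrow> 0) (at 0 within {0..t})"
            using c True \<gamma>0 tendsto_Re[of \<gamma> 0 "at 0 within {0..t}"] by (simp add: continuous_within)
          moreover have "\<forall>\<^sub>F u in at 0 within {0..t}. u \<in> {0<..<\<epsilon>}"
            unfolding eventually_at using t eps by (intro exI[of _ \<epsilon>]) auto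
          moreover have posR: "Re (\<gamma> u) > 0" if "0 < u" "u < \<epsilon>" for u using pos[of u] that by auto
          ultimately have "filterlim (\<lambda>u. Re (\<gamma> u)) (at_right 0) (at 0 within {0..t})"
            unfolding filterlim_at by (auto elim!: eventually_mono dest: posR)
          from filterlim_compose[OF P0(2)[OF zW] this]
          have "((\<lambda>u. P k z (of_real (Re (\<gamma> u)))) \<longlongrightarrow> 0) (at 0 within {0..t})" .
          moreover have "\<forall>\<^sub>F u in at 0 within {0..t}. P k z (of_real (Re (\<gamma> u))) = P k z (\<gamma> u)"
            using \<open>\<forall>\<^sub>F u in at 0 within {0..t}. u \<in> {0<..<\<epsilon>}\<close> by eventually_elim (use pos in metis)
          ultimately show ?thesis using True P0(1)[OF zW] \<gamma>0
            by (auto simp: continuous_within elim: Lim_transform_eventually)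
        qed
      qed
    qed (use t eps in auto)
    then have C: "Cint F t z = P k z (\<gamma> t)" using \<gamma>0 P0(1)[OF zW] by simp
    have "seg (\<lambda>x. K x z * F t x) (\<gamma> t) z = seg (\<lambda>x. K x z * \<phi> k x) (\<gamma> t) z"
    proof (rule seg_cong)
      fix x assume "x \<in> closed_segment (\<gamma> t) z"
      then have "x \<in> ball (\<gamma> t) r" using closed_segment_subset[of "\<gamma> t" "ball (\<gamma> t) r" z] z r by auto
      then show "K x z * F t x = K x z * \<phi> k x" using V(3) r by auto
    qed
    also have "\<dots> = P k z z - P k z (\<gamma> t)"
      by (rule seg_primitive[OF W(1,2) Pder]) (use zW inW t in auto)
    finally have "Cint F t z + seg (\<lambda>x. K x z * F t x) (\<gamma> t) z = (exp z - 1) * \<phi> (Suc k) z"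
      using C Pzz[OF zW, of k] by simp
    then show ?thesis using Wexp[OF zW] by (simp add: nxt_def)
  qed
  moreover have "\<forall>\<^sub>F z in nhds (\<gamma> t). z \<in> ball (\<gamma> t) r"
    using r by (intro eventually_nhds_in_open) auto
  ultimately show ?thesis by (auto elim: eventually_mono)
qed

lemma nxt_good: "good k F \<Longrightarrow> good (Suc k) (nxt F)"
  unfolding good_def[of "Suc k"] germ_family_def
  by (auto intro: nxt_analytic nxt_consistent nxt_init)

primrec Fs :: "nat \<Rightarrow> real \<Rightarrow> complex \<Rightarrow> complex" where
  "Fs 0 = F0"
| "Fs (Suc k) = nxt (Fs k)"

lemma Fs_good: "good k (Fs k)"
proof (induction k)
  case 0
  show ?case using F0 by (simp add: good_def)
qed (simp add: nxt_good)

lemma Fs_Suc_val: "Fs (Suc k) t (\<gamma> t) = Cint (Fs k) t (\<gamma> t) / (exp (\<gamma> t) - 1)"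
  by (simp add: nxt_def)

end

section \<open>Logarithmic singularities\<close>

text \<open>Cauchy's estimate for the derivative on discs of radius (R - \<rho>)/2, half the
  distance left to the boundary.\<close>

lemma holomorphic_lipschitz_at_0:
  assumes f: "f holomorphic_on ball 0 R" and B: "\<And>x. x \<in> ball 0 R \<Longrightarrow> norm (f x) \<le> B"
    and \<rho>: "0 \<le> \<rho>" "\<rho> < R" and w: "norm w \<le> \<rho>"
  shows "norm (f w - f 0) \<le> B / ((R - \<rho>) / 2) * norm w"
proof -
  have "norm (f w - f 0) \<le> B / ((R - \<rho>) / 2) * norm (w - 0)"
  proof (rule field_differentiable_bound[where S="cball 0 \<rho>" and f'="deriv f"])
    fix z :: complex assume z: "z \<in> cball 0 \<rho>"
    have sub: "cball z ((R - \<rho>) / 2) \<subseteq> ball 0 R"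
    proof
      fix x assume "x \<in> cball z ((R - \<rho>) / 2)"
      then show "x \<in> ball 0 R" using z \<rho> norm_triangle_ineq4[of z "z - x"] by (simp add: dist_norm field_simps)
    qed
    have hz: "f holomorphic_on cball z ((R - \<rho>) / 2)" using f sub by (rule holomorphic_on_subset)
    have "norm ((deriv ^^ 1) f z) \<le> fact 1 * B / ((R - \<rho>) / 2) ^ 1"
    proof (rule Cauchy_inequality)
      show "f holomorphic_on ball z ((R - \<rho>) / 2)" using hz ball_subset_cball by (rule holomorphic_on_subset)
      show "continuous_on (cball z ((R - \<rho>) / 2)) f" using hz by (rule holomorphic_on_imp_continuous_on)
      show "norm (f x) \<le> B" if "norm (z - x) = (R - \<rho>) / 2" for x
        using B[of x] sub that by (force simp: dist_norm)
    qed (use \<rho> in simp)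
    then show "norm (deriv f z) \<le> B / ((R - \<rho>) / 2)" by simp
    have "z \<in> ball 0 R" using z \<rho> by auto
    then show "(f has_field_derivative deriv f z) (at z within cball 0 \<rho>)"
      by (rule has_field_derivative_at_within[OF holomorphic_derivI[OF f open_ball]])
  qed (use w \<rho> in auto)
  then show ?thesis by simp
qed

text \<open>A primitive in \<open>y\<close>, depending holomorphically on \<open>z\<close>, of \<open>M(y, z) (A(y) log y + R(y) / y)\<close>: take
  \<open>(P + M(0, z) R(0)) log y + Q\<close> where \<open>P\<close> is the primitive of \<open>M(\<cdot>, z) A\<close> and
  \<open>y \<partial>Q/\<partial>y = M R - M(0, z) R(0) - P\<close>, the right-hand side vanishing at \<open>y = 0\<close>.\<close>

locale log_kernel =
  fixes M :: "complex \<Rightarrow> complex \<Rightarrow> complex" and A R :: "complex \<Rightarrow> complex" and r :: real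
  assumes r: "r > 0"
    and Mc: "continuous_on UNIV (\<lambda>(x, z). M x z)"
    and Mh: "\<And>U p q. open U \<Longrightarrow> p holomorphic_on U \<Longrightarrow> q holomorphic_on U \<Longrightarrow> (\<lambda>z. M (p z) (q z)) holomorphic_on U"
    and A: "A holomorphic_on ball 0 r" and R: "R holomorphic_on ball 0 r"
begin

lemma M_cont: "continuous_on S p \<Longrightarrow> continuous_on S q \<Longrightarrow> continuous_on S (\<lambda>x. M (p x) (q x))"
  using continuous_on_compose2[OF Mc, of S "\<lambda>x. (p x, q x)"] by (simp add: continuous_on_Pair)

lemma M_hol1: "open U \<Longrightarrow> (\<lambda>y. M y z) holomorphic_on U" by (intro Mh holomorphic_intros)

definition Pf :: "complex \<Rightarrow> complex \<Rightarrow> complex" where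
  "Pf y z = seg (\<lambda>x. M x z * A x) 0 y"

lemma Pf_prim:
  obtains G where "\<And>y. y \<in> ball 0 r \<Longrightarrow> (G has_field_derivative M y z * A y) (at y)"
    "\<And>y. y \<in> ball 0 r \<Longrightarrow> Pf y z = G y - G 0"
proof -
  have "(\<lambda>x. M x z * A x) holomorphic_on ball 0 r" by (intro holomorphic_on_mult A M_hol1) auto
  then obtain G where G: "\<And>y. y \<in> ball 0 r \<Longrightarrow> (G has_field_derivative M y z * A y) (at y)"
    using holomorphic_convex_primitive'[of "ball 0 r" "\<lambda>x. M x z * A x"] by (metis at_within_open open_ball convex_ball)
  show ?thesis
  proof (rule that[OF G])
    show "Pf y z = G y - G 0" if y: "y \<in> ball 0 r" for y
      unfolding Pf_def by (rule seg_primitive[where U="ball 0 r"]) (use G y r in auto)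
  qed
qed

lemma Pf_deriv:
  assumes "y \<in> ball 0 r"
  shows "((\<lambda>y. Pf y z) has_field_derivative M y z * A y) (at y)"
proof -
  obtain G where G: "\<And>y. y \<in> ball 0 r \<Longrightarrow> (G has_field_derivative M y z * A y) (at y)"
    "\<And>y. y \<in> ball 0 r \<Longrightarrow> Pf y z = G y - G 0" by (rule Pf_prim[of z]) blast
  have "((\<lambda>y. G y - G 0) has_field_derivative M y z * A y) (at y)"
    using G(1)[OF assms] by (auto intro!: derivative_eq_intros)
  then show ?thesis
    by (rule DERIV_cong_ev[THEN iffD2, rotated -1])
       (use assms G(2) in \<open>auto intro!: eventually_nhds_in_open[THEN eventually_mono, of "ball 0 r"]\<close>)
qed

lemma Pf_0 [simp]: "Pf 0 z = 0" by (simp add: Pf_def)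

lemma Pf_hol:
  assumes U: "open U" and p: "p holomorphic_on U" "p ` U \<subseteq> ball 0 r"
  shows "(\<lambda>z. Pf (p z) z) holomorphic_on U"
  unfolding Pf_def seg_def
proof (rule holomorphic_on_integral_Ioo[OF U])
  have inb: "linepath 0 (p z) s \<in> ball 0 r" if "z \<in> U" "s \<in> {0..1}" for z s
    using that p(2) r by (intro linepath_in_convex) auto
  have cp: "continuous_on (U \<times> {0..1}) (\<lambda>q. p (fst q))"
    by (rule continuous_on_compose2[OF holomorphic_on_imp_continuous_on[OF p(1)]]) (auto intro!: continuous_intros)
  have c: "continuous_on (U \<times> {0..1}) (\<lambda>q. linepath 0 (p (fst q)) (snd q))"
    unfolding linepath_def by (intro continuous_intros cp)
  have "continuous_on (U \<times> {0..1}) (\<lambda>q. A (linepath 0 (p (fst q)) (snd q)))"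
    by (rule continuous_on_compose2[OF holomorphic_on_imp_continuous_on[OF A] c]) (use inb in auto)
  then show "continuous_on (U \<times> {0..1}) (\<lambda>(z, s). M (linepath 0 (p z) s) z * A (linepath 0 (p z) s) * (p z - 0))"
    unfolding case_prod_unfold by (intro continuous_on_mult M_cont c cp continuous_intros)
  fix s :: real assume s: "s \<in> {0<..<1}"
  have h: "(\<lambda>z. linepath 0 (p z) s) holomorphic_on U"
    unfolding linepath_def scaleR_conv_of_real by (intro holomorphic_intros p)
  have "(A \<circ> (\<lambda>z. linepath 0 (p z) s)) holomorphic_on U"
    by (rule holomorphic_on_compose_gen[OF h A]) (use inb s in auto)
  then show "(\<lambda>z. M (linepath 0 (p z) s) z * A (linepath 0 (p z) s) * (p z - 0)) holomorphic_on U"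
    unfolding o_def by (intro holomorphic_intros Mh h p U)
qed

definition N :: "complex \<Rightarrow> complex \<Rightarrow> complex" where
  "N y z = M y z * R y - M 0 z * R 0 - Pf y z"

lemma N_0 [simp]: "N 0 z = 0" by (simp add: N_def)

lemma Pf_hol1: "(\<lambda>y. Pf y z) holomorphic_on ball 0 r"
  unfolding holomorphic_on_open[OF open_ball] using Pf_deriv by blast

lemma N_hol1: "(\<lambda>y. N y z) holomorphic_on ball 0 r"
  unfolding N_def by (intro holomorphic_intros M_hol1 R Pf_hol1) auto

lemma N_hol:
  assumes U: "open U" and p: "p holomorphic_on U" "p ` U \<subseteq> ball 0 r"
  shows "(\<lambda>z. N (p z) z) holomorphic_on U"
proof -
  have "(R \<circ> p) holomorphic_on U" by (rule holomorphic_on_compose_gen[OF p(1) R p(2)])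
  then show ?thesis unfolding N_def o_def by (intro holomorphic_intros Mh U p Pf_hol)
qed

text \<open>\<open>N y z / y\<close> with the removable singularity at y = 0 filled in; it is the
  derivative of \<open>Q\<close> in \<open>y\<close>.\<close>

definition q :: "complex \<Rightarrow> complex \<Rightarrow> complex" where
  "q z = (\<lambda>y. if y = 0 then deriv (\<lambda>y. N y z) 0 else (N y z - N 0 z) / (y - 0))"

definition Q :: "complex \<Rightarrow> complex \<Rightarrow> complex" where
  "Q y z = seg (q z) 0 y"

lemma Q_0 [simp]: "Q 0 z = 0" by (simp add: Q_def)

lemma Q_deriv:
  assumes y: "y \<in> ball 0 r"
  shows "((\<lambda>y. Q y z) has_field_derivative q z y) (at y)"
proof -
  have "q z holomorphic_on ball 0 r"
    unfolding q_def by (rule pole_lemma[OF N_hol1]) (use r in simp)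
  then obtain G where G: "\<And>y. y \<in> ball 0 r \<Longrightarrow> (G has_field_derivative q z y) (at y)"
    using holomorphic_convex_primitive'[of "ball 0 r" "q z"] by (metis at_within_open open_ball convex_ball)
  have eq: "Q y z = G y - G 0" if y: "y \<in> ball 0 r" for y
    unfolding Q_def by (rule seg_primitive[where U="ball 0 r"]) (use G y r in auto)
  have "((\<lambda>y. G y - G 0) has_field_derivative q z y) (at y)"
    using G[OF y] by (auto intro!: derivative_eq_intros)
  then show ?thesis
    by (rule DERIV_cong_ev[THEN iffD2, rotated -1])
       (use y eq in \<open>auto intro!: eventually_nhds_in_open[THEN eventually_mono, of "ball 0 r"]\<close>)
qed

text \<open>In this form the dependence on both variables passes through \<open>N\<close> alone,
  without the exceptional value of \<open>q\<close> at 0, so that holomorphy can be shown under the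
  integral sign.\<close>

lemma Q_altdef: "Q y z = set_lebesgue_integral lborel {0<..<1} (\<lambda>s. N (of_real s * y) z / of_real s)"
  unfolding Q_def seg_def
  by (rule set_lebesgue_integral_cong) (auto simp: q_def linepath_def scaleR_conv_of_real)

text \<open>\<open>N\<close> vanishes at y = 0, so a uniform bound on a slightly larger disc gives a
  linear bound by Cauchy's estimate. It keeps the quotient \<open>N (s y) z / s\<close> bounded for
  small s.\<close>

lemma N_bound:
  assumes \<rho>: "0 \<le> \<rho>" "\<rho> < r" and C: "compact C"
  obtains B where "\<And>y z. norm y \<le> \<rho> \<Longrightarrow> z \<in> C \<Longrightarrow> norm (N y z) \<le> B * norm y"
proof -
  \<comment> \<open>Halfway between \<rho> and r: inside the open disc, where compactness gives
    bounds, with room left for Cauchy's estimate.\<close>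
  define \<sigma> where "\<sigma> = (\<rho> + r) / 2"
  have \<sigma>: "\<rho> < \<sigma>" "\<sigma> < r" "0 < \<sigma>" using \<rho> r by (auto simp: \<sigma>_def)
  have sub: "cball 0 \<sigma> \<subseteq> ball (0::complex) r" using \<sigma> by auto
  have "compact ((\<lambda>(x, z). M x z) ` (cball 0 \<sigma> \<times> C))"
    by (intro compact_continuous_image compact_Times C continuous_on_subset[OF Mc]) auto
  then obtain B1 where "\<forall>y\<in>(\<lambda>(x, z). M x z) ` (cball 0 \<sigma> \<times> C). norm y \<le> B1"
    using compact_imp_bounded bounded_iff by blast
  then have B1: "norm (M x z) \<le> \<bar>B1\<bar>" if "x \<in> cball 0 \<sigma>" "z \<in> C" for x z using that by force
  have "\<exists>B. \<forall>y\<in>f ` cball 0 \<sigma>. norm y \<le> B" if f: "f holomorphic_on ball 0 r" for f :: "complex \<Rightarrow> complex"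
  proof -
    have "compact (f ` cball 0 \<sigma>)"
      by (intro compact_continuous_image continuous_on_subset[OF holomorphic_on_imp_continuous_on[OF f] sub]) simp
    then show ?thesis using compact_imp_bounded bounded_iff by blast
  qed
  from this[OF A] this[OF R] obtain B2 B3 where "\<forall>y\<in>A ` cball 0 \<sigma>. norm y \<le> B2" "\<forall>y\<in>R ` cball 0 \<sigma>. norm y \<le> B3" by blast
  then have B23: "norm (A x) \<le> \<bar>B2\<bar>" "norm (R x) \<le> \<bar>B3\<bar>" if "x \<in> cball 0 \<sigma>" for x using that by force+
  define B where "B = \<bar>B1\<bar> * \<bar>B3\<bar> + \<bar>B1\<bar> * \<bar>B3\<bar> + \<bar>B1\<bar> * \<bar>B2\<bar> * \<sigma>"
  have Nb: "norm (N y z) \<le> B" if y: "y \<in> ball 0 \<sigma>" and z: "z \<in> C" for y z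
  proof -
    obtain G where G: "\<And>y. y \<in> ball 0 r \<Longrightarrow> (G has_field_derivative M y z * A y) (at y)"
      "\<And>y. y \<in> ball 0 r \<Longrightarrow> Pf y z = G y - G 0" by (rule Pf_prim[of z]) blast
    have "norm (G y - G 0) \<le> \<bar>B1\<bar> * \<bar>B2\<bar> * norm (y - 0)"
    proof (rule field_differentiable_bound[where S="cball 0 \<sigma>" and f'="\<lambda>y. M y z * A y"])
      fix x assume x: "x \<in> cball (0::complex) \<sigma>"
      then have "x \<in> ball 0 r" using sub by blast
      then show "(G has_field_derivative M x z * A x) (at x within cball 0 \<sigma>)"
        by (rule has_field_derivative_at_within[OF G(1)])
      show "norm (M x z * A x) \<le> \<bar>B1\<bar> * \<bar>B2\<bar>" unfolding norm_mult by (intro mult_mono B1 B23 x z) auto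
    qed (use y \<sigma> in auto)
    also have "\<dots> \<le> \<bar>B1\<bar> * \<bar>B2\<bar> * \<sigma>" using y by (intro mult_left_mono) auto
    finally have "norm (Pf y z) \<le> \<bar>B1\<bar> * \<bar>B2\<bar> * \<sigma>" using G(2)[of y] y \<sigma> by simp
    moreover have "norm (M y z * R y) \<le> \<bar>B1\<bar> * \<bar>B3\<bar>" "norm (M 0 z * R 0) \<le> \<bar>B1\<bar> * \<bar>B3\<bar>"
      unfolding norm_mult using y z \<sigma> by (intro mult_mono B1 B23; simp)+
    ultimately show ?thesis unfolding N_def B_def
      using norm_triangle_ineq4[of "M y z * R y - M 0 z * R 0" "Pf y z"] norm_triangle_ineq4[of "M y z * R y" "M 0 z * R 0"] by linarith
  qed
  show ?thesis
  proof (rule that[of "B / ((\<sigma> - \<rho>) / 2)"])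
    fix y z :: complex assume yz: "norm y \<le> \<rho>" "z \<in> C"
    have "norm (N y z - N 0 z) \<le> B / ((\<sigma> - \<rho>) / 2) * norm y"
      by (rule holomorphic_lipschitz_at_0[OF holomorphic_on_subset[OF N_hol1]])
         (use yz \<sigma> \<rho> Nb in auto)
    then show "norm (N y z) \<le> B / ((\<sigma> - \<rho>) / 2) * norm y" by simp
  qed
qed

lemma Q_hol:
  assumes U: "open U" and p: "p holomorphic_on U" "p ` U \<subseteq> ball 0 r"
  shows "(\<lambda>z. Q (p z) z) holomorphic_on U"
proof -
  have inb: "of_real s * p z \<in> ball 0 r" if "z \<in> U" "s \<in> {0..1}" for z s
  proof -
    have "norm (p z) < r" using p(2) that(1) by auto
    moreover have "norm (of_real s * p z) \<le> norm (p z)" using that(2) by (auto simp: norm_mult mult_left_le_one_le)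
    ultimately show ?thesis by simp
  qed
  have "(\<lambda>z. set_lebesgue_integral lborel {0<..<1} (\<lambda>s. N (of_real s * p z) z / of_real s * 1)) holomorphic_on U"
  proof (rule holomorphic_on_set_lebesgue_integral[OF _ U])
    have "set_integrable lborel {0..1::real} (\<lambda>s. 1::complex)"
      by (rule borel_integrable_atLeastAtMost') (rule continuous_on_const)
    then show "set_integrable lborel {0<..<1::real} (\<lambda>s. 1::complex)"
      by (rule set_integrable_subset) auto
    show "(\<lambda>z. N (of_real s * p z) z / of_real s) holomorphic_on U" if "s \<in> {0<..<1}" for s
      using that inb by (intro holomorphic_intros N_hol U p) auto
    show "set_borel_measurable lborel {0<..<1} (\<lambda>s. N (of_real s * p z) z / of_real s)" if z: "z \<in> U" for z
    proof -
      have "continuous_on {0<..<1} (\<lambda>s::real. N (of_real s * p z) z)"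
        by (rule continuous_on_compose2[OF holomorphic_on_imp_continuous_on[OF N_hol1]])
           (use inb[OF z] in \<open>auto intro!: continuous_intros\<close>)
      then have "continuous_on {0<..<1} (\<lambda>s::real. N (of_real s * p z) z / of_real s)"
        by (intro continuous_intros) auto
      then show ?thesis unfolding set_borel_measurable_def measurable_lborel2
        by (intro borel_measurable_continuous_on_indicator) auto
    qed
    show "\<exists>\<rho>>0. \<exists>B. cball z \<rho> \<subseteq> U \<and> (\<forall>w\<in>cball z \<rho>. \<forall>s\<in>{0<..<1}. norm (N (of_real s * p w) w / of_real s) \<le> B)" if z: "z \<in> U" for z
    proof -
      obtain \<rho> where \<rho>: "\<rho> > 0" "cball z \<rho> \<subseteq> U" using U z open_contains_cball by blast
      have "compact ((\<lambda>w. norm (p w)) ` cball z \<rho>)"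
        by (intro compact_continuous_image continuous_intros continuous_on_subset[OF holomorphic_on_imp_continuous_on[OF p(1)] \<rho>(2)]) simp
      then obtain m where m: "m \<in> (\<lambda>w. norm (p w)) ` cball z \<rho>" "\<And>w. w \<in> cball z \<rho> \<Longrightarrow> norm (p w) \<le> m"
        using compact_attains_sup[of "(\<lambda>w. norm (p w)) ` cball z \<rho>"] \<rho>(1) by (metis (no_types, lifting) centre_in_cball imageI imageE empty_iff less_imp_le)
      obtain w0 where w0: "w0 \<in> cball z \<rho>" "m = norm (p w0)" using m(1) by blast
      then have "p w0 \<in> ball 0 r" using p(2) \<rho>(2) by blast
      then have mr: "0 \<le> m" "m < r" using w0 by auto
      obtain B where B: "\<And>y w. norm y \<le> m \<Longrightarrow> w \<in> cball z \<rho> \<Longrightarrow> norm (N y w) \<le> B * norm y"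
        by (rule N_bound[OF mr compact_cball]) blast
      have "norm (N (of_real s * p w) w / of_real s) \<le> \<bar>B\<bar> * m" if w: "w \<in> cball z \<rho>" and s: "s \<in> {0<..<1}" for w s
      proof -
        have "norm (of_real s * p w) \<le> m" using m(2)[OF w] s mult_left_le_one_le[of "norm (p w)" s] by (auto simp: norm_mult)
        from B[OF this w] have "norm (N (of_real s * p w) w) \<le> B * (s * norm (p w))" using s by (simp add: norm_mult)
        also have "\<dots> \<le> \<bar>B\<bar> * (s * m)" using m(2)[OF w] s by (intro mult_mono) auto
        finally show ?thesis using s by (simp add: norm_divide field_simps)
      qed
      then show ?thesis using \<rho> by blast
    qed
  qed
  then show ?thesis by (simp add: Q_altdef)
qed

definition Lprim :: "complex \<Rightarrow> complex \<Rightarrow> complex" where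
  "Lprim z y = (Pf y z + M 0 z * R 0) * Ln y + Q y z"

lemma Lprim_deriv:
  assumes "y \<in> ball 0 r" "y \<notin> \<real>\<^sub>\<le>\<^sub>0"
  shows "(Lprim z has_field_derivative M y z * (A y * Ln y + R y / y)) (at y)"
proof -
  have y0: "y \<noteq> 0" using assms by auto
  have "(Lprim z has_field_derivative (M y z * A y * Ln y + (Pf y z + M 0 z * R 0) / y + q z y)) (at y)"
    unfolding Lprim_def[abs_def] using y0 assms(2)
    by (auto intro!: derivative_eq_intros Pf_deriv[OF assms(1)] Q_deriv[OF assms(1)] simp: divide_inverse)
  also have "M y z * A y * Ln y + (Pf y z + M 0 z * R 0) / y + q z y = M y z * (A y * Ln y + R y / y)"
    using y0 by (simp add: q_def N_def field_simps)
  finally show ?thesis .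
qed

text \<open>If M vanishes at (0, z), the coefficient of the logarithm reduces to \<open>Pf\<close>,
  which is O(y); and y log y tends to 0. This is where K(\<omega>, \<omega>) = 0 makes the integral
  converge at the end of the path.\<close>

lemma Lprim_lim:
  assumes M0: "M 0 z = 0"
  shows "((\<lambda>x. Lprim z (of_real x)) \<longlongrightarrow> 0) (at_right 0)"
proof -
  have Pd: "((\<lambda>y. Pf y z) has_field_derivative M 0 z * A 0) (at 0)" by (rule Pf_deriv) (use r in simp)
  have "((\<lambda>h. (Pf (0 + h) z - Pf 0 z) / h) \<longlongrightarrow> M 0 z * A 0) (at 0)" using Pd by (rule DERIV_D)
  then have l1: "((\<lambda>h. Pf h z / h) \<longlongrightarrow> 0) (at 0)" using M0 by simp
  have fl: "filterlim complex_of_real (at 0) (at_right 0)"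
    unfolding filterlim_at by (auto intro!: tendsto_eq_intros simp: eventually_at_filter)
  have l2: "((\<lambda>x. Pf (of_real x) z / of_real x) \<longlongrightarrow> 0) (at_right 0)"
    by (rule filterlim_compose[OF l1 fl])
  have "((\<lambda>x::real. x * ln x) \<longlongrightarrow> 0) (at_right 0)" by real_asymp
  then have l3: "((\<lambda>x. complex_of_real (x * ln x)) \<longlongrightarrow> 0) (at_right 0)"
    using tendsto_of_real[of "\<lambda>x. x * ln x" 0 "at_right 0", where 'a=complex] by simp
  have "isCont (\<lambda>y. Q y z) 0" by (rule DERIV_isCont[OF Q_deriv]) (use r in simp)
  then have l4: "((\<lambda>x. Q (of_real x) z) \<longlongrightarrow> 0) (at_right 0)"
    using filterlim_compose[of "\<lambda>y. Q y z" "nhds (Q 0 z)" "at 0", OF _ fl] by (simp add: isCont_def)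
  have "((\<lambda>x. Pf (of_real x) z / of_real x * of_real (x * ln x) + Q (of_real x) z) \<longlongrightarrow> 0 * 0 + 0) (at_right 0)"
    by (intro tendsto_intros l2 l3 l4)
  moreover have "\<forall>\<^sub>F x in at_right 0. Pf (of_real x) z / of_real x * of_real (x * ln x) + Q (of_real x) z = Lprim z (of_real x)"
    using eventually_at_right_less[of 0] by eventually_elim (auto simp: Lprim_def M0 Ln_of_real)
  ultimately show ?thesis by (auto elim: Lim_transform_eventually)
qed

lemma Lprim_0: "M 0 z = 0 \<Longrightarrow> Lprim z 0 = 0" by (simp add: Lprim_def)

end

section \<open>The singularity at the end of the path\<close>

lemma set_integral_Ioo_split:
  fixes f :: "real \<Rightarrow> complex"
  assumes "set_integrable lborel {a<..<c} f" "a \<le> b" "b \<le> c"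
  shows "set_lebesgue_integral lborel {a<..<c} f = set_lebesgue_integral lborel {a<..<b} f + set_lebesgue_integral lborel {b<..<c} f"
proof -
  have i: "set_integrable lborel {a<..<b} f" "set_integrable lborel {b<..<c} f"
    using assms by (auto intro: set_integrable_subset)
  have "set_lebesgue_integral lborel {a<..<c} f = set_lebesgue_integral lborel ({a<..<b} \<union> {b<..<c}) f"
    unfolding set_lebesgue_integral_def
  proof (rule integral_cong_AE)
    show "(\<lambda>u. indicator {a<..<c} u *\<^sub>R f u) \<in> borel_measurable lborel"
      using assms(1) unfolding set_integrable_def by auto
    have "set_integrable lborel ({a<..<b} \<union> {b<..<c}) f"
      by (rule set_integrable_Un) (use i in auto)
    then show "(\<lambda>u. indicator ({a<..<b} \<union> {b<..<c}) u *\<^sub>R f u) \<in> borel_measurable lborel"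
      unfolding set_integrable_def by auto
    have "AE u in lborel. u \<noteq> b" by (rule AE_lborel_singleton)
    then show "AE u in lborel. indicator {a<..<c} u *\<^sub>R f u = indicator ({a<..<b} \<union> {b<..<c}) u *\<^sub>R f u"
      by eventually_elim (use assms in \<open>auto simp: indicator_def\<close>)
  qed
  also have "\<dots> = set_lebesgue_integral lborel {a<..<b} f + set_lebesgue_integral lborel {b<..<c} f"
    by (rule set_integral_Un) (use i in auto)
  finally show ?thesis .
qed

text \<open>The path arrives at \<omega> along the horizontal segment from the right, so that near
  its end the principal \<open>Ln (z - \<omega>)\<close> is the branch in which the singularity is
  expressed.\<close>

locale resurgent_end = resurgent_path +
  fixes \<omega> :: complex and u0 :: real
  assumes \<omega>1: "exp \<omega> = 1" and u0: "0 < u0" "u0 < 1"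
    and endpos: "\<And>u. u \<in> {u0<..<1} \<Longrightarrow> \<gamma> u - \<omega> = of_real (Re (\<gamma> u - \<omega>)) \<and> 0 < Re (\<gamma> u - \<omega>)"
    and \<gamma>1: "\<gamma> 1 = \<omega>" and K\<omega>: "K \<omega> \<omega> = 0"
begin

text \<open>\<open>A\<close> and \<open>R\<close> are holomorphic on a full disc, but the germs are
  compared with them only at parameters close to 1, where \<gamma> u - \<omega> is positive.\<close>

definition lform :: "(real \<Rightarrow> complex \<Rightarrow> complex) \<Rightarrow> real \<Rightarrow> (complex \<Rightarrow> complex) \<Rightarrow> (complex \<Rightarrow> complex) \<Rightarrow> bool" where
  "lform F r A R \<longleftrightarrow> A holomorphic_on ball 0 r \<and> R holomorphic_on ball 0 r \<and>
     (\<exists>u1<1. \<forall>u\<in>{u1<..<1}. \<forall>\<^sub>F z in nhds (\<gamma> u). F u z = A (z - \<omega>) * Ln (z - \<omega>) + R (z - \<omega>) / (z - \<omega>))"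

lemma near_end:
  assumes "r > 0" "u1 < 1"
  obtains t1 where "u0 < t1" "u1 < t1" "t1 < 1" "\<And>u. u \<in> {t1..1} \<Longrightarrow> \<gamma> u - \<omega> \<in> ball 0 r"
proof -
  obtain d where d: "d > 0" "\<And>u. u \<in> {0..1} \<Longrightarrow> dist u 1 < d \<Longrightarrow> dist (\<gamma> u) (\<gamma> 1) < r"
    using \<gamma>_cont assms(1) unfolding continuous_on_iff by (metis atLeastAtMost_iff order_refl zero_le_one)
  define t1 where "t1 = (1 + max (max u0 u1) (1 - d)) / 2"
  have t1: "u0 < t1" "u1 < t1" "t1 < 1" "1 - d < t1" using u0 assms d(1) by (auto simp: t1_def max_def)
  show ?thesis
  proof (rule that[OF t1(1-3)])
    fix u assume u: "u \<in> {t1..1}"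
    then have "dist (\<gamma> u) (\<gamma> 1) < r" using t1 u0 by (intro d(2)) (auto simp: dist_real_def)
    then show "\<gamma> u - \<omega> \<in> ball 0 r" by (simp add: \<gamma>1 dist_norm norm_minus_commute)
  qed
qed

text \<open>The entire function (e^x - 1) / x. It has no zeros in the disc of radius 2 \<pi>, so
  dividing by it preserves the radius \<open>r\<close>.\<close>

definition e1 :: "complex \<Rightarrow> complex" where
  "e1 x = (if x = 0 then deriv exp 0 else (exp x - exp 0) / (x - 0))"

lemma e1_hol: "e1 holomorphic_on S"
proof -
  have "e1 holomorphic_on UNIV" unfolding e1_def[abs_def] by (rule pole_lemma) (auto intro: holomorphic_intros)
  then show ?thesis by (rule holomorphic_on_subset) simp
qed

lemma e1_0: "e1 0 = 1" by (simp add: e1_def DERIV_imp_deriv[OF DERIV_exp])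

lemma e1_mult: "x * e1 x = exp x - 1" by (simp add: e1_def)

lemma e1_nz: "norm x < 2 * pi \<Longrightarrow> e1 x \<noteq> 0"
  using exp_eq_1_norm_less[of x] e1_0 e1_mult[of x] by (cases "x = 0") auto

lemma exp_shift: "exp (\<omega> + x) = exp x" by (simp add: exp_add \<omega>1)

text \<open>The numerator of \<open>nxt\<close> is a path integral up to a fixed \<open>t1\<close>
  plus an increment of the explicit primitive \<open>Lprim\<close>, whose logarithmic part has a
  coefficient vanishing at x = 0. Hence division by e^x - 1 leaves a holomorphic coefficient of the
  logarithm and a simple pole.\<close>

lemma lform_nxt:
  assumes F: "good k F" and lf: "lform F r A R" and r: "0 < r" "r \<le> 1"
    and int: "set_integrable lborel {0<..<1} (\<lambda>u. K (\<gamma> u) \<omega> * (F u (\<gamma> u) * D u))"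
  obtains A' R' where "lform (nxt F) r A' R'"
    "R' 0 = set_lebesgue_integral lborel {0<..<1} (\<lambda>u. K (\<gamma> u) \<omega> * (F u (\<gamma> u) * D u))"
proof -
  obtain u1 where u1: "u1 < 1" and form: "\<And>u. u \<in> {u1<..<1} \<Longrightarrow> \<forall>\<^sub>F z in nhds (\<gamma> u). F u z = A (z - \<omega>) * Ln (z - \<omega>) + R (z - \<omega>) / (z - \<omega>)"
    using lf unfolding lform_def by blast
  obtain t1 where t1: "u0 < t1" "u1 < t1" "t1 < 1" and inb: "\<And>u. u \<in> {t1..1} \<Longrightarrow> \<gamma> u - \<omega> \<in> ball 0 r"
    by (rule near_end[OF r(1) u1]) blast
  interpret L: log_kernel "\<lambda>x z. K (\<omega> + x) (\<omega> + z)" A R r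
  proof
    show "continuous_on UNIV (\<lambda>(x, z). K (\<omega> + x) (\<omega> + z))"
      unfolding case_prod_unfold by (intro K_cont continuous_intros)
    show "(\<lambda>z. K (\<omega> + p z) (\<omega> + q z)) holomorphic_on U" if "open U" "p holomorphic_on U" "q holomorphic_on U" for U p q
      using that by (intro Kh holomorphic_intros)
  qed (use lf r in \<open>auto simp: lform_def\<close>)
  define H where "H = {x. 0 < Re x} \<inter> ball 0 r"
  have H: "open H" "convex H" unfolding H_def
    by (auto intro!: open_Int convex_Int convex_halfspace_Re_gt simp: open_halfspace_Re_gt)
  have Hb: "x \<in> ball 0 r" "x \<notin> \<real>\<^sub>\<le>\<^sub>0" if "x \<in> H" for x
    using that by (auto simp: H_def complex_nonpos_Reals_iff)
  have \<gamma>H: "\<gamma> u - \<omega> \<in> H" if "u \<in> {t1..<1}" for u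
    using endpos[of u] inb[of u] that t1 by (auto simp: H_def)
  define a where "a = \<gamma> t1 - \<omega>"
  have aH: "a \<in> H" using \<gamma>H[of t1] t1 by (simp add: a_def)
  \<comment> \<open>The coefficient of the logarithm in \<open>Lprim x x\<close>.\<close>
  define A1 where "A1 = (\<lambda>x. L.Pf x x + K \<omega> (\<omega> + x) * R 0)"
  \<comment> \<open>What remains after the logarithmic part of \<open>Lprim x x\<close> is removed:
    the integral up to \<open>t1\<close>, the lower end \<open>a\<close> of the increment, and the
    holomorphic part of the primitive.\<close>
  define E where "E = (\<lambda>x. Cint F t1 (\<omega> + x) - L.Lprim x a + L.Q x x)"
  have t10: "t1 \<in> {0<..<1}" using t1 u0 by auto
  have Qder: "((\<lambda>x. L.Lprim (z - \<omega>) (x - \<omega>)) has_field_derivative K x z * (A (x - \<omega>) * Ln (x - \<omega>) + R (x - \<omega>) / (x - \<omega>))) (at x)"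
    if "x - \<omega> \<in> H" for x z
  proof -
    have "((\<lambda>x. L.Lprim (z - \<omega>) (x - \<omega>)) has_field_derivative
       (K (\<omega> + (x - \<omega>)) (\<omega> + (z - \<omega>)) * (A (x - \<omega>) * Ln (x - \<omega>) + R (x - \<omega>) / (x - \<omega>))) * 1) (at x)"
      by (rule DERIV_chain2[where f="L.Lprim (z - \<omega>)" and g="\<lambda>x. x - \<omega>", OF L.Lprim_deriv[OF Hb[OF that]]]) (auto intro!: derivative_eq_intros)
    then show ?thesis by simp
  qed
  have Fval: "F u (\<gamma> u) = A (\<gamma> u - \<omega>) * Ln (\<gamma> u - \<omega>) + R (\<gamma> u - \<omega>) / (\<gamma> u - \<omega>)" if "u \<in> {t1..<1}" for u
    using eventually_nhds_x_imp_x[OF form[of u]] that t1 by auto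
  have num: "\<forall>\<^sub>F z in nhds (\<gamma> t). Cint F t z + seg (\<lambda>x. K x z * F t x) (\<gamma> t) z = A1 (z - \<omega>) * Ln (z - \<omega>) + E (z - \<omega>) \<and> z - \<omega> \<in> H"
    if t: "t \<in> {t1<..<1}" for t
  proof -
    obtain V where V: "open V" "\<gamma> t \<in> V" "\<And>z. z \<in> V \<Longrightarrow> F t z = A (z - \<omega>) * Ln (z - \<omega>) + R (z - \<omega>) / (z - \<omega>)"
      using form[of t] t t1 unfolding eventually_nhds by auto
    have "open (V \<inter> (\<lambda>x. x - \<omega>) -` H)"
      by (intro open_Int V open_vimage H continuous_intros)
    moreover have "\<gamma> t \<in> V \<inter> (\<lambda>x. x - \<omega>) -` H" using V \<gamma>H[of t] t by auto
    ultimately obtain r' where r': "r' > 0" "ball (\<gamma> t) r' \<subseteq> V \<inter> (\<lambda>x. x - \<omega>) -` H" by (rule openE)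
    have "Cint F t z + seg (\<lambda>x. K x z * F t x) (\<gamma> t) z = A1 (z - \<omega>) * Ln (z - \<omega>) + E (z - \<omega>)"
      if z: "z \<in> ball (\<gamma> t) r'" for z
    proof -
      have "Cint F t z - Cint F t1 z = L.Lprim (z - \<omega>) (\<gamma> t - \<omega>) - L.Lprim (z - \<omega>) (\<gamma> t1 - \<omega>)"
      proof (rule Cint_primitive[OF F, where Q="\<lambda>x. L.Lprim (z - \<omega>) (x - \<omega>)"])
        fix u assume "u \<in> {min t t1..max t t1}"
        then have u: "u \<in> {t1..<1}" using t by auto
        show "((\<lambda>x. L.Lprim (z - \<omega>) (x - \<omega>)) has_field_derivative K (\<gamma> u) z * F u (\<gamma> u)) (at (\<gamma> u))"
          using Qder[OF \<gamma>H[OF u], of z] by (simp add: Fval[OF u])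
      qed (use t t10 in auto)
      moreover have "seg (\<lambda>x. K x z * F t x) (\<gamma> t) z = L.Lprim (z - \<omega>) (z - \<omega>) - L.Lprim (z - \<omega>) (\<gamma> t - \<omega>)"
      proof -
        have "seg (\<lambda>x. K x z * F t x) (\<gamma> t) z = seg (\<lambda>x. K x z * (A (x - \<omega>) * Ln (x - \<omega>) + R (x - \<omega>) / (x - \<omega>))) (\<gamma> t) z"
        proof (rule seg_cong)
          fix x assume "x \<in> closed_segment (\<gamma> t) z"
          then have "x \<in> ball (\<gamma> t) r'" using closed_segment_subset[of "\<gamma> t" "ball (\<gamma> t) r'" z] z r' by auto
          then show "K x z * F t x = K x z * (A (x - \<omega>) * Ln (x - \<omega>) + R (x - \<omega>) / (x - \<omega>))" using V(3) r' by auto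
        qed
        also have "\<dots> = L.Lprim (z - \<omega>) (z - \<omega>) - L.Lprim (z - \<omega>) (\<gamma> t - \<omega>)"
          by (rule seg_primitive[where U="ball (\<gamma> t) r'" and P="\<lambda>x. L.Lprim (z - \<omega>) (x - \<omega>)", OF _ _ Qder]) (use z r' in auto)
        finally show ?thesis .
      qed
      ultimately have "Cint F t z + seg (\<lambda>x. K x z * F t x) (\<gamma> t) z = Cint F t1 z + L.Lprim (z - \<omega>) (z - \<omega>) - L.Lprim (z - \<omega>) a"
        unfolding a_def by algebra
      also have "\<dots> = A1 (z - \<omega>) * Ln (z - \<omega>) + E (z - \<omega>)"
        by (simp add: A1_def E_def L.Lprim_def)
      finally show ?thesis .
    qed
    moreover have "z - \<omega> \<in> H" if "z \<in> ball (\<gamma> t) r'" for z using that r' by auto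
    moreover have "\<forall>\<^sub>F z in nhds (\<gamma> t). z \<in> ball (\<gamma> t) r'"
      using r' by (intro eventually_nhds_in_open) auto
    ultimately show ?thesis by (auto elim: eventually_mono)
  qed
  define A2 where "A2 = (\<lambda>x. if x = 0 then deriv A1 0 else (A1 x - A1 0) / (x - 0))"
  define A' where "A' = (\<lambda>x. A2 x / e1 x)"
  define R' where "R' = (\<lambda>x. E x / e1 x)"
  have nz: "e1 x \<noteq> 0" if "x \<in> ball 0 r" for x using that r pi_gt3 by (intro e1_nz) auto
  \<comment> \<open>Otherwise dividing by e^x - 1 would create a term log x / x, which is not of the
    required form.\<close>
  have A10: "A1 0 = 0" using K\<omega> by (simp add: A1_def)
  have A1h: "A1 holomorphic_on ball 0 r"
    unfolding A1_def by (intro holomorphic_intros L.Pf_hol Kh) auto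
  have A2h: "A2 holomorphic_on ball 0 r"
    unfolding A2_def by (rule pole_lemma[OF A1h]) (use r in simp)
  have Ch: "(\<lambda>x. Cint F t1 (\<omega> + x)) holomorphic_on ball 0 r"
  proof -
    have "(\<lambda>x. \<omega> + x) holomorphic_on ball 0 r" by (intro holomorphic_intros)
    from holomorphic_on_compose_gen[OF this Cint_holomorphic[OF F t1(3)]] show ?thesis by (simp add: o_def)
  qed
  have Eh: "E holomorphic_on ball 0 r"
    unfolding E_def L.Lprim_def using Hb[OF aH] by (intro holomorphic_intros L.Pf_hol L.Q_hol Kh Ch) auto
  have A'h: "A' holomorphic_on ball 0 r" "R' holomorphic_on ball 0 r"
    unfolding A'_def R'_def using nz by (intro holomorphic_intros A2h Eh e1_hol; simp)+
  show ?thesis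
  proof (rule that[of A' R'])
    show "lform (nxt F) r A' R'"
      unfolding lform_def
    proof (intro conjI A'h exI[of _ t1] t1(3) ballI)
      fix t assume t: "t \<in> {t1<..<1}"
      show "\<forall>\<^sub>F z in nhds (\<gamma> t). nxt F t z = A' (z - \<omega>) * Ln (z - \<omega>) + R' (z - \<omega>) / (z - \<omega>)"
        using num[OF t]
      proof eventually_elim
        case (elim z)
        define x where "x = z - \<omega>"
        have x: "x \<noteq> 0" "e1 x \<noteq> 0" using Hb[of x] elim nz[of x] by (auto simp: x_def)
        have "exp z - 1 = x * e1 x" using exp_shift[of x] by (simp add: e1_mult x_def)
        then have "nxt F t z = (A1 x * Ln x + E x) / (x * e1 x)" using elim by (simp add: nxt_def x_def)
        also have "\<dots> = A' x * Ln x + R' x / x"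
          using x by (simp add: A'_def R'_def A2_def A10 add_divide_distrib)
        finally show ?case by (simp add: x_def)
      qed
    qed
    \<comment> \<open>At x = 0 the remainder \<open>E\<close> is the integral up to
      \<open>t1\<close> minus \<open>Lprim 0 a\<close>. As \<open>Lprim 0\<close> tends to 0 at the
      end, the second term is the integral over the rest of the path.\<close>
    have "set_lebesgue_integral lborel {0<..<1} (\<lambda>u. K (\<gamma> u) \<omega> * (F u (\<gamma> u) * D u)) =
       Cint F t1 \<omega> + set_lebesgue_integral lborel {t1<..<1} (\<lambda>u. K (\<gamma> u) \<omega> * F u (\<gamma> u) * D u)"
      using set_integral_Ioo_split[OF int, of t1] t10 by (simp add: Cint_def mult.assoc)
    also have "set_lebesgue_integral lborel {t1<..<1} (\<lambda>u. K (\<gamma> u) \<omega> * F u (\<gamma> u) * D u) = L.Lprim 0 (\<gamma> 1 - \<omega>) - L.Lprim 0 (\<gamma> t1 - \<omega>)"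
    proof (rule bdd_pc1_FTC[OF pc1, where P="\<lambda>x. L.Lprim 0 (x - \<omega>)"])
      have der: "((\<lambda>x. L.Lprim 0 (x - \<omega>)) has_field_derivative K (\<gamma> u) \<omega> * F u (\<gamma> u)) (at (\<gamma> u))" if u: "u \<in> {t1..<1}" for u
        using Qder[OF \<gamma>H[OF u], of \<omega>] by (simp add: Fval[OF u])
      then show "((\<lambda>x. L.Lprim 0 (x - \<omega>)) has_field_derivative K (\<gamma> u) \<omega> * F u (\<gamma> u)) (at (\<gamma> u))" if "u \<in> {t1<..<1}" for u
        using that by simp
      show "set_integrable lborel {t1<..<1} (\<lambda>u. K (\<gamma> u) \<omega> * F u (\<gamma> u) * D u)"
        unfolding mult.assoc by (rule set_integrable_subset[OF int]) (use t10 in auto)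
      show "continuous_on {t1..1} (\<lambda>u. L.Lprim 0 (\<gamma> u - \<omega>))"
        unfolding continuous_on_eq_continuous_within
      proof
        fix u assume u: "u \<in> {t1..1}"
        have c: "continuous (at u within {t1..1}) \<gamma>"
          using \<gamma>_cont'[of "{t1..1}"] t10 u by (auto simp: continuous_on_eq_continuous_within)
        show "continuous (at u within {t1..1}) (\<lambda>u. L.Lprim 0 (\<gamma> u - \<omega>))"
        proof (cases "u = 1")
          case False
          then have u': "u \<in> {t1..<1}" using u by auto
          show ?thesis
            by (rule continuous_within_compose3[where f=\<gamma> and g="\<lambda>x. L.Lprim 0 (x - \<omega>)", OF DERIV_isCont[OF der[OF u']] c])
        next
          case True
          have ev: "\<forall>\<^sub>F u in at 1 within {t1..1}. u \<in> {u0<..<1}"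
            unfolding eventually_at using t1 u0 by (intro exI[of _ 1]) auto
          have "((\<lambda>u. \<gamma> u - \<omega>) \<longlongrightarrow> 0) (at 1 within {t1..1})"
            using c True \<gamma>1 by (auto simp: continuous_within intro!: tendsto_eq_intros)
          from tendsto_Re[OF this] have "((\<lambda>u. Re (\<gamma> u - \<omega>)) \<longlongrightarrow> 0) (at 1 within {t1..1})" by simp
          moreover have "\<forall>\<^sub>F u in at 1 within {t1..1}. 0 < Re (\<gamma> u - \<omega>)"
            using ev by eventually_elim (use endpos in blast)
          ultimately have fl: "filterlim (\<lambda>u. Re (\<gamma> u - \<omega>)) (at_right 0) (at 1 within {t1..1})"
            unfolding filterlim_at by (auto elim!: eventually_mono)
          have "((\<lambda>x. L.Lprim 0 (of_real x)) \<longlongrightarrow> 0) (at_right 0)"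
            by (rule L.Lprim_lim) (use K\<omega> in simp)
          from filterlim_compose[OF this fl]
          have "((\<lambda>u. L.Lprim 0 (of_real (Re (\<gamma> u - \<omega>)))) \<longlongrightarrow> 0) (at 1 within {t1..1})" .
          moreover have "\<forall>\<^sub>F u in at 1 within {t1..1}. L.Lprim 0 (of_real (Re (\<gamma> u - \<omega>))) = L.Lprim 0 (\<gamma> u - \<omega>)"
            using ev by eventually_elim (use endpos in metis)
          ultimately have "((\<lambda>u. L.Lprim 0 (\<gamma> u - \<omega>)) \<longlongrightarrow> 0) (at 1 within {t1..1})"
            by (rule Lim_transform_eventually)
          then show ?thesis using True L.Lprim_0[of 0] K\<omega> \<gamma>1 by (simp add: continuous_within)
        qed
      qed
    qed (use t10 in auto)
    finally show "R' 0 = set_lebesgue_integral lborel {0<..<1} (\<lambda>u. K (\<gamma> u) \<omega> * (F u (\<gamma> u) * D u))"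
      using L.Lprim_0[of 0] K\<omega> \<gamma>1 by (simp add: R'_def E_def e1_0 a_def)
  qed
qed

end

section \<open>Integrals over simplices\<close>

text \<open>The constraint \<open>s\<^sub>1 \<le> \<dots> \<le> s\<^sub>k\<close> is a product of indicators of consecutive pairs, hence can be absorbed
  into \<open>L\<close>; the integral over the simplex becomes an iterated one over the whole line.\<close>

locale simplex_chain =
  fixes a :: "real \<Rightarrow> complex" and L :: "real \<Rightarrow> real \<Rightarrow> complex"
  assumes a_meas [measurable]: "a \<in> borel_measurable borel"
    and L_meas [measurable]: "(\<lambda>(u, v). L u v) \<in> borel_measurable (borel \<Otimes>\<^sub>M borel)"
begin

primrec J :: "nat \<Rightarrow> real \<Rightarrow> complex" where
  "J 0 = a"
| "J (Suc k) = (\<lambda>v. LINT u|lborel. J k u * L u v)"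

text \<open>\<open>J\<close> with absolute values inside, valued in \<open>ennreal\<close> so that
  Tonelli applies before integrability is known.\<close>

primrec JA :: "nat \<Rightarrow> real \<Rightarrow> ennreal" where
  "JA 0 = (\<lambda>u. ennreal (norm (a u)))"
| "JA (Suc k) = (\<lambda>v. \<integral>\<^sup>+u. JA k u * ennreal (norm (L u v)) \<partial>lborel)"

definition Psi :: "nat \<Rightarrow> (nat \<Rightarrow> real) \<Rightarrow> complex" where
  "Psi k s = a (s 1) * (\<Prod>i\<in>{1..k}. L (s i) (s (Suc i)))"

lemma L_meas2 [measurable]:
  assumes [measurable]: "f \<in> borel_measurable N" "g \<in> borel_measurable N"
  shows "(\<lambda>x. L (f x) (g x)) \<in> borel_measurable N"
proof -
  have "(\<lambda>x. (\<lambda>(u, v). L u v) (f x, g x)) \<in> borel_measurable N" by measurable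
  then show ?thesis by simp
qed

lemma JA_meas [measurable]: "JA k \<in> borel_measurable borel"
proof (induction k)
  case (Suc k)
  note [measurable] = Suc
  have "(\<lambda>v. \<integral>\<^sup>+u. JA k u * ennreal (norm (L u v)) \<partial>lborel) \<in> borel_measurable borel" by measurable
  then show ?case by simp
qed simp

lemma J_meas [measurable]: "J k \<in> borel_measurable borel"
proof (induction k)
  case (Suc k)
  note [measurable] = Suc
  have "(\<lambda>v. LINT u|lborel. J k u * L u v) \<in> borel_measurable borel" by measurable
  then show ?case by simp
qed simp

text \<open>Holds for every function: in the non-integrable case the Bochner integral is 0 by
  convention.\<close>

lemma norm_integral_le_nn: "ennreal (norm (integral\<^sup>L M f)) \<le> (\<integral>\<^sup>+x. ennreal (norm (f x)) \<partial>M)" for f :: "_ \<Rightarrow> complex"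
  by (cases "integrable M f") (auto simp: integral_norm_bound_ennreal not_integrable_integral_eq)

lemma norm_J_le: "ennreal (norm (J k u)) \<le> JA k u"
proof (induction k arbitrary: u)
  case (Suc k)
  have "ennreal (norm (J (Suc k) u)) \<le> (\<integral>\<^sup>+w. ennreal (norm (J k w * L w u)) \<partial>lborel)"
    by (simp add: norm_integral_le_nn)
  also have "\<dots> \<le> (\<integral>\<^sup>+w. JA k w * ennreal (norm (L w u)) \<partial>lborel)"
    by (intro nn_integral_mono) (simp add: norm_mult ennreal_mult' mult_right_mono Suc)
  finally show ?case by simp
qed simp

abbreviation (input) "PM k \<equiv> PiM {1..k::nat} (\<lambda>_. lborel :: real measure)"

lemma psf: "product_sigma_finite (\<lambda>_::nat. lborel :: real measure)"
  by (simp add: product_sigma_finite_def sigma_finite_lborel)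

lemma Psi_meas [measurable]: "Psi k \<in> borel_measurable (PM (Suc k))"
  unfolding Psi_def[abs_def] by measurable

lemma Psi_upd: "Psi (Suc k) (x(Suc (Suc k) := y)) = Psi k x * L (x (Suc k)) y"
proof -
  let ?x = "x(Suc (Suc k) := y)"
  have "(\<Prod>i\<in>{1..Suc k}. L (?x i) (?x (Suc i))) = L (?x (Suc k)) (?x (Suc (Suc k))) * (\<Prod>i\<in>{1..k}. L (?x i) (?x (Suc i)))"
    by (rule prod.nat_ivl_Suc') simp
  also have "(\<Prod>i\<in>{1..k}. L (?x i) (?x (Suc i))) = (\<Prod>i\<in>{1..k}. L (x i) (x (Suc i)))"
    by (intro prod.cong refl) auto
  finally show ?thesis by (simp add: Psi_def)
qed

text \<open>The last coordinate is integrated first and absorbed into a new test function, so the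
  induction runs over \<open>k\<close> with \<open>H\<close> arbitrary.\<close>

lemma Psi_nn_integral:
  assumes H: "H \<in> borel_measurable borel"
  shows "(\<integral>\<^sup>+s. ennreal (norm (Psi k s)) * H (s (Suc k)) \<partial>PM (Suc k)) = (\<integral>\<^sup>+u. JA k u * H u \<partial>lborel)"
  using H
proof (induction k arbitrary: H)
  case 0
  interpret product_sigma_finite "\<lambda>_::nat. lborel :: real measure" by (rule psf)
  note [measurable] = 0
  show ?case
    using product_nn_integral_singleton[of "\<lambda>u. ennreal (norm (a u)) * H u" "Suc 0"] by (simp add: Psi_def)
next
  case (Suc k)
  interpret product_sigma_finite "\<lambda>_::nat. lborel :: real measure" by (rule psf)
  note [measurable] = Suc.prems
  define H' where "H' = (\<lambda>u. \<integral>\<^sup>+y. ennreal (norm (L u y)) * H y \<partial>lborel)"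
  have [measurable]: "H' \<in> borel_measurable borel" unfolding H'_def by measurable
  have ins: "{1..Suc (Suc k)} = insert (Suc (Suc k)) {1..Suc k}" by auto
  let ?f = "\<lambda>s. ennreal (norm (Psi (Suc k) s)) * H (s (Suc (Suc k)))"
  have fm: "?f \<in> borel_measurable (PM (Suc (Suc k)))" by measurable
  have "(\<integral>\<^sup>+s. ?f s \<partial>PM (Suc (Suc k))) = (\<integral>\<^sup>+x. \<integral>\<^sup>+y. ?f (x(Suc (Suc k) := y)) \<partial>lborel \<partial>PM (Suc k))"
    using fm unfolding ins by (intro product_nn_integral_insert) auto
  also have "\<dots> = (\<integral>\<^sup>+x. ennreal (norm (Psi k x)) * H' (x (Suc k)) \<partial>PM (Suc k))"
    unfolding H'_def Psi_upd
    by (intro nn_integral_cong) (simp add: norm_mult ennreal_mult' mult.assoc nn_integral_cmult)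
  also have "\<dots> = (\<integral>\<^sup>+u. JA k u * H' u \<partial>lborel)" by (rule Suc.IH) measurable
  also have "\<dots> = (\<integral>\<^sup>+u. \<integral>\<^sup>+y. JA k u * ennreal (norm (L u y)) * H y \<partial>lborel \<partial>lborel)"
    unfolding H'_def by (intro nn_integral_cong) (simp add: nn_integral_cmult mult.assoc)
  also have "\<dots> = (\<integral>\<^sup>+y. \<integral>\<^sup>+u. JA k u * ennreal (norm (L u y)) * H y \<partial>lborel \<partial>lborel)"
    by (rule lborel_pair.Fubini'[symmetric]) measurable
  also have "\<dots> = (\<integral>\<^sup>+y. JA (Suc k) y * H y \<partial>lborel)"
    by (intro nn_integral_cong) (simp add: nn_integral_multc)
  finally show ?case .
qed

text \<open>Finiteness of the single outermost absolute integral suffices: by Tonelli it bounds the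
  corresponding integrals for all shorter chains, which justifies Fubini at every step.\<close>

lemma Psi_integral:
  assumes H: "H \<in> borel_measurable borel" and fin: "(\<integral>\<^sup>+u. JA k u * ennreal (norm (H u)) \<partial>lborel) < \<infinity>"
  shows "integrable (PM (Suc k)) (\<lambda>s. Psi k s * H (s (Suc k)))"
    and "(LINT s|PM (Suc k). Psi k s * H (s (Suc k))) = (LINT u|lborel. J k u * H u)"
proof -
  have int: "integrable (PM (Suc k)) (\<lambda>s. Psi k s * H (s (Suc k)))"
    if [measurable]: "H \<in> borel_measurable borel" and fin: "(\<integral>\<^sup>+u. JA k u * ennreal (norm (H u)) \<partial>lborel) < \<infinity>" for k H
  proof (rule integrableI_bounded)
    have "(\<integral>\<^sup>+s. ennreal (norm (Psi k s * H (s (Suc k)))) \<partial>PM (Suc k)) = (\<integral>\<^sup>+s. ennreal (norm (Psi k s)) * ennreal (norm (H (s (Suc k)))) \<partial>PM (Suc k))"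
      by (simp add: norm_mult ennreal_mult')
    also have "\<dots> = (\<integral>\<^sup>+u. JA k u * ennreal (norm (H u)) \<partial>lborel)" by (rule Psi_nn_integral) measurable
    finally show "(\<integral>\<^sup>+s. ennreal (norm (Psi k s * H (s (Suc k)))) \<partial>PM (Suc k)) < \<infinity>" using fin by simp
  qed measurable
  show "integrable (PM (Suc k)) (\<lambda>s. Psi k s * H (s (Suc k)))" by (rule int[OF H fin])
  show "(LINT s|PM (Suc k). Psi k s * H (s (Suc k))) = (LINT u|lborel. J k u * H u)"
    using H fin
  proof (induction k arbitrary: H)
    case 0
    interpret product_sigma_finite "\<lambda>_::nat. lborel :: real measure" by (rule psf)
    note [measurable] = 0(1)
    show ?case
      using product_integral_singleton[of "\<lambda>u. a u * H u" "Suc 0"] by (simp add: Psi_def)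
  next
    case (Suc k)
    interpret product_sigma_finite "\<lambda>_::nat. lborel :: real measure" by (rule psf)
    note [measurable] = Suc.prems(1)
    define H' where "H' = (\<lambda>u. LINT y|lborel. L u y * H y)"
    have [measurable]: "H' \<in> borel_measurable borel" unfolding H'_def by measurable
    have ins: "{1..Suc (Suc k)} = insert (Suc (Suc k)) {1..Suc k}" by auto
    let ?f = "\<lambda>s. Psi (Suc k) s * H (s (Suc (Suc k)))"
    have fi: "integrable (PM (Suc (Suc k))) ?f" by (rule int[OF Suc.prems])
    have sw: "(\<integral>\<^sup>+u. \<integral>\<^sup>+y. JA k u * ennreal (norm (L u y)) * ennreal (norm (H y)) \<partial>lborel \<partial>lborel) < \<infinity>"
    proof -
      have "(\<integral>\<^sup>+u. \<integral>\<^sup>+y. JA k u * ennreal (norm (L u y)) * ennreal (norm (H y)) \<partial>lborel \<partial>lborel)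
         = (\<integral>\<^sup>+y. \<integral>\<^sup>+u. JA k u * ennreal (norm (L u y)) * ennreal (norm (H y)) \<partial>lborel \<partial>lborel)"
        by (rule lborel_pair.Fubini'[symmetric]) measurable
      also have "\<dots> = (\<integral>\<^sup>+y. JA (Suc k) y * ennreal (norm (H y)) \<partial>lborel)"
        by (intro nn_integral_cong) (simp add: nn_integral_multc)
      finally show ?thesis using Suc.prems(2) by simp
    qed
    have fin': "(\<integral>\<^sup>+u. JA k u * ennreal (norm (H' u)) \<partial>lborel) < \<infinity>"
    proof -
      have "(\<integral>\<^sup>+u. JA k u * ennreal (norm (H' u)) \<partial>lborel) \<le> (\<integral>\<^sup>+u. JA k u * (\<integral>\<^sup>+y. ennreal (norm (L u y * H y)) \<partial>lborel) \<partial>lborel)"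
        unfolding H'_def by (intro nn_integral_mono mult_left_mono norm_integral_le_nn) simp
      also have "\<dots> = (\<integral>\<^sup>+u. \<integral>\<^sup>+y. JA k u * ennreal (norm (L u y)) * ennreal (norm (H y)) \<partial>lborel \<partial>lborel)"
        by (intro nn_integral_cong) (simp add: nn_integral_cmult[symmetric] norm_mult ennreal_mult' mult.assoc)
      finally show ?thesis using sw by simp
    qed
    have pint: "integrable (lborel \<Otimes>\<^sub>M lborel) (\<lambda>(u, y). J k u * L u y * H y)"
    proof (rule integrableI_bounded)
      have "(\<integral>\<^sup>+x. ennreal (norm (case x of (u, y) \<Rightarrow> J k u * L u y * H y)) \<partial>(lborel \<Otimes>\<^sub>M lborel))
          = (\<integral>\<^sup>+u. \<integral>\<^sup>+y. ennreal (norm (J k u * L u y * H y)) \<partial>lborel \<partial>lborel)"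
        by (subst lborel.nn_integral_fst[symmetric]) (simp_all)
      also have "\<dots> \<le> (\<integral>\<^sup>+u. \<integral>\<^sup>+y. JA k u * ennreal (norm (L u y)) * ennreal (norm (H y)) \<partial>lborel \<partial>lborel)"
        by (intro nn_integral_mono) (simp add: norm_mult ennreal_mult' mult_right_mono norm_J_le)
      finally show "(\<integral>\<^sup>+x. ennreal (norm (case x of (u, y) \<Rightarrow> J k u * L u y * H y)) \<partial>(lborel \<Otimes>\<^sub>M lborel)) < \<infinity>"
        using sw by simp
    qed measurable
    have "(LINT s|PM (Suc (Suc k)). ?f s) = (LINT x|PM (Suc k). LINT y|lborel. ?f (x(Suc (Suc k) := y)))"
      using fi unfolding ins by (intro product_integral_insert) auto
    also have "\<dots> = (LINT x|PM (Suc k). Psi k x * H' (x (Suc k)))"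
      unfolding H'_def Psi_upd by (simp add: mult.assoc)
    also have "\<dots> = (LINT u|lborel. J k u * H' u)" by (rule Suc.IH) (use fin' in measurable)
    also have "\<dots> = (LINT u|lborel. LINT y|lborel. J k u * L u y * H y)"
      unfolding H'_def by (simp add: mult.assoc)
    also have "\<dots> = (LINT y|lborel. LINT u|lborel. J k u * L u y * H y)"
      by (rule lborel_pair.Fubini_integral[symmetric, of "\<lambda>u y. J k u * L u y * H y"]) (rule pint)
    also have "\<dots> = (LINT y|lborel. J (Suc k) y * H y)" by simp
    finally show ?case .
  qed
qed

end

section \<open>Arc length and absolute convergence over the simplices\<close>

lemma norm_exp_real_minus_1_ge: "0 \<le> x \<Longrightarrow> x \<le> norm (exp (complex_of_real x) - 1)"
proof -
  assume x: "0 \<le> x"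
  have "exp (complex_of_real x) - 1 = of_real (exp x - 1)" by (simp add: exp_of_real)
  then have "norm (exp (complex_of_real x) - 1) = \<bar>exp x - 1\<bar>" by (simp only: norm_of_real)
  then show ?thesis using exp_ge_add_one_self[of x] x by linarith
qed

lemma prod_1_Suc: "(\<Prod>i\<in>{1..Suc k}. f i) = f 1 * (\<Prod>i\<in>{1..k}. f (Suc i))" for f :: "nat \<Rightarrow> 'a::comm_monoid_mult"
  by (induction k) (auto simp: prod.nat_ivl_Suc' mult_ac)

text \<open>Adds what absolute convergence needs: monotone motion along the first and last pieces,
  the order of vanishing of the continued \<open>b_alpha_hat\<close> at 0, and the linear vanishing
  of K at (\<omega>, \<omega>). \<open>Bh\<close> is defined up to parameter 1 inclusive, as it is
  regular at \<omega>.\<close>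

locale resurgent_simple = resurgent_end +
  fixes Bh :: "real \<Rightarrow> complex \<Rightarrow> complex"
  assumes Bh: "germ_family \<gamma> {0<..1} Bh"
    and F0_eq: "F0 = (\<lambda>t z. Bh t z / (exp z - 1))"
    and Bh_small: "\<exists>C. \<forall>t\<in>{0<..<\<epsilon>}. norm (Bh t (\<gamma> t)) \<le> C * norm (\<gamma> t)"
    and mono0: "mono_on {0<..<\<epsilon>} (\<lambda>u. Re (\<gamma> u))"
    and anti1: "\<And>u v. u0 < u \<Longrightarrow> u \<le> v \<Longrightarrow> v < 1 \<Longrightarrow> Re (\<gamma> v - \<omega>) \<le> Re (\<gamma> u - \<omega>)"
    and K_lip: "\<exists>C d. d > 0 \<and> (\<forall>x z. norm (x - \<omega>) < d \<longrightarrow> norm (z - \<omega>) \<le> norm (x - \<omega>) \<longrightarrow> norm (K x z) \<le> C * norm (x - \<omega>))"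
begin

definition len :: "real \<Rightarrow> real" where
  "len v = set_lebesgue_integral lborel {0<..<v} (\<lambda>u. norm (D u))"

lemma D_integrable: "0 \<le> s \<Longrightarrow> t \<le> 1 \<Longrightarrow> set_integrable lborel {s<..<t} D"
  using set_integrable_bdd_pc1[OF pc1, of s t "\<lambda>u. 1" 1] by simp

lemma normD_integrable: "0 \<le> s \<Longrightarrow> t \<le> 1 \<Longrightarrow> set_integrable lborel {s<..<t} (\<lambda>u. norm (D u))"
  using D_integrable[of s t] by (rule set_integrable_norm)

lemma len_nonneg: "0 \<le> len v"
  unfolding len_def set_lebesgue_integral_def by (rule integral_nonneg_AE) (auto simp: indicator_def)

lemma len_mono: "0 \<le> u \<Longrightarrow> u \<le> v \<Longrightarrow> v \<le> 1 \<Longrightarrow> len u \<le> len v"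
  unfolding len_def set_lebesgue_integral_def
  by (rule integral_mono) (use normD_integrable[of 0 u] normD_integrable[of 0 v] in \<open>auto simp: set_integrable_def indicator_def\<close>)

lemma int_D: "0 \<le> v \<Longrightarrow> v \<le> 1 \<Longrightarrow> set_lebesgue_integral lborel {0<..<v} D = \<gamma> v"
  using bdd_pc1_FTC[OF pc1, of 0 v "\<lambda>z. z" "\<lambda>u. 1"] D_integrable[of 0 v] \<gamma>_cont'[of "{0..v}"] \<gamma>0 by (auto intro: DERIV_ident)

text \<open>The path moves monotonically on the positive axis, so the absolute value of its
  derivative is the real part almost everywhere and the fundamental theorem gives the
  length.\<close>

lemma len_near_0:
  assumes v: "0 < v" "v < \<epsilon>"
  shows "len v = norm (\<gamma> v)"
proof -
  obtain S where S: "finite S" 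
    and vd: "\<And>t. t \<in> {0<..<1} - S \<Longrightarrow> (\<gamma> has_vector_derivative D t) (at t)"
    by (rule bdd_pc1_vector_derivative[OF pc1]) blast
  have nD: "norm (D u) = Re (D u)" if u: "u \<in> {0<..<\<epsilon>}" "u \<notin> S" for u
  proof -
    have d: "(\<gamma> has_vector_derivative D u) (at u)" using vd[of u] u eps by auto
    have "((\<lambda>u. Re (\<gamma> u)) has_vector_derivative Re (D u)) (at u)"
      by (rule bounded_linear.has_vector_derivative[OF bounded_linear_Re d])
    then have "((\<lambda>u. Re (\<gamma> u)) has_real_derivative Re (D u)) (at u)"
      by (simp add: has_real_derivative_iff_has_vector_derivative)
    then have re: "0 \<le> Re (D u)"
      by (rule mono_on_imp_deriv_nonneg[OF mono0]) (use u in \<open>simp add: interior_open\<close>)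
    have im: "((\<lambda>u. Im (\<gamma> u)) has_vector_derivative Im (D u)) (at u)"
      by (rule bounded_linear.has_vector_derivative[OF bounded_linear_Im d])
    have "((\<lambda>u. 0) has_vector_derivative Im (D u)) (at u)"
    proof (rule has_vector_derivative_transform_within_open[OF im, of "{0<..<\<epsilon>}"])
      show "Im (\<gamma> w) = 0" if "w \<in> {0<..<\<epsilon>}" for w using pos[OF that] by (metis Im_complex_of_real)
    qed (use u in auto)
    then have "Im (D u) = 0" using vector_derivative_unique_at has_vector_derivative_const by blast
    then show ?thesis using re by (simp add: cmod_eq_Re)
  qed
  have "AE u in lborel. u \<notin> S" using S by (intro AE_not_in countable_imp_null_set_lborel countable_finite)
  then have ae: "AE u in lborel. indicator {0<..<v} u *\<^sub>R norm (D u) = Re (indicator {0<..<v} u *\<^sub>R D u)"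
    by eventually_elim (use nD v in \<open>auto simp: indicator_def\<close>)
  have i: "integrable lborel (\<lambda>u. indicator {0<..<v} u *\<^sub>R D u)" using D_integrable[of 0 v] v eps by (simp add: set_integrable_def)
  have "len v = (LINT u|lborel. Re (indicator {0<..<v} u *\<^sub>R D u))"
    unfolding len_def set_lebesgue_integral_def
  proof (rule integral_cong_AE[OF _ _ ae])
    show "(\<lambda>u. indicator {0<..<v} u *\<^sub>R norm (D u)) \<in> borel_measurable lborel"
      using normD_integrable[of 0 v] v eps unfolding set_integrable_def by (intro borel_measurable_integrable) auto
    show "(\<lambda>u. Re (indicator {0<..<v} u *\<^sub>R D u)) \<in> borel_measurable lborel"
      by (rule borel_measurable_integrable[OF integrable_Re[OF i]])
  qed
  also have "\<dots> = Re (LINT u|lborel. indicator {0<..<v} u *\<^sub>R D u)" using i by (rule integral_Re)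
  also have "\<dots> = Re (\<gamma> v)" using int_D[of v] v eps by (simp add: set_lebesgue_integral_def)
  also have "\<dots> = norm (\<gamma> v)"
  proof -
    have p: "\<gamma> v = of_real (Re (\<gamma> v))" "0 < Re (\<gamma> v)" using pos[of v] v by auto
    have "norm (\<gamma> v) = norm (complex_of_real (Re (\<gamma> v)))" using p(1) by (rule arg_cong)
    then show ?thesis using p(2) by simp
  qed
  finally show ?thesis .
qed

lemma nn_integral_normD: "0 \<le> v \<Longrightarrow> v \<le> 1 \<Longrightarrow> (\<integral>\<^sup>+u. ennreal (indicator {0<..v} u * norm (D u)) \<partial>lborel) = ennreal (len v)"
proof -
  assume v: "0 \<le> v" "v \<le> 1"
  have "AE u in lborel. u \<noteq> v" by (rule AE_lborel_singleton)
  then have "(\<integral>\<^sup>+u. ennreal (indicator {0<..v} u * norm (D u)) \<partial>lborel) = (\<integral>\<^sup>+u. ennreal (indicator {0<..<v} u * norm (D u)) \<partial>lborel)"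
    by (intro nn_integral_cong_AE, elim eventually_mono) (auto simp: indicator_def)
  also have "\<dots> = ennreal (len v)"
    unfolding len_def set_lebesgue_integral_def
    using nn_integral_eq_integral[of lborel "\<lambda>u. indicator {0<..<v} u * norm (D u)"] normD_integrable[of 0 v] v
    by (simp add: set_integrable_def)
  finally show ?thesis .
qed

lemma \<gamma>_antimono_end:
  assumes "u0 < u" "u < 1" "u \<le> v" "v \<le> 1"
  shows "norm (\<gamma> v - \<omega>) \<le> norm (\<gamma> u - \<omega>)"
proof (cases "v = 1")
  case False
  have e: "norm (\<gamma> w - \<omega>) = Re (\<gamma> w - \<omega>)" if "u0 < w" "w < 1" for w
  proof -
    have p: "\<gamma> w - \<omega> = of_real (Re (\<gamma> w - \<omega>))" "0 < Re (\<gamma> w - \<omega>)" using endpos[of w] that by auto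
    have "norm (\<gamma> w - \<omega>) = norm (complex_of_real (Re (\<gamma> w - \<omega>)))" using p(1) by (rule arg_cong)
    then show ?thesis using p(2) by (simp only: norm_of_real)
  qed
  show ?thesis using e[of u] e[of v] anti1[of u v] assms False by auto
qed (simp add: \<gamma>1)

text \<open>The poles of \<open>1 / (e\<^sup>\<xi> - 1)\<close> at both ends of the path are compensated after weighting with the arc length
  \<open>len\<close>: near 0 because \<open>len u = |\<gamma> u|\<close>, near \<open>\<omega>\<close> because \<open>K(\<omega>, \<omega>) = 0\<close>. Hence the iterated
  absolute integrals converge.\<close>

lemma K_len_bound:
  obtains C where "C \<ge> 0" "\<And>u v. 0 < u \<Longrightarrow> u \<le> v \<Longrightarrow> v \<le> 1 \<Longrightarrow> u < 1 \<Longrightarrow> norm (K (\<gamma> u) (\<gamma> v)) * len u \<le> C * norm (exp (\<gamma> u) - 1)"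
proof -
  obtain B where "\<forall>x\<in>\<gamma> ` {0..1}. \<forall>z\<in>\<gamma> ` {0..1}. norm (K x z) \<le> B"
    using K_bounded[OF \<gamma>_image_compact \<gamma>_image_compact] by blast
  then have B: "norm (K (\<gamma> u) (\<gamma> v)) \<le> \<bar>B\<bar>" if "u \<in> {0..1}" "v \<in> {0..1}" for u v using that by force
  obtain C1 d where d: "d > 0" and C1: "\<And>x z. norm (x - \<omega>) < d \<Longrightarrow> norm (z - \<omega>) \<le> norm (x - \<omega>) \<Longrightarrow> norm (K x z) \<le> C1 * norm (x - \<omega>)"
    using K_lip by blast
  obtain t1 where t1: "u0 < t1" "t1 < 1" "\<And>u. u \<in> {t1..1} \<Longrightarrow> \<gamma> u - \<omega> \<in> ball 0 d"
    by (rule near_end[OF d zero_less_one]) blast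
  have "continuous_on {\<epsilon>/2..t1} (\<lambda>u. norm (1 / (exp (\<gamma> u) - 1)))"
  proof -
    have "exp (\<gamma> u) - 1 \<noteq> 0" if "u \<in> {\<epsilon>/2..t1}" for u using avoid[of u] that eps t1 by auto
    then show ?thesis using eps t1 by (intro continuous_intros \<gamma>_cont') auto
  qed
  then have "compact ((\<lambda>u. norm (1 / (exp (\<gamma> u) - 1))) ` {\<epsilon>/2..t1})" by (rule compact_continuous_image) simp
  then obtain m where "\<forall>y\<in>(\<lambda>u. norm (1 / (exp (\<gamma> u) - 1))) ` {\<epsilon>/2..t1}. norm y \<le> m"
    using compact_imp_bounded bounded_iff by blast
  then have m: "norm (1 / (exp (\<gamma> u) - 1)) \<le> m" if "u \<in> {\<epsilon>/2..t1}" for u using that by force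
  \<comment> \<open>One summand for each range of \<open>u\<close>: the initial piece, the compact
    middle part where 1 / (e^\<xi> - 1) is bounded by \<open>m\<close>, and the final piece.\<close>
  define C where "C = \<bar>B\<bar> + \<bar>B\<bar> * len 1 * \<bar>m\<bar> + \<bar>C1\<bar> * len 1"
  have C0: "0 \<le> \<bar>B\<bar>" "0 \<le> \<bar>B\<bar> * len 1 * \<bar>m\<bar>" "0 \<le> \<bar>C1\<bar> * len 1" using len_nonneg by auto
  show ?thesis
  proof (rule that[of C])
    show "C \<ge> 0" using C0 by (simp add: C_def)
    fix u v :: real assume uv: "0 < u" "u \<le> v" "v \<le> 1" "u < 1"
    have e0: "norm (exp (\<gamma> u) - 1) > 0" using avoid[of u] uv by auto
    have l1: "len u \<le> len 1" using uv by (intro len_mono) auto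
    consider "u < \<epsilon>" | "u \<in> {\<epsilon>/2..t1}" | "u > t1" using eps uv by fastforce
    then show "norm (K (\<gamma> u) (\<gamma> v)) * len u \<le> C * norm (exp (\<gamma> u) - 1)"
    proof cases
      case 1
      have p: "\<gamma> u = of_real (Re (\<gamma> u))" "0 < Re (\<gamma> u)" using pos[of u] uv 1 by auto
      have "norm (\<gamma> u) = norm (complex_of_real (Re (\<gamma> u)))" using p(1) by (rule arg_cong)
      then have "norm (\<gamma> u) \<le> norm (exp (\<gamma> u) - 1)" using norm_exp_real_minus_1_ge[of "Re (\<gamma> u)"] p by (metis abs_of_pos less_imp_le norm_of_real)
      then have "norm (K (\<gamma> u) (\<gamma> v)) * len u \<le> \<bar>B\<bar> * norm (exp (\<gamma> u) - 1)"
        using uv 1 by (intro mult_mono B) (auto simp: len_near_0)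
      also have "\<dots> \<le> C * norm (exp (\<gamma> u) - 1)" using C0 by (intro mult_right_mono) (auto simp: C_def)
      finally show ?thesis .
    next
      case 2
      have "0 \<le> m" by (rule order_trans[OF norm_ge_zero m[OF 2]])
      then have "1 \<le> \<bar>m\<bar> * norm (exp (\<gamma> u) - 1)" using m[OF 2] e0 by (simp add: norm_divide field_simps abs_if split: if_splits)
      then have "\<bar>B\<bar> * len 1 * 1 \<le> \<bar>B\<bar> * len 1 * (\<bar>m\<bar> * norm (exp (\<gamma> u) - 1))" using len_nonneg by (intro mult_left_mono) auto
      moreover have "norm (K (\<gamma> u) (\<gamma> v)) * len u \<le> \<bar>B\<bar> * len 1" using uv l1 len_nonneg by (intro mult_mono B) auto
      moreover have "\<bar>B\<bar> * len 1 * \<bar>m\<bar> * norm (exp (\<gamma> u) - 1) \<le> C * norm (exp (\<gamma> u) - 1)" using C0 by (intro mult_right_mono) (auto simp: C_def)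
      ultimately show ?thesis by (simp add: mult.assoc)
    next
      case 3
      have p: "\<gamma> u - \<omega> = of_real (Re (\<gamma> u - \<omega>))" "0 < Re (\<gamma> u - \<omega>)" using endpos[of u] 3 t1 uv by auto
      have ex: "exp (\<gamma> u) = exp (\<gamma> u - \<omega>)" using exp_shift[of "\<gamma> u - \<omega>"] by simp
      have "norm (\<gamma> u - \<omega>) = norm (complex_of_real (Re (\<gamma> u - \<omega>)))" using p(1) by (rule arg_cong)
      then have ge: "norm (\<gamma> u - \<omega>) \<le> norm (exp (\<gamma> u) - 1)"
        unfolding ex using norm_exp_real_minus_1_ge[of "Re (\<gamma> u - \<omega>)"] p by (metis abs_of_pos less_imp_le norm_of_real)
      \<comment> \<open>Later points of the last segment are closer to \<omega>, so the Lipschitz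
        bound at (\<omega>, \<omega>) can be stated in terms of the earlier point alone.\<close>
      have "norm (K (\<gamma> u) (\<gamma> v)) \<le> C1 * norm (\<gamma> u - \<omega>)"
        by (rule C1) (use t1(3)[of u] 3 uv \<gamma>_antimono_end[of u v] t1 in auto)
      also have "\<dots> \<le> \<bar>C1\<bar> * norm (exp (\<gamma> u) - 1)" using ge by (intro mult_mono) auto
      finally have "norm (K (\<gamma> u) (\<gamma> v)) * len u \<le> \<bar>C1\<bar> * norm (exp (\<gamma> u) - 1) * len 1"
        using l1 len_nonneg by (intro mult_mono) auto
      also have "\<dots> = \<bar>C1\<bar> * len 1 * norm (exp (\<gamma> u) - 1)" by simp
      also have "\<dots> \<le> C * norm (exp (\<gamma> u) - 1)" using C0 by (intro mult_right_mono) (auto simp: C_def)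
      finally show ?thesis .
    qed
  qed
qed

lemma Bh_cont: "continuous_on {0<..1} (\<lambda>u. Bh u (\<gamma> u))"
  by (rule germ_family_continuous_on[OF Bh], rule \<gamma>_cont') auto

text \<open>Near 0 the length equals the distance to 0, of which \<open>Bh\<close> is a bounded
  multiple; elsewhere a bound for \<open>Bh\<close> is compared with the positive length of the
  initial piece.\<close>

lemma Bh_len_bound:
  obtains C where "C \<ge> 0" "\<And>u. u \<in> {0<..<1} \<Longrightarrow> norm (Bh u (\<gamma> u)) \<le> C * len u"
proof -
  obtain C1 where C1: "\<And>t. t \<in> {0<..<\<epsilon>} \<Longrightarrow> norm (Bh t (\<gamma> t)) \<le> C1 * norm (\<gamma> t)" using Bh_small by blast
  have "compact ((\<lambda>u. Bh u (\<gamma> u)) ` {\<epsilon>/2..1})"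
    by (rule compact_continuous_image[OF continuous_on_subset[OF Bh_cont]]) (use eps in auto)
  then obtain C2 where C2: "\<And>u. u \<in> {\<epsilon>/2..1} \<Longrightarrow> norm (Bh u (\<gamma> u)) \<le> C2"
    by (metis (no_types, lifting) bounded_iff compact_imp_bounded imageI)
  have l: "len (\<epsilon>/2) > 0" using len_near_0[of "\<epsilon>/2"] pos[of "\<epsilon>/2"] eps by auto
  define C where "C = \<bar>C1\<bar> + \<bar>C2\<bar> / len (\<epsilon>/2)"
  show ?thesis
  proof (rule that[of C])
    show "C \<ge> 0" using l by (simp add: C_def)
    fix u :: real assume u: "u \<in> {0<..<1}"
    show "norm (Bh u (\<gamma> u)) \<le> C * len u"
    proof (cases "u < \<epsilon>")
      case True
      have "norm (Bh u (\<gamma> u)) \<le> C1 * norm (\<gamma> u)" using C1 u True by auto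
      also have "\<dots> \<le> C * len u"
      proof -
        have "0 \<le> \<bar>C2\<bar> / len (\<epsilon>/2)" using l by simp
        then have "C1 \<le> C" unfolding C_def by linarith
        then show ?thesis using len_near_0[of u] u True by (auto intro!: mult_right_mono)
      qed
      finally show ?thesis .
    next
      case False
      have "len (\<epsilon>/2) \<le> len u" using False u eps by (intro len_mono) auto
      then have "\<bar>C2\<bar> / len (\<epsilon>/2) * len (\<epsilon>/2) \<le> C * len u" using l by (intro mult_mono) (auto simp: C_def)
      moreover have "norm (Bh u (\<gamma> u)) \<le> \<bar>C2\<bar>" using C2[of u] False u eps by auto
      ultimately show ?thesis using l by simp
    qed
  qed
qed

text \<open>The pulled-back form is distributed over a chain: \<open>ca\<close> takes the factors of
  the first variable, \<open>cL\<close> the kernel between neighbours with the derivative and the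
  denominator of the later one, and \<open>cH\<close> the final kernel at \<omega>.\<close>

definition ca :: "real \<Rightarrow> complex" where
  "ca u = indicator {0<..<1} u *\<^sub>R (Bh u (\<gamma> u) / (exp (\<gamma> u) - 1) * D u)"

definition cL :: "real \<Rightarrow> real \<Rightarrow> complex" where
  "cL u v = (indicator {0<..v} u * indicator {0<..<1} v) *\<^sub>R (K (\<gamma> u) (\<gamma> v) * D v / (exp (\<gamma> v) - 1))"

definition cH :: "real \<Rightarrow> complex" where
  "cH u = indicator {0<..<1} u *\<^sub>R K (\<gamma> u) \<omega>"

lemma D_meas: "(\<lambda>u. indicator {0<..<1} u *\<^sub>R D u) \<in> borel_measurable borel"
  by (rule bdd_pc1_vector_derivative[OF pc1]) blast

lemma ind_meas: "continuous_on {0<..<1} f \<Longrightarrow> (\<lambda>u. indicator {0<..<1} u *\<^sub>R f u) \<in> borel_measurable borel" for f :: "real \<Rightarrow> complex"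
  by (rule borel_measurable_continuous_on_indicator) auto

lemma inv_meas: "(\<lambda>u. indicator {0<..<1} u *\<^sub>R (1 / (exp (\<gamma> u) - 1))) \<in> borel_measurable borel"
proof (rule ind_meas)
  have "exp (\<gamma> u) - 1 \<noteq> 0" if "u \<in> {0<..<1}" for u using avoid[OF that] by simp
  then show "continuous_on {0<..<1} (\<lambda>u. 1 / (exp (\<gamma> u) - 1))" by (intro continuous_intros \<gamma>_cont') auto
qed

lemma cH_meas: "cH \<in> borel_measurable borel"
  unfolding cH_def[abs_def] by (rule ind_meas) (auto intro!: K_cont \<gamma>_cont' continuous_intros)

sublocale C: simplex_chain ca cL
proof
  have b: "(\<lambda>u. indicator {0<..<1} u *\<^sub>R Bh u (\<gamma> u)) \<in> borel_measurable borel"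
    by (rule ind_meas[OF continuous_on_subset[OF Bh_cont]]) auto
  have "ca = (\<lambda>u. (indicator {0<..<1} u *\<^sub>R Bh u (\<gamma> u)) * (indicator {0<..<1} u *\<^sub>R (1 / (exp (\<gamma> u) - 1))) * (indicator {0<..<1} u *\<^sub>R D u))"
    by (auto simp: ca_def fun_eq_iff indicator_def)
  moreover have "\<dots> \<in> borel_measurable borel" by (intro borel_measurable_times b inv_meas D_meas)
  ultimately show "ca \<in> borel_measurable borel" by (simp only:)
  have [measurable]: "(\<lambda>p. indicator ({0..1} \<times> {0..1}) p *\<^sub>R K (\<gamma> (fst p)) (\<gamma> (snd p))) \<in> borel_measurable (borel \<Otimes>\<^sub>M borel)"
    unfolding borel_prod
  proof (rule borel_measurable_continuous_on_indicator)
    have "continuous_on ({0..1} \<times> {0..1}) (\<lambda>p. \<gamma> (fst p))" "continuous_on ({0..1} \<times> {0..1}) (\<lambda>p. \<gamma> (snd p))"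
      by (rule continuous_on_compose2[OF \<gamma>_cont]; auto intro!: continuous_intros)+
    then show "continuous_on ({0..1} \<times> {0..1}) (\<lambda>p. K (\<gamma> (fst p)) (\<gamma> (snd p)))" by (rule K_cont)
  qed (auto intro!: borel_closed closed_Times)
  note [measurable] = inv_meas D_meas
  have "(\<lambda>(u, v). cL u v) = (\<lambda>p. (if 0 < fst p \<and> fst p \<le> snd p then 1 else 0) * (indicator ({0..1} \<times> {0..1}) p *\<^sub>R K (\<gamma> (fst p)) (\<gamma> (snd p))) *
     ((indicator {0<..<1} (snd p) *\<^sub>R (1 / (exp (\<gamma> (snd p)) - 1))) * (indicator {0<..<1} (snd p) *\<^sub>R D (snd p))))"
    by (auto simp: cL_def fun_eq_iff indicator_def)
  also have "\<dots> \<in> borel_measurable (borel \<Otimes>\<^sub>M borel)"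
    using measurable_compose[OF measurable_snd inv_meas] measurable_compose[OF measurable_snd D_meas] by measurable
  finally show "(\<lambda>(u, v). cL u v) \<in> borel_measurable (borel \<Otimes>\<^sub>M borel)" .
qed

lemma J_val: "v \<in> {0<..<1} \<Longrightarrow> C.J k v = Fs k v (\<gamma> v) * D v"
proof (induction k arbitrary: v)
  case 0
  have "C.J 0 v = ca v" by (simp only: C.J.simps)
  also have "\<dots> = F0 v (\<gamma> v) * D v" using 0 by (simp add: ca_def F0_eq)
  finally show ?case by (simp only: Fs.simps)
next
  case (Suc k)
  have "C.J (Suc k) v = (LINT u|lborel. C.J k u * cL u v)" by simp
  also have "\<dots> = (LINT u|lborel. (indicator {0<..<v} u *\<^sub>R (K (\<gamma> u) (\<gamma> v) * (Fs k u (\<gamma> u) * D u))) * (D v / (exp (\<gamma> v) - 1)))"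
  proof (rule integral_cong_AE)
    show "(\<lambda>u. C.J k u * cL u v) \<in> borel_measurable lborel" by measurable
    show "(\<lambda>u. (indicator {0<..<v} u *\<^sub>R (K (\<gamma> u) (\<gamma> v) * (Fs k u (\<gamma> u) * D u))) * (D v / (exp (\<gamma> v) - 1))) \<in> borel_measurable lborel"
      using good_K_integrable[OF Fs_good[of k], of 0 v "\<gamma> v"] Suc.prems unfolding set_integrable_def by (intro borel_measurable_times) auto
    have "AE u in lborel. u \<noteq> v" by (rule AE_lborel_singleton)
    then show "AE u in lborel. C.J k u * cL u v = (indicator {0<..<v} u *\<^sub>R (K (\<gamma> u) (\<gamma> v) * (Fs k u (\<gamma> u) * D u))) * (D v / (exp (\<gamma> v) - 1))"
    proof eventually_elim
      case (elim u)
      show ?case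
      proof (cases "0 < u \<and> u < v")
        case True
        then have 1: "C.J k u = Fs k u (\<gamma> u) * D u" using Suc.prems by (intro Suc.IH) auto
        have 2: "cL u v = K (\<gamma> u) (\<gamma> v) * (D v / (exp (\<gamma> v) - 1))" using True Suc.prems by (simp add: cL_def)
        have 3: "indicator {0<..<v} u = (1::real)" using True by simp
        show ?thesis unfolding 1 2 3 by (simp only: scaleR_one mult_ac)
      next
        case False
        then have 2: "cL u v = 0" and 3: "indicator {0<..<v} u = (0::real)" using elim by (auto simp: cL_def)
        show ?thesis unfolding 2 3 by (simp only: scaleR_zero_left mult_zero_left mult_zero_right)
      qed
    qed
  qed
  also have "\<dots> = Cint (Fs k) v (\<gamma> v) * (D v / (exp (\<gamma> v) - 1))"
    unfolding Cint_def set_lebesgue_integral_def by (rule integral_mult_left_zero)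
  finally show ?case by (simp add: Fs_Suc_val del: Fs.simps C.J.simps)
qed

text \<open>The bound reproduces itself: by \<open>K_len_bound\<close> the kernel times
  \<open>len u\<close> cancels the denominator at \<open>u\<close>, and the remaining integral of
  the absolute derivative up to \<open>v\<close> is again \<open>len v\<close>.\<close>

lemma JA_bound:
  "\<exists>B\<ge>0. \<forall>v\<in>{0<..<1}. C.JA k v \<le> ennreal (B * (norm (D v) * len v / norm (exp (\<gamma> v) - 1)))"
proof (induction k)
  case 0
  obtain B where B: "B \<ge> 0" "\<And>u. u \<in> {0<..<1} \<Longrightarrow> norm (Bh u (\<gamma> u)) \<le> B * len u" by (rule Bh_len_bound) blast
  have "C.JA 0 v \<le> ennreal (B * (norm (D v) * len v / norm (exp (\<gamma> v) - 1)))" if v: "v \<in> {0<..<1}" for v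
  proof -
    have "norm (ca v) = norm (Bh v (\<gamma> v)) * (norm (D v) / norm (exp (\<gamma> v) - 1))"
      using v by (simp add: ca_def norm_mult norm_divide)
    also have "\<dots> \<le> B * len v * (norm (D v) / norm (exp (\<gamma> v) - 1))" by (intro mult_right_mono B v) auto
    finally show ?thesis by (simp add: ennreal_leI mult_ac)
  qed
  then show ?case using B(1) by blast
next
  case (Suc k)
  then obtain B where B: "B \<ge> 0" "\<And>v. v \<in> {0<..<1} \<Longrightarrow> C.JA k v \<le> ennreal (B * (norm (D v) * len v / norm (exp (\<gamma> v) - 1)))" by blast
  obtain C where C: "C \<ge> 0" "\<And>u v. 0 < u \<Longrightarrow> u \<le> v \<Longrightarrow> v \<le> 1 \<Longrightarrow> u < 1 \<Longrightarrow> norm (K (\<gamma> u) (\<gamma> v)) * len u \<le> C * norm (exp (\<gamma> u) - 1)"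
    by (rule K_len_bound) blast
  have "C.JA (Suc k) v \<le> ennreal (B * C * (norm (D v) * len v / norm (exp (\<gamma> v) - 1)))" if v: "v \<in> {0<..<1}" for v
  proof -
    define w where "w = norm (D v) / norm (exp (\<gamma> v) - 1)"
    have w0: "w \<ge> 0" by (simp add: w_def)
    have "C.JA k u * ennreal (norm (cL u v)) \<le> ennreal (B * C * w) * ennreal (indicator {0<..v} u * norm (D u))" for u
    proof (cases "u \<in> {0<..v}")
      case True
      then have u: "u \<in> {0<..<1}" using v by auto
      have e0: "norm (exp (\<gamma> u) - 1) > 0" using avoid[OF u] by simp
      have "C.JA k u * ennreal (norm (cL u v)) \<le> ennreal (B * (norm (D u) * len u / norm (exp (\<gamma> u) - 1))) * ennreal (norm (K (\<gamma> u) (\<gamma> v)) * w)"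
        using True v by (intro mult_mono B(2) u) (auto simp: cL_def w_def norm_mult norm_divide)
      also have "\<dots> = ennreal (B * (norm (D u) * len u / norm (exp (\<gamma> u) - 1)) * (norm (K (\<gamma> u) (\<gamma> v)) * w))"
        using B(1) len_nonneg by (subst ennreal_mult) (auto simp: w0)
      also have "B * (norm (D u) * len u / norm (exp (\<gamma> u) - 1)) * (norm (K (\<gamma> u) (\<gamma> v)) * w) =
         B * w * norm (D u) * ((norm (K (\<gamma> u) (\<gamma> v)) * len u) / norm (exp (\<gamma> u) - 1))" by (simp add: mult_ac)
      also have "ennreal \<dots> \<le> ennreal (B * w * norm (D u) * C)"
        using C(2)[of u v] True v u e0 B(1) w0 by (intro ennreal_leI mult_left_mono) (auto simp: divide_le_eq)
      also have "\<dots> = ennreal (B * C * w) * ennreal (indicator {0<..v} u * norm (D u))"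
        using True B(1) C(1) w0 by (subst ennreal_mult[symmetric]) (auto simp: mult_ac)
      finally show ?thesis .
    qed (auto simp: cL_def)
    then have "C.JA (Suc k) v \<le> (\<integral>\<^sup>+u. ennreal (B * C * w) * ennreal (indicator {0<..v} u * norm (D u)) \<partial>lborel)"
      by (simp add: nn_integral_mono)
    also have "\<dots> = ennreal (B * C * w) * (\<integral>\<^sup>+u. ennreal (indicator {0<..v} u * norm (D u)) \<partial>lborel)"
    proof (rule nn_integral_cmult)
      have "(\<lambda>u. indicator {0<..v} u * norm (indicator {0<..<1} u *\<^sub>R D u)) \<in> borel_measurable borel" using D_meas by measurable
      also have "(\<lambda>u. indicator {0<..v} u * norm (indicator {0<..<1} u *\<^sub>R D u)) = (\<lambda>u. indicator {0<..v} u * norm (D u))"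
        using v by (auto simp: fun_eq_iff indicator_def)
      finally show "(\<lambda>u. ennreal (indicator {0<..v} u * norm (D u))) \<in> borel_measurable lborel" by simp
    qed
    also have "\<dots> = ennreal (B * C * w) * ennreal (len v)"
      by (subst nn_integral_normD) (use v in auto)
    also have "\<dots> = ennreal (B * C * w * len v)"
      using B(1) C(1) w0 len_nonneg by (subst ennreal_mult) auto
    also have "B * C * w * len v = B * C * (norm (D v) * len v / norm (exp (\<gamma> v) - 1))" by (simp add: w_def)
    finally show ?thesis .
  qed
  then show ?case using B(1) C(1) by (intro exI[of _ "B * C"]) auto
qed

text \<open>As \<omega> is the point \<gamma> 1, the case v = 1 of \<open>K_len_bound\<close>
  removes the last denominator, and the total length is finite.\<close>

lemma JA_finite: "(\<integral>\<^sup>+u. C.JA k u * ennreal (norm (cH u)) \<partial>lborel) < \<infinity>"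
proof -
  obtain B where B: "B \<ge> 0" "\<And>v. v \<in> {0<..<1} \<Longrightarrow> C.JA k v \<le> ennreal (B * (norm (D v) * len v / norm (exp (\<gamma> v) - 1)))"
    using JA_bound by blast
  obtain C where C: "C \<ge> 0" "\<And>u v. 0 < u \<Longrightarrow> u \<le> v \<Longrightarrow> v \<le> 1 \<Longrightarrow> u < 1 \<Longrightarrow> norm (K (\<gamma> u) (\<gamma> v)) * len u \<le> C * norm (exp (\<gamma> u) - 1)"
    by (rule K_len_bound) blast
  have "C.JA k u * ennreal (norm (cH u)) \<le> ennreal (B * C * (indicator {0<..<1} u * norm (D u)))" for u
  proof (cases "u \<in> {0<..<1}")
    case True
    have e0: "norm (exp (\<gamma> u) - 1) > 0" using avoid[OF True] by simp
    have "C.JA k u * ennreal (norm (cH u)) \<le> ennreal (B * (norm (D u) * len u / norm (exp (\<gamma> u) - 1))) * ennreal (norm (K (\<gamma> u) \<omega>))"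
      using True by (intro mult_mono B(2)) (auto simp: cH_def)
    also have "\<dots> = ennreal (B * (norm (D u) * len u / norm (exp (\<gamma> u) - 1)) * norm (K (\<gamma> u) \<omega>))"
      using B(1) len_nonneg by (subst ennreal_mult) auto
    also have "B * (norm (D u) * len u / norm (exp (\<gamma> u) - 1)) * norm (K (\<gamma> u) \<omega>) =
         B * norm (D u) * ((norm (K (\<gamma> u) (\<gamma> 1)) * len u) / norm (exp (\<gamma> u) - 1))" by (simp add: mult_ac \<gamma>1)
    also have "ennreal \<dots> \<le> ennreal (B * norm (D u) * C)"
      using C(2)[of u 1] True e0 B(1) by (intro ennreal_leI mult_left_mono) (auto simp: divide_le_eq)
    finally show ?thesis using True by (simp add: mult_ac)
  qed (auto simp: cH_def)
  then have "(\<integral>\<^sup>+u. C.JA k u * ennreal (norm (cH u)) \<partial>lborel) \<le> (\<integral>\<^sup>+u. ennreal (B * C * (indicator {0<..<1} u * norm (D u))) \<partial>lborel)"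
    by (rule nn_integral_mono)
  also have "\<dots> < \<infinity>"
  proof -
    have "integrable lborel (\<lambda>u. B * C * (indicator {0<..<1} u * norm (D u)))"
      using normD_integrable[of 0 1] by (intro integrable_mult_right) (simp add: set_integrable_def)
    then have "(\<integral>\<^sup>+u. ennreal (norm (B * C * (indicator {0<..<1} u * norm (D u)))) \<partial>lborel) < \<infinity>"
      by (simp only: integrable_iff_bounded)
    then show ?thesis using B(1) C(1) by simp
  qed
  finally show ?thesis .
qed

lemma J_cH: "C.J k u * cH u = indicator {0<..<1} u *\<^sub>R (K (\<gamma> u) \<omega> * (Fs k u (\<gamma> u) * D u))"
  by (auto simp: cH_def J_val indicator_def)

lemma Fs_end_integrable: "set_integrable lborel {0<..<1} (\<lambda>u. K (\<gamma> u) \<omega> * (Fs k u (\<gamma> u) * D u))"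
  unfolding set_integrable_def J_cH[symmetric]
proof (rule integrableI_bounded)
  show "(\<lambda>u. C.J k u * cH u) \<in> borel_measurable lborel" using cH_meas by measurable
  have "(\<integral>\<^sup>+u. ennreal (norm (C.J k u * cH u)) \<partial>lborel) \<le> (\<integral>\<^sup>+u. C.JA k u * ennreal (norm (cH u)) \<partial>lborel)"
    by (intro nn_integral_mono) (simp add: norm_mult ennreal_mult' mult_right_mono C.norm_J_le)
  then show "(\<integral>\<^sup>+u. ennreal (norm (C.J k u * cH u)) \<partial>lborel) < \<infinity>" using JA_finite by (rule le_less_trans)
qed

text \<open>The first iterate has no logarithm: it is a germ holomorphic at \<omega> divided by a
  simple zero, with residue \<open>Bh 1 \<omega>\<close>. All others follow from
  \<open>lform_nxt\<close>.\<close>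

lemma Fs_lform:
  "\<exists>r A R. 0 < r \<and> r \<le> 1 \<and> lform (Fs k) r A R \<and>
     R 0 = (if k = 0 then Bh 1 \<omega> else set_lebesgue_integral lborel {0<..<1} (\<lambda>u. K (\<gamma> u) \<omega> * (Fs (k - 1) u (\<gamma> u) * D u)))"
proof (induction k)
  case 0
  have "Bh 1 analytic_on {\<omega>}" using Bh \<gamma>1 unfolding germ_family_def by auto
  then obtain r0 where r0: "r0 > 0" "Bh 1 holomorphic_on ball \<omega> r0" unfolding analytic_on_def by blast
  define r where "r = min r0 1"
  have r: "0 < r" "r \<le> 1" using r0 by (auto simp: r_def)
  obtain d where d: "d > 0" "\<And>s. s \<in> {0<..1} \<Longrightarrow> dist s 1 < d \<Longrightarrow> \<forall>\<^sub>F z in nhds (\<gamma> s). Bh s z = Bh 1 z"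
    by (rule germ_familyD[OF Bh, of 1]) auto
  have nz: "e1 x \<noteq> 0" if "x \<in> ball 0 r" for x using that r pi_gt3 by (intro e1_nz) auto
  define R where "R = (\<lambda>x. Bh 1 (\<omega> + x) / e1 x)"
  have "(\<lambda>x. \<omega> + x) holomorphic_on ball 0 r" by (intro holomorphic_intros)
  moreover have "(\<lambda>x. \<omega> + x) ` ball 0 r \<subseteq> ball \<omega> r0" by (rule image_subsetI) (simp add: r_def dist_norm)
  ultimately have "(\<lambda>x. Bh 1 (\<omega> + x)) holomorphic_on ball 0 r"
    using holomorphic_on_compose_gen[of "\<lambda>x. \<omega> + x" "ball 0 r" "Bh 1" "ball \<omega> r0"] r0(2) by (simp add: o_def)
  then have Rh: "R holomorphic_on ball 0 r" unfolding R_def using nz by (intro holomorphic_intros e1_hol) auto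
  have "lform (Fs 0) r (\<lambda>_. 0) R"
    unfolding lform_def
  proof (intro conjI Rh exI[of _ "max u0 (1 - d)"] ballI)
    show "max u0 (1 - d) < 1" using u0 d by auto
    fix u assume u: "u \<in> {max u0 (1 - d)<..<1}"
    have "\<forall>\<^sub>F z in nhds (\<gamma> u). Bh u z = Bh 1 z" using u u0 by (intro d(2)) (auto simp: dist_real_def)
    moreover have "\<gamma> u \<noteq> \<omega>" using endpos[of u] u by auto
    then have "\<forall>\<^sub>F z in nhds (\<gamma> u). z \<noteq> \<omega>" by (rule t1_space_nhds)
    ultimately show "\<forall>\<^sub>F z in nhds (\<gamma> u). Fs 0 u z = 0 * Ln (z - \<omega>) + R (z - \<omega>) / (z - \<omega>)"
    proof eventually_elim
      case (elim z)
      have "exp z - 1 = (z - \<omega>) * e1 (z - \<omega>)" using exp_shift[of "z - \<omega>"] by (simp add: e1_mult)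
      moreover have F: "F0 u z = Bh u z / (exp z - 1)" by (simp add: F0_eq)
      ultimately show ?case using elim unfolding Fs.simps(1) F by (simp add: R_def)
    qed
  qed auto
  then show ?case using r by (intro exI[of _ r] exI[of _ "\<lambda>_. 0"] exI[of _ R]) (simp add: R_def e1_0)
next
  case (Suc k)
  then obtain r A R where r: "0 < r" "r \<le> 1" and lf: "lform (Fs k) r A R" by blast
  obtain A' R' where "lform (nxt (Fs k)) r A' R'" "R' 0 = set_lebesgue_integral lborel {0<..<1} (\<lambda>u. K (\<gamma> u) \<omega> * (Fs k u (\<gamma> u) * D u))"
    by (rule lform_nxt[OF Fs_good lf r Fs_end_integrable])
  then show ?case using r by (intro exI[of _ r] exI[of _ A'] exI[of _ R']) simp
qed

text \<open>The two integrands agree pointwise, although the simplex admits the parameter 1 and the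
  chain does not: there the denominator is 0 and the quotient is 0 by the convention for
  division.\<close>

lemma Psi_param_simplex:
  assumes s: "s \<in> space (PiM {1..Suc k} (\<lambda>_. lborel))"
  shows "indicator (param_simplex (Suc k)) s *\<^sub>R pullback_form \<gamma> (Suc k)
     (\<lambda>s. Bh (s 1) (\<gamma> (s 1)) * ((\<Prod>i\<in>{1..<Suc k}. K (\<gamma> (s i)) (\<gamma> (s (Suc i)))) * K (\<gamma> (s (Suc k))) \<omega>) / (\<Prod>i\<in>{1..Suc k}. exp (\<gamma> (s i)) - 1)) s
     = C.Psi k s * cH (s (Suc k))"
proof -
  have ext: "s \<in> extensional {1..Suc k}" using s by (simp add: space_PiM PiE_def)
  define ok where "ok \<longleftrightarrow> (\<forall>i\<in>{1..Suc k}. 0 < s i \<and> s i < 1) \<and> (\<forall>i\<in>{1..k}. s i \<le> s (Suc i))"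
  show ?thesis
  proof (cases ok)
    case True
    then have i01: "\<And>i. i \<in> {1..Suc k} \<Longrightarrow> 0 < s i \<and> s i < 1" and le: "\<And>i. i \<in> {1..k} \<Longrightarrow> s i \<le> s (Suc i)" by (auto simp: ok_def)
    have ps: "s \<in> param_simplex (Suc k)"
      using i01 le ext by (force simp: param_simplex_def PiE_def Pi_def)
    have 1: "ca (s 1) = Bh (s 1) (\<gamma> (s 1)) * (D (s 1) / (exp (\<gamma> (s 1)) - 1))"
      using i01[of 1] by (simp add: ca_def)
    have 2: "(\<Prod>i\<in>{1..k}. cL (s i) (s (Suc i))) = (\<Prod>i\<in>{1..k}. K (\<gamma> (s i)) (\<gamma> (s (Suc i)))) * (\<Prod>i\<in>{1..k}. D (s (Suc i)) / (exp (\<gamma> (s (Suc i))) - 1))"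
      unfolding prod.distrib[symmetric]
    proof (intro prod.cong refl)
      fix i assume i: "i \<in> {1..k}"
      then show "cL (s i) (s (Suc i)) = K (\<gamma> (s i)) (\<gamma> (s (Suc i))) * (D (s (Suc i)) / (exp (\<gamma> (s (Suc i))) - 1))"
        using i01[of i] i01[of "Suc i"] le[OF i] by (simp add: cL_def)
    qed
    have 3: "cH (s (Suc k)) = K (\<gamma> (s (Suc k))) \<omega>" using i01[of "Suc k"] by (simp add: cH_def)
    have 4: "(\<Prod>i\<in>{1..Suc k}. D (s i)) / (\<Prod>i\<in>{1..Suc k}. exp (\<gamma> (s i)) - 1) = (D (s 1) / (exp (\<gamma> (s 1)) - 1)) * (\<Prod>i\<in>{1..k}. D (s (Suc i)) / (exp (\<gamma> (s (Suc i))) - 1))"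
      unfolding prod_dividef[symmetric] by (rule prod_1_Suc)
    have iv: "{1..<Suc k} = {1..k}" by auto
    have "indicator (param_simplex (Suc k)) s *\<^sub>R pullback_form \<gamma> (Suc k)
     (\<lambda>s. Bh (s 1) (\<gamma> (s 1)) * ((\<Prod>i\<in>{1..<Suc k}. K (\<gamma> (s i)) (\<gamma> (s (Suc i)))) * K (\<gamma> (s (Suc k))) \<omega>) / (\<Prod>i\<in>{1..Suc k}. exp (\<gamma> (s i)) - 1)) s
     = Bh (s 1) (\<gamma> (s 1)) * ((\<Prod>i\<in>{1..k}. K (\<gamma> (s i)) (\<gamma> (s (Suc i)))) * K (\<gamma> (s (Suc k))) \<omega>) *
        ((\<Prod>i\<in>{1..Suc k}. D (s i)) / (\<Prod>i\<in>{1..Suc k}. exp (\<gamma> (s i)) - 1))"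
      using ps unfolding pullback_form_def iv by (simp del: prod.cl_ivl_Suc)
    also have "\<dots> = C.Psi k s * cH (s (Suc k))"
      unfolding 4 C.Psi_def 1 2 3 by (simp only: mult_ac)
    finally show ?thesis .
  next
    case False
    have "C.Psi k s * cH (s (Suc k)) = 0"
    proof (rule ccontr)
      assume nz: "C.Psi k s * cH (s (Suc k)) \<noteq> 0"
      then have "ca (s 1) \<noteq> 0" "\<And>i. i \<in> {1..k} \<Longrightarrow> cL (s i) (s (Suc i)) \<noteq> 0" by (auto simp: C.Psi_def)
      then have a: "s 1 \<in> {0<..<1}" and L: "\<And>i. i \<in> {1..k} \<Longrightarrow> s i \<le> s (Suc i) \<and> s (Suc i) \<in> {0<..<1}"
        by (auto simp: ca_def cL_def indicator_def split: if_splits)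
      have "s i \<in> {0<..<1}" if i: "i \<in> {1..Suc k}" for i
      proof (cases "i = 1")
        case False
        then obtain j where "i = Suc j" "j \<in> {1..k}" using i by (cases i) auto
        then show ?thesis using L by blast
      qed (use a in simp)
      then have ok using L by (auto simp: ok_def)
      then show False using False by simp
    qed
    moreover have "indicator (param_simplex (Suc k)) s *\<^sub>R pullback_form \<gamma> (Suc k)
     (\<lambda>s. Bh (s 1) (\<gamma> (s 1)) * ((\<Prod>i\<in>{1..<Suc k}. K (\<gamma> (s i)) (\<gamma> (s (Suc i)))) * K (\<gamma> (s (Suc k))) \<omega>) / (\<Prod>i\<in>{1..Suc k}. exp (\<gamma> (s i)) - 1)) s = 0"
    proof (cases "s \<in> param_simplex (Suc k)")
      case True
      then have p: "\<And>i. i \<in> {1..Suc k} \<Longrightarrow> 0 < s i \<and> s i \<le> 1" "\<And>i. i \<in> {1..k} \<Longrightarrow> s i \<le> s (Suc i)"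
        by (auto simp: param_simplex_def PiE_def Pi_def)
      have "\<not> (\<forall>i\<in>{1..Suc k}. 0 < s i \<and> s i < 1)" using False p(2) unfolding ok_def by blast
      then obtain i where i': "i \<in> {1..Suc k}" "\<not> (0 < s i \<and> s i < 1)" by blast
      then have i: "i \<in> {1..Suc k}" "s i = 1" using p(1)[of i] by auto
      have "(\<Prod>i\<in>{1..Suc k}. exp (\<gamma> (s i)) - 1) = 0"
        using i \<gamma>1 \<omega>1 by (intro prod_zero) (auto intro!: bexI[of _ i])
      then show ?thesis by (simp add: pullback_form_def del: prod.cl_ivl_Suc)
    qed simp
    ultimately show ?thesis by (simp only:)
  qed
qed

lemma simplex_integral:
  assumes G: "\<And>s. s \<in> param_simplex (Suc k) \<Longrightarrow> G s = Bh (s 1) (\<gamma> (s 1)) * ((\<Prod>i\<in>{1..<Suc k}. K (\<gamma> (s i)) (\<gamma> (s (Suc i)))) * K (\<gamma> (s (Suc k))) \<omega>) / (\<Prod>i\<in>{1..Suc k}. exp (\<gamma> (s i)) - 1)"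
  shows "simplex_form_integrable \<gamma> (Suc k) G"
    and "simplex_form_integral \<gamma> (Suc k) G = set_lebesgue_integral lborel {0<..<1} (\<lambda>u. K (\<gamma> u) \<omega> * (Fs k u (\<gamma> u) * D u))"
proof -
  have eq: "indicator (param_simplex (Suc k)) s *\<^sub>R pullback_form \<gamma> (Suc k) G s = C.Psi k s * cH (s (Suc k))"
    if s: "s \<in> space (PiM {1..Suc k} (\<lambda>_. lborel))" for s
    unfolding Psi_param_simplex[OF s, symmetric] pullback_form_def
    by (cases "s \<in> param_simplex (Suc k)") (auto simp: G)
  show "simplex_form_integrable \<gamma> (Suc k) G"
    unfolding simplex_form_integrable_def set_integrable_def
    using C.Psi_integral(1)[OF cH_meas JA_finite] by (subst Bochner_Integration.integrable_cong[OF refl eq]) auto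
  have "simplex_form_integral \<gamma> (Suc k) G = (LINT u|lborel. C.J k u * cH u)"
    unfolding simplex_form_integral_def set_lebesgue_integral_def
    using C.Psi_integral(2)[OF cH_meas JA_finite] by (subst Bochner_Integration.integral_cong[OF refl eq]) auto
  then show "simplex_form_integral \<gamma> (Suc k) G = set_lebesgue_integral lborel {0<..<1} (\<lambda>u. K (\<gamma> u) \<omega> * (Fs k u (\<gamma> u) * D u))"
    by (simp add: J_cH set_lebesgue_integral_def)
qed

end

section \<open>Uniqueness of the singular part\<close>

lemma eval_fps_tendsto_at_right:
  fixes F :: "complex fps"
  assumes "fps_conv_radius F > 0"
  shows "((\<lambda>x. eval_fps F (of_real x)) \<longlongrightarrow> fps_nth F 0) (at_right 0)"
proof -
  have fl: "filterlim complex_of_real (at 0) (at_right 0)"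
    unfolding filterlim_at by (auto intro!: tendsto_eq_intros simp: eventually_at_filter)
  have "(eval_fps F has_field_derivative eval_fps (fps_deriv F) 0) (at 0)"
    by (rule has_field_derivative_eval_fps) (use assms in \<open>simp add: zero_ereal_def\<close>)
  then have "isCont (eval_fps F) 0" by (rule DERIV_isCont)
  then have "(eval_fps F \<longlongrightarrow> fps_nth F 0) (at 0)" by (simp add: isCont_def eval_fps_at_0)
  from filterlim_compose[OF this fl] show ?thesis .
qed

lemma x_ln_x_tendsto: "((\<lambda>x. complex_of_real (x * ln x)) \<longlongrightarrow> 0) (at_right 0)"
proof -
  have "((\<lambda>x::real. x * ln x) \<longlongrightarrow> 0) (at_right 0)" by real_asymp
  then show ?thesis using tendsto_of_real[of "\<lambda>x. x * ln x" 0 "at_right 0", where 'a=complex] by simp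
qed

text \<open>Compare orders of vanishing at 0. If R vanishes at least to the order of \<psi>,
  dividing gives ln x a finite limit; if to a smaller order, its leading coefficient is a limit
  containing the factor x ln x, hence 0.\<close>

lemma log_expansion_unique:
  fixes \<psi> R :: "complex fps"
  assumes \<psi>: "fps_conv_radius \<psi> > 0" and R: "fps_conv_radius R > 0"
    and eq: "\<forall>\<^sub>F x in at_right 0. eval_fps \<psi> (of_real x) * of_real (ln x) = eval_fps R (of_real x)"
  shows "\<psi> = 0"
proof (rule ccontr)
  assume nz: "\<psi> \<noteq> 0"
  define n where "n = subdegree \<psi>"
  define \<psi>1 where "\<psi>1 = fps_shift n \<psi>"
  have \<psi>1: "\<psi> = fps_X ^ n * \<psi>1" "fps_nth \<psi>1 0 \<noteq> 0" "fps_conv_radius \<psi>1 > 0"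
    using nz \<psi> subdegree_decompose[of \<psi>] by (auto simp: \<psi>1_def n_def mult.commute)
  have small: "\<forall>\<^sub>F x in at_right (0::real). ereal (norm (complex_of_real x)) < fps_conv_radius F" if F: "fps_conv_radius F > 0" for F :: "complex fps"
  proof -
    obtain e where e: "0 < ereal e" "ereal e < fps_conv_radius F" using F ereal_dense2 by blast
    have "\<forall>\<^sub>F x in at_right (0::real). x \<in> {0<..<e}" by (rule eventually_at_right_real) (use e in simp)
    then show ?thesis by eventually_elim (use e(2) in \<open>auto intro: less_trans simp: le_less_trans[OF _ e(2)]\<close>)
  qed
  have pos: "\<forall>\<^sub>F x in at_right (0::real). x > 0" by (rule eventually_at_right_less)
  have l\<psi>: "((\<lambda>x. eval_fps \<psi>1 (of_real x)) \<longlongrightarrow> fps_nth \<psi>1 0) (at_right 0)"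
    by (rule eval_fps_tendsto_at_right[OF \<psi>1(3)])
  have ev: "\<forall>\<^sub>F x in at_right 0. complex_of_real x ^ n * eval_fps \<psi>1 (of_real x) * of_real (ln x) = eval_fps R (of_real x)"
    using eq small[OF \<psi>1(3)]
    by eventually_elim (simp add: \<psi>1(1) eval_fps_mult)
  show False
  proof (cases "\<forall>i<n. fps_nth R i = 0")
    case True
    define R1 where "R1 = fps_shift n R"
    have R1: "R = fps_X ^ n * R1"
      using True by (auto simp: R1_def fps_eq_iff fps_X_power_mult_nth)
    have R1c: "fps_conv_radius R1 > 0" using R by (simp add: R1_def)
    have "\<forall>\<^sub>F x in at_right 0. eval_fps \<psi>1 (of_real x) * of_real (ln x) = eval_fps R1 (of_real x)"
      using ev small[OF R1c] pos
      by eventually_elim (simp add: R1 eval_fps_mult)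
    moreover have "((\<lambda>x. eval_fps R1 (of_real x)) \<longlongrightarrow> fps_nth R1 0) (at_right 0)"
      by (rule eval_fps_tendsto_at_right[OF R1c])
    ultimately have "((\<lambda>x. eval_fps \<psi>1 (of_real x) * of_real (ln x)) \<longlongrightarrow> fps_nth R1 0) (at_right 0)"
      by (subst tendsto_cong) auto
    from tendsto_divide[OF this l\<psi> \<psi>1(2)]
    have l: "((\<lambda>x. eval_fps \<psi>1 (of_real x) * of_real (ln x) / eval_fps \<psi>1 (of_real x)) \<longlongrightarrow> fps_nth R1 0 / fps_nth \<psi>1 0) (at_right 0)" .
    have "\<forall>\<^sub>F x in at_right 0. eval_fps \<psi>1 (of_real x) \<noteq> 0"
      by (rule tendsto_imp_eventually_ne[OF l\<psi> \<psi>1(2)])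
    then have "\<forall>\<^sub>F x in at_right 0. eval_fps \<psi>1 (of_real x) * of_real (ln x) / eval_fps \<psi>1 (of_real x) = complex_of_real (ln x)"
      by eventually_elim simp
    from Lim_transform_eventually[OF l this]
    have "((\<lambda>x. complex_of_real (ln x)) \<longlongrightarrow> fps_nth R1 0 / fps_nth \<psi>1 0) (at_right 0)" .
    from tendsto_Re[OF this] have "((\<lambda>x. ln x) \<longlongrightarrow> Re (fps_nth R1 0 / fps_nth \<psi>1 0)) (at_right (0::real))" by simp
    moreover have "filterlim ln at_bot (at_right (0::real))" by (rule ln_at_0)
    ultimately show False
      using not_tendsto_and_filterlim_at_infinity[of "at_right (0::real)" ln] filterlim_at_bot_imp_at_infinity trivial_limit_at_right_real by blast
  next
    case False
    define m where "m = subdegree R"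
    have Rnz: "R \<noteq> 0" using False by auto
    have mn: "m < n" using False subdegree_leI[of R] unfolding m_def by (meson le_less_trans)
    define R1 where "R1 = fps_shift m R"
    have R1: "R = fps_X ^ m * R1" "fps_nth R1 0 \<noteq> 0" "fps_conv_radius R1 > 0"
      using Rnz R subdegree_decompose[of R] by (auto simp: R1_def m_def mult.commute)
    have "\<forall>\<^sub>F x in at_right 0. complex_of_real x ^ (n - m - 1) * eval_fps \<psi>1 (of_real x) * of_real (x * ln x) = eval_fps R1 (of_real x)"
      using ev small[OF R1(3)] pos
    proof eventually_elim
      case (elim x)
      have "n = m + (n - m - 1) + 1" using mn by simp
      then have "complex_of_real x ^ n = of_real x ^ m * of_real x ^ (n - m - 1) * of_real x"
        by (metis power_add power_one_right)
      then have "of_real x ^ m * (complex_of_real x ^ (n - m - 1) * eval_fps \<psi>1 (of_real x) * of_real (x * ln x)) = of_real x ^ m * eval_fps R1 (of_real x)"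
        using elim by (simp add: R1(1) eval_fps_mult mult_ac)
      then show ?case using elim(3) by (simp del: of_real_mult)
    qed
    moreover have "((\<lambda>x. complex_of_real x ^ (n - m - 1) * eval_fps \<psi>1 (of_real x) * of_real (x * ln x)) \<longlongrightarrow> 0 ^ (n - m - 1) * fps_nth \<psi>1 0 * 0) (at_right 0)"
      by (intro tendsto_mult l\<psi> x_ln_x_tendsto tendsto_power) (auto intro!: tendsto_eq_intros)
    ultimately have "((\<lambda>x. eval_fps R1 (of_real x)) \<longlongrightarrow> 0) (at_right 0)"
      by (auto elim: Lim_transform_eventually)
    then have "fps_nth R1 0 = 0"
      using eval_fps_tendsto_at_right[OF R1(3)] tendsto_unique trivial_limit_at_right_real by blast
    then show False using R1(2) by simp
  qed
qed

text \<open>Multiplying by 2 \<pi> i x and letting x tend to 0 isolates \<open>c\<close>; the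
  logarithmic parts are then compared by the preceding uniqueness.\<close>

lemma simple_singularity_unique:
  assumes "simple_singularity \<omega> \<Gamma> \<beta> F c \<psi> R" "simple_singularity \<omega> \<Gamma> \<beta> F c' \<psi>' R'"
  shows "c = c'" "\<psi> = \<psi>'"
proof -
  define p where "p = 2 * complex_of_real pi * \<i>"
  have p: "p \<noteq> 0" by (simp add: p_def)
  have rad: "fps_conv_radius \<psi> > 0" "fps_conv_radius R > 0" "fps_conv_radius \<psi>' > 0" "fps_conv_radius R' > 0"
    using assms by (auto simp: simple_singularity_def)
  have pos: "\<forall>\<^sub>F x in at_right (0::real). x > 0" by (rule eventually_at_right_less)
  have "\<forall>\<^sub>F x in at_right 0. c / (p * of_real x) + eval_fps \<psi> (of_real x) * of_real (ln x) / p + eval_fps R (of_real x)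
     = c' / (p * of_real x) + eval_fps \<psi>' (of_real x) * of_real (ln x) / p + eval_fps R' (of_real x)"
    using assms unfolding simple_singularity_def p_def by (elim conjE) (auto elim: eventually_elim2)
  then have eq: "\<forall>\<^sub>F x in at_right 0. c - c' = (eval_fps \<psi>' (of_real x) - eval_fps \<psi> (of_real x)) * of_real (x * ln x) + p * of_real x * (eval_fps R' (of_real x) - eval_fps R (of_real x))"
    using pos
  proof eventually_elim
    case (elim x)
    then have x: "complex_of_real x \<noteq> 0" by simp
    have "c / (p * of_real x) * (p * of_real x) = c" "c' / (p * of_real x) * (p * of_real x) = c'" using p x by simp_all
    then show ?case using arg_cong[OF elim(1), of "\<lambda>y. y * (p * of_real x)"] p by (simp add: algebra_simps)
  qed
  have "((\<lambda>x. (eval_fps \<psi>' (of_real x) - eval_fps \<psi> (of_real x)) * of_real (x * ln x) + p * of_real x * (eval_fps R' (of_real x) - eval_fps R (of_real x)))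
     \<longlongrightarrow> (fps_nth \<psi>' 0 - fps_nth \<psi> 0) * 0 + p * 0 * (fps_nth R' 0 - fps_nth R 0)) (at_right 0)"
    by (intro tendsto_intros x_ln_x_tendsto eval_fps_tendsto_at_right rad) (auto intro!: tendsto_eq_intros)
  then have "((\<lambda>x::real. c - c') \<longlongrightarrow> 0) (at_right 0)"
    by (subst tendsto_cong[OF eq]) simp
  then show c: "c = c'" by (simp add: tendsto_const_iff)
  have rad2: "fps_conv_radius (\<psi> - \<psi>') > 0" "fps_conv_radius (fps_const p * (R' - R)) > 0"
    using rad by (auto intro!: fps_conv_pos_diff fps_conv_pos_mult)
  have "\<forall>\<^sub>F x in at_right (0::real). ereal (norm (complex_of_real x)) < fps_conv_radius F" if F: "fps_conv_radius F > 0" for F :: "complex fps"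
  proof -
    obtain e where e: "0 < ereal e" "ereal e < fps_conv_radius F" using F ereal_dense2 by blast
    have "\<forall>\<^sub>F x in at_right (0::real). x \<in> {0<..<e}" by (rule eventually_at_right_real) (use e in simp)
    then show ?thesis by eventually_elim (use e(2) in \<open>auto intro: less_trans simp: le_less_trans[OF _ e(2)]\<close>)
  qed
  note small = this[OF rad(1)] this[OF rad(2)] this[OF rad(3)] this[OF rad(4)] this[OF fps_conv_pos_diff[OF rad(4) rad(2)]]
  have "\<forall>\<^sub>F x in at_right 0. eval_fps (\<psi> - \<psi>') (of_real x) * of_real (ln x) = eval_fps (fps_const p * (R' - R)) (of_real x)"
    using eq pos small
  proof eventually_elim
    case (elim x)
    have "of_real x * ((eval_fps \<psi> (of_real x) - eval_fps \<psi>' (of_real x)) * of_real (ln x)) = of_real x * (p * (eval_fps R' (of_real x) - eval_fps R (of_real x)))"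
      using elim(1) c by (simp add: algebra_simps)
    then have "(eval_fps \<psi> (of_real x) - eval_fps \<psi>' (of_real x)) * of_real (ln x) = p * (eval_fps R' (of_real x) - eval_fps R (of_real x))"
      using elim(2) by (simp del: of_real_mult)
    then show ?case using elim by (simp add: eval_fps_diff eval_fps_mult)
  qed
  then have "\<psi> - \<psi>' = 0" by (rule log_expansion_unique[OF rad2])
  then show "\<psi> = \<psi>'" by simp
qed

lemma alien_nth_0:
  assumes "simple_singularity \<omega> \<Gamma> \<beta> F c \<psi> R"
  shows "fps_nth (alien \<omega> \<Gamma> \<beta> F) 0 = c"
proof -
  obtain G where G: "borel_coeffs 0 G = \<psi>" by (rule borel_coeffs_surj[of 0]) auto
  define A where "A = fps_const c + fps_X * G"
  have A: "fps_nth A 0 = c" "fps_shift 1 A = G" by (auto simp: A_def fps_eq_iff)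
  have "alien \<omega> \<Gamma> \<beta> F = A"
    unfolding alien_def
  proof (rule the_equality)
    show "\<exists>R. simple_singularity \<omega> \<Gamma> \<beta> F (fps_nth A 0) (borel_coeffs 0 (fps_shift 1 A)) R"
      using assms A G by auto
    fix A' assume "\<exists>R. simple_singularity \<omega> \<Gamma> \<beta> F (fps_nth A' 0) (borel_coeffs 0 (fps_shift 1 A')) R"
    then obtain R' where "simple_singularity \<omega> \<Gamma> \<beta> F (fps_nth A' 0) (borel_coeffs 0 (fps_shift 1 A')) R'" by blast
    from simple_singularity_unique[OF this assms]
    have "fps_nth A' 0 = c" "borel_coeffs 0 (fps_shift 1 A') = borel_coeffs 0 G" using G by auto
    then have "fps_nth A' 0 = fps_nth A 0" "fps_shift 1 A' = fps_shift 1 A"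
      using borel_coeffs_inject[of 0 "fps_shift 1 A'" G] A by auto
    then have "fps_nth A' n = fps_nth A n" for n
      by (cases n) (auto dest: arg_cong[where f="\<lambda>F. fps_nth F (n - 1)"])
    then show "A' = A" by (rule fps_ext)
  qed
  then show ?thesis using A by simp
qed

section \<open>Paths, the germ and its kernel\<close>

lemma bdd_pc1_cong:
  assumes "bdd_pc1 \<gamma>" "\<And>t. t \<in> {0..1} \<Longrightarrow> \<gamma>' t = \<gamma> t"
  shows "bdd_pc1 \<gamma>'"
proof -
  obtain S D B where S: "finite S" and D: "continuous_on ({0<..<1} - S) D"
    and der: "\<And>t. t \<in> {0<..<1} - S \<Longrightarrow> (\<gamma> has_vector_derivative D t) (at t) \<and> norm (D t) \<le> B"
    using assms(1) unfolding bdd_pc1_def by blast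
  have "(\<gamma>' has_vector_derivative D t) (at t)" if t: "t \<in> {0<..<1} - S" for t
  proof (rule has_vector_derivative_transform_within_open)
    show "(\<gamma> has_vector_derivative D t) (at t)" using der[OF t] by blast
    show "open {0<..<1::real}" "t \<in> {0<..<1}" using t by auto
    show "\<gamma> x = \<gamma>' x" if "x \<in> {0<..<1}" for x using assms(2)[of x] that by simp
  qed
  moreover have "continuous_on {0..1} \<gamma>'"
    using assms by (metis bdd_pc1_def continuous_on_cong)
  ultimately show ?thesis unfolding bdd_pc1_def using S D der by blast
qed

text \<open>Induction over the break points. Taking the library's \<open>vector_derivative\<close>
  as the derivative from the outset means that the pieces need no gluing.\<close>

lemma piecewise_C1_imp_bdd_pc1:
  assumes "piecewise_C1 \<gamma>"
  shows "bdd_pc1 \<gamma>"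
proof -
  obtain n t where t: "t 0 = 0" "t n = (1::real)" and lt: "\<And>i. i < n \<Longrightarrow> t i < t (Suc i)"
    and ex: "\<And>i. i < n \<Longrightarrow> \<exists>D. continuous_on {t i..t (Suc i)} D \<and> (\<forall>s\<in>{t i..t (Suc i)}. (\<gamma> has_vector_derivative D s) (at s within {t i..t (Suc i)}))"
    using assms unfolding piecewise_C1_def by blast
  define S where "S = t ` {..n}"
  define D where "D = (\<lambda>u. vector_derivative \<gamma> (at u))"
  have "0 \<le> t m \<and> continuous_on {0..t m} \<gamma> \<and> continuous_on ({0<..<t m} - S) D \<and>
     (\<exists>B. \<forall>u\<in>{0<..<t m} - S. (\<gamma> has_vector_derivative D u) (at u) \<and> norm (D u) \<le> B)" if "m \<le> n" for m
    using that
  proof (induction m)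
    case 0
    then show ?case by (simp add: t)
  next
    case (Suc m)
    let ?I = "{t m..t (Suc m)}" and ?O = "{t m<..<t (Suc m)}"
    have m: "m < n" "t m < t (Suc m)" using Suc.prems lt by auto
    obtain B where IH: "0 \<le> t m" "continuous_on {0..t m} \<gamma>" "continuous_on ({0<..<t m} - S) D"
      and B: "\<And>u. u \<in> {0<..<t m} - S \<Longrightarrow> (\<gamma> has_vector_derivative D u) (at u) \<and> norm (D u) \<le> B"
      using Suc by (meson Suc_leD)
    obtain D' where D': "continuous_on ?I D'" "\<And>s. s \<in> ?I \<Longrightarrow> (\<gamma> has_vector_derivative D' s) (at s within ?I)"
      using ex[OF m(1)] by blast
    have "continuous_on ?I \<gamma>"
      using D'(2) has_vector_derivative_continuous by (fastforce simp: continuous_on_eq_continuous_within)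
    then have "continuous_on ({0..t m} \<union> ?I) \<gamma>" using IH by (intro continuous_on_closed_Un) auto
    moreover have "{0..t m} \<union> ?I = {0..t (Suc m)}" using IH(1) m(2) by auto
    ultimately have c: "continuous_on {0..t (Suc m)} \<gamma>" by simp
    have der: "(\<gamma> has_vector_derivative D' u) (at u)" if u: "u \<in> ?O" for u
    proof -
      have "(\<gamma> has_vector_derivative D' u) (at u within ?O)"
        by (rule has_vector_derivative_within_subset[OF D'(2)]) (use u in auto)
      then show ?thesis using at_within_open[of u ?O] u by simp
    qed
    have DD: "D u = D' u" if "u \<in> ?O" for u unfolding D_def by (rule vector_derivative_at[OF der[OF that]])
    have "compact (D' ` ?I)" by (rule compact_continuous_image[OF D'(1)]) simp
    then obtain B' where "\<forall>y\<in>D' ` ?I. norm y \<le> B'" using compact_imp_bounded bounded_iff by blast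
    then have B': "norm (D' u) \<le> B'" if "u \<in> ?I" for u using that by blast
    have cO: "continuous_on (?O - S) D"
    proof -
      have "continuous_on (?O - S) D'" by (rule continuous_on_subset[OF D'(1)]) auto
      then show ?thesis using DD by (simp cong: continuous_on_cong_simp)
    qed
    have fS: "finite S" by (simp add: S_def)
    have tS: "t m \<in> S" using m by (auto simp: S_def)
    have un: "{0<..<t (Suc m)} - S = ({0<..<t m} - S) \<union> (?O - S)"
    proof
      show "{0<..<t (Suc m)} - S \<subseteq> ({0<..<t m} - S) \<union> (?O - S)"
      proof
        fix x assume x: "x \<in> {0<..<t (Suc m)} - S"
        then have "x \<noteq> t m" using tS by auto
        then show "x \<in> ({0<..<t m} - S) \<union> (?O - S)" using x by auto
      qed
      show "({0<..<t m} - S) \<union> (?O - S) \<subseteq> {0<..<t (Suc m)} - S" using IH(1) m(2) by auto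
    qed
    have cD: "continuous_on ({0<..<t (Suc m)} - S) D"
      unfolding un by (rule continuous_on_open_Un) (use IH cO fS in \<open>auto intro!: open_Diff finite_imp_closed\<close>)
    have "(\<gamma> has_vector_derivative D u) (at u) \<and> norm (D u) \<le> max B B'" if u: "u \<in> {0<..<t (Suc m)} - S" for u
    proof (cases "u \<in> ?O")
      case True
      then show ?thesis using der[OF True] DD[OF True] B'[of u] by auto
    next
      case False
      then show ?thesis using u un B[of u] by auto
    qed
    moreover have "0 \<le> t (Suc m)" using IH(1) m(2) by simp
    ultimately show ?case using c cD by blast
  qed
  from this[of n] have "continuous_on {0..1} \<gamma> \<and> continuous_on ({0<..<1} - S) D \<and>
     (\<exists>B. \<forall>u\<in>{0<..<1} - S. (\<gamma> has_vector_derivative D u) (at u) \<and> norm (D u) \<le> B)" by (simp add: t(2))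
  moreover have "finite S" by (simp add: S_def)
  ultimately show ?thesis unfolding bdd_pc1_def by blast
qed

lemma bdd_pc1_linepath: "bdd_pc1 (linepath a b)"
  unfolding bdd_pc1_def
  by (auto intro!: exI[of _ "{}"] exI[of _ "\<lambda>_. b - a"] exI[of _ "norm (b - a)"] has_vector_derivative_linepath_within continuous_on_linepath)

lemma bdd_pc1_join:
  assumes "bdd_pc1 p1" "bdd_pc1 p2" and fin: "pathfinish p1 = pathstart p2"
  shows "bdd_pc1 (p1 +++ p2)"
proof -
  obtain S1 D1 B1 where S1: "finite S1" and D1: "continuous_on ({0<..<1} - S1) D1"
    and d1: "\<And>t. t \<in> {0<..<1} - S1 \<Longrightarrow> (p1 has_vector_derivative D1 t) (at t) \<and> norm (D1 t) \<le> B1"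
    using assms(1) unfolding bdd_pc1_def by blast
  obtain S2 D2 B2 where S2: "finite S2" and D2: "continuous_on ({0<..<1} - S2) D2"
    and d2: "\<And>t. t \<in> {0<..<1} - S2 \<Longrightarrow> (p2 has_vector_derivative D2 t) (at t) \<and> norm (D2 t) \<le> B2"
    using assms(2) unfolding bdd_pc1_def by blast
  define S where "S = insert (1/2) ((\<lambda>x. x / 2) ` S1 \<union> (\<lambda>x. (x + 1) / 2) ` S2)"
  define D where "D = (\<lambda>u. if u < 1/2 then 2 *\<^sub>R D1 (2 * u) else 2 *\<^sub>R D2 (2 * u - 1))"
  have fS: "finite S" using S1 S2 by (simp add: S_def)
  have c: "continuous_on {0..1} (p1 +++ p2)"
    using assms by (intro continuous_on_joinpaths) (auto simp: bdd_pc1_def)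
  have in1: "2 * u \<in> {0<..<1} - S1" if "u \<in> {0<..<1/2} - S" for u
  proof -
    have "2 * u \<notin> S1"
    proof
      assume "2 * u \<in> S1"
      then have "2 * u / 2 \<in> (\<lambda>x. x / 2) ` S1" by blast
      then show False using that by (simp add: S_def)
    qed
    then show ?thesis using that by auto
  qed
  have in2: "2 * u - 1 \<in> {0<..<1} - S2" if "u \<in> {1/2<..<1} - S" for u
  proof -
    have "2 * u - 1 \<notin> S2" 
    proof
      assume "2 * u - 1 \<in> S2"
      then have "(2 * u - 1 + 1) / 2 \<in> (\<lambda>x. (x + 1) / 2) ` S2" by blast
      then show False using that by (simp add: S_def)
    qed
    then show ?thesis using that by auto
  qed
  have un: "{0<..<1} - S = ({0<..<1/2} - S) \<union> ({1/2<..<1} - S)" by (auto simp: S_def)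
  have "continuous_on ({0<..<1/2} - S) (\<lambda>u. 2 *\<^sub>R D1 (2 * u))"
    by (intro continuous_intros continuous_on_compose2[OF D1]) (use in1 in auto)
  then have c1: "continuous_on ({0<..<1/2} - S) D"
    by (rule continuous_on_eq) (auto simp: D_def)
  have "continuous_on ({1/2<..<1} - S) (\<lambda>u. 2 *\<^sub>R D2 (2 * u - 1))"
    by (intro continuous_intros continuous_on_compose2[OF D2]) (use in2 in auto)
  then have c2: "continuous_on ({1/2<..<1} - S) D"
    by (rule continuous_on_eq) (auto simp: D_def)
  have cD: "continuous_on ({0<..<1} - S) D"
    unfolding un by (rule continuous_on_open_Un[OF _ _ c1 c2]) (auto intro!: open_Diff finite_imp_closed fS)
  have "((p1 +++ p2) has_vector_derivative D u) (at u) \<and> norm (D u) \<le> 2 * max B1 B2" if u: "u \<in> {0<..<1} - S" for u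
  proof (cases "u < 1/2")
    case True
    have i: "2 * u \<in> {0<..<1} - S1" using in1[of u] u True by auto
    have "((\<lambda>u. 2 * u) has_vector_derivative 2) (at u)" by (auto intro!: derivative_eq_intros)
    from vector_diff_chain_at[OF this, of p1 "D1 (2 * u)"]
    have "((\<lambda>u. p1 (2 * u)) has_vector_derivative 2 *\<^sub>R D1 (2 * u)) (at u)" using d1[OF i] by (simp add: o_def)
    then have "((p1 +++ p2) has_vector_derivative 2 *\<^sub>R D1 (2 * u)) (at u)"
      by (rule has_vector_derivative_transform_within_open[of _ _ _ "{..<1/2}"]) (use True in \<open>auto simp: joinpaths_def\<close>)
    then show ?thesis using True d1[OF i] by (auto simp: D_def le_max_iff_disj)
  next
    case False
    then have u2: "u > 1/2" using u by (auto simp: S_def)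
    have i: "2 * u - 1 \<in> {0<..<1} - S2" using in2[of u] u u2 by auto
    have "((\<lambda>u. 2 * u - 1) has_vector_derivative 2) (at u)" by (auto intro!: derivative_eq_intros)
    from vector_diff_chain_at[OF this, of p2 "D2 (2 * u - 1)"]
    have "((\<lambda>u. p2 (2 * u - 1)) has_vector_derivative 2 *\<^sub>R D2 (2 * u - 1)) (at u)" using d2[OF i] by (simp add: o_def)
    then have "((p1 +++ p2) has_vector_derivative 2 *\<^sub>R D2 (2 * u - 1)) (at u)"
      by (rule has_vector_derivative_transform_within_open[of _ _ _ "{1/2<..}"]) (use u2 in \<open>auto simp: joinpaths_def\<close>)
    then show ?thesis using False d2[OF i] by (auto simp: D_def le_max_iff_disj)
  qed
  then show ?thesis unfolding bdd_pc1_def using c cD fS by blast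
qed

text \<open>Strict monotonicity of \<open>h\<close> keeps the set of exceptional parameters finite,
  because its restriction to the preimage of \<open>S1\<close> is injective.\<close>

lemma bdd_pc1_compose:
  assumes "bdd_pc1 p" "bdd_pc1 h" and h: "strict_mono_on {0..1} h" "h 0 = 0" "h 1 = (1::real)"
  shows "bdd_pc1 (\<lambda>t. p (h t))"
proof -
  obtain S1 D1 B1 where S1: "finite S1" and D1: "continuous_on ({0<..<1} - S1) D1"
    and d1: "\<And>t. t \<in> {0<..<1} - S1 \<Longrightarrow> (p has_vector_derivative D1 t) (at t) \<and> norm (D1 t) \<le> B1"
    using assms(1) unfolding bdd_pc1_def by blast
  obtain S2 D2 B2 where S2: "finite S2" and D2: "continuous_on ({0<..<1} - S2) D2"
    and d2: "\<And>t. t \<in> {0<..<1} - S2 \<Longrightarrow> (h has_vector_derivative D2 t) (at t) \<and> norm (D2 t) \<le> B2"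
    using assms(2) unfolding bdd_pc1_def by blast
  have ch: "continuous_on {0..1} h" and cp: "continuous_on {0..1} p" using assms by (auto simp: bdd_pc1_def)
  have hlt: "h u < h v" if "0 \<le> u" "u < v" "v \<le> 1" for u v
    using h(1) that by (auto simp: strict_mono_on_def)
  have inj: "inj_on h {0..1}" using h(1) by (rule strict_mono_on_imp_inj_on)
  have h01: "h u \<in> {0<..<1}" if "u \<in> {0<..<1}" for u using hlt[of 0 u] hlt[of u 1] that h by auto
  have h01': "h u \<in> {0..1}" if "u \<in> {0..1}" for u using hlt[of 0 u] hlt[of u 1] that h by (cases "u = 0 \<or> u = 1") auto
  define S where "S = S2 \<union> {u \<in> {0..1}. h u \<in> S1}"
  have fS: "finite S"
  proof -
    have "finite {u \<in> {0..1}. h u \<in> S1}"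
    proof (rule finite_imageD)
      show "finite (h ` {u \<in> {0..1}. h u \<in> S1})" by (rule finite_subset[OF _ S1]) auto
      show "inj_on h {u \<in> {0..1}. h u \<in> S1}" using inj by (rule inj_on_subset) auto
    qed
    then show ?thesis using S2 by (simp add: S_def)
  qed
  define D where "D = (\<lambda>u. D2 u *\<^sub>R D1 (h u))"
  have i1: "h u \<in> {0<..<1} - S1" if "u \<in> {0<..<1} - S" for u using h01[of u] that by (auto simp: S_def)
  have i2: "u \<in> {0<..<1} - S2" if "u \<in> {0<..<1} - S" for u using that by (auto simp: S_def)
  have cD: "continuous_on ({0<..<1} - S) D"
    unfolding D_def
  proof (intro continuous_on_scaleR)
    show "continuous_on ({0<..<1} - S) D2" by (rule continuous_on_subset[OF D2]) (use i2 in auto)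
    have "continuous_on ({0<..<1} - S) h" by (rule continuous_on_subset[OF ch]) auto
    then show "continuous_on ({0<..<1} - S) (\<lambda>u. D1 (h u))"
      by (rule continuous_on_compose2[OF D1]) (use i1 in auto)
  qed
  have "((\<lambda>t. p (h t)) has_vector_derivative D u) (at u) \<and> norm (D u) \<le> \<bar>B2\<bar> * \<bar>B1\<bar>" if u: "u \<in> {0<..<1} - S" for u
  proof
    show "((\<lambda>t. p (h t)) has_vector_derivative D u) (at u)"
      using vector_diff_chain_at[of h "D2 u" u p "D1 (h u)"] d1[OF i1[OF u]] d2[OF i2[OF u]] by (simp add: o_def D_def)
    have "norm (D1 (h u)) \<le> \<bar>B1\<bar>" "\<bar>D2 u\<bar> \<le> \<bar>B2\<bar>" using d1[OF i1[OF u]] d2[OF i2[OF u]] by auto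
    then show "norm (D u) \<le> \<bar>B2\<bar> * \<bar>B1\<bar>" by (auto simp: D_def intro!: mult_mono)
  qed
  moreover have "continuous_on {0..1} (\<lambda>t. p (h t))"
    by (rule continuous_on_compose2[OF cp ch]) (use h01' in auto)
  ultimately show ?thesis unfolding bdd_pc1_def using fS cD by blast
qed

lemma two_pi_i_Z_iff: "z \<in> two_pi_i_Z \<longleftrightarrow> exp z = 1"
proof
  assume "z \<in> two_pi_i_Z"
  then obtain m where "z = 2 * of_real pi * \<i> * of_int m" by (auto simp: two_pi_i_Z_def)
  then show "exp z = 1" by (auto simp: exp_eq_1 intro!: exI[of _ m])
next
  assume "exp z = 1"
  then obtain n where "Re z = 0" "Im z = of_int (2 * n) * pi" by (auto simp: exp_eq_1)
  then have "z = 2 * of_real pi * \<i> * of_int n" by (simp add: complex_eq_iff)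
  then show "z \<in> two_pi_i_Z" by (auto simp: two_pi_i_Z_def)
qed

text \<open>The asymptotic expansion of f at infinity shows that the function in x = 1/w is
  differentiable at 0 with derivative -\<rho>; it is holomorphic off 0, so the singularity is
  removable.\<close>

lemma germ_b_facts:
  assumes "simple_parabolic_germ f \<rho>"
  shows "fps_conv_radius (germ_b f) > 0" "fps_nth (germ_b f) 0 = 0" "fps_nth (germ_b f) (Suc 0) = - \<rho>"
proof -
  obtain r0 where r0: "f holomorphic_on {z. norm z > r0}" 
    and O: "(\<lambda>z. f z - (z + 1 - \<rho> / z)) \<in> O[at_infinity](\<lambda>z. 1 / z ^ 2)"
    using assms unfolding simple_parabolic_germ_def by blast
  obtain C where C: "\<forall>\<^sub>F z in at_infinity. norm (f z - (z + 1 - \<rho> / z)) \<le> C * norm (1 / z ^ 2)"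
    using O by (auto elim: landau_o.bigE)
  then obtain r1 where r1: "\<And>z. norm z \<ge> r1 \<Longrightarrow> norm (f z - (z + 1 - \<rho> / z)) \<le> C * norm (1 / z ^ 2)"
    unfolding eventually_at_infinity by blast
  define r where "r = max (max r0 r1) 0"
  \<comment> \<open>For 0 < |x| < e the point 1/x - 1 lies outside the disc of radius r, and |1 - x|
    is at least 1/2.\<close>
  define e where "e = 1 / (r + 2)"
  have e: "0 < e" "e \<le> 1/2" by (auto simp: e_def r_def field_simps)
  have big: "norm (1 / x - 1) > r" "x \<noteq> 0" "norm (1 - x) \<ge> 1/2" if x: "x \<in> ball 0 e - {0}" for x :: complex
  proof -
    have n: "0 < norm x" "norm x < e" using x by auto
    have "1 / norm x > r + 2" using n by (simp add: e_def r_def field_simps)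
    then show "norm (1 / x - 1) > r" using norm_triangle_ineq2[of "1 / x" 1] by (simp add: norm_divide)
    show "x \<noteq> 0" using n by auto
    show "norm (1 - x) \<ge> 1/2" using norm_triangle_ineq2[of 1 x] n e by simp
  qed
  define g where "g = (\<lambda>x. if x = 0 then 0 else f (1 / x - 1) - 1 / x)"
  \<comment> \<open>With z = 1/x - 1 one has z + 1 = 1/x, and \<rho>/z = \<rho> x / (1 - x) differs
    from \<rho> x by O(x^2).\<close>
  have est: "norm (g x + \<rho> * x) \<le> (2 * norm \<rho> + 4 * \<bar>C\<bar>) * norm x ^ 2" if x: "x \<in> ball 0 e - {0}" for x
  proof -
    note b = big[OF x]
    have x1: "1 - x \<noteq> 0" using b(3) by auto
    have w: "1 / x - 1 = (1 - x) / x" using b(2) by (simp add: field_simps)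
    have "norm (f (1 / x - 1) - (1 / x - 1 + 1 - \<rho> / (1 / x - 1))) \<le> C * norm (1 / (1 / x - 1) ^ 2)"
      by (rule r1) (use b(1) in \<open>simp add: r_def\<close>)
    also have "\<dots> = C * (norm x ^ 2 / norm (1 - x) ^ 2)" unfolding w by (simp add: norm_divide norm_power power_divide)
    also have "\<dots> \<le> \<bar>C\<bar> * (4 * norm x ^ 2)"
    proof (intro mult_mono)
      have "(1/2) ^ 2 \<le> norm (1 - x) ^ 2" by (rule power_mono[OF b(3)]) simp
      then show "norm x ^ 2 / norm (1 - x) ^ 2 \<le> 4 * norm x ^ 2"
        using x1 mult_right_mono[of "1/4" "norm (1 - x) ^ 2" "4 * norm x ^ 2"] by (simp add: power2_eq_square divide_le_eq mult_ac)
    qed auto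
    finally have 1: "norm (f (1 / x - 1) - (1 / x - \<rho> / (1 / x - 1))) \<le> \<bar>C\<bar> * (4 * norm x ^ 2)" by simp
    have "\<rho> * x - \<rho> / (1 / x - 1) = - (\<rho> * x ^ 2 / (1 - x))" unfolding w using b(2) x1 by (simp add: field_simps power2_eq_square)
    then have "norm (\<rho> * x - \<rho> / (1 / x - 1)) = norm \<rho> * norm x ^ 2 / norm (1 - x)" by (simp add: norm_mult norm_divide norm_power)
    also have "\<dots> \<le> norm \<rho> * norm x ^ 2 / (1/2)" using b(3) by (intro divide_left_mono) auto
    finally have 2: "norm (\<rho> * x - \<rho> / (1 / x - 1)) \<le> 2 * norm \<rho> * norm x ^ 2" by simp
    have "g x + \<rho> * x = (f (1 / x - 1) - (1 / x - \<rho> / (1 / x - 1))) + (\<rho> * x - \<rho> / (1 / x - 1))" using b(2) by (simp add: g_def)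
    then have "norm (g x + \<rho> * x) \<le> norm (f (1 / x - 1) - (1 / x - \<rho> / (1 / x - 1))) + norm (\<rho> * x - \<rho> / (1 / x - 1))" by (metis norm_triangle_ineq)
    also have "\<dots> \<le> \<bar>C\<bar> * (4 * norm x ^ 2) + 2 * norm \<rho> * norm x ^ 2" using 1 2 by (rule add_mono)
    finally show ?thesis by (simp add: algebra_simps)
  qed
  have lim: "((\<lambda>x. (g x - g 0) / (x - 0)) \<longlongrightarrow> - \<rho>) (at 0)"
  proof (rule LIM_zero_cancel, rule Lim_null_comparison)
    show "\<forall>\<^sub>F x in at 0. norm ((g x - g 0) / (x - 0) - - \<rho>) \<le> (2 * norm \<rho> + 4 * \<bar>C\<bar>) * norm x"
      unfolding eventually_at
    proof (intro exI[of _ e] conjI ballI impI e)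
      fix x :: complex assume "x \<noteq> 0 \<and> dist x 0 < e"
      then have x: "x \<in> ball 0 e - {0}" by auto
      have "(g x - g 0) / (x - 0) - - \<rho> = (g x + \<rho> * x) / x" using x by (simp add: g_def add_divide_distrib)
      then have "norm ((g x - g 0) / (x - 0) - - \<rho>) = norm (g x + \<rho> * x) / norm x" by (simp add: norm_divide)
      also have "\<dots> \<le> (2 * norm \<rho> + 4 * \<bar>C\<bar>) * norm x ^ 2 / norm x" by (rule divide_right_mono[OF est[OF x]]) simp
      finally show "norm ((g x - g 0) / (x - 0) - - \<rho>) \<le> (2 * norm \<rho> + 4 * \<bar>C\<bar>) * norm x" using x by (simp add: power2_eq_square)
    qed
    show "((\<lambda>x. (2 * norm \<rho> + 4 * \<bar>C\<bar>) * norm x) \<longlongrightarrow> 0) (at (0::complex))" by (auto intro!: tendsto_eq_intros)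
  qed
  then have der: "(g has_field_derivative - \<rho>) (at 0)" by (simp add: has_field_derivative_iff)
  have hol: "g holomorphic_on ball 0 e"
  proof (rule no_isolated_singularity[where K="{0}"])
    have inn: "(\<lambda>x. 1 / x - 1) holomorphic_on ball 0 e - {0}" by (intro holomorphic_intros) auto
    have "(f \<circ> (\<lambda>x. 1 / x - 1)) holomorphic_on ball 0 e - {0}"
      by (rule holomorphic_on_compose_gen[OF inn r0]) (use big(1) in \<open>force simp: r_def\<close>)
    then have "(\<lambda>x. f (1 / x - 1) - 1 / x) holomorphic_on ball 0 e - {0}"
      unfolding o_def by (intro holomorphic_intros) auto
    then show h: "g holomorphic_on ball 0 e - {0}" by (rule holomorphic_transform) (auto simp: g_def)
    show "continuous_on (ball 0 e) g"
      unfolding continuous_on_eq_continuous_within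
    proof
      fix x :: complex assume x: "x \<in> ball 0 e"
      show "continuous (at x within ball 0 e) g"
      proof (cases "x = 0")
        case True
        then show ?thesis using DERIV_isCont[OF der] by (simp add: continuous_at_imp_continuous_at_within)
      next
        case False
        then have "isCont g x" using holomorphic_on_imp_continuous_on[OF h] x by (simp add: continuous_on_eq_continuous_at open_Diff)
        then show ?thesis by (rule continuous_at_imp_continuous_at_within)
      qed
    qed
  qed auto
  have gb: "germ_b f = fps_expansion g 0" by (simp add: germ_b_def g_def)
  have "fps_conv_radius (fps_expansion g 0) \<ge> ereal e"
    by (rule conv_radius_fps_expansion) (use hol in simp)
  then show "fps_conv_radius (germ_b f) > 0" unfolding gb using e(1) by (meson ereal_less(2) less_le_trans)
  show "fps_nth (germ_b f) 0 = 0" by (simp add: gb fps_expansion_def g_def)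
  show "fps_nth (germ_b f) (Suc 0) = - \<rho>" using DERIV_imp_deriv[OF der] by (simp add: gb fps_expansion_def)
qed

lemma dbl_compose_holomorphic:
  assumes a: "dbl_bdd a C A" and U: "open U" and p: "p holomorphic_on U" and q: "q holomorphic_on U"
  shows "(\<lambda>z. dbl a (p z) (q z)) holomorphic_on U"
  unfolding holomorphic_on_open[OF U]
proof
  fix z assume z: "z \<in> U"
  obtain P Q where "((\<lambda>(x, y). dbl a x y) has_derivative (\<lambda>(u, v). P * u + Q * v)) (at (p z, q z))"
    using dbl_has_derivative[OF a] by blast
  moreover have "(p has_derivative (*) (deriv p z)) (at z)" "(q has_derivative (*) (deriv q z)) (at z)"
    using holomorphic_derivI[OF p U z] holomorphic_derivI[OF q U z] by (auto simp: has_field_derivative_def)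
  then have "((\<lambda>z. (p z, q z)) has_derivative (\<lambda>h. (deriv p z * h, deriv q z * h))) (at z)"
    by (rule has_derivative_Pair)
  ultimately have "((\<lambda>(x, y). dbl a x y) \<circ> (\<lambda>z. (p z, q z)) has_derivative (\<lambda>(u, v). P * u + Q * v) \<circ> (\<lambda>h. (deriv p z * h, deriv q z * h))) (at z)"
    by (intro diff_chain_at)
  then have "((\<lambda>z. dbl a (p z) (q z)) has_derivative (\<lambda>h. P * (deriv p z * h) + Q * (deriv q z * h))) (at z)"
    by (simp add: o_def)
  moreover have "(\<lambda>h. P * (deriv p z * h) + Q * (deriv q z * h)) = (*) (P * deriv p z + Q * deriv q z)"
    by (auto simp: fun_eq_iff algebra_simps)
  ultimately have "((\<lambda>z. dbl a (p z) (q z)) has_derivative (*) (P * deriv p z + Q * deriv q z)) (at z)"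
    by (simp only:)
  then show "\<exists>f'. ((\<lambda>z. dbl a (p z) (q z)) has_field_derivative f') (at z)"
    by (auto simp: has_field_derivative_def)
qed

text \<open>On the diagonal only the linear coefficient of each \<open>D_series\<close> matters: it
  is \<alpha> for k = 0, that of \<open>b\<close> for k = 1, and 0 beyond because b^k vanishes to
  order k. For the germ this gives \<alpha> + \<rho> w.\<close>

lemma K_alpha_facts:
  assumes b: "fps_conv_radius b > 0" "fps_nth b 0 = 0"
  shows "continuous_on UNIV (\<lambda>(x, z). K_alpha b \<alpha> x z)"
    "\<And>U p q. open U \<Longrightarrow> p holomorphic_on U \<Longrightarrow> q holomorphic_on U \<Longrightarrow> (\<lambda>z. K_alpha b \<alpha> (p z) (q z)) holomorphic_on U"
    "holomorphic_C2 (K_alpha b \<alpha>)"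
    "K_alpha b \<alpha> w w = \<alpha> - fps_nth b (Suc 0) * w"
proof -
  let ?a = "K_coeff (c_alpha b \<alpha>) b"
  obtain C A where a: "dbl_bdd ?a C A" using K_alpha_eq_dbl(4)[OF b] by blast
  have K: "K_alpha b \<alpha> = (\<lambda>x z. dbl ?a x (z - x))" using K_alpha_eq_dbl(3)[OF b] by blast
  have "continuous_on UNIV (\<lambda>p. (\<lambda>(x, y). dbl ?a x y) (fst p, snd p - fst p))"
    by (rule continuous_on_compose2[OF continuous_on_dbl[OF a]]) (auto intro!: continuous_intros)
  then show "continuous_on UNIV (\<lambda>(x, z). K_alpha b \<alpha> x z)" by (simp add: K case_prod_unfold)
  show "(\<lambda>z. K_alpha b \<alpha> (p z) (q z)) holomorphic_on U" if "open U" "p holomorphic_on U" "q holomorphic_on U" for U p q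
    unfolding K using that by (intro dbl_compose_holomorphic[OF a] holomorphic_intros)
  show "holomorphic_C2 (K_alpha b \<alpha>)"
    unfolding holomorphic_C2_def
  proof
    fix p :: "complex \<times> complex"
    obtain P Q where d: "((\<lambda>(x, y). dbl ?a x y) has_derivative (\<lambda>(u, v). P * u + Q * v)) (at (fst p, snd p - fst p))"
      using dbl_has_derivative[OF a] by blast
    have "((\<lambda>p. (fst p, snd p - fst p)) has_derivative (\<lambda>h. (fst h, snd h - fst h))) (at p)"
      by (auto intro!: derivative_eq_intros)
    from diff_chain_at[OF this d]
    have "((\<lambda>(x, z). K_alpha b \<alpha> x z) has_derivative (\<lambda>(u, v). (P - Q) * u + Q * v)) (at p)"
      by (simp add: o_def K case_prod_unfold algebra_simps)
    then show "\<exists>a c. ((\<lambda>(x, z). K_alpha b \<alpha> x z) has_derivative (\<lambda>(u, v). a * u + c * v)) (at p)" by blast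
  qed
  have D: "fps_nth (D_series (c_alpha b \<alpha>) b n) (Suc 0) = (if n = 0 then \<alpha> else if n = 1 then fps_nth b (Suc 0) else 0)" for n
  proof (cases n)
    case 0
    then show ?thesis using c_alpha_nth[OF b(2)] by (simp add: D_series_def)
  next
    case (Suc m)
    have pz: "fps_nth (b ^ j) 0 = (if j = 0 then 1 else 0)" for j using b(2) by (simp add: fps_power_zeroth)
    have "fps_nth (b ^ Suc m) (Suc 0) = (if m = 0 then fps_nth b (Suc 0) else 0)"
      using b(2) by (simp add: fps_mult_nth pz)
    then show ?thesis using Suc c_alpha_nth[OF b(2)] pz[of "Suc m"] by (simp add: D_series_def fps_mult_nth del: power_Suc)
  qed
  have t: "dbl_term ?a n w 0 = ?a n 0 * w ^ n" for n
  proof -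
    have "dbl_term ?a n w 0 = (\<Sum>k\<le>n. if k = n then ?a n 0 * w ^ n else 0)"
      unfolding dbl_term_def by (intro sum.cong refl) (auto simp: power_0_left)
    then show ?thesis by simp
  qed
  have "K_alpha b \<alpha> w w = (\<Sum>n. ?a n 0 * w ^ n)" by (simp add: K dbl_def t)
  also have "\<dots> = (\<Sum>n\<in>{0,1}. ?a n 0 * w ^ n)"
    by (rule suminf_finite) (auto simp: K_coeff_def D)
  also have "\<dots> = \<alpha> - fps_nth b (Suc 0) * w" by (simp add: K_coeff_def D)
  finally show "K_alpha b \<alpha> w w = \<alpha> - fps_nth b (Suc 0) * w" .
qed

text \<open>Differentiability at a zero of K. The 2 in the constant bounds the product norm of the
  increment, whose second component is no longer than the first.\<close>

lemma holomorphic_C2_Lipschitz_at: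
  assumes "holomorphic_C2 K" "K w w = 0"
  shows "\<exists>C d. d > 0 \<and> (\<forall>x z. norm (x - w) < d \<longrightarrow> norm (z - w) \<le> norm (x - w) \<longrightarrow> norm (K x z) \<le> C * norm (x - w))"
proof -
  obtain P Q where "((\<lambda>(x, z). K x z) has_derivative (\<lambda>(u, v). P * u + Q * v)) (at (w, w))"
    using assms(1) unfolding holomorphic_C2_def by blast
  then have "\<exists>d>0. \<forall>y. norm (y - (w, w)) < d \<longrightarrow>
      norm ((\<lambda>(x, z). K x z) y - (\<lambda>(x, z). K x z) (w, w) - (\<lambda>(u, v). P * u + Q * v) (y - (w, w))) \<le> 1 * norm (y - (w, w))"
    unfolding has_derivative_at_alt using zero_less_one by blast
  then obtain d where d: "d > 0" and D: "\<And>y. norm (y - (w, w)) < d \<Longrightarrow>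
      norm ((\<lambda>(x, z). K x z) y - (\<lambda>(x, z). K x z) (w, w) - (\<lambda>(u, v). P * u + Q * v) (y - (w, w))) \<le> 1 * norm (y - (w, w))"
    by blast
  have "norm (K x z) \<le> (2 + norm P + norm Q) * norm (x - w)" if xz: "norm (x - w) < d / 2" "norm (z - w) \<le> norm (x - w)" for x z
  proof -
    have n: "norm ((x, z) - (w, w)) \<le> 2 * norm (x - w)" using norm_Pair_le[of "x - w" "z - w"] xz by simp
    have "norm (K x z - (P * (x - w) + Q * (z - w))) \<le> norm ((x, z) - (w, w))"
      using D[of "(x, z)"] n xz(1) assms(2) by simp
    moreover have "norm (P * (x - w) + Q * (z - w)) \<le> norm P * norm (x - w) + norm Q * norm (x - w)"
      by (rule order_trans[OF norm_triangle_ineq]) (use xz in \<open>auto simp: norm_mult intro!: add_mono mult_left_mono\<close>)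
    ultimately have "norm (K x z) \<le> norm P * norm (x - w) + norm Q * norm (x - w) + 2 * norm (x - w)"
      using n norm_triangle_sub[of "K x z" "P * (x - w) + Q * (z - w)"] by linarith
    then show ?thesis by (simp add: algebra_simps)
  qed
  then show ?thesis using d by (intro exI[of _ "2 + norm P + norm Q"] exI[of _ "d / 2"]) auto
qed

text \<open>Joins nest to the right: the first segment fills the first half of the parameter
  interval, \<Gamma> and the last segment a quarter each.\<close>

lemma path3_values:
  fixes \<Gamma> :: "real \<Rightarrow> complex"
  assumes "pathstart \<Gamma> = 1" and "p = linepath 0 1 +++ \<Gamma> +++ linepath (pathfinish \<Gamma>) e"
  shows "t \<le> 1/2 \<Longrightarrow> p t = of_real (2 * t)"
    and "1/2 \<le> t \<Longrightarrow> t \<le> 3/4 \<Longrightarrow> p t = \<Gamma> (4 * t - 2)"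
    and "3/4 \<le> t \<Longrightarrow> p t = linepath (pathfinish \<Gamma>) e (4 * t - 3)"
proof -
  show 1: "t \<le> 1/2 \<Longrightarrow> p t = of_real (2 * t)"
    by (simp add: assms(2) joinpaths_def linepath_def scaleR_conv_of_real)
  show "1/2 \<le> t \<Longrightarrow> t \<le> 3/4 \<Longrightarrow> p t = \<Gamma> (4 * t - 2)"
  proof (cases "t = 1/2")
    case True
    have "p t = 1" "\<Gamma> (4 * t - 2) = \<Gamma> 0" using 1 unfolding True by simp_all
    then show ?thesis using assms(1) by (simp add: pathstart_def)
  next
    case False
    assume "1/2 \<le> t" "t \<le> 3/4"
    then show ?thesis using False by (simp add: assms(2) joinpaths_def field_simps)
  qed
  show "3/4 \<le> t \<Longrightarrow> p t = linepath (pathfinish \<Gamma>) e (4 * t - 3)"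
  proof (cases "t = 3/4")
    case True
    show ?thesis unfolding True assms(2) by (simp add: joinpaths_def pathfinish_def linepath_def)
  next
    case False
    assume "3/4 \<le> t"
    then show ?thesis using False by (simp add: assms(2) joinpaths_def field_simps)
  qed
qed

lemma exp_real_ne_1: "0 < x \<Longrightarrow> exp (complex_of_real x) \<noteq> 1"
  using norm_exp_real_minus_1_ge[of x] by auto

section \<open>The iterates on the first sheet and along paths\<close>

locale resurgent_germ =
  fixes b :: "complex fps" and \<rho> \<omega> \<alpha> \<beta> :: complex and N :: nat
  assumes b: "fps_conv_radius b > 0" "fps_nth b 0 = 0" "fps_nth b (Suc 0) = - \<rho>"
    and \<alpha>: "\<alpha> = - \<rho> * \<omega>" and \<beta>: "\<beta> = \<alpha> + of_nat N" "Re \<beta> \<ge> 0"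
begin

abbreviation "K \<equiv> K_alpha b \<alpha>"

definition Ph :: "nat \<Rightarrow> complex fps" where "Ph k = Phi \<rho> b \<omega> N k"

lemma Ph_0: "Ph 0 = E_op \<beta> (b_alpha \<rho> b \<alpha> N)"
  by (simp add: Ph_def Phi_def Let_def \<alpha> \<beta>)

lemma Ph_Suc: "Ph (Suc k) = E_op \<beta> (B_op b \<alpha> \<beta> (Ph k))"
  by (simp add: Ph_def Phi_def Let_def \<alpha> \<beta>)

definition G :: "nat \<Rightarrow> complex fps" where "G k = borel_coeffs \<beta> (Ph k)"

lemma radius_b_alpha: "fps_conv_radius (borel_coeffs (\<beta> + 1) (b_alpha \<rho> b \<alpha> N)) = \<infinity>"
  by (rule fps_conv_radius_borel_coeffs) (use b \<beta> in \<open>auto intro: fps_conv_pos_b_alpha\<close>)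

lemma G_radius: "fps_conv_radius (G k) \<ge> ereal (2 * pi)"
proof (induction k)
  case 0
  show ?case unfolding G_def Ph_0
    by (rule borel_E_op_analytic(1)) (use \<beta> radius_b_alpha in auto)
next
  case (Suc k)
  show ?case unfolding G_def Ph_Suc
    by (rule borel_E_op_analytic(1)[OF \<beta>(2)], rule order_trans[OF Suc[unfolded G_def]])
       (rule fps_conv_radius_B_op[OF b(1,2) \<beta>(2)])
qed

lemma in_G_radius: "norm z < 2 * pi \<Longrightarrow> ereal (norm z) < fps_conv_radius (G k)"
  using G_radius[of k] by (meson ereal_less_eq(3) less_ereal.simps(1) less_le_trans)

definition \<phi> :: "nat \<Rightarrow> complex \<Rightarrow> complex" where "\<phi> k = borel_sum \<beta> (Ph k)"

lemma \<phi>_alt: "\<phi> k z = z powr \<beta> * eval_fps (G k) z"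
  by (simp add: \<phi>_def borel_sum_def G_def)

text \<open>A convex neighbourhood of the first segment without 0, avoiding both the zeros of e^z -
  1 and the cut of the principal power.\<close>

definition W :: "complex set" where "W = {z. 0 < Re z} \<inter> ball 0 (2 * pi)"

lemma W_props: "open W" "convex W" "0 < x \<Longrightarrow> x \<le> 1 \<Longrightarrow> complex_of_real x \<in> W"
  "z \<in> W \<Longrightarrow> exp z \<noteq> 1" "z \<in> W \<Longrightarrow> norm z < 2 * pi" "z \<in> W \<Longrightarrow> z \<notin> \<real>\<^sub>\<le>\<^sub>0"
proof -
  show "open W" "convex W" unfolding W_def
    by (auto intro!: open_Int convex_Int convex_halfspace_Re_gt simp: open_halfspace_Re_gt)
  show "complex_of_real x \<in> W" if "0 < x" "x \<le> 1" using that pi_gt3 by (simp add: W_def)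
  show "exp z \<noteq> 1" if "z \<in> W" using that exp_eq_1_norm_less[of z] by (auto simp: W_def)
  show "norm z < 2 * pi" "z \<notin> \<real>\<^sub>\<le>\<^sub>0" if "z \<in> W" using that by (auto simp: W_def complex_nonpos_Reals_iff)
qed

lemma eval_G_hol: "eval_fps (G k) holomorphic_on ball 0 (2 * pi)"
  by (rule holomorphic_on_eval_fps) (use in_G_radius in \<open>auto simp: eball_def\<close>)

lemma \<phi>_analytic: "z \<in> W \<Longrightarrow> \<phi> k analytic_on {z}"
proof -
  assume z: "z \<in> W"
  have "\<phi> k holomorphic_on W"
    unfolding \<phi>_alt[abs_def] using W_props(5,6)
    by (intro holomorphic_intros holomorphic_on_subset[OF eval_G_hol]) auto
  then show ?thesis using z W_props(1) by (auto simp: analytic_at)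
qed

text \<open>The product of kernel and regular factor as a series in x for fixed z, so that its
  weighted primitive \<open>P\<close> is a power times a series.\<close>

definition f :: "nat \<Rightarrow> complex \<Rightarrow> complex fps" where
  "f k z = fps_expansion (\<lambda>x. K x z * eval_fps (G k) x) 0"

lemma f_props: "fps_conv_radius (f k z) \<ge> ereal (2 * pi)" "norm x < 2 * pi \<Longrightarrow> eval_fps (f k z) x = K x z * eval_fps (G k) x"
proof -
  have "(\<lambda>x. K x z * eval_fps (G k) x) holomorphic_on eball 0 (ereal (2 * pi))"
    by (simp, intro holomorphic_on_mult eval_G_hol K_alpha_facts(2)[OF b(1,2)] holomorphic_intros) auto
  from conv_radius_fps_expansion[OF this] eval_fps_expansion'[OF this, of x]
  show "fps_conv_radius (f k z) \<ge> ereal (2 * pi)" "norm x < 2 * pi \<Longrightarrow> eval_fps (f k z) x = K x z * eval_fps (G k) x"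
    by (auto simp: f_def)
qed

lemma in_f_radius: "norm x < 2 * pi \<Longrightarrow> ereal (norm x) < fps_conv_radius (f k z)"
  using f_props(1)[of k z] by (meson ereal_less_eq(3) less_ereal.simps(1) less_le_trans)

definition P :: "nat \<Rightarrow> complex \<Rightarrow> complex \<Rightarrow> complex" where
  "P k z x = x powr (\<beta> + 1) * eval_fps (powr_prim \<beta> (f k z)) x"

lemma P_deriv:
  assumes "x \<in> W"
  shows "(P k z has_field_derivative K x z * \<phi> k x) (at x)"
proof -
  note x = W_props(5,6)[OF assms]
  have "(P k z has_field_derivative x powr \<beta> * eval_fps (f k z) x) (at x)"
    unfolding P_def[abs_def] by (rule powr_prim_has_field_derivative[OF \<beta>(2) in_f_radius[OF x(1)] x(2)])
  then show ?thesis by (simp add: f_props(2)[OF x(1)] \<phi>_alt mult_ac)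
qed

lemma norm_powr_beta1_le: "0 \<le> x \<Longrightarrow> x \<le> 1 \<Longrightarrow> norm (complex_of_real x powr (\<beta> + 1)) \<le> x"
proof -
  assume x: "0 \<le> x" "x \<le> 1"
  have "complex_of_real x powr (\<beta> + 1) = of_real x * of_real x powr \<beta>"
    by (cases "x = 0") (auto simp: powr_add)
  then show ?thesis using x norm_powr_le_one[OF x \<beta>(2)] by (simp add: norm_mult mult_left_le)
qed

lemma P_lim: "P k z 0 = 0" "((\<lambda>x. P k z (of_real x)) \<longlongrightarrow> 0) (at_right 0)"
proof -
  show "P k z 0 = 0" by (simp add: P_def)
  have rad: "fps_conv_radius (powr_prim \<beta> (f k z)) > 0"
  proof -
    have "0 < ereal (2 * pi)" by simp
    also have "\<dots> \<le> fps_conv_radius (f k z)" by (rule f_props(1))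
    also have "\<dots> \<le> fps_conv_radius (powr_prim \<beta> (f k z))" by (rule fps_conv_radius_powr_prim[OF \<beta>(2)])
    finally show ?thesis .
  qed
  have "((\<lambda>x. complex_of_real x powr (\<beta> + 1)) \<longlongrightarrow> 0) (at_right 0)"
  proof (rule Lim_null_comparison)
    have "\<forall>\<^sub>F x in at_right (0::real). x \<in> {0<..<1}" by (rule eventually_at_right_real) simp
    then show "\<forall>\<^sub>F x in at_right 0. norm (complex_of_real x powr (\<beta> + 1)) \<le> x"
      by eventually_elim (use norm_powr_beta1_le in auto)
    show "((\<lambda>x::real. x) \<longlongrightarrow> 0) (at_right 0)" by (rule tendsto_ident_at)
  qed
  from tendsto_mult[OF this eval_fps_tendsto_at_right[OF rad]]
  show "((\<lambda>x. P k z (of_real x)) \<longlongrightarrow> 0) (at_right 0)" by (simp add: P_def)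
qed

text \<open>Joins the two operators: the primitive on the diagonal is z^(\<beta>+1) times the
  transform of \<open>B_op\<close>, and \<open>E_op\<close> relates this to the next iterate through
  the factor e^z - 1.\<close>

lemma P_diag:
  assumes z: "z \<in> W"
  shows "P k z z = (exp z - 1) * \<phi> (Suc k) z"
proof -
  have n: "norm z < 2 * pi" and z0: "z \<noteq> 0" using W_props(5,6)[OF z] by auto
  let ?H = "borel_coeffs (\<beta> + 1) (B_op b \<alpha> \<beta> (Ph k))"
  have rad: "fps_conv_radius ?H \<ge> ereal (2 * pi)"
    using G_radius[of k] fps_conv_radius_B_op[OF b(1,2) \<beta>(2), of "Ph k" \<alpha>] unfolding G_def by (rule order_trans)
  have "eval_fps (powr_prim \<beta> (f k z)) z = integral {0..1} (\<lambda>t. complex_of_real t powr \<beta> * eval_fps (f k z) (of_real t * z))"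
    by (rule eval_powr_prim[OF \<beta>(2) in_f_radius[OF n]])
  also have "\<dots> = integral {0..1} (\<lambda>t. complex_of_real t powr \<beta> * (eval_fps (borel_coeffs \<beta> (Ph k)) (of_real t * z) * K (of_real t * z) z))"
  proof (rule integral_cong)
    fix t :: real assume t: "t \<in> {0..1}"
    have "norm (of_real t * z) \<le> norm z" using t by (auto simp: norm_mult mult_left_le_one_le)
    then have "norm (of_real t * z) < 2 * pi" using n by linarith
    from f_props(2)[OF this, of k z]
    show "complex_of_real t powr \<beta> * eval_fps (f k z) (of_real t * z) = complex_of_real t powr \<beta> * (eval_fps (borel_coeffs \<beta> (Ph k)) (of_real t * z) * K (of_real t * z) z)"
      by (simp add: G_def mult_ac)
  qed
  also have "\<dots> = eval_fps ?H z"
    using B_op_borel_integral[OF b(1,2) \<beta>(2) in_G_radius[OF n, of k, unfolded G_def], of \<alpha>]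
    by (simp add: eval_fps_def sums_iff)
  finally have 1: "eval_fps (powr_prim \<beta> (f k z)) z = eval_fps ?H z" .
  have 2: "(exp z - 1) * eval_fps (G (Suc k)) z = z * eval_fps ?H z"
    unfolding G_def Ph_Suc by (rule borel_E_op_analytic(2)[OF \<beta>(2) rad n])
  have "P k z z = z powr \<beta> * (z * eval_fps ?H z)" using z0 by (simp add: P_def 1 powr_add)
  also have "\<dots> = (exp z - 1) * \<phi> (Suc k) z" unfolding 2[symmetric] \<phi>_alt by simp
  finally show ?thesis .
qed

lemma \<phi>_bounded: "\<exists>B. \<forall>x\<in>{0<..<1}. norm (\<phi> k (of_real x)) \<le> B"
proof -
  have sub: "cball 0 1 \<subseteq> ball (0::complex) (2 * pi)" using pi_gt3 by auto
  have "compact (eval_fps (G k) ` cball 0 1)"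
    by (rule compact_continuous_image[OF continuous_on_subset[OF holomorphic_on_imp_continuous_on[OF eval_G_hol] sub]]) simp
  then obtain B where "\<forall>y\<in>eval_fps (G k) ` cball 0 1. norm y \<le> B" using compact_imp_bounded bounded_iff by blast
  then have B: "norm (eval_fps (G k) (of_real x)) \<le> B" if "x \<in> {0<..<1}" for x using that by force
  have "norm (\<phi> k (of_real x)) \<le> 1 * B" if "x \<in> {0<..<1}" for x
    unfolding \<phi>_alt norm_mult by (intro mult_mono norm_powr_le_one \<beta>(2) B) (use that in auto)
  then show ?thesis by blast
qed

definition B0 :: "complex \<Rightarrow> complex" where
  "B0 = eval_fps (borel_coeffs (\<beta> + 1) (b_alpha \<rho> b \<alpha> N))"

lemma B0_hol: "B0 holomorphic_on S"
  unfolding B0_def by (rule holomorphic_on_eval_fps) (simp add: radius_b_alpha eball_def)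

lemma b_alpha_hat_alt: "b_alpha_hat \<rho> b \<alpha> N z = z powr (\<beta> + 1) * B0 z"
  unfolding b_alpha_hat_def borel_sum_def B0_def \<beta>(1)[symmetric] ..

lemma \<phi>_0:
  assumes z: "z \<in> W"
  shows "\<phi> 0 z = z powr (\<beta> + 1) * B0 z / (exp z - 1)"
proof -
  have n: "norm z < 2 * pi" and z0: "z \<noteq> 0" using W_props(5,6)[OF z] by auto
  have "(exp z - 1) * eval_fps (G 0) z = z * B0 z"
    unfolding G_def Ph_0 B0_def by (rule borel_E_op_analytic(2)[OF \<beta>(2) _ n]) (simp add: radius_b_alpha)
  then have "eval_fps (G 0) z = z * B0 z / (exp z - 1)" using W_props(4)[OF z] by (simp add: field_simps)
  then show ?thesis using z0 by (simp add: \<phi>_alt powr_add)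
qed

text \<open>The branch of the transformed \<open>b_alpha\<close> is continued up to and including
  parameter 1, where the path must miss only 0; its quotient by e^z - 1 starts the recursion on the
  open interval.\<close>

lemma path_setup:
  assumes \<gamma>: "bdd_pc1 \<gamma>" and eps: "0 < \<epsilon>" "\<epsilon> < 1" and \<gamma>0: "\<gamma> 0 = 0"
    and pos: "\<And>t. t \<in> {0<..<\<epsilon>} \<Longrightarrow> \<gamma> t = of_real (Re (\<gamma> t)) \<and> 0 < Re (\<gamma> t) \<and> Re (\<gamma> t) < 1"
    and avoid: "\<And>t. t \<in> {0<..<1} \<Longrightarrow> exp (\<gamma> t) \<noteq> 1" and \<gamma>1: "\<gamma> 1 \<noteq> 0"
  obtains Bh where "germ_family \<gamma> {0<..1} Bh"
    "\<And>t. t \<in> {0<..<\<epsilon>} \<Longrightarrow> \<forall>\<^sub>F z in nhds (\<gamma> t). Bh t z = z powr (\<beta> + 1) * B0 z"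
    "resurgent_path \<gamma> \<epsilon> K \<phi> P (\<lambda>t z. Bh t z / (exp z - 1)) W"
proof -
  have inW: "\<gamma> t \<in> W" if "t \<in> {0<..<\<epsilon>}" for t
  proof -
    have "complex_of_real (Re (\<gamma> t)) \<in> W" using pos[OF that] by (intro W_props(3)) auto
    then show ?thesis using pos[OF that] by metis
  qed
  have "\<exists>Bh. germ_family \<gamma> {0<..1} Bh \<and> (\<forall>t\<in>{0<..<\<epsilon>}. \<forall>\<^sub>F z in nhds (\<gamma> t). Bh t z = z powr (\<beta> + 1) * B0 z)"
  proof (rule powr_germ_family[of \<gamma> \<epsilon> B0 "\<beta> + 1"])
    show "continuous_on {0..1} \<gamma>" using \<gamma> by (simp add: bdd_pc1_def)
    show "\<gamma> t \<noteq> 0" if "t \<in> {0<..1}" for t using that avoid[of t] \<gamma>1 by (cases "t = 1") auto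
    show "\<gamma> t \<notin> \<real>\<^sub>\<le>\<^sub>0" if "t \<in> {0<..<\<epsilon>}" for t using W_props(6)[OF inW[OF that]] .
  qed (use eps B0_hol in blast)+
  then obtain Bh where Bh: "germ_family \<gamma> {0<..1} Bh"
    "\<And>t. t \<in> {0<..<\<epsilon>} \<Longrightarrow> \<forall>\<^sub>F z in nhds (\<gamma> t). Bh t z = z powr (\<beta> + 1) * B0 z" by blast
  let ?F0 = "\<lambda>t z. Bh t z / (exp z - 1)"
  have gf: "germ_family \<gamma> {0<..<1} ?F0"
    unfolding germ_family_def
  proof (intro ballI conjI)
    fix t :: real assume t: "t \<in> {0<..<1}"
    have "Bh t analytic_on {\<gamma> t}" using Bh(1) t unfolding germ_family_def by auto
    then show "?F0 t analytic_on {\<gamma> t}" using avoid[OF t] by (intro analytic_intros) auto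
    obtain d where d: "d > 0" "\<And>s. s \<in> {0<..1} \<Longrightarrow> dist s t < d \<Longrightarrow> \<forall>\<^sub>F z in nhds (\<gamma> s). Bh s z = Bh t z"
      by (rule germ_familyD[OF Bh(1), of t]) (use t in auto)
    show "\<forall>\<^sub>F s in at t within {0<..<1}. \<forall>\<^sub>F z in nhds (\<gamma> s). ?F0 s z = ?F0 t z"
      unfolding eventually_at
    proof (intro exI[of _ d] conjI d(1) ballI impI)
      fix s :: real assume s: "s \<in> {0<..<1}" "s \<noteq> t \<and> dist s t < d"
      have "\<forall>\<^sub>F z in nhds (\<gamma> s). Bh s z = Bh t z" using s by (intro d(2)) auto
      then show "\<forall>\<^sub>F z in nhds (\<gamma> s). ?F0 s z = ?F0 t z" by eventually_elim simp
    qed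
  qed
  have ini: "\<forall>\<^sub>F z in nhds (\<gamma> t). ?F0 t z = \<phi> 0 z" if t: "t \<in> {0<..<\<epsilon>}" for t
  proof -
    have "\<forall>\<^sub>F z in nhds (\<gamma> t). z \<in> W" using inW[OF t] W_props(1) by (intro eventually_nhds_in_open) auto
    then show ?thesis using Bh(2)[OF t] by eventually_elim (simp add: \<phi>_0)
  qed
  have "resurgent_path \<gamma> \<epsilon> K \<phi> P ?F0 W"
  proof
    show "(\<lambda>z. K (p z) (q z)) holomorphic_on U" if "open U" "p holomorphic_on U" "q holomorphic_on U" for U p q
      using K_alpha_facts(2)[OF b(1,2) that] .
    show "continuous_on UNIV (\<lambda>(x, z). K x z)" by (rule K_alpha_facts(1)[OF b(1,2)])
    show "\<gamma> t = of_real (Re (\<gamma> t)) \<and> 0 < Re (\<gamma> t) \<and> Re (\<gamma> t) < 1" if "t \<in> {0<..<\<epsilon>}" for t by (rule pos[OF that])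
    show "exp (\<gamma> t) \<noteq> 1" if "t \<in> {0<..<1}" for t by (rule avoid[OF that])
    show "complex_of_real x \<in> W" if "0 < x" "x < 1" for x using that by (intro W_props(3)) auto
    show "(P k z has_field_derivative K x z * \<phi> k x) (at x)" if "z \<in> W" "x \<in> W" for k z x by (rule P_deriv[OF that(2)])
    show "P k z z = (exp z - 1) * \<phi> (Suc k) z" if "z \<in> W" for k z by (rule P_diag[OF that])
    show "exp z \<noteq> 1" if "z \<in> W" for z by (rule W_props(4)[OF that])
    show "\<exists>B. \<forall>x\<in>{0<..<1}. norm (\<phi> k (of_real x)) \<le> B" for k by (rule \<phi>_bounded)
    show "\<forall>\<^sub>F z in nhds (\<gamma> t). ?F0 t z = \<phi> 0 z" if "t \<in> {0<..<\<epsilon>}" for t by (rule ini[OF that])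
  qed (use \<gamma> eps \<gamma>0 W_props(1,2) P_lim gf in auto)
  then show ?thesis using Bh by (intro that[of Bh]) auto
qed

text \<open>The locale gives agreement only on the initial parameters. As long as the path stays on
  the segment (0, 1], uniqueness carries it further, in particular to the base point 1.\<close>

lemma Fs_eq_borel_sum:
  assumes R: "resurgent_path \<gamma> \<epsilon> K \<phi> P F0 W" and t0: "t0 \<in> {0<..<1}"
    and pos: "\<And>u. u \<in> {0<..t0} \<Longrightarrow> \<gamma> u = of_real (Re (\<gamma> u)) \<and> 0 < Re (\<gamma> u) \<and> Re (\<gamma> u) \<le> 1"
  shows "\<forall>\<^sub>F z in nhds (\<gamma> t0). resurgent_path.Fs \<gamma> K F0 k t0 z = \<phi> k z"
proof -
  interpret R: resurgent_path \<gamma> \<epsilon> K \<phi> P F0 W by (rule R)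
  have inW: "\<gamma> t \<in> W" if "t \<in> {0<..t0}" for t
  proof -
    have "complex_of_real (Re (\<gamma> t)) \<in> W" using pos[OF that] by (intro W_props(3)) auto
    then show ?thesis using pos[OF that] by metis
  qed
  define s where "s = min (\<epsilon> / 2) t0"
  have s: "s \<in> {0<..<\<epsilon>}" "s \<in> {0<..t0}" using R.eps t0 by (auto simp: s_def)
  show ?thesis
  proof (rule germ_family_unique[where F="R.Fs k" and G="\<lambda>t. \<phi> k" and \<gamma>=\<gamma>, OF _ _ _ _ s(2)])
    show "continuous_on {0<..t0} \<gamma>" using t0 by (intro R.\<gamma>_cont') auto
    show "germ_family \<gamma> {0<..t0} (R.Fs k)"
    proof (rule germ_family_compose[OF R.good_germ[OF R.Fs_good], where \<tau>="\<lambda>t. t"])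
      show "(\<lambda>t. t) ` {0<..t0} \<subseteq> {0<..<1}" using t0 by auto
    qed auto
    show "germ_family \<gamma> {0<..t0} (\<lambda>t. \<phi> k)" by (rule germ_family_const) (rule \<phi>_analytic[OF inW])
    show "\<forall>\<^sub>F z in nhds (\<gamma> s). R.Fs k s z = \<phi> k z" by (rule R.good_near0[OF R.Fs_good s(1)])
  qed (use t0 in auto)
qed

lemma Fs_continuation_along:
  assumes R: "resurgent_path \<gamma> \<epsilon> K \<phi> P F0 W"
    and pos: "\<And>u. u \<in> {0<..\<tau> 0} \<Longrightarrow> \<gamma> u = of_real (Re (\<gamma> u)) \<and> 0 < Re (\<gamma> u) \<and> Re (\<gamma> u) \<le> 1"
    and \<tau>: "continuous_on {0..1} \<tau>" "\<tau> ` {0..1} \<subseteq> {0<..<1}" and q: "\<And>t. t \<in> {0..1} \<Longrightarrow> q t = \<gamma> (\<tau> t)"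
  shows "continuation_along q (\<phi> k) (\<lambda>t. resurgent_path.Fs \<gamma> K F0 k (\<tau> t))"
proof -
  interpret R: resurgent_path \<gamma> \<epsilon> K \<phi> P F0 W by (rule R)
  have "\<tau> 0 \<in> \<tau> ` {0..1}" by (rule imageI) simp
  then have t0: "\<tau> 0 \<in> {0<..<1}" using \<tau>(2) by blast
  show ?thesis
  proof (rule continuation_alongI)
    show "germ_family q {0..1} (\<lambda>t. R.Fs k (\<tau> t))"
      by (rule germ_family_compose[OF R.good_germ[OF R.Fs_good] \<tau> q])
    have "continuous_on {0..1} (\<lambda>t. \<gamma> (\<tau> t))"
      by (rule continuous_on_compose2[OF R.\<gamma>_cont \<tau>(1)]) (use \<tau>(2) in force)
    then show "continuous_on {0..1} q" by (rule continuous_on_eq) (use q in auto)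
    show "\<forall>\<^sub>F z in nhds (q 0). R.Fs k (\<tau> 0) z = \<phi> k z"
      using Fs_eq_borel_sum[OF R t0 pos] q[of 0] by simp
  qed
qed

lemma resurgent_Phi: "resurgent \<beta> (Phi \<rho> b \<omega> N k)"
  unfolding resurgent_def
proof (intro conjI allI impI)
  show "ereal (2 * pi) \<le> fps_conv_radius (borel_coeffs \<beta> (Phi \<rho> b \<omega> N k))"
    using G_radius[of k] by (simp add: G_def Ph_def)
  fix \<gamma> :: "real \<Rightarrow> complex"
  assume "piecewise_C1 \<gamma> \<and> pathstart \<gamma> = 1 \<and> path_image \<gamma> \<inter> two_pi_i_Z = {}"
  then have a: "piecewise_C1 \<gamma>" "pathstart \<gamma> = 1" "path_image \<gamma> \<inter> two_pi_i_Z = {}" by auto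
  have "exp (\<gamma> t) \<noteq> 1" if "t \<in> {0..1}" for t
    using a(3) that unfolding path_image_def two_pi_i_Z_iff[symmetric] by blast
  note \<gamma> = piecewise_C1_imp_bdd_pc1[OF a(1)] a(2) this
  \<comment> \<open>The constant last piece puts the end of \<gamma> at parameter 3/4, since the
    recursion provides germs only at parameters below 1.\<close>
  define \<delta> where "\<delta> = linepath 0 1 +++ \<gamma> +++ linepath (pathfinish \<gamma>) (pathfinish \<gamma>)"
  note v = path3_values[OF \<gamma>(2) \<delta>_def]
  have bd: "bdd_pc1 \<delta>"
    unfolding \<delta>_def by (intro bdd_pc1_join bdd_pc1_linepath \<gamma>(1)) (auto simp: \<gamma>(2))
  have ex: "exp (\<delta> t) \<noteq> 1" if "t \<in> {0<..1}" for t
  proof -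
    consider "t \<le> 1/2" | "1/2 \<le> t" "t \<le> 3/4" | "3/4 \<le> t" by linarith
    then show ?thesis
    proof cases
      case 1
      then show ?thesis using v(1)[OF 1] exp_real_ne_1[of "2 * t"] that by simp
    next
      case 2
      then show ?thesis using v(2)[OF 2] \<gamma>(3)[of "4 * t - 2"] by simp
    next
      case 3
      then show ?thesis using v(3)[OF 3] \<gamma>(3)[of 1] by (simp add: pathfinish_def linepath_def flip: scaleR_add_left)
    qed
  qed
  obtain Bh where R: "resurgent_path \<delta> (1/4) K \<phi> P (\<lambda>t z. Bh t z / (exp z - 1)) W"
  proof (rule path_setup[OF bd, of "1/4"])
    show "\<delta> 0 = 0" using v(1)[of 0] by simp
    show "\<delta> t = of_real (Re (\<delta> t)) \<and> 0 < Re (\<delta> t) \<and> Re (\<delta> t) < 1" if "t \<in> {0<..<1/4}" for t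
      using v(1)[of t] that by simp
    show "exp (\<delta> t) \<noteq> 1" if "t \<in> {0<..<1}" for t using ex that by simp
    show "\<delta> 1 \<noteq> 0" using ex[of 1] by auto
  qed auto
  \<comment> \<open>\<gamma> is the part of \<delta> between the parameters 1/2 and 3/4.\<close>
  have "continuation_along \<gamma> (\<phi> k) (\<lambda>t. resurgent_path.Fs \<delta> K (\<lambda>t z. Bh t z / (exp z - 1)) k (1/2 + t/4))"
  proof (rule Fs_continuation_along[OF R, where \<tau>="\<lambda>t. 1/2 + t/4"])
    show "\<delta> u = of_real (Re (\<delta> u)) \<and> 0 < Re (\<delta> u) \<and> Re (\<delta> u) \<le> 1" if "u \<in> {0<..1/2 + 0/4}" for u
      using v(1)[of u] that by simp
    show "\<gamma> t = \<delta> (1/2 + t/4)" if "t \<in> {0..1}" for t using v(2)[of "1/2 + t/4"] that by simp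
  qed (auto intro!: continuous_intros)
  then show "\<exists>G. continuation_along \<gamma> (borel_sum \<beta> (Phi \<rho> b \<omega> N k)) G"
    by (auto simp: \<phi>_def[abs_def] Ph_def)
qed

end

section \<open>The coefficients\<close>

text \<open>Translates the times of the concatenated path back into parameters of an arbitrary
  parametrisation of it.\<close>

lemma strict_mono_inverse_on_unit:
  fixes h :: "real \<Rightarrow> real"
  assumes c: "continuous_on {0..1} h" and m: "strict_mono_on {0..1} h" and h: "h 0 = 0" "h 1 = 1"
  obtains g where "continuous_on {0..1} g" "\<And>y. y \<in> {0..1} \<Longrightarrow> g y \<in> {0..1} \<and> h (g y) = y"
proof -
  have im: "h ` {0..1} = {0..1}"
  proof
    show "h ` {0..1} \<subseteq> {0..1}"
    proof
      fix y assume "y \<in> h ` {0..1}"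
      then obtain u where u: "u \<in> {0..1}" "y = h u" by blast
      have "h 0 \<le> h u" "h u \<le> h 1" using strict_mono_on_imp_mono_on[OF m] u(1) by (auto simp: mono_on_def)
      then show "y \<in> {0..1}" using u h by simp
    qed
    show "{0..1} \<subseteq> h ` {0..1}"
    proof
      fix y :: real assume "y \<in> {0..1}"
      then have "\<exists>x\<ge>0. x \<le> 1 \<and> h x = y" using h by (intro IVT' c) auto
      then show "y \<in> h ` {0..1}" by auto
    qed
  qed
  have inj: "inj_on h {0..1}" using m by (rule strict_mono_on_imp_inj_on)
  have "continuous_on (h ` {0..1}) (the_inv_into {0..1} h)"
    by (rule continuous_on_inv_into[OF c _ inj]) simp
  then have "continuous_on {0..1} (the_inv_into {0..1} h)" by (simp add: im)
  moreover have "the_inv_into {0..1} h y \<in> {0..1} \<and> h (the_inv_into {0..1} h y) = y" if "y \<in> {0..1}" for y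
    using that im the_inv_into_into[OF inj, of y "{0..1}"] f_the_inv_into_f[OF inj, of y] by auto
  ultimately show ?thesis by (rule that)
qed

theorem mainTheorem3:
  fixes f :: "complex \<Rightarrow> complex" and \<rho> \<omega> \<alpha> \<beta> :: complex and b :: "complex fps"
    and \<Gamma> \<Gamma>' :: "real \<Rightarrow> complex" and N :: nat
  assumes "simple_parabolic_germ f \<rho>"
    and "b = germ_b f"
    and "\<omega> \<in> two_pi_i_Z - {0}"
    and "piecewise_C1 \<Gamma>" and "path_image \<Gamma> \<inter> two_pi_i_Z = {}"
    and "pathstart \<Gamma> = 1" and "pathfinish \<Gamma> = \<omega> + 1"
    and "\<alpha> = - \<rho> * \<omega>"
    and "real N \<ge> - 2 * Re \<alpha>"
    and "\<beta> = \<alpha> + of_nat N"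
    and "parametrization_of \<Gamma>' (linepath 0 1 +++ \<Gamma> +++ linepath (\<omega> + 1) \<omega>)"
  shows
    "fps_conv_radius (borel_coeffs 0 (fps_shift 1 (c_alpha b \<alpha> - 1))) = \<infinity> \<and>
     (\<forall>\<xi> \<zeta>. summable (\<lambda>k. K_term1 b \<xi> \<zeta> (Suc k)) \<and> summable (\<lambda>k. K_term2 b \<alpha> \<xi> \<zeta> (Suc k))) \<and>
     holomorphic_C2 (K_alpha b \<alpha>) \<and>
     (\<forall>k. simple_resurgent \<omega> \<Gamma> \<beta> (Phi \<rho> b \<omega> N k)) \<and>
     S_coeff \<rho> b \<omega> N \<Gamma> 0 = 2 * of_real pi * \<i> * cont_val \<Gamma>' (b_alpha_hat \<rho> b \<alpha> N) 1 \<and>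
     (\<forall>k\<ge>1. simplex_form_integrable \<Gamma>' k (S_integrand \<rho> b \<omega> N \<Gamma>' k) \<and>
        S_coeff \<rho> b \<omega> N \<Gamma> k =
          2 * of_real pi * \<i> * simplex_form_integral \<Gamma>' k (S_integrand \<rho> b \<omega> N \<Gamma>' k))"
proof -
  have b: "fps_conv_radius b > 0" "fps_nth b 0 = 0" "fps_nth b (Suc 0) = - \<rho>"
    using germ_b_facts[OF assms(1)] assms(2) by auto
  \<comment> \<open>N is nonnegative and at least -2 Re \<alpha>; the average of the two bounds is
    -Re \<alpha>.\<close>
  have Re\<beta>: "Re \<beta> \<ge> 0" using assms(9) by (simp add: assms(10))
  interpret RG: resurgent_germ b \<rho> \<omega> \<alpha> \<beta> N
    using b assms(8,10) Re\<beta> by unfold_locales auto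
  define p where "p = linepath 0 1 +++ \<Gamma> +++ linepath (pathfinish \<Gamma>) \<omega>"
  note v = path3_values[OF assms(6) p_def]
  obtain h where h: "piecewise_C1 h" "strict_mono_on {0..1} h" "h 0 = 0" "h 1 = (1::real)"
    and \<Gamma>': "\<And>s. s \<in> {0..1} \<Longrightarrow> \<Gamma>' s = p (h s)"
    using assms(11) unfolding parametrization_of_def p_def assms(7) by blast
  have hb: "bdd_pc1 h" by (rule piecewise_C1_imp_bdd_pc1[OF h(1)])
  have hc: "continuous_on {0..1} h" using hb by (simp add: bdd_pc1_def)
  have hlt: "h u < h v" if "0 \<le> u" "u < v" "v \<le> 1" for u v
    using h(2) that by (auto simp: strict_mono_on_def)
  have hle: "h u \<le> h v" if "0 \<le> u" "u \<le> v" "v \<le> 1" for u v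
    using hlt[of u v] that by (cases "u = v") auto
  obtain g where gc: "continuous_on {0..1} g" and g: "\<And>y. y \<in> {0..1} \<Longrightarrow> g y \<in> {0..1} \<and> h (g y) = y"
    by (rule strict_mono_inverse_on_unit[OF hc h(2-4)]) blast
  have g01: "g y \<in> {0<..<1}" if "y \<in> {0<..<1}" for y
  proof -
    have "g y \<noteq> 0" "g y \<noteq> 1" using g[of y] that h by auto
    then show ?thesis using g[of y] that by auto
  qed
  have less_gI: "u < g y" if "h u < y" "u \<in> {0..1}" "y \<in> {0..1}" for u y
    using hle[of "g y" u] g[OF that(3)] that by (cases "u < g y") auto
  have \<Gamma>b: "bdd_pc1 \<Gamma>" by (rule piecewise_C1_imp_bdd_pc1[OF assms(4)])
  have pb: "bdd_pc1 p"
    unfolding p_def by (intro bdd_pc1_join bdd_pc1_linepath \<Gamma>b) (auto simp: assms(6,7))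
  have \<Gamma>'b: "bdd_pc1 \<Gamma>'"
    by (rule bdd_pc1_cong[OF bdd_pc1_compose[OF pb hb h(2-4)] \<Gamma>'])
  have e\<omega>: "exp \<omega> = 1" using assms(3) two_pi_i_Z_iff by blast
  have \<Gamma>ex: "exp (\<Gamma> t) \<noteq> 1" if "t \<in> {0..1}" for t
    using assms(5) that unfolding path_image_def two_pi_i_Z_iff[symmetric] by blast
  have V1: "\<Gamma>' u = of_real (2 * h u)" if "u \<in> {0..1}" "h u \<le> 1/2" for u
    using v(1)[OF that(2)] \<Gamma>'[OF that(1)] by simp
  have V3: "\<Gamma>' u = \<omega> + of_real (4 * (1 - h u))" if "u \<in> {0..1}" "3/4 \<le> h u" for u
    using v(3)[OF that(2)] \<Gamma>'[OF that(1)]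
    by (simp add: linepath_def assms(7) scaleR_conv_of_real algebra_simps)
  have h01: "h u \<in> {0<..<1}" if "u \<in> {0<..<1}" for u using hlt[of 0 u] hlt[of u 1] that h by auto
  \<comment> \<open>The parameters at which \<Gamma>' finishes the first segment and enters the last
    one.\<close>
  define \<epsilon> where "\<epsilon> = g (1/2)"
  define u0 where "u0 = g (3/4)"
  have \<epsilon>: "0 < \<epsilon>" "\<epsilon> < 1" "h \<epsilon> = 1/2" using g01[of "1/2"] g[of "1/2"] by (auto simp: \<epsilon>_def)
  have u0: "0 < u0" "u0 < 1" "h u0 = 3/4" using g01[of "3/4"] g[of "3/4"] by (auto simp: u0_def)
  have \<Gamma>'0: "\<Gamma>' 0 = 0" using V1[of 0] h by simp
  have \<Gamma>'1: "\<Gamma>' 1 = \<omega>" using V3[of 1] h by simp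
  have pos: "\<Gamma>' t = of_real (Re (\<Gamma>' t)) \<and> 0 < Re (\<Gamma>' t) \<and> Re (\<Gamma>' t) < 1" if t: "t \<in> {0<..<\<epsilon>}" for t
  proof -
    have "h t < 1/2" "0 < h t" using hlt[of t \<epsilon>] hlt[of 0 t] t \<epsilon> h by auto
    then show ?thesis using V1[of t] t \<epsilon> by simp
  qed
  have avoid: "exp (\<Gamma>' t) \<noteq> 1" if t: "t \<in> {0<..<1}" for t
  proof -
    note ht = h01[OF t]
    consider "h t \<le> 1/2" | "1/2 \<le> h t" "h t \<le> 3/4" | "3/4 \<le> h t" by linarith
    then show ?thesis
    proof cases
      case 1
      then show ?thesis using V1[of t] exp_real_ne_1[of "2 * h t"] t ht by simp
    next
      case 2
      then show ?thesis using v(2)[OF 2] \<Gamma>'[of t] \<Gamma>ex[of "4 * h t - 2"] t by simp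
    next
      case 3
      then show ?thesis using V3[of t] exp_real_ne_1[of "4 * (1 - h t)"] t ht e\<omega> by (simp add: exp_add)
    qed
  qed
  have "\<Gamma>' 1 \<noteq> 0" using assms(3) by (simp add: \<Gamma>'1)
  then obtain Bh where Bh: "germ_family \<Gamma>' {0<..1} Bh"
    and Bh0: "\<And>t. t \<in> {0<..<\<epsilon>} \<Longrightarrow> \<forall>\<^sub>F z in nhds (\<Gamma>' t). Bh t z = z powr (\<beta> + 1) * RG.B0 z"
    and Rpath: "resurgent_path \<Gamma>' \<epsilon> RG.K RG.\<phi> RG.P (\<lambda>t z. Bh t z / (exp z - 1)) RG.W"
    using RG.path_setup[OF \<Gamma>'b \<epsilon>(1,2) \<Gamma>'0 pos avoid] by blast
  have K\<omega>: "RG.K \<omega> \<omega> = 0" using K_alpha_facts(4)[OF b(1,2)] by (simp add: b(3) assms(8))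
  interpret R0: resurgent_path \<Gamma>' \<epsilon> RG.K RG.\<phi> RG.P "\<lambda>t z. Bh t z / (exp z - 1)" RG.W by (rule Rpath)
  interpret R: resurgent_simple \<Gamma>' \<epsilon> RG.K RG.\<phi> RG.P "\<lambda>t z. Bh t z / (exp z - 1)" RG.W \<omega> u0 Bh
  proof unfold_locales
    show "exp \<omega> = 1" "0 < u0" "u0 < 1" "\<Gamma>' 1 = \<omega>" "RG.K \<omega> \<omega> = 0" by fact+
    have hu: "3/4 < h u" "h u < 1" if "u \<in> {u0<..<1}" for u
      using hlt[of u0 u] h01[of u] u0 that by auto
    show "\<Gamma>' u - \<omega> = of_real (Re (\<Gamma>' u - \<omega>)) \<and> 0 < Re (\<Gamma>' u - \<omega>)" if "u \<in> {u0<..<1}" for u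
      using V3[of u] hu[OF that] that u0 by simp
    show "Re (\<Gamma>' w - \<omega>) \<le> Re (\<Gamma>' u - \<omega>)" if "u0 < u" "u \<le> w" "w < 1" for u w
      using V3[of u] V3[of w] hu[of u] hu[of w] hle[of u w] that u0 by simp
    show "germ_family \<Gamma>' {0<..1} Bh" by (rule Bh)
    show "(\<lambda>t z. Bh t z / (exp z - 1)) = (\<lambda>t z. Bh t z / (exp z - 1))" by simp
    show "mono_on {0<..<\<epsilon>} (\<lambda>u. Re (\<Gamma>' u))"
    proof (rule mono_onI)
      fix u w assume uw: "u \<in> {0<..<\<epsilon>}" "w \<in> {0<..<\<epsilon>}" "u \<le> w"
      then have "h u \<le> 1/2" "h w \<le> 1/2" using hle[of u \<epsilon>] hle[of w \<epsilon>] \<epsilon> by auto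
      then show "Re (\<Gamma>' u) \<le> Re (\<Gamma>' w)" using V1[of u] V1[of w] hle[of u w] uw \<epsilon> by simp
    qed
    show "\<exists>C d. d > 0 \<and> (\<forall>x z. norm (x - \<omega>) < d \<longrightarrow> norm (z - \<omega>) \<le> norm (x - \<omega>) \<longrightarrow> norm (RG.K x z) \<le> C * norm (x - \<omega>))"
      by (rule holomorphic_C2_Lipschitz_at[OF K_alpha_facts(3)[OF b(1,2)] K\<omega>])
    show "\<exists>C. \<forall>t\<in>{0<..<\<epsilon>}. norm (Bh t (\<Gamma>' t)) \<le> C * norm (\<Gamma>' t)"
    proof -
      have "compact (RG.B0 ` cball 0 1)"
        by (rule compact_continuous_image[OF holomorphic_on_imp_continuous_on[OF RG.B0_hol]]) simp
      then obtain C where "\<forall>y\<in>RG.B0 ` cball 0 1. norm y \<le> C" using compact_imp_bounded bounded_iff by blast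
      then have C: "norm (RG.B0 z) \<le> C" if "norm z \<le> 1" for z using that by force
      have "norm (Bh t (\<Gamma>' t)) \<le> C * norm (\<Gamma>' t)" if t: "t \<in> {0<..<\<epsilon>}" for t
      proof -
        define x where "x = Re (\<Gamma>' t)"
        have x: "\<Gamma>' t = of_real x" "0 < x" "x < 1" using pos[OF t] by (auto simp: x_def)
        have "Bh t (\<Gamma>' t) = of_real x powr (\<beta> + 1) * RG.B0 (of_real x)"
          using eventually_nhds_x_imp_x[OF Bh0[OF t]] x by simp
        then have "norm (Bh t (\<Gamma>' t)) \<le> x * C"
          using x RG.norm_powr_beta1_le[of x] C[of "of_real x"] by (simp add: norm_mult mult_mono)
        then show ?thesis using x by (simp add: mult.commute)
      qed
      then show ?thesis by blast
    qed
  qed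
  have \<Gamma>'c: "continuous_on {0..1} \<Gamma>'" using \<Gamma>'b by (simp add: bdd_pc1_def)
  have Bval: "cont_val \<Gamma>' (b_alpha_hat \<rho> b \<alpha> N) t = Bh t (\<Gamma>' t)" if t: "t \<in> {0<..1}" for t
  proof (rule cont_val_eq[OF \<Gamma>'c _ t])
    have "\<forall>\<^sub>F t in at_right 0. t \<in> {0<..<\<epsilon>}" by (rule eventually_at_right_real[OF \<epsilon>(1)])
    then have "\<forall>\<^sub>F t in at_right 0. \<forall>\<^sub>F z in nhds (\<Gamma>' t). Bh t z = b_alpha_hat \<rho> b \<alpha> N z"
      by eventually_elim (simp add: RG.b_alpha_hat_alt Bh0)
    then show "continuation_along \<Gamma>' (b_alpha_hat \<rho> b \<alpha> N) Bh"
      using Bh unfolding continuation_along_def germ_family_def by blast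
  qed
  define p2 where "p2 = 2 * complex_of_real pi * \<i>"
  define I where "I = (\<lambda>k. set_lebesgue_integral lborel {0<..<1} (\<lambda>u. RG.K (\<Gamma>' u) \<omega> * (R0.Fs k u (\<Gamma>' u) * vector_derivative \<Gamma>' (at u))))"
  have sing: "\<exists>\<psi> Q. simple_singularity \<omega> \<Gamma> \<beta> (Phi \<rho> b \<omega> N k) (p2 * (if k = 0 then Bh 1 \<omega> else I (k - 1))) \<psi> Q" for k
  proof -
    obtain r A R where r: "0 < r" "r \<le> 1" and lf: "R.lform (R0.Fs k) r A R"
      and R0: "R 0 = (if k = 0 then Bh 1 \<omega> else I (k - 1))"
      using R.Fs_lform[of k] unfolding I_def by blast
    have Ah: "A holomorphic_on ball 0 r" and Rh: "R holomorphic_on ball 0 r" using lf by (auto simp: R.lform_def)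
    obtain u1 where u1: "u1 < 1" and form: "\<And>u. u \<in> {u1<..<1} \<Longrightarrow> \<forall>\<^sub>F z in nhds (\<Gamma>' u). R0.Fs k u z = A (z - \<omega>) * Ln (z - \<omega>) + R (z - \<omega>) / (z - \<omega>)"
      using lf unfolding R.lform_def by blast
    \<comment> \<open>Splits R(x)/x into the pole R(0)/x and a function holomorphic at 0.\<close>
    define Rq where "Rq = (\<lambda>x. if x = 0 then deriv R 0 else (R x - R 0) / (x - 0))"
    have Rqh: "Rq holomorphic_on ball 0 r" unfolding Rq_def by (rule pole_lemma[OF Rh]) (use r in simp)
    \<comment> \<open>The factor compensates the division by 2 \<pi> i in the definition of a simple
      singularity.\<close>
    define \<psi> where "\<psi> = fps_const p2 * fps_expansion A 0"
    define Q where "Q = fps_expansion Rq 0"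
    have eb: "eball 0 (ereal r) = ball (0::complex) r" by simp
    have rA: "fps_conv_radius (fps_expansion A 0) \<ge> ereal r" by (rule conv_radius_fps_expansion) (simp add: eb Ah)
    have rQ: "fps_conv_radius Q \<ge> ereal r" unfolding Q_def by (rule conv_radius_fps_expansion) (simp add: eb Rqh)
    have r0: "0 < ereal r" using r by simp
    have pos\<psi>: "fps_conv_radius \<psi> > 0" unfolding \<psi>_def
      by (intro fps_conv_pos_mult less_le_trans[OF r0 rA]) simp
    have posQ: "fps_conv_radius Q > 0" by (rule less_le_trans[OF r0 rQ])
    define s1 where "s1 = max u1 0"
    have s1: "0 \<le> s1" "s1 < 1" "u1 \<le> s1" using u1 by (auto simp: s1_def)
    have hs1: "h s1 < 1" using hlt[of s1 1] s1 h by simp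
    \<comment> \<open>The point \<omega> + \<zeta> is reached at time 1 - \<zeta>/4 of the
      concatenated path. The last bound on \<open>d\<close> puts this after parameter
      \<open>s1\<close>, where the logarithmic form is valid.\<close>
    define d where "d = min r (min 1 (4 * (1 - h s1)))"
    have d: "0 < d" "d \<le> r" "d \<le> 1" "d \<le> 4 * (1 - h s1)" using r hs1 by (auto simp: d_def)
    have val: "cont_val (\<Gamma> +++ linepath (\<omega> + 1) (\<omega> + of_real \<zeta>)) (RG.\<phi> k) 1 =
        A (of_real \<zeta>) * of_real (ln \<zeta>) + R (of_real \<zeta>) / of_real \<zeta>" if \<zeta>: "\<zeta> \<in> {0<..<d}" for \<zeta>
    proof -
      define q where "q = \<Gamma> +++ linepath (\<omega> + 1) (\<omega> + of_real \<zeta>)"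
      \<comment> \<open>At time 1/2 + m t / 2 the concatenated path is at \<open>q t\<close>: the
        first half of \<open>q\<close> is \<Gamma>, the second half covers only the fraction 1 -
        \<zeta> of the last segment.\<close>
      define m where "m = (\<lambda>t::real. min t (1/2) + (1 - \<zeta>) * max 0 (t - 1/2))"
      define \<tau> where "\<tau> = (\<lambda>t. g (1/2 + m t / 2))"
      have \<zeta>1: "0 < \<zeta>" "\<zeta> < 1" using \<zeta> d by auto
      have m_le: "0 \<le> m t" "m t \<le> 1 - \<zeta>/2" if "t \<in> {0..1}" for t
      proof -
        show "0 \<le> m t" using that \<zeta>1 by (auto simp: m_def)
        have "m t \<le> 1/2 + (1 - \<zeta>) * (1/2)" unfolding m_def using that \<zeta>1 by (intro add_mono mult_left_mono) (auto simp: max_def)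
        then show "m t \<le> 1 - \<zeta>/2" by (simp add: field_simps)
      qed
      have in01: "1/2 + m t / 2 \<in> {0<..<1}" if "t \<in> {0..1}" for t
        using m_le[OF that] \<zeta>1 by simp
      have mc: "continuous_on {0..1} (\<lambda>t. 1/2 + m t / 2)" unfolding m_def by (intro continuous_intros) simp
      have \<tau>c: "continuous_on {0..1} \<tau>"
        unfolding \<tau>_def by (rule continuous_on_compose2[OF gc mc]) (use in01 in force)
      have \<tau>01: "\<tau> ` {0..1} \<subseteq> {0<..<1}" using g01[OF in01] by (auto simp: \<tau>_def)
      have h\<tau>: "h (\<tau> t) = 1/2 + m t / 2" if "t \<in> {0..1}" for t
        using g[of "1/2 + m t / 2"] in01[OF that] by (auto simp: \<tau>_def)
      have q: "q t = \<Gamma>' (\<tau> t)" if t: "t \<in> {0..1}" for t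
      proof -
        have "\<tau> t \<in> {0<..<1}" using \<tau>01 t by blast
        then have e: "\<Gamma>' (\<tau> t) = p (1/2 + m t / 2)" using \<Gamma>'[of "\<tau> t"] h\<tau>[OF t] by simp
        show ?thesis
        proof (cases "t \<le> 1/2")
          case True
          then have "m t = t" by (simp add: m_def)
          then show ?thesis using e v(2)[of "1/2 + t/2"] True t by (simp add: q_def joinpaths_def)
        next
          case False
          have mt: "m t = 1/2 + (1 - \<zeta>) * (t - 1/2)" using False by (simp add: m_def)
          have "3/4 \<le> 1/2 + m t / 2" unfolding mt using False \<zeta>1 by simp
          from v(3)[OF this] have "\<Gamma>' (\<tau> t) = linepath (\<omega> + 1) \<omega> (4 * (1/2 + m t / 2) - 3)" using e assms(7) by simp
          also have "4 * (1/2 + m t / 2) - 3 = (1 - \<zeta>) * (2 * t - 1)" unfolding mt by (simp add: field_simps)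
          also have "linepath (\<omega> + 1) \<omega> ((1 - \<zeta>) * (2 * t - 1)) = linepath (\<omega> + 1) (\<omega> + of_real \<zeta>) (2 * t - 1)"
            by (simp add: linepath_def scaleR_conv_of_real algebra_simps)
          finally show ?thesis using False by (simp add: q_def joinpaths_def)
        qed
      qed
      have \<tau>0: "\<tau> 0 = \<epsilon>" using \<zeta>1 by (simp add: \<tau>_def m_def \<epsilon>_def)
      have cont: "continuation_along q (RG.\<phi> k) (\<lambda>t. R0.Fs k (\<tau> t))"
      proof (rule RG.Fs_continuation_along[OF Rpath _ \<tau>c \<tau>01 q])
        fix u assume u: "u \<in> {0<..\<tau> 0}"
        then have "0 < h u" "h u \<le> 1/2" using hlt[of 0 u] hle[of u \<epsilon>] \<epsilon> h by (auto simp: \<tau>0)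
        then show "\<Gamma>' u = of_real (Re (\<Gamma>' u)) \<and> 0 < Re (\<Gamma>' u) \<and> Re (\<Gamma>' u) \<le> 1"
          using V1[of u] u \<epsilon> by (simp add: \<tau>0)
      qed
      have "continuous_on {0..1} (\<lambda>t. \<Gamma>' (\<tau> t))"
        by (rule continuous_on_compose2[OF \<Gamma>'c \<tau>c]) (use \<tau>01 in force)
      then have "continuous_on {0..1} q" by (rule continuous_on_eq) (use q in auto)
      from cont_val_eq[OF this cont, of 1] have cv: "cont_val q (RG.\<phi> k) 1 = R0.Fs k (\<tau> 1) (q 1)" by simp
      have q1: "q 1 = \<omega> + of_real \<zeta>" by (simp add: q_def joinpaths_def linepath_def)
      have "1/2 + m 1 / 2 = 1 - \<zeta> / 4" using \<zeta>1 by (simp add: m_def field_simps)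
      then have "h s1 < 1/2 + m 1 / 2" using \<zeta> d by auto
      then have "s1 < \<tau> 1" unfolding \<tau>_def using in01[of 1] s1 by (intro less_gI) auto
      moreover have "\<tau> 1 \<in> \<tau> ` {0..1}" by (rule imageI) simp
      then have "\<tau> 1 < 1" using subsetD[OF \<tau>01] greaterThanLessThan_iff by blast
      ultimately have t1: "\<tau> 1 \<in> {u1<..<1}" using s1 by auto
      have "R0.Fs k (\<tau> 1) (q 1) = A (q 1 - \<omega>) * Ln (q 1 - \<omega>) + R (q 1 - \<omega>) / (q 1 - \<omega>)"
        using eventually_nhds_x_imp_x[OF form[OF t1]] q[of 1] by simp
      then show ?thesis using cv \<zeta>1 by (simp add: q1 q_def[symmetric] Ln_of_real)
    qed
    have "simple_singularity \<omega> \<Gamma> \<beta> (Phi \<rho> b \<omega> N k) (p2 * R 0) \<psi> Q"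
      unfolding simple_singularity_def
    proof (intro conjI pos\<psi> posQ)
      have "\<forall>\<^sub>F \<zeta> in at_right 0. \<zeta> \<in> {0<..<d}" by (rule eventually_at_right_real[OF d(1)])
      then show "\<forall>\<^sub>F \<zeta> in at_right 0. cont_val (\<Gamma> +++ linepath (\<omega> + 1) (\<omega> + of_real \<zeta>)) (borel_sum \<beta> (Phi \<rho> b \<omega> N k)) 1 =
          p2 * R 0 / (2 * of_real pi * \<i> * of_real \<zeta>) + eval_fps \<psi> (of_real \<zeta>) * of_real (ln \<zeta>) / (2 * of_real pi * \<i>) + eval_fps Q (of_real \<zeta>)"
      proof eventually_elim
        case (elim \<zeta>)
        have z: "norm (complex_of_real \<zeta>) < r" "complex_of_real \<zeta> \<noteq> 0" using elim d by auto
        have p20: "p2 \<noteq> 0" by (simp add: p2_def)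
        have eA: "eval_fps (fps_expansion A 0) (of_real \<zeta>) = A (of_real \<zeta>)"
          using eval_fps_expansion'[of A 0 "ereal r" "of_real \<zeta>"] Ah z by simp
        have eQ: "eval_fps Q (of_real \<zeta>) = Rq (of_real \<zeta>)"
          unfolding Q_def using eval_fps_expansion'[of Rq 0 "ereal r" "of_real \<zeta>"] Rqh z by simp
        have "ereal (norm (complex_of_real \<zeta>)) < fps_conv_radius (fps_expansion A 0)"
          by (rule less_le_trans[OF _ rA]) (use z in simp)
        then have e\<psi>: "eval_fps \<psi> (of_real \<zeta>) = p2 * A (of_real \<zeta>)" unfolding \<psi>_def by (simp add: eval_fps_mult eA)
        have "R (of_real \<zeta>) / of_real \<zeta> = R 0 / of_real \<zeta> + Rq (of_real \<zeta>)"
          using z by (simp add: Rq_def add_divide_distrib[symmetric])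
        then show ?case
          using val[OF elim] p20 z unfolding p2_def[symmetric] e\<psi> eQ
          by (simp add: RG.\<phi>_def RG.Ph_def)
      qed
    qed
    then show ?thesis unfolding R0 by blast
  qed
  \<comment> \<open>The constant term of the alien operator is the coefficient of 1 / (2 \<pi> i
    \<zeta>), hence 2 \<pi> i times the residue R(0).\<close>
  have Sc: "S_coeff \<rho> b \<omega> N \<Gamma> k = p2 * (if k = 0 then Bh 1 \<omega> else I (k - 1))" for k
    using sing[of k] alien_nth_0 unfolding S_coeff_def assms(10)[unfolded assms(8), symmetric] by blast
  have simplex: "simplex_form_integrable \<Gamma>' (Suc k) (S_integrand \<rho> b \<omega> N \<Gamma>' (Suc k))"
    "simplex_form_integral \<Gamma>' (Suc k) (S_integrand \<rho> b \<omega> N \<Gamma>' (Suc k)) = I k" for k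
  proof -
    have "S_integrand \<rho> b \<omega> N \<Gamma>' (Suc k) s = Bh (s 1) (\<Gamma>' (s 1)) * ((\<Prod>i\<in>{1..<Suc k}. RG.K (\<Gamma>' (s i)) (\<Gamma>' (s (Suc i)))) * RG.K (\<Gamma>' (s (Suc k))) \<omega>) / (\<Prod>i\<in>{1..Suc k}. exp (\<Gamma>' (s i)) - 1)"
      if s: "s \<in> param_simplex (Suc k)" for s
    proof -
      have "s 1 \<in> {0<..1}" using s by (auto simp: param_simplex_def PiE_def Pi_def)
      then show ?thesis unfolding S_integrand_def Let_def assms(8)[symmetric] by (simp only: Bval)
    qed
    from R.simplex_integral[of k, OF this]
    show "simplex_form_integrable \<Gamma>' (Suc k) (S_integrand \<rho> b \<omega> N \<Gamma>' (Suc k))"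
      "simplex_form_integral \<Gamma>' (Suc k) (S_integrand \<rho> b \<omega> N \<Gamma>' (Suc k)) = I k"
      unfolding I_def by blast+
  qed
  show ?thesis
  proof (intro conjI allI impI)
    show "fps_conv_radius (borel_coeffs 0 (fps_shift 1 (c_alpha b \<alpha> - 1))) = \<infinity>"
      by (rule fps_conv_radius_borel_hat) (use b in \<open>auto intro!: fps_conv_pos_diff fps_conv_pos_c_alpha\<close>)
    show "summable (\<lambda>k. K_term1 b \<xi> \<zeta> (Suc k))" "summable (\<lambda>k. K_term2 b \<alpha> \<xi> \<zeta> (Suc k))" for \<xi> \<zeta>
      using K_alpha_eq_dbl(1,2)[OF b(1,2)] by auto
    show "holomorphic_C2 (K_alpha b \<alpha>)" by (rule K_alpha_facts(3)[OF b(1,2)])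
    show "simple_resurgent \<omega> \<Gamma> \<beta> (Phi \<rho> b \<omega> N k)" for k
      unfolding simple_resurgent_def using RG.resurgent_Phi[of k] sing[of k] by blast
    show "S_coeff \<rho> b \<omega> N \<Gamma> 0 = 2 * of_real pi * \<i> * cont_val \<Gamma>' (b_alpha_hat \<rho> b \<alpha> N) 1"
      by (simp add: Sc Bval \<Gamma>'1 p2_def)
    fix k :: nat assume "1 \<le> k"
    then obtain j where k: "k = Suc j" by (cases k) auto
    show "simplex_form_integrable \<Gamma>' k (S_integrand \<rho> b \<omega> N \<Gamma>' k)" unfolding k by (rule simplex(1))
    show "S_coeff \<rho> b \<omega> N \<Gamma> k = 2 * of_real pi * \<i> * simplex_form_integral \<Gamma>' k (S_integrand \<rho> b \<omega> N \<Gamma>' k)"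
      unfolding k simplex(2) by (simp add: Sc p2_def)
  qed
qed

end
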